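(* Let $\Omega\subset\mathbb R^n$, $n\ge 2$, be any open set with $\mathcal L^n(\Omega)<\infty$ and $\mathcal H^{n-1}(\partial\Omega)<\infty$. Let $\mu$ be a Borel measure on $\Omega$ with $\mu(\Omega)<\infty$ such that $\mu(B_r(x)\cap\Omega)\le C_\mu r^\alpha$ for all $x\in\Omega$ and $r>0$, for some $\alpha\in(n-1,n]$ and some $C_\mu>0$. (i) Let $1<p<n$, $r>1$, and $q=\min\{\frac{p\alpha}{n-p},\frac{r\alpha}{n-1}\}$. Then there exists a constant $C=C(n,p,r,\alpha,C_\mu)$ such that $$\|u\|_{L^q(\Omega,\mu)}\le C\Big(\max\{\mu(\Omega)^{\frac n\alpha},\mathcal L^n(\Omega)\}^{\frac{\alpha}{qn}-\frac{n-p}{pn}}\|\nabla u\|_{L^p(\Omega)}+\max\{\mu(\Omega)^{\frac{n-1}\alpha},\mathcal H^{n-1}(\partial\Omega)\}^{\frac{\alpha}{q(n-1)}-\frac1r}\|u\|_{L^r(\partial\Omega)}\Big)$$ for every $u\in V^1L^p(\Omega)\cap C_b(\overline\Omega)$. (ii) Let $\beta>0$ and $\gamma=\min\{n',\beta\}$, where $n'=\frac{n}{n-1}$. Then there exists a constant $C=C(n,\beta,\alpha,C_\mu,\mathcal L^n(\Omega),\mathcal H^{n-1}(\partial\Omega),\mu(\Omega))$ such that $$\|u\|_{\exp L^\gamma(\Omega,\mu)}\le C\big(\|\nabla u\|_{L^n(\Omega)}+\|u\|_{\exp L^\beta(\partial\Omega)}\big)$$ for every $u\in V^1L^n(\Omega)\cap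 C_b(\overline\Omega)$. (iii) Let $p>n$. Then there exists a constant $C=C(n,p)$ such that $$\|u\|_{L^\infty(\Omega)}\le C\big(\mathcal L^n(\Omega)^{\frac1n-\frac1p}\|\nabla u\|_{L^p(\Omega)}+\|u\|_{L^\infty(\partial\Omega)}\big)$$ for every $u\in V^1L^p(\Omega)\cap C_b(\overline\Omega)$.
   Context: $\mathcal L^n$ is Lebesgue measure and $\mathcal H^{n-1}$ the $(n-1)$-dimensional Hausdorff measure restricted to $\partial\Omega$; function spaces on $\Omega$ (resp. $\partial\Omega$) written without a measure are taken w.r.t. $\mathcal L^n$ (resp. $\mathcal H^{n-1}$). $B_r(x)$ is the ball of radius $r$ centred at $x$. $C_b(\overline\Omega)$ denotes continuous functions on $\overline\Omega$ with bounded support; norms over $\partial\Omega$ of $u$ mean norms of the restriction of $u$ to $\partial\Omega$. For a rearrangement-invariant space $X(\Omega)$, $V^1X(\Omega)$ is the set of weakly differentiable functions $u$ on $\Omega$ with $|\nabla u|\in X(\Omega)$ (no integrability of $u$ itself is required). For a finite measure space $(\mathcal R,m)$ and $\gamma>0$, $\exp L^\gamma(\mathcal R,m)$ is the Orlicz space with Luxemburg norm $\|\phi\|=\inf\{\lambda>0:\int_{\mathcal R}A(|\phi|/\lambda)\,dm\le1\}$, where $A$ is a Young function (left-continuous convex, not identically $0$ or $\infty$) equivalent to $e^{t^\gamma}-1$ near infinity. *)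

theory Defs
  imports "HOL-Analysis.Analysis" "HOL-Probability.Essential_Supremum"
begin

definition hausdorff_const :: "real \<Rightarrow> real" where
  "hausdorff_const s = pi powr (s / 2) / Gamma (s / 2 + 1) / 2 powr s"

definition hausdorff_outer :: "real \<Rightarrow> 'a::euclidean_space set \<Rightarrow> ennreal" where
  "hausdorff_outer s A =
     (SUP \<delta>\<in>{0<..}. INF C\<in>{C :: nat \<Rightarrow> 'a set. A \<subseteq> (\<Union>i. C i) \<and>
                                 (\<forall>i. bounded (C i) \<and> diameter (C i) \<le> \<delta>)}.
        (\<Sum>i. ennreal (hausdorff_const s * diameter (C i) powr s)))"

definition hausdorff_measure_on :: "real \<Rightarrow> 'a::euclidean_space set \<Rightarrow> 'a measure" where
  "hausdorff_measure_on s S = measure_of S (sets (restrict_space borel S)) (hausdorff_outer s)"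

definition boundary_measure :: "'a::euclidean_space set \<Rightarrow> 'a measure" where
  "boundary_measure \<Omega> = hausdorff_measure_on (real DIM('a) - 1) (frontier \<Omega>)"

definition enn_root :: "ennreal \<Rightarrow> real \<Rightarrow> ennreal" where
  "enn_root x e = (if x = top then top else ennreal (enn2real x powr e))"

definition lp_norm :: "'a measure \<Rightarrow> real \<Rightarrow> ('a \<Rightarrow> real) \<Rightarrow> ennreal" where
  "lp_norm M p f = enn_root (\<integral>\<^sup>+ x. ennreal (\<bar>f x\<bar> powr p) \<partial>M) (1 / p)"

definition linf_norm :: "'a measure \<Rightarrow> ('a \<Rightarrow> real) \<Rightarrow> ennreal" where
  "linf_norm M f = e2ennreal (esssup M (\<lambda>x. ereal \<bar>f x\<bar>))"

definition young_function :: "(real \<Rightarrow> ennreal) \<Rightarrow> bool" where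
  "young_function A \<longleftrightarrow>
     A 0 = 0 \<and>
     (\<forall>s t l. 0 \<le> s \<longrightarrow> 0 \<le> t \<longrightarrow> 0 \<le> l \<longrightarrow> l \<le> 1 \<longrightarrow>
         A (l * s + (1 - l) * t) \<le> ennreal l * A s + ennreal (1 - l) * A t) \<and>
     (\<forall>t>0. (A \<longlongrightarrow> A t) (at_left t)) \<and>
     (\<exists>t>0. A t \<noteq> 0) \<and> (\<exists>t>0. A t \<noteq> top)"

definition equiv_exp_near_infinity :: "(real \<Rightarrow> ennreal) \<Rightarrow> real \<Rightarrow> bool" where
  "equiv_exp_near_infinity A \<gamma> \<longleftrightarrow>
     (\<exists>c t0. c > 0 \<and> t0 > 0 \<and>
        (\<forall>t\<ge>t0. A t \<le> ennreal (exp ((c * t) powr \<gamma>) - 1) \<and>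
                 ennreal (exp (t powr \<gamma>) - 1) \<le> A (c * t)))"

definition luxemburg_norm :: "'a measure \<Rightarrow> (real \<Rightarrow> ennreal) \<Rightarrow> ('a \<Rightarrow> real) \<Rightarrow> ennreal" where
  "luxemburg_norm M A f =
     (INF k\<in>{k::real. k > 0 \<and> (\<integral>\<^sup>+ x. A (\<bar>f x\<bar> / k) \<partial>M) \<le> 1}. ennreal k)"

definition partial_deriv :: "'a::euclidean_space \<Rightarrow> ('a \<Rightarrow> real) \<Rightarrow> 'a \<Rightarrow> real" where
  "partial_deriv v g x = deriv (\<lambda>t. g (x + t *\<^sub>R v)) 0"

fun iter_partial :: "'a::euclidean_space list \<Rightarrow> ('a \<Rightarrow> real) \<Rightarrow> 'a \<Rightarrow> real" where
  "iter_partial [] f = f"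
| "iter_partial (v # vs) f = partial_deriv v (iter_partial vs f)"

definition smooth_fun :: "('a::euclidean_space \<Rightarrow> real) \<Rightarrow> bool" where
  "smooth_fun f \<longleftrightarrow>
     (\<forall>vs. set vs \<subseteq> Basis \<longrightarrow>
        continuous_on UNIV (iter_partial vs f) \<and>
        (\<forall>v\<in>Basis. \<forall>x. (\<lambda>t. iter_partial vs f (x + t *\<^sub>R v)) differentiable (at 0)))"

definition test_function :: "'a::euclidean_space set \<Rightarrow> ('a \<Rightarrow> real) \<Rightarrow> bool" where
  "test_function \<Omega> \<phi> \<longleftrightarrow> smooth_fun \<phi> \<and> compact (closure {x. \<phi> x \<noteq> 0}) \<and>
                           closure {x. \<phi> x \<noteq> 0} \<subseteq> \<Omega>"

definition weak_gradient :: "'a::euclidean_space set \<Rightarrow> ('a \<Rightarrow> real) \<Rightarrow> ('a \<Rightarrow> 'a) \<Rightarrow> bool" where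
  "weak_gradient \<Omega> u G \<longleftrightarrow>
     (\<forall>K. compact K \<and> K \<subseteq> \<Omega> \<longrightarrow> integrable (lebesgue_on K) u \<and> integrable (lebesgue_on K) G) \<and>
     (\<forall>\<phi>. test_function \<Omega> \<phi> \<longrightarrow> (\<forall>i\<in>Basis.
         (LINT x|lebesgue_on \<Omega>. u x * partial_deriv i \<phi> x) =
         - (LINT x|lebesgue_on \<Omega>. (G x \<bullet> i) * \<phi> x)))"

definition standing_domain :: "'a::euclidean_space set \<Rightarrow> bool" where
  "standing_domain \<Omega> \<longleftrightarrow> open \<Omega> \<and> emeasure lebesgue \<Omega> < top \<and>
     hausdorff_outer (real DIM('a) - 1) (frontier \<Omega>) < top"

definition admissible_measure :: "'a::euclidean_space set \<Rightarrow> 'a measure \<Rightarrow> real \<Rightarrow> real \<Rightarrow> bool" where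
  "admissible_measure \<Omega> M \<alpha> C\<^sub>\<mu> \<longleftrightarrow> sets M = sets (restrict_space borel \<Omega>) \<and>
     emeasure M \<Omega> < top \<and>
     (\<forall>x\<in>\<Omega>. \<forall>\<rho>>0. emeasure M (ball x \<rho> \<inter> \<Omega>) \<le> ennreal (C\<^sub>\<mu> * \<rho> powr \<alpha>))"

definition Cb_closure :: "'a::euclidean_space set \<Rightarrow> ('a \<Rightarrow> real) \<Rightarrow> bool" where
  "Cb_closure \<Omega> u \<longleftrightarrow> continuous_on (closure \<Omega>) u \<and> bounded {x\<in>closure \<Omega>. u x \<noteq> 0}"

end

theory Submission
  imports Defs
begin

text \<open>Everything rests on a pointwise estimate: for a nonnegative $C^1$ function \<open>\<phi>\<close> with
  \<open>\<phi> 0 = 0\<close>, the value \<open>\<phi> (u x)\<close> is bounded by the Riesz potentials of order one of \<open>|\<phi>' (u)| |\<nabla>u|\<close>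
  on \<open>\<Omega>\<close> and of \<open>\<phi> (u)\<close> on the boundary. It follows by testing the weak gradient against a regularised
  gradient of the fundamental solution times a cutoff which vanishes near the boundary and is built
  from a near-optimal Hausdorff covering.

  Taking for \<open>\<phi>\<close> a smooth truncation at the level \<open>t\<close> gives a weak-type estimate with respect to \<open>\<mu>\<close>
  in which only the gradient between the levels \<open>t\<close> and \<open>2 t\<close> and the boundary values above \<open>t\<close> enter.
  Such estimates sum over dyadic levels (Maz'ya truncation), and this gives the inequality for \<open>p = 1\<close>
  with a weight \<open>|u|\<^bsup>s-1\<^esup>\<close>. Applied first to Lebesgue measure, where the weighted gradient term is
  absorbed by Hoelder's inequality, and then to \<open>\<mu>\<close>, it gives the critical case of (i); the other exponents
  reduce to the critical ones. In (ii) the gradient potential is estimated in all $L^q$ with the sharp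
  growth in \<open>q\<close>, while truncation still takes care of the boundary term. In (iii) the truncation level
  is taken above the essential supremum on the boundary, so that the boundary term disappears.\<close>

section \<open>Hausdorff measure\<close>

text \<open>Of the boundary only its finite (n-1)-dimensional measure is known, so there is no trace
  operator, no extension and no divergence theorem up to the boundary. A matching of scales replaces
  them: cutting out a ball of radius r costs a gradient of size 1/r on a volume of order r^n, hence
  r^(n-1), which is the weight of that ball in a Hausdorff sum. The condition \<alpha> > n-1 makes
  the kernel |x-y|^(1-n) integrable against \<mu>, uniformly in y, with integral at most C
  m^(1-(n-1)/\<alpha>) over a set of \<mu>-measure m. As y may lie anywhere, the single exponent
  \<alpha>/(n-1) serves the source in \<Omega> as well as the source on the boundary, and the
  boundary measure enters only through its mass. Fubini with this bound yields weak-type estimates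
  for integrable sources; truncation is what upgrades them to strong ones.\<close>

lemma metric_outer_measure_separated_sum:
  fixes \<phi> :: "'a::metric_space set \<Rightarrow> ennreal" and h :: "'a \<Rightarrow> real"
  assumes emp: "\<phi> {} = 0"
    and inc: "\<And>A B. A \<subseteq> B \<Longrightarrow> \<phi> A \<le> \<phi> B"
    and sep: "\<And>A B d. d > 0 \<Longrightarrow> (\<And>a b. a \<in> A \<Longrightarrow> b \<in> B \<Longrightarrow> d \<le> dist a b) \<Longrightarrow> \<phi> A + \<phi> B \<le> \<phi> (A \<union> B)"
    and lip: "\<And>x y. h x \<le> h y + dist x y"
    and R: "\<And>j. R j = {x \<in> X. 1 / (real j + 2) \<le> h x \<and> h x < 1 / (real j + 1)}"
  shows "(\<Sum>j<N. \<phi> (R (2 * j + c))) \<le> \<phi> X"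
proof -
  have "(\<Sum>j<N. \<phi> (R (2 * j + c))) \<le> \<phi> (\<Union>j<N. R (2 * j + c))"
  proof (induction N)
    case 0
    then show ?case by simp
  next
    case (Suc N)
    let ?U = "\<Union>j<N. R (2 * j + c)"
    have "\<phi> ?U + \<phi> (R (2 * N + c)) \<le> \<phi> (?U \<union> R (2 * N + c))"
    proof (cases "N = 0")
      case True
      then show ?thesis by (simp add: emp)
    next
      case False
      define m where "m = real (2 * N + c)"
      have m: "m > 0" using False by (simp add: m_def)
      show ?thesis
      \<comment> \<open>Shells whose indices differ by at least 2 are separated: on the earlier ones
        h is at least 1/m, on the new one it is below 1/(m+1), and h is 1-Lipschitz.\<close>
      proof (rule sep[of "1 / m - 1 / (m + 1)"])
        show "0 < 1 / m - 1 / (m + 1)"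
          using divide_strict_left_mono[of m "m + 1" 1] m by simp
      next
        fix a b assume a: "a \<in> ?U" and b: "b \<in> R (2 * N + c)"
        from a obtain j where j: "j < N" "a \<in> R (2 * j + c)" by auto
        have "real (2 * j + c) + 2 \<le> m" using j by (simp add: m_def)
        then have "1 / m \<le> 1 / (real (2 * j + c) + 2)"
          by (intro divide_left_mono) (use m in auto)
        also have "\<dots> \<le> h a" using j R by auto
        finally have "1 / m \<le> h a" .
        moreover have "h b < 1 / (m + 1)" using b R by (auto simp: m_def)
        moreover have "h a \<le> h b + dist a b" by (rule lip)
        ultimately show "1 / m - 1 / (m + 1) \<le> dist a b" by linarith
      qed
    qed
    then show ?case using Suc by (simp add: lessThan_Suc Un_commute add.commute)
      (meson add_left_mono order_trans)
  qed
  also have "\<dots> \<le> \<phi> X" by (rule inc) (auto simp: R)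
  finally show ?thesis .
qed

text \<open>Caratheodory's criterion for metric outer measures. \<open>T k\<close> is at positive
  distance from F and therefore adds to the part in F. What is left of \<open>X - F\<close> is
  covered by thin shells around F; their sums over even and over odd indices are each at most
  \<open>\<phi> X\<close>, so the tail of the series vanishes.\<close>

theorem metric_outer_measure_closed:
  fixes \<phi> :: "'a::metric_space set \<Rightarrow> ennreal"
  assumes emp: "\<phi> {} = 0"
    and inc: "\<And>A B. A \<subseteq> B \<Longrightarrow> \<phi> A \<le> \<phi> B"
    and sub: "\<And>A :: nat \<Rightarrow> 'a set. \<phi> (\<Union>i. A i) \<le> (\<Sum>i. \<phi> (A i))"
    and sep: "\<And>A B d. d > 0 \<Longrightarrow> (\<And>a b. a \<in> A \<Longrightarrow> b \<in> B \<Longrightarrow> d \<le> dist a b) \<Longrightarrow> \<phi> A + \<phi> B \<le> \<phi> (A \<union> B)"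
    and "closed F"
  shows "\<phi> (F \<inter> X) + \<phi> (X - F) = \<phi> X"
proof (rule antisym)
  have sub2: "\<phi> (A \<union> B) \<le> \<phi> A + \<phi> B" for A B
  proof -
    have "\<phi> (A \<union> B) = \<phi> (\<Union>i. binaryset A B i)" by (simp add: UN_binaryset_eq)
    also have "\<dots> \<le> (\<Sum>i. \<phi> (binaryset A B i))" by (rule sub)
    also have "\<dots> = \<phi> A + \<phi> B" by (simp add: suminf_binaryset_eq emp)
    finally show ?thesis .
  qed
  show "\<phi> X \<le> \<phi> (F \<inter> X) + \<phi> (X - F)"
    by (rule order_trans[OF inc sub2]) auto
  show "\<phi> (F \<inter> X) + \<phi> (X - F) \<le> \<phi> X"
  \<comment> \<open>\<open>infdist\<close> to the empty set is 0 by convention, so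
    \<open>F = {}\<close> is treated apart; if \<open>\<phi> X\<close> is infinite there is nothing
    to show.\<close>
  proof (cases "F = {} \<or> \<phi> X = top")
    case True
    then show ?thesis by (auto simp: emp)
  next
    case False
    then have F: "F \<noteq> {}" and fin: "\<phi> X < top" by (auto simp: top.not_eq_extremum)
    define h where "h x = infdist x F" for x
    have lip: "h x \<le> h y + dist x y" for x y
      unfolding h_def by (rule infdist_triangle)
    define R where "R j = {x \<in> X. 1 / (real j + 2) \<le> h x \<and> h x < 1 / (real j + 1)}" for j :: nat
    define T where "T k = {x \<in> X. 1 / (real k + 1) \<le> h x}" for k :: nat
    have sums: "(\<Sum>j. \<phi> (R (2 * j + c))) \<le> \<phi> X" for c :: nat
      using metric_outer_measure_separated_sum[OF emp inc sep lip R_def]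
      by (intro suminf_le_const) (auto intro: summableI)
    have "(\<Sum>j<N. \<phi> (R j)) \<le> \<phi> X + \<phi> X" for N
    proof -
      have "(\<Sum>j<N. \<phi> (R j)) \<le> (\<Sum>j<2*N. \<phi> (R j))" by (rule sum_mono2) auto
      also have "\<dots> = (\<Sum>j<N. \<phi> (R (2*j+0))) + (\<Sum>j<N. \<phi> (R (2*j+1)))"
        by (induction N) (auto simp: algebra_simps)
      also have "\<dots> \<le> \<phi> X + \<phi> X"
        by (intro add_mono metric_outer_measure_separated_sum[OF emp inc sep lip R_def])
      finally show ?thesis .
    qed
    then have "(\<Sum>j. \<phi> (R j)) \<le> \<phi> X + \<phi> X"
      by (intro suminf_le_const) (auto intro: summableI)
    also have "\<dots> < top" using fin by (simp add: ennreal_add_less_top)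
    finally have "(\<Sum>j. \<phi> (R j)) < top" .
    then have tail: "(\<lambda>k. \<Sum>j. \<phi> (R (j + k))) \<longlonglongrightarrow> 0"
    proof -
      have eq: "(\<Sum>j. \<phi> (R (j + k))) = (\<Sum>j. \<phi> (R j)) - (\<Sum>j<k. \<phi> (R j))" for k
      proof -
        have "(\<Sum>j. \<phi> (R j)) = (\<Sum>j. \<phi> (R (j + k))) + (\<Sum>j<k. \<phi> (R j))"
          by (rule suminf_offset) auto
        moreover have "(\<Sum>j<k. \<phi> (R j)) \<noteq> top"
          using \<open>(\<Sum>j. \<phi> (R j)) < top\<close> sum_le_suminf[of "\<lambda>j. \<phi> (R j)" "{..<k}"]
          by (metis finite_lessThan leD summableI zero_le)
        ultimately show ?thesis by simp
      qed
      have "(\<lambda>k. (\<Sum>j. \<phi> (R j)) - (\<Sum>j<k. \<phi> (R j))) \<longlonglongrightarrow> (\<Sum>j. \<phi> (R j)) - (\<Sum>j. \<phi> (R j))"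
        using \<open>(\<Sum>j. \<phi> (R j)) < top\<close>
        by (intro tendsto_diff_ennreal summable_LIMSEQ tendsto_const) auto
      then show ?thesis using \<open>(\<Sum>j. \<phi> (R j)) < top\<close> by (simp add: eq)
    qed
    have step: "\<phi> (F \<inter> X) + \<phi> (X - F) \<le> \<phi> X + (\<Sum>j. \<phi> (R (j + k)))" for k
    proof -
      have pos: "h x > 0" if "x \<in> X - F" for x
        using that F \<open>closed F\<close> infdist_pos_not_in_closed unfolding h_def by auto
      have "X - F \<subseteq> T k \<union> (\<Union>j. R (j + k))"
      proof
        fix x assume x: "x \<in> X - F"
        show "x \<in> T k \<union> (\<Union>j. R (j + k))"
        proof (cases "1 / (real k + 1) \<le> h x")
          case True
          then show ?thesis using x by (auto simp: T_def)
        next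
          case False
          define P where "P j \<longleftrightarrow> 1 / (real j + 2) \<le> h x" for j :: nat
          have "\<exists>j. P j"
          proof -
            obtain j :: nat where "1 / h x < real j" using reals_Archimedean2 by blast
            then have "1 / (real j + 2) \<le> h x" using pos[OF x] by (simp add: field_simps)
            then show ?thesis by (auto simp: P_def)
          qed
          \<comment> \<open>Minimality gives the upper bound of the shell for positive j; at j = k
            it comes from x lying outside \<open>T k\<close>.\<close>
          define j where "j = (LEAST j. P j)"
          have j: "P j" unfolding j_def using \<open>\<exists>j. P j\<close> by (rule LeastI_ex)
          have kj: "k \<le> j"
          proof (rule ccontr)
            assume "\<not> k \<le> j"
            then have "1 / (real k + 1) \<le> 1 / (real j + 2)" by (intro divide_left_mono) auto
            then show False using j False by (simp add: P_def)
          qed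
          have "h x < 1 / (real j + 1)"
          proof (cases "j = k")
            case True then show ?thesis using False by simp
          next
            case ne: False
            then obtain i where i: "j = Suc i" using kj by (cases j) auto
            then have "\<not> P i" unfolding j_def using not_less_Least by (metis j_def lessI)
            then show ?thesis by (simp add: P_def i algebra_simps)
          qed
          then have "x \<in> R ((j - k) + k)" using j kj x by (auto simp: P_def R_def)
          then show ?thesis by blast
        qed
      qed
      then have "\<phi> (X - F) \<le> \<phi> (T k) + (\<Sum>j. \<phi> (R (j + k)))"
        by (intro order_trans[OF inc order_trans[OF sub2 add_left_mono[OF sub]]])
      moreover have "\<phi> (F \<inter> X) + \<phi> (T k) \<le> \<phi> ((F \<inter> X) \<union> T k)"
      proof (rule sep[of "1 / (real k + 1)"])
        fix a b assume "a \<in> F \<inter> X" "b \<in> T k"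
        then have "h a = 0" "1 / (real k + 1) \<le> h b" by (auto simp: h_def T_def)
        then show "1 / (real k + 1) \<le> dist a b" using lip[of b a] by (simp add: dist_commute)
      qed simp
      moreover have "\<phi> ((F \<inter> X) \<union> T k) \<le> \<phi> X" by (rule inc) (auto simp: T_def)
      ultimately show ?thesis
        by (smt (verit, ccfv_threshold) add.assoc add_left_mono add_right_mono order_trans)
    qed
    have "(\<lambda>k. \<phi> X + (\<Sum>j. \<phi> (R (j + k)))) \<longlonglongrightarrow> \<phi> X + 0"
      by (intro tendsto_add tail tendsto_const)
    then show ?thesis
      using step by (intro LIMSEQ_le_const[where X = "\<lambda>k. \<phi> X + (\<Sum>j. \<phi> (R (j + k)))"]) auto
  qed
qed

section \<open>Hausdorff measure from its premeasures at fixed scale; Borel sets are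
  measurable\<close>

definition hausdorff_pre :: "real \<Rightarrow> real \<Rightarrow> 'a::euclidean_space set \<Rightarrow> ennreal" where
  "hausdorff_pre s \<delta> A =
     (INF C\<in>{C :: nat \<Rightarrow> 'a set. A \<subseteq> (\<Union>i. C i) \<and> (\<forall>i. bounded (C i) \<and> diameter (C i) \<le> \<delta>)}.
        (\<Sum>i. ennreal (hausdorff_const s * diameter (C i) powr s)))"

lemma hausdorff_outer_eq_SUP: "hausdorff_outer s A = (SUP \<delta>\<in>{0<..}. hausdorff_pre s \<delta> A)"
  by (simp add: hausdorff_outer_def hausdorff_pre_def)

lemma hausdorff_const_pos: "s \<ge> 0 \<Longrightarrow> hausdorff_const s > 0"
  unfolding hausdorff_const_def by (intro divide_pos_pos Gamma_real_pos) auto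

lemma hausdorff_pre_empty: "\<delta> > 0 \<Longrightarrow> hausdorff_pre s \<delta> {} = 0"
proof -
  assume d: "\<delta> > 0"
  have "hausdorff_pre s \<delta> {} \<le> 0"
    unfolding hausdorff_pre_def by (rule INF_lower2[where i = "\<lambda>_. {}"]) (use d in auto)
  then show ?thesis by simp
qed

lemma hausdorff_pre_mono: "A \<subseteq> B \<Longrightarrow> hausdorff_pre s \<delta> A \<le> hausdorff_pre s \<delta> B"
  unfolding hausdorff_pre_def by (rule INF_superset_mono) auto

lemma hausdorff_pre_antimono: "\<delta> \<le> \<epsilon> \<Longrightarrow> hausdorff_pre s \<epsilon> A \<le> hausdorff_pre s \<delta> A"
  unfolding hausdorff_pre_def by (rule INF_superset_mono) (auto intro: order_trans)

lemma hausdorff_pre_approx: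
  assumes "hausdorff_pre s \<delta> A < top" "e > 0"
  obtains C where "A \<subseteq> (\<Union>i. C i)" "\<And>i::nat. bounded (C i)" "\<And>i. diameter (C i) \<le> \<delta>"
    "(\<Sum>i. ennreal (hausdorff_const s * diameter (C i) powr s)) \<le> hausdorff_pre s \<delta> A + ennreal e"
proof -
  have "hausdorff_pre s \<delta> A < hausdorff_pre s \<delta> A + ennreal e"
    using assms by (simp add: ennreal_add_left_cancel_less[of _ 0, simplified])
  then show thesis
    using that unfolding hausdorff_pre_def[of s \<delta> A] INF_less_iff
    by (auto intro: less_imp_le)
qed

lemma hausdorff_pre_countably_subadditive:
  fixes A :: "nat \<Rightarrow> 'a::euclidean_space set"
  shows "hausdorff_pre s \<delta> (\<Union>i. A i) \<le> (\<Sum>i. hausdorff_pre s \<delta> (A i))"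
proof (cases "(\<Sum>i. hausdorff_pre s \<delta> (A i)) = top")
  case False
  then have fin: "hausdorff_pre s \<delta> (A i) < top" for i
    by (meson ennreal_suminf_lessD top.not_eq_extremum)
  show ?thesis
  proof (rule ennreal_le_epsilon)
    fix e :: real assume e: "0 < e"
    have "\<exists>C. A i \<subseteq> (\<Union>j. C j) \<and> (\<forall>j::nat. bounded (C j) \<and> diameter (C j) \<le> \<delta>) \<and>
       (\<Sum>j. ennreal (hausdorff_const s * diameter (C j) powr s)) \<le> hausdorff_pre s \<delta> (A i) + ennreal (e * (1/2) ^ Suc i)" for i
      using hausdorff_pre_approx[OF fin[of i], of "e * (1/2) ^ Suc i"] e by (metis mult_pos_pos zero_less_divide_1_iff zero_less_numeral zero_less_power)
    then obtain C where C: "\<And>i. A i \<subseteq> (\<Union>j. C i j)" "\<And>i j::nat. bounded (C i j)" "\<And>i j. diameter (C i j) \<le> \<delta>"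
       "\<And>i. (\<Sum>j. ennreal (hausdorff_const s * diameter (C i j) powr s)) \<le> hausdorff_pre s \<delta> (A i) + ennreal (e * (1/2) ^ Suc i)"
      by metis
    \<comment> \<open>Near-optimal coverings of the \<open>A i\<close>, with errors e/2^(i+1), are
      merged into one sequence along the pairing of natural numbers.\<close>
    define D where "D k = (case prod_decode k of (i, j) \<Rightarrow> C i j)" for k
    have cov: "(\<Union>i. A i) \<subseteq> (\<Union>k. D k)"
    proof
      fix x assume "x \<in> (\<Union>i. A i)"
      then obtain i j where "x \<in> C i j" using C(1) by blast
      then have "x \<in> D (prod_encode (i, j))" by (simp add: D_def)
      then show "x \<in> (\<Union>k. D k)" by blast
    qed
    have "hausdorff_pre s \<delta> (\<Union>i. A i) \<le> (\<Sum>k. ennreal (hausdorff_const s * diameter (D k) powr s))"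
      unfolding hausdorff_pre_def using cov C by (intro INF_lower) (auto simp: D_def split: prod.split)
    also have "\<dots> = (\<Sum>i. \<Sum>j. ennreal (hausdorff_const s * diameter (C i j) powr s))"
      using suminf_ennreal_2dimen[where f = "\<lambda>(i, j). ennreal (hausdorff_const s * diameter (C i j) powr s)", OF refl]
      by (auto simp: D_def comp_def case_prod_beta)
    also have "\<dots> \<le> (\<Sum>i. hausdorff_pre s \<delta> (A i) + ennreal (e * (1/2) ^ Suc i))"
      using C(4) by (intro suminf_le) auto
    also have "\<dots> = (\<Sum>i. hausdorff_pre s \<delta> (A i)) + (\<Sum>i. ennreal (e * (1/2) ^ Suc i))"
      by (subst suminf_add) auto
    also have "(\<Sum>i. ennreal (e * (1/2) ^ Suc i)) = ennreal e"
      using sums_mult[OF power_half_series, of e] e by (subst suminf_ennreal_eq[of _ e]) auto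
    finally show "hausdorff_pre s \<delta> (\<Union>i. A i) \<le> (\<Sum>i. hausdorff_pre s \<delta> (A i)) + ennreal e" .
  qed
qed auto

lemma hausdorff_outer_empty: "hausdorff_outer s {} = 0"
  by (simp add: hausdorff_outer_eq_SUP hausdorff_pre_empty)

lemma hausdorff_outer_mono: "A \<subseteq> B \<Longrightarrow> hausdorff_outer s A \<le> hausdorff_outer s B"
  unfolding hausdorff_outer_eq_SUP by (intro SUP_mono) (auto intro: hausdorff_pre_mono)

lemma hausdorff_outer_countably_subadditive:
  fixes A :: "nat \<Rightarrow> 'a::euclidean_space set"
  shows "hausdorff_outer s (\<Union>i. A i) \<le> (\<Sum>i. hausdorff_outer s (A i))"
  unfolding hausdorff_outer_eq_SUP[of s "\<Union>i. A i"]
proof (rule SUP_least)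
  fix \<delta> :: real assume d: "\<delta> \<in> {0<..}"
  have "hausdorff_pre s \<delta> (\<Union>i. A i) \<le> (\<Sum>i. hausdorff_pre s \<delta> (A i))"
    by (rule hausdorff_pre_countably_subadditive)
  also have "\<dots> \<le> (\<Sum>i. hausdorff_outer s (A i))"
    using d by (intro suminf_le) (auto simp: hausdorff_outer_eq_SUP intro: SUP_upper)
  finally show "hausdorff_pre s \<delta> (\<Union>i. A i) \<le> (\<Sum>i. hausdorff_outer s (A i))" .
qed

text \<open>A covering set of diameter at most \<delta> < d cannot meet both A and B, so every
  covering of the union splits into one of A and one of B without sharing a set.\<close>

lemma hausdorff_pre_separated:
  assumes d: "\<delta> < d" "\<delta> > 0" and sep: "\<And>a b. a \<in> A \<Longrightarrow> b \<in> B \<Longrightarrow> d \<le> dist a b"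
  shows "hausdorff_pre s \<delta> A + hausdorff_pre s \<delta> B \<le> hausdorff_pre s \<delta> (A \<union> B)"
  unfolding hausdorff_pre_def[of s \<delta> "A \<union> B"]
proof (rule INF_greatest)
  fix C assume "C \<in> {C :: nat \<Rightarrow> 'a set. A \<union> B \<subseteq> (\<Union>i. C i) \<and> (\<forall>i. bounded (C i) \<and> diameter (C i) \<le> \<delta>)}"
  then have C: "A \<union> B \<subseteq> (\<Union>i. C i)" "\<And>i. bounded (C i)" "\<And>i. diameter (C i) \<le> \<delta>" by auto
  \<comment> \<open>Discarded sets become empty; their diameter 0 costs \<open>0 powr s\<close>,
    which is 0 for every s.\<close>
  define CA where "CA i = (if C i \<inter> A = {} then {} else C i)" for i
  define CB where "CB i = (if C i \<inter> B = {} then {} else C i)" for i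
  let ?w = "\<lambda>S. ennreal (hausdorff_const s * diameter S powr s)"
  have "hausdorff_pre s \<delta> A \<le> (\<Sum>i. ?w (CA i))"
    unfolding hausdorff_pre_def
  proof (rule INF_lower)
    have "x \<in> (\<Union>i. CA i)" if "x \<in> A" for x
      using that C(1) unfolding CA_def by (auto 4 4)
    then show "CA \<in> {C. A \<subseteq> (\<Union>i. C i) \<and> (\<forall>i. bounded (C i) \<and> diameter (C i) \<le> \<delta>)}"
      using C d(2) by (auto simp: CA_def)
  qed
  moreover have "hausdorff_pre s \<delta> B \<le> (\<Sum>i. ?w (CB i))"
    unfolding hausdorff_pre_def
  proof (rule INF_lower)
    have "x \<in> (\<Union>i. CB i)" if "x \<in> B" for x
      using that C(1) unfolding CB_def by (auto 4 4)
    then show "CB \<in> {C. B \<subseteq> (\<Union>i. C i) \<and> (\<forall>i. bounded (C i) \<and> diameter (C i) \<le> \<delta>)}"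
      using C d(2) by (auto simp: CB_def)
  qed
  ultimately have "hausdorff_pre s \<delta> A + hausdorff_pre s \<delta> B \<le> (\<Sum>i. ?w (CA i)) + (\<Sum>i. ?w (CB i))"
    by (rule add_mono)
  also have "\<dots> = (\<Sum>i. ?w (CA i) + ?w (CB i))" by (subst suminf_add) auto
  also have "\<dots> \<le> (\<Sum>i. ?w (C i))"
  proof (intro suminf_le allI summableI)
    fix i
    have "C i \<inter> A = {} \<or> C i \<inter> B = {}"
    proof (rule ccontr)
      assume "\<not> ?thesis"
      then obtain a b where ab: "a \<in> C i" "a \<in> A" "b \<in> C i" "b \<in> B" by auto
      then have "dist a b \<le> \<delta>" using diameter_bounded_bound[OF C(2)] C(3) order_trans by blast
      then show False using sep[OF ab(2,4)] d by simp
    qed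
    then show "?w (CA i) + ?w (CB i) \<le> ?w (C i)" by (auto simp: CA_def CB_def)
  qed
  finally show "hausdorff_pre s \<delta> A + hausdorff_pre s \<delta> B \<le> (\<Sum>i. ?w (C i))" .
qed

text \<open>Premeasures grow as the scale shrinks, so two different scales can be replaced by a
  common one below both and below d, where separated sets add. The two suprema are then taken one
  after the other.\<close>

lemma hausdorff_outer_separated:
  assumes "d > 0" and sep: "\<And>a b. a \<in> A \<Longrightarrow> b \<in> B \<Longrightarrow> d \<le> dist a b"
  shows "hausdorff_outer s A + hausdorff_outer s B \<le> hausdorff_outer s (A \<union> B)"
proof -
  have "hausdorff_pre s \<delta> A + hausdorff_pre s \<epsilon> B \<le> hausdorff_outer s (A \<union> B)"
    if "\<delta> > 0" "\<epsilon> > 0" for \<delta> \<epsilon>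
  proof -
    define \<eta> where "\<eta> = min (min \<delta> \<epsilon>) (d / 2)"
    have \<eta>: "\<eta> > 0" "\<eta> < d" "\<eta> \<le> \<delta>" "\<eta> \<le> \<epsilon>" using that assms by (auto simp: \<eta>_def)
    have "hausdorff_pre s \<delta> A + hausdorff_pre s \<epsilon> B \<le> hausdorff_pre s \<eta> A + hausdorff_pre s \<eta> B"
      using \<eta> by (intro add_mono hausdorff_pre_antimono)
    also have "\<dots> \<le> hausdorff_pre s \<eta> (A \<union> B)"
      using \<eta> sep by (intro hausdorff_pre_separated[of _ d]) auto
    also have "\<dots> \<le> hausdorff_outer s (A \<union> B)"
      unfolding hausdorff_outer_eq_SUP using \<eta> by (intro SUP_upper) auto
    finally show ?thesis .
  qed
  then have "hausdorff_pre s \<delta> A + hausdorff_outer s B \<le> hausdorff_outer s (A \<union> B)" if "\<delta> > 0" for \<delta>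
    unfolding hausdorff_outer_eq_SUP[of s B] using that
    by (subst ennreal_SUP_add_right) (auto intro!: SUP_least)
  then show ?thesis
    unfolding hausdorff_outer_eq_SUP[of s A]
    by (simp add: ennreal_SUP_add_left[symmetric]) (auto intro!: SUP_least)
qed

lemma hausdorff_outer_closed:
  "closed F \<Longrightarrow> hausdorff_outer s (F \<inter> X) + hausdorff_outer s (X - F) = hausdorff_outer s X"
  by (rule metric_outer_measure_closed)
     (auto intro: hausdorff_outer_empty hausdorff_outer_mono hausdorff_outer_countably_subadditive
        hausdorff_outer_separated)

text \<open>The Caratheodory measurable sets form a sigma-algebra on which the outer measure is
  countably additive; it contains the closed sets, hence all Borel sets.\<close>

lemma hausdorff_measure_space_borel:
  "measure_space UNIV (sets (borel :: 'a::euclidean_space measure)) (hausdorff_outer s)"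
proof -
  interpret sigma_algebra UNIV "Pow (UNIV :: 'a set)" by (rule sigma_algebra_Pow)
  have "outer_measure_space (Pow UNIV) (hausdorff_outer s :: 'a set \<Rightarrow> ennreal)"
    unfolding outer_measure_space_def positive_def increasing_def countably_subadditive_def
    by (auto intro: hausdorff_outer_empty hausdorff_outer_mono hausdorff_outer_countably_subadditive)
  from caratheodory_lemma[OF this]
  have ms: "measure_space UNIV (lambda_system UNIV (Pow UNIV) (hausdorff_outer s :: 'a set \<Rightarrow> ennreal)) (hausdorff_outer s)" .
  then have sa: "sigma_algebra UNIV (lambda_system UNIV (Pow UNIV) (hausdorff_outer s :: 'a set \<Rightarrow> ennreal))"
    by (simp add: measure_space_def)
  have "closed F \<Longrightarrow> F \<in> lambda_system UNIV (Pow UNIV) (hausdorff_outer s)" for F :: "'a set"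
    using hausdorff_outer_closed[of F s] by (auto simp: lambda_system_def Diff_eq Int_commute)
  then have "sets (borel :: 'a measure) \<subseteq> lambda_system UNIV (Pow UNIV) (hausdorff_outer s)"
    unfolding borel_eq_closed using sigma_algebra.sigma_sets_subset[OF sa, of "Collect closed"] by auto
  moreover have "sigma_algebra UNIV (sets (borel :: 'a measure))"
    by (metis sets.sigma_algebra_axioms space_borel)
  ultimately show ?thesis
    using ms unfolding measure_space_def positive_def countably_additive_def by blast
qed

lemma sets_hausdorff_measure_on: "sets (hausdorff_measure_on s S) = sets (restrict_space borel S)"
  unfolding hausdorff_measure_on_def
  by (metis sets.sets_measure_of_eq space_restrict_space2 sets.sigma_sets_eq sets.space_closed sets_measure_of space_borel space_restrict_space Int_UNIV_right)

lemma space_hausdorff_measure_on: "space (hausdorff_measure_on s S) = S"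
  using sets_eq_imp_space_eq[OF sets_hausdorff_measure_on[of s S]] by (simp add: space_restrict_space)

text \<open>Relative Borel sets of a Borel S are Borel, so countable additivity carries over to S
  and \<open>measure_of\<close> does not fall back to the zero measure.\<close>

lemma emeasure_hausdorff_measure_on:
  assumes "S \<in> sets borel" "A \<in> sets borel" "A \<subseteq> S"
  shows "emeasure (hausdorff_measure_on s S) A = hausdorff_outer s A"
  unfolding hausdorff_measure_on_def
proof (rule emeasure_measure_of_sigma)
  show "sigma_algebra S (sets (restrict_space borel S))"
    by (metis inf_top.right_neutral sets.sigma_algebra_axioms space_borel space_restrict_space)
  show "positive (sets (restrict_space borel S)) (hausdorff_outer s)"
    by (simp add: positive_def hausdorff_outer_empty)
  have "sets (restrict_space borel S) \<subseteq> sets borel"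
    using \<open>S \<in> sets borel\<close> by (auto simp: sets_restrict_space_iff)
  then show "countably_additive (sets (restrict_space borel S)) (hausdorff_outer s)"
    using hausdorff_measure_space_borel[where 'a='a, of s]
    unfolding measure_space_def countably_additive_def by blast
  show "A \<in> sets (restrict_space borel S)" using assms by (simp add: sets_restrict_space_iff)
qed

section \<open>Directional derivatives and smooth bumps\<close>

text \<open>The weak gradient is tested one coordinate at a time, so derivatives along lines are
  enough. The derivative is carried as an explicit function rather than through
  \<open>deriv\<close>, which makes its continuity and support accessible.\<close>

definition dir_deriv :: "'a::euclidean_space \<Rightarrow> ('a \<Rightarrow> real) \<Rightarrow> ('a \<Rightarrow> real) \<Rightarrow> bool" where
  "dir_deriv v f f' \<longleftrightarrow> (\<forall>x. ((\<lambda>t. f (x + t *\<^sub>R v)) has_real_derivative f' x) (at 0))"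

lemma dir_derivD: "dir_deriv v f f' \<Longrightarrow> ((\<lambda>t. f (x + t *\<^sub>R v)) has_real_derivative f' x) (at 0)"
  by (simp add: dir_deriv_def)

lemma dir_deriv_partial: "dir_deriv v f f' \<Longrightarrow> partial_deriv v f = f'"
  unfolding dir_deriv_def partial_deriv_def by (auto intro: DERIV_imp_deriv)

lemma dir_deriv_line:
  assumes "dir_deriv v f f'"
  shows "((\<lambda>t. f (x + t *\<^sub>R v)) has_real_derivative f' (x + s *\<^sub>R v)) (at s)"
proof -
  have "((\<lambda>t. f (x + s *\<^sub>R v + t *\<^sub>R v)) has_real_derivative f' (x + s *\<^sub>R v)) (at 0)"
    using assms by (simp add: dir_deriv_def)
  then show ?thesis
    using DERIV_shift[of "\<lambda>t. f (x + t *\<^sub>R v)" "f' (x + s *\<^sub>R v)" 0 s]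
    by (simp add: scaleR_add_left add.commute add.left_commute)
qed

lemma dir_deriv_const: "dir_deriv v (\<lambda>x. c) (\<lambda>x. 0)"
  by (simp add: dir_deriv_def)

lemma dir_deriv_add: "dir_deriv v f f' \<Longrightarrow> dir_deriv v g g' \<Longrightarrow> dir_deriv v (\<lambda>x. f x + g x) (\<lambda>x. f' x + g' x)"
  unfolding dir_deriv_def by (auto intro: DERIV_add)

lemma dir_deriv_mult:
  "dir_deriv v f f' \<Longrightarrow> dir_deriv v g g' \<Longrightarrow> dir_deriv v (\<lambda>x. f x * g x) (\<lambda>x. f' x * g x + f x * g' x)"
  unfolding dir_deriv_def
proof
  fix x assume "\<forall>x. ((\<lambda>t. f (x + t *\<^sub>R v)) has_real_derivative f' x) (at 0)"
    "\<forall>x. ((\<lambda>t. g (x + t *\<^sub>R v)) has_real_derivative g' x) (at 0)"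
  then show "((\<lambda>t. f (x + t *\<^sub>R v) * g (x + t *\<^sub>R v)) has_real_derivative f' x * g x + f x * g' x) (at 0)"
    by (auto intro!: derivative_eq_intros)
qed

text \<open>The outer function need be differentiable only at the values taken, as for a real power
  of a positive quantity.\<close>

lemma dir_deriv_chain_at:
  assumes "dir_deriv v f f'" "\<And>x. (\<phi> has_real_derivative \<phi>' x) (at (f x))"
  shows "dir_deriv v (\<lambda>x. \<phi> (f x)) (\<lambda>x. \<phi>' x * f' x)"
  unfolding dir_deriv_def
proof
  fix x
  show "((\<lambda>t. \<phi> (f (x + t *\<^sub>R v))) has_real_derivative \<phi>' x * f' x) (at 0)"
    using DERIV_chain2[of \<phi> "\<phi>' x" "\<lambda>t. f (x + t *\<^sub>R v)" 0 "f' x" UNIV] assms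
    by (auto simp: dir_deriv_def)
qed

lemma dir_deriv_chain:
  assumes "dir_deriv v f f'" "\<And>s. (\<phi> has_real_derivative \<phi>' s) (at s)"
  shows "dir_deriv v (\<lambda>x. \<phi> (f x)) (\<lambda>x. \<phi>' (f x) * f' x)"
  by (rule dir_deriv_chain_at[OF assms])

lemma dir_deriv_inner: "dir_deriv v (\<lambda>x. (x - x0) \<bullet> w) (\<lambda>x. v \<bullet> w)"
  unfolding dir_deriv_def by (auto intro!: derivative_eq_intros simp: algebra_simps)

lemma dir_deriv_norm_sq: "dir_deriv v (\<lambda>x. (norm (x - x0))\<^sup>2) (\<lambda>x. 2 * ((x - x0) \<bullet> v))"
  unfolding dir_deriv_def power2_norm_eq_inner
  by (auto intro!: derivative_eq_intros simp: algebra_simps inner_commute)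

lemma dir_deriv_polynomial:
  assumes "real_polynomial_function p"
  obtains p' where "real_polynomial_function p'" "dir_deriv v p p'"
proof -
  have "\<exists>p'. real_polynomial_function p' \<and> dir_deriv v p p'"
    using assms
  proof (induction p rule: real_polynomial_function.induct)
    case (linear h)
    then interpret bounded_linear h .
    have "dir_deriv v h (\<lambda>x. h v)"
      unfolding dir_deriv_def by (auto simp: add scaleR intro!: derivative_eq_intros)
    then show ?case by (blast intro: real_polynomial_function.intros)
  next
    case (const c)
    then show ?case
      by (intro exI[of _ "\<lambda>x. 0"] conjI dir_deriv_const real_polynomial_function.intros(2))
  next
    case (add f g)
    then obtain f' g' where "real_polynomial_function f'" "dir_deriv v f f'"
      "real_polynomial_function g'" "dir_deriv v g g'" by auto
    then show ?case
      by (intro exI[of _ "\<lambda>x. f' x + g' x"] conjI dir_deriv_add real_polynomial_function.intros(3))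
  next
    case (mult f g)
    then obtain f' g' where "real_polynomial_function f'" "dir_deriv v f f'"
      "real_polynomial_function g'" "dir_deriv v g g'" by auto
    then show ?case using mult
      by (intro exI[of _ "\<lambda>x. f' x * g x + f x * g' x"] conjI dir_deriv_mult real_polynomial_function.intros(3,4))
  qed
  then show thesis using that by blast
qed

text \<open>f vanishes on the open complement of K, hence on a neighbourhood of x. This passes
  compact support on to derivatives.\<close>

lemma dir_deriv_eq_zero_outside:
  assumes "dir_deriv v f f'" "closed K" "\<And>x. x \<notin> K \<Longrightarrow> f x = 0" "x \<notin> K"
  shows "f' x = 0"
proof -
  have "open (- K)" using assms by auto
  then have ev: "eventually (\<lambda>y. y \<in> - K) (nhds x)"
    using \<open>x \<notin> K\<close> eventually_nhds_in_open by blast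
  have "((\<lambda>t. x + t *\<^sub>R v) \<longlongrightarrow> x + 0 *\<^sub>R v) (nhds 0)"
    by (intro tendsto_intros filterlim_ident)
  then have "filterlim (\<lambda>t. x + t *\<^sub>R v) (nhds x) (nhds 0)" by simp
  then have "eventually (\<lambda>t. x + t *\<^sub>R v \<in> - K) (nhds 0)"
    using ev by (auto simp: filterlim_iff)
  then have "eventually (\<lambda>t. f (x + t *\<^sub>R v) = 0) (nhds 0)"
    by eventually_elim (use assms in auto)
  then have "((\<lambda>t. 0) has_real_derivative f' x) (at 0)"
    using DERIV_cong_ev[OF refl, of "\<lambda>t. f (x + t *\<^sub>R v)" "\<lambda>t. 0" 0 "f' x" "f' x"] dir_derivD[OF assms(1), of x] by simp
  then show ?thesis using DERIV_unique DERIV_const by blast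
qed

text \<open>The functions $t^{-k} e^{-1/t}$, extended by zero to $t \<le> 0$; the case $k = 0$ is the standard
  smooth transition.\<close>

definition exp_inv :: "nat \<Rightarrow> real \<Rightarrow> real" where
  "exp_inv k t = (if t > 0 then inverse t ^ k * exp (- inverse t) else 0)"

lemma exp_inv_tendsto_0: "(exp_inv k \<longlongrightarrow> 0) (at 0)"
proof -
  have "((\<lambda>x::real. x ^ k / exp x) \<longlongrightarrow> 0) at_top" by (rule tendsto_power_div_exp_0)
  then have "((\<lambda>t. inverse t ^ k / exp (inverse t)) \<longlongrightarrow> 0) (at_right (0::real))"
    by (rule filterlim_compose[OF _ filterlim_inverse_at_top_right])
  then have "(exp_inv k \<longlongrightarrow> 0) (at_right 0)"
  proof (rule Lim_transform_eventually)
    show "\<forall>\<^sub>F x in at_right 0. inverse x ^ k / exp (inverse x) = exp_inv k x"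
      by (auto simp: eventually_at_filter exp_inv_def exp_minus divide_inverse)
  qed
  moreover have "(exp_inv k \<longlongrightarrow> 0) (at_left 0)"
    by (rule Lim_transform_eventually[OF tendsto_const])
       (auto simp: eventually_at_filter exp_inv_def)
  ultimately show ?thesis by (simp add: filterlim_at_split)
qed

lemma exp_inv_deriv:
  "(exp_inv k has_real_derivative exp_inv (k + 2) t - real k * exp_inv (k + 1) t) (at t)"
proof (cases t "0 :: real" rule: linorder_cases)
  case less
  have "((\<lambda>t. 0 :: real) has_real_derivative exp_inv (k + 2) t - real k * exp_inv (k + 1) t) (at t)"
    using less by (simp add: exp_inv_def)
  then show ?thesis
    by (rule has_field_derivative_transform_within_open[where S = "{..<0}"])
       (use less in \<open>auto simp: exp_inv_def\<close>)
next
  case equal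
  \<comment> \<open>At 0 the difference quotient of \<open>exp_inv k\<close> is
    \<open>exp_inv (k + 1)\<close>, which tends to 0.\<close>
  have "((\<lambda>h. (exp_inv k (0 + h) - exp_inv k 0) / h) \<longlongrightarrow> 0) (at 0)"
    by (rule Lim_transform_eventually[OF exp_inv_tendsto_0[of "Suc k"]])
       (auto simp: eventually_at_filter exp_inv_def field_simps)
  then show ?thesis using equal by (simp add: DERIV_def exp_inv_def)
next
  case greater
  have "((\<lambda>t. inverse t ^ k * exp (- inverse t)) has_real_derivative
      exp_inv (k + 2) t - real k * exp_inv (k + 1) t) (at t)"
  proof -
    have "((\<lambda>x. x ^ k * exp (- x)) has_real_derivative
        real k * x ^ (k - 1) * exp (- x) - x ^ k * exp (- x)) (at x)" for x :: real
      by (auto intro!: derivative_eq_intros)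
    from DERIV_chain2[OF this DERIV_inverse[of t UNIV]]
    have "((\<lambda>t. inverse t ^ k * exp (- inverse t)) has_real_derivative
      (real k * inverse t ^ (k - 1) * exp (- inverse t) - inverse t ^ k * exp (- inverse t)) * - (inverse t)\<^sup>2) (at t)"
      using greater by (simp add: numeral_2_eq_2)
    moreover have "(real k * inverse t ^ (k - 1) * exp (- inverse t) - inverse t ^ k * exp (- inverse t)) * - (inverse t)\<^sup>2
       = exp_inv (k + 2) t - real k * exp_inv (k + 1) t"
      using greater by (cases k) (simp_all add: exp_inv_def algebra_simps power2_eq_square)
    ultimately show ?thesis by simp
  qed
  then show ?thesis
    by (rule has_field_derivative_transform_within_open[where S = "{0<..}"])
       (use greater in \<open>auto simp: exp_inv_def\<close>)
qed

lemma continuous_on_exp_inv: "continuous_on S (exp_inv k)"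
  by (meson DERIV_isCont continuous_at_imp_continuous_on exp_inv_deriv)

text \<open>Chosen to be closed under every partial derivative: differentiation only changes the
  polynomials and raises k. One induction over the list of directions then gives smoothness in the
  iterated sense of \<open>smooth_fun\<close>.\<close>

inductive bump_span :: "'a::euclidean_space \<Rightarrow> real \<Rightarrow> ('a \<Rightarrow> real) \<Rightarrow> bool" for x0 c where
  prod: "real_polynomial_function p \<Longrightarrow> bump_span x0 c (\<lambda>x. p x * exp_inv k (c - (norm (x - x0))\<^sup>2))"
| add: "bump_span x0 c f \<Longrightarrow> bump_span x0 c g \<Longrightarrow> bump_span x0 c (\<lambda>x. f x + g x)"

lemma real_polynomial_function_continuous: "real_polynomial_function p \<Longrightarrow> continuous_on S p"
  by (metis continuous_on_polymonial_function real_polynomial_function_eq)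

lemma bump_span_continuous: "bump_span x0 c f \<Longrightarrow> continuous_on S f"
proof (induction rule: bump_span.induct)
  case (prod p k)
  have "continuous_on S (exp_inv k \<circ> (\<lambda>x. c - (norm (x - x0))\<^sup>2))"
    by (intro continuous_on_compose continuous_on_exp_inv continuous_intros)
  then show ?case
    by (intro continuous_on_mult real_polynomial_function_continuous[OF prod]) (simp add: comp_def)
qed (intro continuous_intros)

lemma bump_span_deriv: "bump_span x0 c f \<Longrightarrow> \<exists>g. bump_span x0 c g \<and> dir_deriv v f g"
proof (induction rule: bump_span.induct)
  case (prod p k)
  obtain p' where p': "real_polynomial_function p'" "dir_deriv v p p'"
    using dir_deriv_polynomial prod by blast
  let ?s = "\<lambda>x. c - (norm (x - x0))\<^sup>2"
  have "dir_deriv v ?s (\<lambda>x. 0 + (- 1) * (2 * ((x - x0) \<bullet> v)))"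
    using dir_deriv_add[OF dir_deriv_const dir_deriv_mult[OF dir_deriv_const dir_deriv_norm_sq], of v c "-1" x0] by simp
  from dir_deriv_mult[OF p'(2) dir_deriv_chain[OF this exp_inv_deriv[of k]]]
  have "dir_deriv v (\<lambda>x. p x * exp_inv k (?s x))
     (\<lambda>x. p' x * exp_inv k (?s x) + p x * ((exp_inv (k + 2) (?s x) - real k * exp_inv (k + 1) (?s x)) * (0 + (- 1) * (2 * ((x - x0) \<bullet> v)))))" .
  also have "(\<lambda>x. p' x * exp_inv k (?s x) + p x * ((exp_inv (k + 2) (?s x) - real k * exp_inv (k + 1) (?s x)) * (0 + (- 1) * (2 * ((x - x0) \<bullet> v)))))
    = (\<lambda>x. p' x * exp_inv k (?s x) + ((p x * (-2 * (x \<bullet> v - x0 \<bullet> v))) * exp_inv (k + 2) (?s x)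
         + (p x * (2 * real k * (x \<bullet> v - x0 \<bullet> v))) * exp_inv (k + 1) (?s x)))"
    by (auto simp: fun_eq_iff algebra_simps)
  finally have d: "dir_deriv v (\<lambda>x. p x * exp_inv k (?s x)) \<dots>" .
  have pol: "real_polynomial_function (\<lambda>x. x \<bullet> v - x0 \<bullet> v)"
    by (intro real_polynomial_function_diff real_polynomial_function.intros bounded_linear_inner_left)
  show ?case
    by (rule exI, rule conjI[OF _ d])
      (intro bump_span.intros real_polynomial_function.intros prod p' pol)
next
  case (add f g)
  then obtain f' g' where "bump_span x0 c f'" "dir_deriv v f f'" "bump_span x0 c g'" "dir_deriv v g g'"
    by auto
  then show ?case
    by (intro exI[of _ "\<lambda>x. f' x + g' x"] conjI bump_span.add dir_deriv_add)
qed

lemma bump_span_smooth: "bump_span x0 c f \<Longrightarrow> smooth_fun f"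
proof -
  assume f: "bump_span x0 c f"
  have "bump_span x0 c (iter_partial vs f)" for vs
  proof (induction vs)
    case (Cons v vs)
    then show ?case using bump_span_deriv[OF Cons, of v] dir_deriv_partial by force
  qed (simp add: f)
  moreover have "(\<lambda>t. g (x + t *\<^sub>R v)) differentiable (at 0)" if "bump_span x0 c g" for g v x
    using bump_span_deriv[OF that, of v] dir_derivD real_differentiable_def by blast
  ultimately show ?thesis unfolding smooth_fun_def
    by (auto intro: bump_span_continuous)
qed

section \<open>The standard mollifier and integration by parts for compactly supported
  functions\<close>

definition mollifier :: "real \<Rightarrow> 'a::euclidean_space \<Rightarrow> real" where
  "mollifier e z = exp_inv 0 (e\<^sup>2 - (norm z)\<^sup>2) / (\<integral>z. exp_inv 0 (e\<^sup>2 - (norm (z::'a))\<^sup>2) \<partial>lborel)"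

text \<open>The index 2 appears because \<open>exp_inv 0\<close> has derivative
  \<open>exp_inv 2\<close>; the other factor is the inner derivative of
  \<open>e\<^sup>2 - (norm z)\<^sup>2\<close> along v.\<close>

definition mollifier_grad :: "real \<Rightarrow> 'a::euclidean_space \<Rightarrow> 'a \<Rightarrow> real" where
  "mollifier_grad e v z = exp_inv 2 (e\<^sup>2 - (norm z)\<^sup>2) * (- 2 * (z \<bullet> v)) / (\<integral>z. exp_inv 0 (e\<^sup>2 - (norm (z::'a))\<^sup>2) \<partial>lborel)"

lemma exp_inv_norm_outside: "e > 0 \<Longrightarrow> norm z \<ge> e \<Longrightarrow> exp_inv k (e\<^sup>2 - (norm z)\<^sup>2) = 0"
proof -
  assume "e > 0" "norm z \<ge> e"
  then have "e\<^sup>2 \<le> (norm z)\<^sup>2" by (intro power_mono) auto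
  then have "\<not> e\<^sup>2 - (norm z)\<^sup>2 > 0" by linarith
  then show ?thesis by (simp only: exp_inv_def if_False)
qed

lemma mollifier_outside: "e > 0 \<Longrightarrow> norm z \<ge> e \<Longrightarrow> mollifier e z = 0"
  by (simp add: mollifier_def exp_inv_norm_outside)

lemma mollifier_grad_outside: "e > 0 \<Longrightarrow> norm z \<ge> e \<Longrightarrow> mollifier_grad e v z = 0"
  by (simp add: mollifier_grad_def exp_inv_norm_outside)

lemma mollifier_minus: "mollifier e (x - y) = mollifier e (y - x)"
  by (simp add: mollifier_def norm_minus_commute)

lemma continuous_on_exp_inv_norm:
  "continuous_on S (\<lambda>z::'a::euclidean_space. exp_inv k (c - (norm z)\<^sup>2))"
proof -
  have "continuous_on S (exp_inv k \<circ> (\<lambda>z::'a. c - (norm z)\<^sup>2))"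
    by (intro continuous_on_compose continuous_on_exp_inv continuous_intros)
  then show ?thesis by (simp add: comp_def)
qed

lemma continuous_on_mollifier: "continuous_on S (mollifier e)"
  unfolding mollifier_def divide_inverse
  by (intro continuous_intros continuous_on_exp_inv_norm)

lemma continuous_on_mollifier_grad: "continuous_on S (mollifier_grad e v)"
  unfolding mollifier_grad_def divide_inverse
  by (intro continuous_intros continuous_on_exp_inv_norm)

lemma integrable_continuous_compact_support:
  fixes f :: "'a::euclidean_space \<Rightarrow> real"
  assumes "continuous_on UNIV f" "compact K" "\<And>x. x \<notin> K \<Longrightarrow> f x = 0"
  shows "integrable lborel f"
proof -
  have "integrable lborel (\<lambda>x. indicator K x *\<^sub>R f x)"
    using borel_integrable_compact[OF \<open>compact K\<close> continuous_on_subset[OF assms(1)]] by simp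
  moreover have "(\<lambda>x. indicator K x *\<^sub>R f x) = f"
    by (rule ext) (auto simp: indicator_def assms(3))
  ultimately show ?thesis by simp
qed

lemma bounded_continuous_compact_support:
  fixes f :: "'a::euclidean_space \<Rightarrow> real"
  assumes "continuous_on UNIV f" "compact K" "\<And>x. x \<notin> K \<Longrightarrow> f x = 0"
  shows "\<exists>B>0. \<forall>x. \<bar>f x\<bar> \<le> B"
proof -
  have "compact (f ` K)" using assms by (intro compact_continuous_image) (auto intro: continuous_on_subset)
  then obtain B where B: "\<And>x. x \<in> K \<Longrightarrow> \<bar>f x\<bar> \<le> B"
    using compact_imp_bounded bounded_iff by (metis imageI real_norm_def)
  have "\<bar>f x\<bar> \<le> max B 1" for x
    by (cases "x \<in> K") (use assms B in \<open>auto intro: max.coboundedI1\<close>)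
  then show ?thesis by (intro exI[of _ "max B 1"]) auto
qed

text \<open>A vanishing integral of a nonnegative function forces it to vanish almost everywhere,
  but the bump is positive on a ball of positive measure.\<close>

lemma mollifier_mass_pos:
  assumes "e > 0"
  shows "(\<integral>z. exp_inv 0 (e\<^sup>2 - (norm (z::'a::euclidean_space))\<^sup>2) \<partial>lborel) > 0"
proof -
  have int: "integrable lborel (\<lambda>z::'a. exp_inv 0 (e\<^sup>2 - (norm z)\<^sup>2))"
  proof (rule integrable_continuous_compact_support[of _ "cball 0 e"])
    fix x :: 'a assume "x \<notin> cball 0 e"
    then show "exp_inv 0 (e\<^sup>2 - (norm x)\<^sup>2) = 0"
      using assms by (intro exp_inv_norm_outside) auto
  qed (auto intro: continuous_on_exp_inv_norm)
  have nn: "exp_inv 0 (e\<^sup>2 - (norm z)\<^sup>2) \<ge> 0" for z :: 'a by (simp add: exp_inv_def)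
  have "(\<integral>z. exp_inv 0 (e\<^sup>2 - (norm (z::'a))\<^sup>2) \<partial>lborel) \<noteq> 0"
  proof
    assume "(\<integral>z. exp_inv 0 (e\<^sup>2 - (norm (z::'a))\<^sup>2) \<partial>lborel) = 0"
    then have "AE z in lborel. exp_inv 0 (e\<^sup>2 - (norm (z::'a))\<^sup>2) = 0"
      using integral_nonneg_eq_0_iff_AE[OF int] nn by auto
    then have "AE z in lborel. (z::'a) \<notin> ball 0 e"
    proof eventually_elim
      case (elim z)
      have "\<not> (norm z < e)"
      proof
        assume "norm z < e"
        then have "(norm z)\<^sup>2 < e\<^sup>2" using assms by (intro power_strict_mono) auto
        then show False using elim by (simp add: exp_inv_def)
      qed
      then show ?case by simp
    qed
    then have "emeasure lborel (ball (0::'a) e) = 0"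
      by (subst (asm) AE_iff_measurable[OF _ refl]) (auto simp: ball_def)
    then show False using emeasure_lborel_ball_finite assms
      by (metis content_ball_pos emeasure_eq_ennreal_measure ennreal_eq_0_iff less_irrefl measure_def measure_eq_emeasure_eq_ennreal measure_nonneg top.not_eq_extremum enn2real_0 leD lborel_def)
  qed
  moreover have "(\<integral>z. exp_inv 0 (e\<^sup>2 - (norm (z::'a))\<^sup>2) \<partial>lborel) \<ge> 0"
    using nn by (intro Bochner_Integration.integral_nonneg) auto
  ultimately show ?thesis by linarith
qed

lemma mollifier_nonneg: "mollifier e z \<ge> 0"
  unfolding mollifier_def by (intro divide_nonneg_nonneg Bochner_Integration.integral_nonneg) (auto simp: exp_inv_def)

lemma mollifier_integrable:
  assumes "e > 0"
  shows "integrable lborel (mollifier e)"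
  by (rule integrable_continuous_compact_support[of _ "cball 0 e"])
     (auto intro: continuous_on_mollifier mollifier_outside assms)

lemma mollifier_integral:
  assumes "e > 0"
  shows "(\<integral>z. mollifier e (z::'a::euclidean_space) \<partial>lborel) = 1"
  unfolding mollifier_def using mollifier_mass_pos[OF assms, where 'a='a] by simp

lemma lborel_has_integral_translate:
  fixes f :: "'a::euclidean_space \<Rightarrow> real"
  assumes "integrable lborel f"
  shows "integrable lborel (\<lambda>x. f (x + c))" "(\<integral>x. f (x + c) \<partial>lborel) = (\<integral>x. f x \<partial>lborel)"
proof -
  have "integrable (distr lborel borel ((+) c)) f" using assms by (simp add: lborel_distr_plus)
  then show "integrable lborel (\<lambda>x. f (x + c))"
    by (subst (asm) integrable_distr_eq) (use assms in \<open>auto simp: add.commute\<close>)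
  have "(\<integral>x. f x \<partial>lborel) = (\<integral>x. f x \<partial>(distr lborel borel ((+) c)))" by (simp add: lborel_distr_plus)
  also have "\<dots> = (\<integral>x. f (c + x) \<partial>lborel)"
    by (subst integral_distr) (use assms in auto)
  finally show "(\<integral>x. f (x + c) \<partial>lborel) = (\<integral>x. f x \<partial>lborel)" by (simp add: add.commute)
qed

lemma mollifier_centered:
  assumes "e > 0"
  shows "integrable lborel (\<lambda>y. mollifier e (y - x))" "(\<integral>y. mollifier e (y - x) \<partial>lborel) = 1"
  using lborel_has_integral_translate[OF mollifier_integrable[OF assms], of "-x"] mollifier_integral[OF assms, where 'a='a]
  by simp_all

lemma mollifier_dir_deriv: "dir_deriv v (\<lambda>z. mollifier e (z - x0)) (\<lambda>z. mollifier_grad e v (z - x0))"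
proof -
  have "dir_deriv v (\<lambda>x. e\<^sup>2 - (norm (x - x0))\<^sup>2) (\<lambda>x. - 2 * ((x - x0) \<bullet> v))"
    using dir_deriv_add[OF dir_deriv_const dir_deriv_mult[OF dir_deriv_const dir_deriv_norm_sq], of v "e\<^sup>2" "-1" x0] by simp
  from dir_deriv_mult[OF dir_deriv_chain[OF this exp_inv_deriv[of 0]] dir_deriv_const,
      of "1 / (\<integral>z. exp_inv 0 (e\<^sup>2 - (norm (z::'a))\<^sup>2) \<partial>lborel)"]
  show ?thesis by (simp add: mollifier_def mollifier_grad_def numeral_2_eq_2)
qed

text \<open>The translated mollifier is a member of \<open>bump_span\<close> with a constant
  polynomial; this admits it in the test identity that defines the weak gradient.\<close>

lemma mollifier_test_function:
  assumes "e > 0" "cball x e \<subseteq> \<Omega>"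
  shows "test_function \<Omega> (\<lambda>y. mollifier e (y - x))"
proof -
  have "bump_span x (e\<^sup>2) (\<lambda>y. inverse (\<integral>z. exp_inv 0 (e\<^sup>2 - (norm (z::'a))\<^sup>2) \<partial>lborel) * exp_inv 0 (e\<^sup>2 - (norm (y - x))\<^sup>2))"
    by (intro bump_span.intros real_polynomial_function.intros)
  then have "smooth_fun (\<lambda>y. mollifier e (y - x))"
    by (auto dest!: bump_span_smooth simp: mollifier_def divide_inverse mult.commute)
  moreover have sub: "closure {y. mollifier e (y - x) \<noteq> 0} \<subseteq> cball x e"
  proof (rule closure_minimal)
    show "{y. mollifier e (y - x) \<noteq> 0} \<subseteq> cball x e"
      using mollifier_outside[OF assms(1)] by (force simp: dist_norm norm_minus_commute)
  qed auto
  moreover have "compact (closure {y. mollifier e (y - x) \<noteq> 0})"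
    using bounded_subset[OF bounded_cball sub] by (simp add: compact_eq_bounded_closed)
  ultimately show ?thesis using assms by (auto simp: test_function_def)
qed

text \<open>By translation invariance every difference quotient of \<open>w\<close> has integral zero.\<close>

lemma integral_dir_deriv_eq_0:
  fixes w w' :: "'a::euclidean_space \<Rightarrow> real"
  assumes w: "continuous_on UNIV w" and w': "continuous_on UNIV w'" and d: "dir_deriv v w w'"
    and K: "compact K" "\<And>x. x \<notin> K \<Longrightarrow> w x = 0"
  shows "(\<integral>x. w' x \<partial>lborel) = 0"
proof -
  have K': "x \<notin> K \<Longrightarrow> w' x = 0" for x
    using dir_deriv_eq_zero_outside[OF d compact_imp_closed[OF K(1)] K(2)] by blast
  obtain B where B: "B > 0" "\<And>x. \<bar>w' x\<bar> \<le> B"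
    using bounded_continuous_compact_support[OF w' K(1) K'] by auto
  obtain R where R: "K \<subseteq> cball 0 R"
    using compact_imp_bounded[OF K(1)] unfolding bounded_iff by force
  define h where "h k = 1 / (real k + 1)" for k :: nat
  have h: "h k > 0" "h k \<le> 1" for k by (auto simp: h_def)
  have h0: "h \<longlonglongrightarrow> 0" unfolding h_def
    using LIMSEQ_inverse_real_of_nat by (simp add: inverse_eq_divide add.commute)
  have intw: "integrable lborel w" by (rule integrable_continuous_compact_support[OF w K])
  let ?q = "\<lambda>k x. (w (x + h k *\<^sub>R v) - w x) / h k"
  have "(\<integral>x. ?q k x \<partial>lborel) = 0" for k
    using lborel_has_integral_translate[OF intw, of "h k *\<^sub>R v"] intw by simp
  moreover have "(\<lambda>k. \<integral>x. ?q k x \<partial>lborel) \<longlonglongrightarrow> (\<integral>x. w' x \<partial>lborel)"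
  \<comment> \<open>Steps of length at most 1 keep all difference quotients inside the ball of
    radius R + |v|, where the mean value theorem bounds them by B.\<close>
  proof (rule integral_dominated_convergence[where w = "\<lambda>x. indicator (cball 0 (R + norm v)) x *\<^sub>R B"])
    show "w' \<in> borel_measurable lborel" using w' by (simp add: borel_measurable_continuous_onI)
    show "(\<lambda>x. ?q k x) \<in> borel_measurable lborel" for k
      using lborel_has_integral_translate(1)[OF intw, of "h k *\<^sub>R v"] intw by auto
    show "integrable lborel (\<lambda>x. indicator (cball 0 (R + norm v)) x *\<^sub>R B)"
      using emeasure_bounded_finite[OF bounded_cball] by (intro integrable_indicator) auto
    show "AE x in lborel. (\<lambda>k. ?q k x) \<longlonglongrightarrow> w' x"
    proof (rule AE_I2)
      fix x
      have "((\<lambda>t. (w (x + t *\<^sub>R v) - w x) / t) \<longlongrightarrow> w' x) (at 0)"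
        using dir_derivD[OF d, of x] by (simp add: DERIV_def)
      moreover have "filterlim h (at 0) sequentially"
        using h0 h by (auto simp: filterlim_at intro!: always_eventually) (metis less_irrefl)
      ultimately show "(\<lambda>k. ?q k x) \<longlonglongrightarrow> w' x" by (rule filterlim_compose)
    qed
    show "AE x in lborel. norm (?q k x) \<le> indicator (cball 0 (R + norm v)) x *\<^sub>R B" for k
    proof (rule AE_I2)
      fix x
      show "norm (?q k x) \<le> indicator (cball 0 (R + norm v)) x *\<^sub>R B"
      proof (cases "x \<in> cball 0 (R + norm v)")
        case True
        have "\<exists>z. z > 0 \<and> z < h k \<and> w (x + h k *\<^sub>R v) - w (x + 0 *\<^sub>R v) = (h k - 0) * w' (x + z *\<^sub>R v)"
          by (rule MVT2[OF h(1)]) (rule dir_deriv_line[OF d])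
        then obtain z where "w (x + h k *\<^sub>R v) - w x = h k * w' (x + z *\<^sub>R v)" by auto
        then show ?thesis using True B(2) h(1)[of k] by simp
      next
        case False
        then have far: "R + norm v < norm x" by simp
        have "norm x \<le> norm (x + h k *\<^sub>R v) + norm (h k *\<^sub>R v)"
          by (metis add_diff_cancel_right' norm_triangle_ineq4)
        also have "norm (h k *\<^sub>R v) \<le> norm v" using h[of k] by (simp add: mult_left_le_one_le)
        finally have "x + h k *\<^sub>R v \<notin> cball 0 R" using far unfolding mem_cball dist_0_norm by linarith
        moreover have "x \<notin> cball 0 R" using far norm_ge_zero[of v] unfolding mem_cball dist_0_norm by linarith
        ultimately have "w (x + h k *\<^sub>R v) = 0" "w x = 0" using R K(2) by blast+
        then show ?thesis using False by simp
      qed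
    qed
  qed
  ultimately have "(\<lambda>k. 0) \<longlonglongrightarrow> (\<integral>x. w' x \<partial>lborel)" by (simp only:)
  then show ?thesis by (simp add: LIMSEQ_const_iff)
qed

section \<open>Mollification and the chain rule\<close>

lemma integrable_mult_bounded:
  fixes f \<kappa> :: "'a \<Rightarrow> real"
  assumes "integrable M f" "\<kappa> \<in> borel_measurable M" "\<And>x. \<bar>\<kappa> x\<bar> \<le> B"
  shows "integrable M (\<lambda>x. f x * \<kappa> x)"
proof (rule Bochner_Integration.integrable_bound[of M "\<lambda>x. B * f x"])
  show "AE x in M. norm (f x * \<kappa> x) \<le> norm (B * f x)"
  proof (rule AE_I2)
    fix x
    have "\<bar>\<kappa> x\<bar> \<le> \<bar>B\<bar>" using assms(3)[of x] by linarith
    then show "norm (f x * \<kappa> x) \<le> norm (B * f x)"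
      by (simp add: abs_mult mult.commute mult_right_mono)
  qed
qed (use assms in auto)

text \<open>Differentiation under the integral sign: by the mean value theorem the difference
  quotients of the kernel are bounded by B, so B |f| is a dominating function.\<close>

lemma dir_deriv_integral:
  fixes f :: "'b \<Rightarrow> real" and k :: "'a::euclidean_space \<Rightarrow> 'b \<Rightarrow> real"
  assumes f: "integrable M f"
    and d: "\<And>y. dir_deriv v (\<lambda>x. k x y) (\<lambda>x. k' x y)"
    and k: "\<And>x. k x \<in> borel_measurable M" "\<And>x y. \<bar>k x y\<bar> \<le> B"
    and k': "\<And>x. k' x \<in> borel_measurable M" "\<And>x y. \<bar>k' x y\<bar> \<le> B"
  shows "dir_deriv v (\<lambda>x. \<integral>y. f y * k x y \<partial>M) (\<lambda>x. \<integral>y. f y * k' x y \<partial>M)"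
  unfolding dir_deriv_def
proof
  fix x
  let ?F = "\<lambda>x. \<integral>y. f y * k x y \<partial>M"
  have "((\<lambda>h. (?F (x + h *\<^sub>R v) - ?F x) / h) \<longlongrightarrow> (\<integral>y. f y * k' x y \<partial>M)) (at 0)"
    unfolding tendsto_at_iff_sequentially
  proof (intro allI impI)
    fix X :: "nat \<Rightarrow> real" assume X: "\<forall>i. X i \<in> UNIV - {0}" and X0: "X \<longlonglongrightarrow> 0"
    have X': "X i \<noteq> 0" for i using X by auto
    let ?q = "\<lambda>i y. f y * ((k (x + X i *\<^sub>R v) y - k x y) / X i)"
    have "(?F (x + X i *\<^sub>R v) - ?F x) / X i = (\<integral>y. ?q i y \<partial>M)" for i
      using integrable_mult_bounded[OF f k] by (simp add: algebra_simps diff_divide_distrib)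
    moreover have "(\<lambda>i. \<integral>y. ?q i y \<partial>M) \<longlonglongrightarrow> (\<integral>y. f y * k' x y \<partial>M)"
    proof (rule integral_dominated_convergence[where w = "\<lambda>y. \<bar>f y\<bar> * B"])
      show "integrable M (\<lambda>y. \<bar>f y\<bar> * B)" using f by auto
      show "AE y in M. (\<lambda>i. ?q i y) \<longlonglongrightarrow> f y * k' x y"
      proof (rule AE_I2)
        fix y
        have "((\<lambda>t. (k (x + t *\<^sub>R v) y - k x y) / t) \<longlongrightarrow> k' x y) (at 0)"
          using dir_derivD[OF d[of y], of x] by (simp add: DERIV_def)
        then have "(\<lambda>i. (k (x + X i *\<^sub>R v) y - k x y) / X i) \<longlonglongrightarrow> k' x y"
          unfolding tendsto_at_iff_sequentially using X X0 by (auto simp: comp_def)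
        then show "(\<lambda>i. ?q i y) \<longlonglongrightarrow> f y * k' x y" by (intro tendsto_intros)
      qed
      show "AE y in M. norm (?q i y) \<le> \<bar>f y\<bar> * B" for i
      proof (rule AE_I2)
        fix y
        let ?g = "\<lambda>t. k (x + t *\<^sub>R v) y"
        have "\<bar>?g (X i) - ?g 0\<bar> \<le> B * \<bar>X i - 0\<bar>"
          using field_differentiable_bound[of UNIV ?g "\<lambda>t. k' (x + t *\<^sub>R v) y" B "X i" 0]
            dir_deriv_line[OF d[of y]] k'(2) by (simp add: real_norm_def)
        then have "\<bar>(k (x + X i *\<^sub>R v) y - k x y) / X i\<bar> \<le> B"
          using X'[of i] by (simp add: abs_divide divide_le_eq)
        then show "norm (?q i y) \<le> \<bar>f y\<bar> * B" by (simp only: real_norm_def abs_mult mult_left_mono abs_ge_zero)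
      qed
    qed (use f k k' in auto)
    ultimately show "((\<lambda>h. (?F (x + h *\<^sub>R v) - ?F x) / h) \<circ> X) \<longlonglongrightarrow> (\<integral>y. f y * k' x y \<partial>M)"
      by (simp only: comp_def)
  qed
  then show "((\<lambda>t. ?F (x + t *\<^sub>R v)) has_real_derivative (\<integral>y. f y * k' x y \<partial>M)) (at 0)"
    by (simp add: DERIV_def)
qed

lemma continuous_on_integral_kernel:
  fixes f :: "'b \<Rightarrow> real" and k :: "'a::euclidean_space \<Rightarrow> 'b \<Rightarrow> real"
  assumes f: "integrable M f"
    and c: "\<And>y. continuous_on UNIV (\<lambda>x. k x y)"
    and k: "\<And>x. k x \<in> borel_measurable M" "\<And>x y. \<bar>k x y\<bar> \<le> B"
  shows "continuous_on UNIV (\<lambda>x. \<integral>y. f y * k x y \<partial>M)"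
proof -
  have "continuous (at x) (\<lambda>x. \<integral>y. f y * k x y \<partial>M)" for x
    unfolding continuous_at_sequentially
  proof (intro allI impI)
    fix X assume X: "X \<longlonglongrightarrow> x"
    have "(\<lambda>i. \<integral>y. f y * k (X i) y \<partial>M) \<longlonglongrightarrow> (\<integral>y. f y * k x y \<partial>M)"
    proof (rule integral_dominated_convergence[where w = "\<lambda>y. \<bar>f y\<bar> * B"])
      show "integrable M (\<lambda>y. \<bar>f y\<bar> * B)" using f by auto
      show "AE y in M. (\<lambda>i. f y * k (X i) y) \<longlonglongrightarrow> f y * k x y"
        using c X by (intro AE_I2 tendsto_intros continuous_on_tendsto_compose[of UNIV "\<lambda>x. k x _"]) auto
      show "AE y in M. norm (f y * k (X i) y) \<le> \<bar>f y\<bar> * B" for i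
        using k(2) by (auto simp: abs_mult mult_left_mono)
    qed (use f k in auto)
    then show "((\<lambda>x. \<integral>y. f y * k x y \<partial>M) \<circ> X) \<longlonglongrightarrow> (\<integral>y. f y * k x y \<partial>M)"
      by (simp add: comp_def)
  qed
  then show ?thesis by (simp add: continuous_on_eq_continuous_at)
qed

lemma mollifier_bounded:
  assumes "e > 0"
  shows "\<exists>B>0. (\<forall>z::'a::euclidean_space. \<bar>mollifier e z\<bar> \<le> B) \<and> (\<forall>z::'a. \<bar>mollifier_grad e v z\<bar> \<le> B)"
proof -
  have "\<exists>A>0. \<forall>z::'a. \<bar>mollifier e z\<bar> \<le> A"
    by (rule bounded_continuous_compact_support[of _ "cball 0 e"])
      (auto intro: continuous_on_mollifier mollifier_outside assms)
  then obtain A where A: "A > 0" "\<forall>z::'a. \<bar>mollifier e z\<bar> \<le> A" by blast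
  have "\<exists>B>0. \<forall>z::'a. \<bar>mollifier_grad e v z\<bar> \<le> B"
    by (rule bounded_continuous_compact_support[of _ "cball 0 e"])
      (auto intro: continuous_on_mollifier_grad mollifier_grad_outside assms)
  then obtain B where B: "B > 0" "\<forall>z::'a. \<bar>mollifier_grad e v z\<bar> \<le> B" by blast
  show ?thesis using A B by (intro exI[of _ "max A B"]) (auto intro: max.coboundedI1 max.coboundedI2)
qed

lemma mollifier_grad_minus: "mollifier_grad e v (- z) = - mollifier_grad e v z"
  by (simp add: mollifier_grad_def)

lemma mollifier_measurable [measurable]: "mollifier e \<in> borel_measurable borel"
  by (intro borel_measurable_continuous_onI continuous_on_mollifier)

lemma mollifier_grad_measurable [measurable]: "mollifier_grad e v \<in> borel_measurable borel"
  by (intro borel_measurable_continuous_onI continuous_on_mollifier_grad)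

text \<open>The mollifier is a probability density living on the e-ball, so averaging cannot
  increase the deviation of g from a. With a = 0 this gives uniform bounds, with a the expected
  limit it gives convergence.\<close>

lemma mollifier_average:
  fixes g :: "'a::euclidean_space \<Rightarrow> real"
  assumes e: "e > 0" and g: "integrable lborel g"
    and near: "\<And>y. norm (y - x) < e \<Longrightarrow> \<bar>g y - a\<bar> \<le> \<eta>"
  shows "\<bar>(\<integral>y. g y * mollifier e (y - x) \<partial>lborel) - a\<bar> \<le> \<eta>"
proof -
  have \<eta>: "\<eta> \<ge> 0" using near[of x] e by auto
  obtain B where B: "\<And>z::'a. \<bar>mollifier e z\<bar> \<le> B" using mollifier_bounded[OF e] by blast
  have ig: "integrable lborel (\<lambda>y. g y * mollifier e (y - x))"
    by (rule integrable_mult_bounded[OF g _ B]) auto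
  note im = mollifier_centered[OF e, of x]
  have "(\<integral>y. g y * mollifier e (y - x) \<partial>lborel) - a = (\<integral>y. g y * mollifier e (y - x) - a * mollifier e (y - x) \<partial>lborel)"
    using ig im by simp
  also have "\<bar>\<dots>\<bar> \<le> (\<integral>y. \<eta> * mollifier e (y - x) \<partial>lborel)"
  proof (rule order_trans[OF integral_abs_bound integral_mono])
    show "\<bar>g y * mollifier e (y - x) - a * mollifier e (y - x)\<bar> \<le> \<eta> * mollifier e (y - x)" for y
    proof (cases "norm (y - x) < e")
      case True
      then show ?thesis using near[OF True] mollifier_nonneg[of e "y - x"]
        by (simp add: left_diff_distrib[symmetric] abs_mult mult_right_mono)
    next
      case False
      then show ?thesis using mollifier_outside[OF e, of "y - x"] by simp
    qed
  qed (use ig im in auto)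
  also have "\<dots> = \<eta>" using im by simp
  finally show ?thesis .
qed

text \<open>For Borel integrands the completed measure restricted to S can be traded for
  \<open>lborel\<close> with an indicator, where Fubini and translation invariance are at
  hand.\<close>

lemma lebesgue_on_integral_lborel:
  fixes f :: "'a::euclidean_space \<Rightarrow> 'b::euclidean_space"
  assumes "S \<in> sets borel" "(\<lambda>x. indicator S x *\<^sub>R f x) \<in> borel_measurable borel"
  shows "(LINT x|lebesgue_on S. f x) = (\<integral>x. indicator S x *\<^sub>R f x \<partial>lborel)"
    and "integrable (lebesgue_on S) f \<longleftrightarrow> integrable lborel (\<lambda>x. indicator S x *\<^sub>R f x)"
  using assms
  by (simp_all add: integral_restrict_space integrable_restrict_space integral_completion integrable_completion)

text \<open>Glueing along the open cover by \<Omega> and the complement of K: a function continuous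
  only inside \<Omega> becomes globally continuous after multiplication by a factor supported in
  K.\<close>

lemma continuous_on_mult_compact_support:
  fixes f \<psi> :: "'a::euclidean_space \<Rightarrow> real"
  assumes "open \<Omega>" "continuous_on \<Omega> f" "continuous_on UNIV \<psi>" "compact K" "K \<subseteq> \<Omega>" "\<And>x. x \<notin> K \<Longrightarrow> \<psi> x = 0"
  shows "continuous_on UNIV (\<lambda>x. f x * \<psi> x)"
proof -
  have "continuous_on \<Omega> (\<lambda>x. f x * \<psi> x)"
    by (intro continuous_intros assms continuous_on_subset[OF assms(3)]) auto
  moreover have "continuous_on (- K) (\<lambda>x. f x * \<psi> x)"
    by (rule continuous_on_eq[of _ "\<lambda>x. 0"]) (auto simp: assms)
  ultimately have "continuous_on (\<Omega> \<union> - K) (\<lambda>x. f x * \<psi> x)"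
    using assms by (intro continuous_on_open_Un) (auto simp: compact_imp_closed open_Compl)
  moreover have "\<Omega> \<union> - K = UNIV" using assms by auto
  ultimately show ?thesis by simp
qed

text \<open>Only weak convergence of the mollified gradients is needed: by Fubini the mollifier is moved
  onto the continuous factor \<open>\<phi>' (u) \<psi>\<close>, where it converges uniformly.\<close>

theorem weak_gradient_chain:
  fixes \<Omega> :: "'a::euclidean_space set"
  assumes \<Omega>: "open \<Omega>" and wg: "weak_gradient \<Omega> u G" and Gm: "G \<in> borel_measurable borel"
    and cu: "continuous_on \<Omega> u"
    and \<phi>: "\<And>s. (\<phi> has_real_derivative \<phi>' s) (at s)" and c\<phi>': "continuous_on UNIV \<phi>'"
    and v: "v \<in> Basis"
    and \<psi>: "continuous_on UNIV \<psi>" "continuous_on UNIV \<psi>'" "dir_deriv v \<psi> \<psi>'"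
    and K: "compact K" "K \<subseteq> \<Omega>" "\<And>x. x \<notin> K \<Longrightarrow> \<psi> x = 0"
  shows "(\<integral>x. \<phi> (u x) * \<psi>' x \<partial>lborel) = - (\<integral>x. \<phi>' (u x) * (G x \<bullet> v) * \<psi> x \<partial>lborel)"
proof -
  have \<psi>'0: "x \<notin> K \<Longrightarrow> \<psi>' x = 0" for x
    using dir_deriv_eq_zero_outside[OF \<psi>(3) compact_imp_closed[OF K(1)] K(3)] by blast
  obtain d where d: "d > 0" "(\<Union>x\<in>K. cball x d) \<subseteq> \<Omega>"
    using compact_subset_open_imp_cball_epsilon_subset[OF K(1) \<Omega> K(2)] by metis
  \<comment> \<open>A compact neighbourhood of K inside \<Omega>. Mollifiers of radius at most d
    centred in K see nothing outside it, so u and G may be cut off to \<open>K'\<close> and become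
    integrable on the whole space.\<close>
  define K' where "K' = (\<Union>x\<in>K. cball x d)"
  have K': "compact K'" "K' \<subseteq> \<Omega>" "K \<subseteq> K'"
    using compact_minkowski_sum_cball[OF K(1)] d by (auto simp: K'_def)
  have near: "y \<in> K'" if "x \<in> K" "norm (y - x) \<le> d" for x y
    using that by (auto simp: K'_def dist_norm norm_minus_commute)
  have [measurable]: "K' \<in> sets borel" "\<Omega> \<in> sets borel"
    using K' \<Omega> by (auto intro: borel_compact)
  have cuK': "continuous_on K' u" using cu K' continuous_on_subset by blast
  obtain B where B: "B > 0" "\<And>x. x \<in> K' \<Longrightarrow> \<bar>u x\<bar> \<le> B"
  proof -
    have "bounded (u ` K')" using compact_continuous_image[OF cuK' K'(1)] compact_imp_bounded by blast
    then obtain B where "\<And>x. x \<in> K' \<Longrightarrow> \<bar>u x\<bar> \<le> B" by (auto simp: bounded_iff)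
    then show thesis by (intro that[of "max B 1"]) (auto simp: le_max_iff_disj)
  qed
  define f where "f y = indicator K' y *\<^sub>R u y" for y
  define g where "g y = (indicator K' y *\<^sub>R G y) \<bullet> v" for y
  have f: "integrable lborel f"
    unfolding f_def by (rule borel_integrable_compact[OF K'(1) cuK'])
  have "integrable (lebesgue_on K') G" using wg K' by (auto simp: weak_gradient_def)
  then have "integrable lborel (\<lambda>y. indicator K' y *\<^sub>R G y)"
    by (subst (asm) lebesgue_on_integral_lborel(2)) (use Gm in auto)
  then have g: "integrable lborel g" unfolding g_def by (rule integrable_inner_left)
  define e where "e k = d / (real k + 1)" for k :: nat
  have e: "e k > 0" "e k \<le> d" for k using d by (auto simp: e_def field_simps)
  have e0: "e \<longlonglongrightarrow> 0"
    unfolding e_def using tendsto_mult[OF tendsto_const[of d] LIMSEQ_inverse_real_of_nat]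
    by (simp add: inverse_eq_divide add.commute)
  define U where "U k x = (\<integral>y. f y * mollifier (e k) (x - y) \<partial>lborel)" for k x
  define U' where "U' k x = (\<integral>y. f y * mollifier_grad (e k) v (x - y) \<partial>lborel)" for k x
  have comp: "continuous_on UNIV (\<lambda>x. mollifier (e k) (x - y))" "continuous_on UNIV (\<lambda>x. mollifier_grad (e k) v (x - y))" for k and y :: 'a
    by (rule continuous_on_compose2[of UNIV _ UNIV]; auto intro!: continuous_intros continuous_on_mollifier continuous_on_mollifier_grad)+
  have dU: "dir_deriv v (U k) (U' k)" and cU: "continuous_on UNIV (U k)" and cU': "continuous_on UNIV (U' k)" for k
  proof -
    obtain A where A: "\<And>z::'a. \<bar>mollifier (e k) z\<bar> \<le> A" "\<And>z::'a. \<bar>mollifier_grad (e k) v z\<bar> \<le> A"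
      using mollifier_bounded[OF e(1)] by blast
    show "dir_deriv v (U k) (U' k)" unfolding U_def U'_def
      by (rule dir_deriv_integral[OF f mollifier_dir_deriv _ A(1) _ A(2)]) auto
    show "continuous_on UNIV (U k)" unfolding U_def
      by (rule continuous_on_integral_kernel[OF f comp(1) _ A(1)]) auto
    show "continuous_on UNIV (U' k)" unfolding U'_def
      by (rule continuous_on_integral_kernel[OF f comp(2) _ A(2)]) auto
  qed
  \<comment> \<open>On K the classical derivative of the mollified u is the mollified gradient
    component: the mollifier centred at x is a test function, and since
    \<open>mollifier_grad\<close> is odd the derivative in y becomes one in x.\<close>
  have U'_eq: "U' k x = (\<integral>y. g y * mollifier (e k) (x - y) \<partial>lborel)" if "x \<in> K" for k x
  proof -
    have sub: "cball x (e k) \<subseteq> K'"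
      using e(2)[of k] near[OF that] by (auto simp: dist_norm norm_minus_commute)
    have out: "mollifier (e k) (y - x) = 0" "mollifier_grad (e k) v (y - x) = 0" if "y \<notin> K'" for y
    proof -
      have "norm (y - x) \<ge> e k" using that sub by (force simp: dist_norm norm_minus_commute)
      then show "mollifier (e k) (y - x) = 0" "mollifier_grad (e k) v (y - x) = 0"
        using e by (auto intro: mollifier_outside mollifier_grad_outside)
    qed
    have "test_function \<Omega> (\<lambda>y. mollifier (e k) (y - x))"
      using sub K' by (intro mollifier_test_function e) auto
    then have "(LINT y|lebesgue_on \<Omega>. u y * partial_deriv v (\<lambda>y. mollifier (e k) (y - x)) y) =
       - (LINT y|lebesgue_on \<Omega>. (G y \<bullet> v) * mollifier (e k) (y - x))"
      using wg v unfolding weak_gradient_def by blast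
    also have "partial_deriv v (\<lambda>y. mollifier (e k) (y - x)) = (\<lambda>y. mollifier_grad (e k) v (y - x))"
      by (rule dir_deriv_partial[OF mollifier_dir_deriv])
    also have "(LINT y|lebesgue_on \<Omega>. u y * mollifier_grad (e k) v (y - x)) = (\<integral>y. f y * mollifier_grad (e k) v (y - x) \<partial>lborel)"
    proof (subst lebesgue_on_integral_lborel)
      have eq: "(\<lambda>y. indicator \<Omega> y *\<^sub>R (u y * mollifier_grad (e k) v (y - x))) = (\<lambda>y. f y * mollifier_grad (e k) v (y - x))"
        using out K' by (auto simp: fun_eq_iff f_def indicator_def)
      show "(\<lambda>y. indicator \<Omega> y *\<^sub>R (u y * mollifier_grad (e k) v (y - x))) \<in> borel_measurable borel"
        unfolding eq using f by measurable
      show "(\<integral>y. indicator \<Omega> y *\<^sub>R (u y * mollifier_grad (e k) v (y - x)) \<partial>lborel) = (\<integral>y. f y * mollifier_grad (e k) v (y - x) \<partial>lborel)"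
        unfolding eq ..
    qed simp
    also have "(LINT y|lebesgue_on \<Omega>. (G y \<bullet> v) * mollifier (e k) (y - x)) = (\<integral>y. g y * mollifier (e k) (y - x) \<partial>lborel)"
    proof (subst lebesgue_on_integral_lborel)
      have eq: "(\<lambda>y. indicator \<Omega> y *\<^sub>R ((G y \<bullet> v) * mollifier (e k) (y - x))) = (\<lambda>y. g y * mollifier (e k) (y - x))"
        using out K' by (auto simp: fun_eq_iff g_def indicator_def)
      show "(\<lambda>y. indicator \<Omega> y *\<^sub>R ((G y \<bullet> v) * mollifier (e k) (y - x))) \<in> borel_measurable borel"
        unfolding eq using g by measurable
      show "(\<integral>y. indicator \<Omega> y *\<^sub>R ((G y \<bullet> v) * mollifier (e k) (y - x)) \<partial>lborel) = (\<integral>y. g y * mollifier (e k) (y - x) \<partial>lborel)"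
        unfolding eq ..
    qed simp
    finally have "(\<integral>y. f y * mollifier_grad (e k) v (y - x) \<partial>lborel) = - (\<integral>y. g y * mollifier (e k) (y - x) \<partial>lborel)" .
    moreover have "mollifier_grad (e k) v (x - y) = - mollifier_grad (e k) v (y - x)" for y
      using mollifier_grad_minus[of "e k" v "y - x"] by simp
    ultimately show ?thesis by (simp add: U'_def mollifier_minus[of _ x])
  qed
  have Ub: "\<bar>U k x\<bar> \<le> B" for k x
    using mollifier_average[OF e(1)[of k] f, where x = x and a = 0 and \<eta> = B] B
    by (auto simp: U_def mollifier_minus[of _ x] f_def indicator_def)
  have ucK: "uniformly_continuous_on K' u" by (rule compact_uniformly_continuous[OF cuK' K'(1)])
  have Uu: "\<exists>k0. \<forall>k\<ge>k0. \<forall>x\<in>K. \<bar>U k x - u x\<bar> \<le> \<epsilon>" if "\<epsilon> > 0" for \<epsilon>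
  proof -
    obtain \<delta> where \<delta>: "\<delta> > 0" "\<And>x y. x \<in> K' \<Longrightarrow> y \<in> K' \<Longrightarrow> dist y x < \<delta> \<Longrightarrow> dist (u y) (u x) < \<epsilon>"
      using ucK \<open>\<epsilon> > 0\<close> unfolding uniformly_continuous_on_def by metis
    obtain k0 where k0: "\<And>k. k \<ge> k0 \<Longrightarrow> e k < \<delta>"
      using order_tendstoD(2)[OF e0 \<delta>(1)] by (auto simp: eventually_sequentially)
    show ?thesis
    proof (intro exI[of _ k0] allI impI ballI)
      fix k x assume "k0 \<le> k" and x: "x \<in> K"
      have "\<bar>f y - u x\<bar> \<le> \<epsilon>" if "norm (y - x) < e k" for y
      proof -
        have "y \<in> K'" using near[OF x] that e(2)[of k] by auto
        moreover have "dist y x < \<delta>" using that k0[OF \<open>k0 \<le> k\<close>] by (simp add: dist_norm)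
        ultimately show ?thesis using \<delta>(2)[of x y] x K' by (auto simp: f_def dist_real_def)
      qed
      from mollifier_average[OF e(1) f this]
      show "\<bar>U k x - u x\<bar> \<le> \<epsilon>" by (simp add: U_def mollifier_minus[of _ x])
    qed
  qed
  have Ulim: "(\<lambda>k. U k x) \<longlonglongrightarrow> u x" if "x \<in> K" for x
  proof (rule LIMSEQ_I)
    fix r :: real assume "r > 0"
    then obtain k0 where "\<forall>k\<ge>k0. \<forall>x\<in>K. \<bar>U k x - u x\<bar> \<le> r / 2" using Uu[of "r/2"] by auto
    then show "\<exists>no. \<forall>n\<ge>no. norm (U n x - u x) < r"
    proof (intro exI[of _ k0] allI impI)
      fix k assume "k \<ge> k0"
      then have "\<bar>U k x - u x\<bar> \<le> r / 2"
        using that \<open>\<forall>k\<ge>k0. \<forall>x\<in>K. \<bar>U k x - u x\<bar> \<le> r / 2\<close> by blast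
      then show "norm (U k x - u x) < r" using \<open>r > 0\<close> by simp
    qed
  qed
  \<comment> \<open>The values of u on \<open>K'\<close> and of all its mollifications lie in one
    compact interval; there \<phi> and \<phi>' are bounded and \<phi>' is uniformly
    continuous.\<close>
  define I where "I = {-B..B}"
  have I: "compact I" and UI: "U k x \<in> I" and uI: "x \<in> K' \<Longrightarrow> u x \<in> I" for k x
    using Ub[of k x] B(2)[of x] by (auto simp: I_def)
  have c\<phi>: "continuous_on UNIV \<phi>" using \<phi> DERIV_isCont continuous_at_imp_continuous_on by blast
  obtain C where C: "C > 0" "\<And>s. s \<in> I \<Longrightarrow> \<bar>\<phi> s\<bar> \<le> C" "\<And>s. s \<in> I \<Longrightarrow> \<bar>\<phi>' s\<bar> \<le> C"
  proof -
    have "bounded (\<phi> ` I)" "bounded (\<phi>' ` I)"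
      by (intro compact_imp_bounded compact_continuous_image I
        continuous_on_subset[OF c\<phi>] continuous_on_subset[OF c\<phi>'] subset_UNIV)+
    then obtain C1 C2 where "\<forall>x\<in>\<phi> ` I. norm x \<le> C1" "\<forall>x\<in>\<phi>' ` I. norm x \<le> C2"
      unfolding bounded_iff by blast
    then have "\<And>s. s \<in> I \<Longrightarrow> \<bar>\<phi> s\<bar> \<le> C1" "\<And>s. s \<in> I \<Longrightarrow> \<bar>\<phi>' s\<bar> \<le> C2" by auto
    then show thesis by (intro that[of "max 1 (max C1 C2)"]) (auto simp: le_max_iff_disj)
  qed
  obtain D where D: "D > 0" "\<And>x. \<bar>\<psi> x\<bar> \<le> D" using bounded_continuous_compact_support[OF \<psi>(1) K(1,3)] by auto
  obtain D' where D': "D' > 0" "\<And>x. \<bar>\<psi>' x\<bar> \<le> D'" using bounded_continuous_compact_support[OF \<psi>(2) K(1) \<psi>'0] by auto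
  define h where "h k x = \<phi>' (U k x) * \<psi> x" for k x
  define h0 where "h0 x = \<phi>' (u x) * \<psi> x" for x
  have ch: "continuous_on UNIV (h k)" for k
    unfolding h_def by (intro continuous_intros \<psi> continuous_on_compose2[OF c\<phi>' cU]) auto
  have hK: "x \<notin> K \<Longrightarrow> h k x = 0" for k x by (simp add: h_def K)
  have hb: "\<bar>h k x\<bar> \<le> C * D" for k x
    unfolding h_def abs_mult by (intro mult_mono C UI D) (use C D in auto)
  have ih: "integrable lborel (h k)" for k by (rule integrable_continuous_compact_support[OF ch K(1) hK])
  have ch0: "continuous_on UNIV h0"
    unfolding h0_def
    by (rule continuous_on_mult_compact_support[OF \<Omega> continuous_on_compose2[OF c\<phi>' cu subset_UNIV] \<psi>(1) K])
  have hh0: "\<exists>k0. \<forall>k\<ge>k0. \<forall>x. \<bar>h k x - h0 x\<bar> \<le> \<epsilon>" if "\<epsilon> > 0" for \<epsilon>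
  proof -
    have "uniformly_continuous_on I \<phi>'"
      using compact_uniformly_continuous[OF continuous_on_subset[OF c\<phi>'] I] by simp
    then obtain \<delta> where \<delta>: "\<delta> > 0" "\<And>s t. s \<in> I \<Longrightarrow> t \<in> I \<Longrightarrow> dist t s < \<delta> \<Longrightarrow> dist (\<phi>' t) (\<phi>' s) < \<epsilon> / D"
      using \<open>\<epsilon> > 0\<close> D(1) unfolding uniformly_continuous_on_def by (metis divide_pos_pos)
    obtain k0 where k0: "\<forall>k\<ge>k0. \<forall>x\<in>K. \<bar>U k x - u x\<bar> \<le> \<delta> / 2" using Uu[of "\<delta> / 2"] \<delta> by auto
    show ?thesis
    proof (intro exI[of _ k0] allI impI)
      fix k x assume "k0 \<le> k"
      show "\<bar>h k x - h0 x\<bar> \<le> \<epsilon>"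
      proof (cases "x \<in> K")
        case True
        have "\<bar>U k x - u x\<bar> \<le> \<delta> / 2" using k0 \<open>k0 \<le> k\<close> True by blast
        then have "dist (U k x) (u x) < \<delta>" using \<delta>(1) by (simp add: dist_real_def)
        then have "\<bar>\<phi>' (U k x) - \<phi>' (u x)\<bar> \<le> \<epsilon> / D"
          using \<delta>(2)[of "u x" "U k x"] UI uI K'(3) True by (auto simp: dist_real_def)
        then have "\<bar>\<phi>' (U k x) - \<phi>' (u x)\<bar> * \<bar>\<psi> x\<bar> \<le> \<epsilon> / D * D"
          using D \<open>\<epsilon> > 0\<close> by (intro mult_mono) auto
        then show ?thesis using D(1) by (simp add: h_def h0_def left_diff_distrib[symmetric] abs_mult)
      qed (use that K in \<open>auto simp: h_def h0_def\<close>)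
    qed
  qed
  define H where "H k y = (\<integral>x. h k x * mollifier (e k) (x - y) \<partial>lborel)" for k y
  have Hlim: "(\<lambda>k. H k y) \<longlonglongrightarrow> h0 y" for y
  proof (rule LIMSEQ_I)
    fix r :: real assume r: "r > 0"
    obtain k0 where k0: "\<forall>k\<ge>k0. \<forall>x. \<bar>h k x - h0 x\<bar> \<le> r / 4" using hh0[of "r / 4"] r by auto
    obtain \<delta> where \<delta>: "\<delta> > 0" "\<And>x. dist x y < \<delta> \<Longrightarrow> dist (h0 x) (h0 y) < r / 4"
      using ch0 r unfolding continuous_on_iff by (metis UNIV_I zero_less_divide_iff zero_less_numeral)
    obtain k1 where k1: "\<And>k. k \<ge> k1 \<Longrightarrow> e k < \<delta>"
      using order_tendstoD(2)[OF e0 \<delta>(1)] by (auto simp: eventually_sequentially)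
    show "\<exists>no. \<forall>n\<ge>no. norm (H n y - h0 y) < r"
    proof (intro exI[of _ "max k0 k1"] allI impI)
      fix k assume k: "max k0 k1 \<le> k"
      have "\<bar>H k y - h0 y\<bar> \<le> r / 2" unfolding H_def
      proof (rule mollifier_average[OF e(1) ih])
        fix x assume "norm (x - y) < e k"
        then have "dist x y < \<delta>" using k1[of k] k by (simp add: dist_norm)
        then have "\<bar>h0 x - h0 y\<bar> < r / 4" using \<delta>(2)[of x] by (simp add: dist_real_def)
        moreover have "\<bar>h k x - h0 x\<bar> \<le> r / 4" using k0 k by auto
        ultimately show "\<bar>h k x - h0 y\<bar> \<le> r / 2" by linarith
      qed
      then show "norm (H k y - h0 y) < r" using r by simp
    qed
  qed
  have Hb: "\<bar>H k y\<bar> \<le> C * D" for k y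
    using mollifier_average[OF e(1)[of k] ih[of k], where x = y and a = 0 and \<eta> = "C * D"] hb by (simp add: H_def)
  have Hm: "H k \<in> borel_measurable borel" for k
  proof -
    obtain A where A: "\<And>z::'a. \<bar>mollifier (e k) z\<bar> \<le> A" using mollifier_bounded[OF e(1)] by blast
    have "continuous_on UNIV (\<lambda>y. mollifier (e k) (x - y))" for x :: 'a
      using comp(1)[of k x] by (simp add: mollifier_minus[of _ x])
    then have "continuous_on UNIV (H k)"
      unfolding H_def by (rule continuous_on_integral_kernel[OF ih _ _ A]) auto
    then show ?thesis by (rule borel_measurable_continuous_onI)
  qed
  \<comment> \<open>Classical integration by parts for the mollified function, followed by Fubini; u
    itself is never differentiated.\<close>
  have key: "(\<integral>x. \<phi> (U k x) * \<psi>' x \<partial>lborel) = - (\<integral>y. g y * H k y \<partial>lborel)" for k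
  proof -
    have c1: "continuous_on UNIV (\<lambda>x. \<phi> (U k x) * \<psi>' x)"
      by (intro continuous_intros \<psi> continuous_on_compose2[OF c\<phi> cU]) auto
    have c2: "continuous_on UNIV (\<lambda>x. h k x * U' k x)"
      by (intro continuous_intros ch cU')
    have i1: "integrable lborel (\<lambda>x. \<phi> (U k x) * \<psi>' x)"
      by (rule integrable_continuous_compact_support[OF c1 K(1)]) (simp add: \<psi>'0)
    have i2: "integrable lborel (\<lambda>x. h k x * U' k x)"
      by (rule integrable_continuous_compact_support[OF c2 K(1)]) (simp add: hK)
    have "(\<integral>x. \<phi>' (U k x) * U' k x * \<psi> x + \<phi> (U k x) * \<psi>' x \<partial>lborel) = 0"
    proof (rule integral_dir_deriv_eq_0)
      show "dir_deriv v (\<lambda>x. \<phi> (U k x) * \<psi> x) (\<lambda>x. \<phi>' (U k x) * U' k x * \<psi> x + \<phi> (U k x) * \<psi>' x)"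
        by (intro dir_deriv_mult dir_deriv_chain dU \<phi> \<psi>)
      show "continuous_on UNIV (\<lambda>x. \<phi> (U k x) * \<psi> x)"
        by (intro continuous_intros \<psi> continuous_on_compose2[OF c\<phi> cU]) auto
      show "continuous_on UNIV (\<lambda>x. \<phi>' (U k x) * U' k x * \<psi> x + \<phi> (U k x) * \<psi>' x)"
        by (intro continuous_intros \<psi> cU' continuous_on_compose2[OF c\<phi> cU] continuous_on_compose2[OF c\<phi>' cU]) auto
      show "compact K" by fact
      show "x \<notin> K \<Longrightarrow> \<phi> (U k x) * \<psi> x = 0" for x by (simp add: K)
    qed
    then have "(\<integral>x. h k x * U' k x + \<phi> (U k x) * \<psi>' x \<partial>lborel) = 0"
      by (simp add: h_def mult.assoc mult.commute[of "\<psi> _"])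
    then have "(\<integral>x. \<phi> (U k x) * \<psi>' x \<partial>lborel) = - (\<integral>x. h k x * U' k x \<partial>lborel)"
      using i1 i2 by simp
    also have "(\<integral>x. h k x * U' k x \<partial>lborel) = (\<integral>x. (\<integral>y. h k x * (g y * mollifier (e k) (x - y)) \<partial>lborel) \<partial>lborel)"
    proof (rule Bochner_Integration.integral_cong[OF refl])
      show "h k x * U' k x = (\<integral>y. h k x * (g y * mollifier (e k) (x - y)) \<partial>lborel)" for x
        by (cases "x \<in> K") (simp_all add: U'_eq hK)
    qed
    also have "\<dots> = (\<integral>y. (\<integral>x. h k x * (g y * mollifier (e k) (x - y)) \<partial>lborel) \<partial>lborel)"
    proof (rule lborel_pair.Fubini_integral[symmetric])
      obtain A where A: "A > 0" "\<And>z::'a. \<bar>mollifier (e k) z\<bar> \<le> A" using mollifier_bounded[OF e(1)] by blast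
      have [measurable]: "h k \<in> borel_measurable borel" "g \<in> borel_measurable borel"
        using ch g by (auto intro: borel_measurable_continuous_onI)
      \<comment> \<open>The product of two integrable functions of separate variables is integrable,
        and the mollifier is a bounded factor.\<close>
      have p: "integrable (lborel \<Otimes>\<^sub>M lborel) (\<lambda>z. h k (fst z) * g (snd z))"
      proof (rule lborel_pair.Fubini_integrable)
        show "integrable lborel (\<lambda>x. \<integral>y. norm (h k (fst (x, y)) * g (snd (x, y))) \<partial>lborel)"
          using ih g by (simp add: abs_mult)
        show "AE x in lborel. integrable lborel (\<lambda>y. h k (fst (x, y)) * g (snd (x, y)))"
          using g by simp
      qed simp
      show "integrable (lborel \<Otimes>\<^sub>M lborel) (\<lambda>(x, y). h k x * (g y * mollifier (e k) (x - y)))"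
        using integrable_mult_bounded[OF p, of "\<lambda>z. mollifier (e k) (fst z - snd z)" A] A(2)
        by (simp add: case_prod_beta' mult.assoc)
    qed
    also have "\<dots> = (\<integral>y. g y * H k y \<partial>lborel)"
      by (simp add: H_def mult.left_commute)
    finally show ?thesis .
  qed
  have "(\<lambda>k. \<integral>y. g y * H k y \<partial>lborel) \<longlonglongrightarrow> (\<integral>y. g y * h0 y \<partial>lborel)"
  proof (rule integral_dominated_convergence[where w = "\<lambda>y. \<bar>g y\<bar> * (C * D)"])
    show "AE y in lborel. (\<lambda>k. g y * H k y) \<longlonglongrightarrow> g y * h0 y"
      by (intro AE_I2 tendsto_intros Hlim)
    show "AE y in lborel. norm (g y * H k y) \<le> \<bar>g y\<bar> * (C * D)" for k
      using Hb[of k] by (auto simp: abs_mult intro!: mult_left_mono)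
    show "(\<lambda>y. g y * h0 y) \<in> borel_measurable lborel"
      using g borel_measurable_continuous_onI[OF ch0] by simp
    show "(\<lambda>y. g y * H k y) \<in> borel_measurable lborel" for k
      using g Hm[of k] by simp
  qed (use g in auto)
  moreover have "(\<lambda>k. \<integral>x. \<phi> (U k x) * \<psi>' x \<partial>lborel) \<longlonglongrightarrow> (\<integral>x. \<phi> (u x) * \<psi>' x \<partial>lborel)"
  proof (rule integral_dominated_convergence[where w = "\<lambda>x. indicator K x * (C * D')"])
    show "AE x in lborel. (\<lambda>k. \<phi> (U k x) * \<psi>' x) \<longlonglongrightarrow> \<phi> (u x) * \<psi>' x"
    proof (rule AE_I2)
      show "(\<lambda>k. \<phi> (U k x) * \<psi>' x) \<longlonglongrightarrow> \<phi> (u x) * \<psi>' x" for x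
        by (cases "x \<in> K") (auto simp: \<psi>'0 intro!: tendsto_intros continuous_on_tendsto_compose[OF c\<phi> Ulim])
    qed
    show "AE x in lborel. norm (\<phi> (U k x) * \<psi>' x) \<le> indicator K x * (C * D')" for k
    proof (rule AE_I2)
      show "norm (\<phi> (U k x) * \<psi>' x) \<le> indicator K x * (C * D')" for x
        by (cases "x \<in> K") (use C D' UI in \<open>auto simp: \<psi>'0 abs_mult intro!: mult_mono\<close>)
    qed
    show "(\<lambda>x. \<phi> (U k x) * \<psi>' x) \<in> borel_measurable lborel" for k
      using borel_measurable_continuous_onI[OF continuous_on_compose2[OF c\<phi> cU]]
        borel_measurable_continuous_onI[OF \<psi>(2)] by simp
    show "(\<lambda>x. \<phi> (u x) * \<psi>' x) \<in> borel_measurable lborel"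
    proof -
      have "(\<lambda>x. indicator K x *\<^sub>R \<phi> (u x)) \<in> borel_measurable borel"
        using K(1) K' by (intro borel_measurable_continuous_on_indicator continuous_on_compose2[OF c\<phi>]
          continuous_on_subset[OF cu] borel_compact) auto
      then have "(\<lambda>x. (indicator K x *\<^sub>R \<phi> (u x)) * \<psi>' x) \<in> borel_measurable borel"
        using borel_measurable_continuous_onI[OF \<psi>(2)] by simp
      also have "(\<lambda>x. (indicator K x *\<^sub>R \<phi> (u x)) * \<psi>' x) = (\<lambda>x. \<phi> (u x) * \<psi>' x)"
        by (auto simp: fun_eq_iff indicator_def \<psi>'0)
      finally show ?thesis by simp
    qed
    show "integrable lborel (\<lambda>x. indicator K x * (C * D'))"
      using emeasure_bounded_finite[OF compact_imp_bounded[OF K(1)]] K(1) borel_compact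
      by (intro integrable_mult_left integrable_real_indicator) auto
  qed
  ultimately have "(\<lambda>k. - (\<integral>y. g y * H k y \<partial>lborel)) \<longlonglongrightarrow> (\<integral>x. \<phi> (u x) * \<psi>' x \<partial>lborel)"
    "(\<lambda>k. - (\<integral>y. g y * H k y \<partial>lborel)) \<longlonglongrightarrow> - (\<integral>y. g y * h0 y \<partial>lborel)"
    unfolding key by (auto intro: tendsto_minus)
  then have "(\<integral>x. \<phi> (u x) * \<psi>' x \<partial>lborel) = - (\<integral>y. g y * h0 y \<partial>lborel)"
    by (rule LIMSEQ_unique)
  also have "(\<lambda>y. g y * h0 y) = (\<lambda>x. \<phi>' (u x) * (G x \<bullet> v) * \<psi> x)"
    using K K' by (auto simp: fun_eq_iff g_def h0_def indicator_def)
  finally show ?thesis .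
qed

section \<open>Cutoff functions and Hausdorff coverings\<close>

definition half_square :: "real \<Rightarrow> real" where
  "half_square z = (max 0 (1 - z))\<^sup>2"

text \<open>Composing \<open>half_square\<close> with itself gives a $C^1$ transition from 0 (for \<open>z \<le> 0\<close>) to 1 (for \<open>z \<ge> 1\<close>).\<close>

definition smoothstep :: "real \<Rightarrow> real" where
  "smoothstep z = half_square (half_square z)"

definition smoothstep' :: "real \<Rightarrow> real" where
  "smoothstep' z = 4 * max 0 (1 - half_square z) * max 0 (1 - z)"

lemma half_square_deriv: "(half_square has_real_derivative - 2 * max 0 (1 - z)) (at z)"
proof (cases z "1 :: real" rule: linorder_cases)
  case less
  have "((\<lambda>z. (1 - z)\<^sup>2) has_real_derivative - 2 * max 0 (1 - z)) (at z)"
    using less by (auto intro!: derivative_eq_intros)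
  then show ?thesis
    by (rule has_field_derivative_transform_within_open[where S = "{..<1}"])
      (use less in \<open>auto simp: half_square_def\<close>)
next
  case equal
  \<comment> \<open>At the junction the difference quotient is at most |h|: the square removes the
    kink of \<open>max 0 (1 - z)\<close>.\<close>
  have "((\<lambda>h. (half_square (1 + h) - half_square 1) / h) \<longlongrightarrow> 0) (at 0)"
  proof (rule Lim_null_comparison)
    show "\<forall>\<^sub>F h in at (0::real). norm ((half_square (1 + h) - half_square 1) / h) \<le> \<bar>h\<bar>"
      by (auto simp: half_square_def max_def power2_eq_square eventually_at_filter)
    show "((\<lambda>h::real. \<bar>h\<bar>) \<longlongrightarrow> 0) (at 0)" by (intro tendsto_rabs_zero tendsto_ident_at)
  qed
  then show ?thesis using equal by (simp add: DERIV_def)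
next
  case greater
  have "((\<lambda>z. 0) has_real_derivative - 2 * max 0 (1 - z)) (at z)"
    using greater by simp
  then show ?thesis
    by (rule has_field_derivative_transform_within_open[where S = "{1<..}"])
      (use greater in \<open>auto simp: half_square_def\<close>)
qed

lemma smoothstep_deriv: "(smoothstep has_real_derivative smoothstep' z) (at z)"
proof -
  have "((\<lambda>z. half_square (half_square z)) has_real_derivative
      - 2 * max 0 (1 - half_square z) * (- 2 * max 0 (1 - z))) (at z)"
    by (rule DERIV_chain2[OF half_square_deriv half_square_deriv])
  then show ?thesis by (simp add: smoothstep_def[abs_def] smoothstep'_def mult.assoc)
qed

lemma continuous_on_smoothstep': "continuous_on S smoothstep'"
  unfolding smoothstep'_def half_square_def by (intro continuous_intros)

lemma continuous_on_smoothstep: "continuous_on S smoothstep"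
  unfolding smoothstep_def half_square_def by (intro continuous_intros)

lemma smoothstep_le0: "z \<le> 0 \<Longrightarrow> smoothstep z = 0"
proof -
  assume "z \<le> 0"
  then have "half_square z \<ge> 1" by (simp add: half_square_def one_le_power)
  then show ?thesis by (simp add: smoothstep_def half_square_def[of "half_square z"])
qed

lemma smoothstep_ge1: "z \<ge> 1 \<Longrightarrow> smoothstep z = 1"
  by (simp add: smoothstep_def half_square_def)

lemma smoothstep_nonneg: "smoothstep z \<ge> 0"
  by (simp add: smoothstep_def half_square_def)

lemma smoothstep_le1: "smoothstep z \<le> 1"
proof -
  have "half_square z \<ge> 0" by (simp add: half_square_def)
  then show ?thesis by (simp add: smoothstep_def half_square_def[of "half_square z"] power_le_one)
qed

lemma smoothstep'_zero: "z \<le> 0 \<or> z \<ge> 1 \<Longrightarrow> smoothstep' z = 0"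
proof -
  assume "z \<le> 0 \<or> z \<ge> 1"
  then have "half_square z \<ge> 1 \<or> z \<ge> 1" by (auto simp: half_square_def one_le_power)
  then show ?thesis by (auto simp: smoothstep'_def)
qed

lemma smoothstep'_bound: "0 \<le> smoothstep' z" "smoothstep' z \<le> 4"
proof -
  show "0 \<le> smoothstep' z" by (simp add: smoothstep'_def)
  show "smoothstep' z \<le> 4"
  proof (cases "z \<le> 0")
    case False
    have "max 0 (1 - half_square z) \<le> 1" by (simp add: half_square_def)
    moreover have "max 0 (1 - z) \<le> 1" using False by simp
    ultimately have "max 0 (1 - half_square z) * max 0 (1 - z) \<le> 1 * 1" by (intro mult_mono) auto
    then show ?thesis by (simp add: smoothstep'_def)
  qed (simp add: smoothstep'_zero)
qed

text \<open>Written in the squared distance, which is differentiable at the centre too. The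
  transition from 0 to 1 takes place for |y - c| between r and sqrt 2 r.\<close>

definition ball_cutoff :: "'a::euclidean_space \<Rightarrow> real \<Rightarrow> 'a \<Rightarrow> real" where
  "ball_cutoff c r y = smoothstep ((norm (y - c))\<^sup>2 / r\<^sup>2 - 1)"

definition ball_cutoff_grad :: "'a::euclidean_space \<Rightarrow> real \<Rightarrow> 'a \<Rightarrow> 'a" where
  "ball_cutoff_grad c r y = (smoothstep' ((norm (y - c))\<^sup>2 / r\<^sup>2 - 1) * (2 / r\<^sup>2)) *\<^sub>R (y - c)"

lemma ball_cutoff_dir_deriv: "dir_deriv v (ball_cutoff c r) (\<lambda>y. ball_cutoff_grad c r y \<bullet> v)"
proof -
  have "dir_deriv v (\<lambda>y. (norm (y - c))\<^sup>2 * (1 / r\<^sup>2) + (- 1)) (\<lambda>y. (2 * ((y - c) \<bullet> v)) * (1 / r\<^sup>2) + (norm (y - c))\<^sup>2 * 0 + 0)"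
    by (intro dir_deriv_add dir_deriv_mult dir_deriv_norm_sq dir_deriv_const)
  from dir_deriv_chain[OF this smoothstep_deriv] show ?thesis
    unfolding ball_cutoff_def[abs_def] ball_cutoff_grad_def by (simp add: algebra_simps)
qed

lemma ball_cutoff_continuous: "continuous_on S (ball_cutoff c r)" "continuous_on S (ball_cutoff_grad c r)"
  unfolding ball_cutoff_def ball_cutoff_grad_def divide_inverse
  by (intro continuous_intros continuous_on_compose2[OF continuous_on_smoothstep[of UNIV]]
      continuous_on_compose2[OF continuous_on_smoothstep'[of UNIV]]; simp)+

lemma ball_cutoff_inside: "r > 0 \<Longrightarrow> norm (y - c) \<le> r \<Longrightarrow> ball_cutoff c r y = 0"
  unfolding ball_cutoff_def by (intro smoothstep_le0) (auto simp: divide_le_eq intro!: power_mono)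

lemma ball_cutoff_outside: "r > 0 \<Longrightarrow> norm (y - c) \<ge> 2 * r \<Longrightarrow> ball_cutoff c r y = 1"
proof -
  assume r: "r > 0" and "norm (y - c) \<ge> 2 * r"
  then have "(2 * r)\<^sup>2 \<le> (norm (y - c))\<^sup>2" by (intro power_mono) auto
  then have "(norm (y - c))\<^sup>2 / r\<^sup>2 \<ge> 4" using r by (simp add: le_divide_eq power_mult_distrib)
  then show ?thesis unfolding ball_cutoff_def by (intro smoothstep_ge1) auto
qed

lemma ball_cutoff_grad_inside: "r > 0 \<Longrightarrow> norm (y - c) \<le> r \<Longrightarrow> ball_cutoff_grad c r y = 0"
proof -
  assume "r > 0" "norm (y - c) \<le> r"
  then have "(norm (y - c))\<^sup>2 / r\<^sup>2 - 1 \<le> 0" by (auto simp: divide_le_eq intro!: power_mono)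
  then show ?thesis by (simp add: ball_cutoff_grad_def smoothstep'_zero)
qed

lemma ball_cutoff_grad_bound:
  assumes r: "r > 0"
  shows "norm (ball_cutoff_grad c r y) \<le> 16 / r * indicator (ball c (2 * r)) y"
proof (cases "norm (y - c) < 2 * r")
  case True
  have "norm (ball_cutoff_grad c r y) = smoothstep' ((norm (y - c))\<^sup>2 / r\<^sup>2 - 1) * (2 / r\<^sup>2) * norm (y - c)"
    using smoothstep'_bound by (simp add: ball_cutoff_grad_def)
  \<comment> \<open>4 bounds \<open>smoothstep'\<close>, and |y - c| < 2 r in this case.\<close>
  also have "\<dots> \<le> 4 * (2 / r\<^sup>2) * (2 * r)"
    using True r smoothstep'_bound by (intro mult_mono) auto
  also have "\<dots> = 16 / r" using r by (simp add: power2_eq_square)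
  finally show ?thesis using True by (simp add: dist_norm norm_minus_commute)
next
  case False
  then have "(2 * r)\<^sup>2 \<le> (norm (y - c))\<^sup>2" using r by (intro power_mono) auto
  then have "(norm (y - c))\<^sup>2 / r\<^sup>2 \<ge> 4" using r by (simp add: le_divide_eq power_mult_distrib)
  then have "smoothstep' ((norm (y - c))\<^sup>2 / r\<^sup>2 - 1) = 0" by (intro smoothstep'_zero) auto
  then show ?thesis using r by (simp add: ball_cutoff_grad_def)
qed

text \<open>A product of single cutoffs. All factors lie in [0,1], so the gradient of the product is
  at most the sum of the single gradients, and a sum over balls is what a Hausdorff covering
  controls.\<close>

lemma ball_family_cutoff:
  fixes c :: "'i \<Rightarrow> 'a::euclidean_space"
  assumes "finite I" "\<forall>i\<in>I. r i > 0"
  shows "\<exists>\<zeta> D. continuous_on UNIV \<zeta> \<and> continuous_on UNIV D \<and> (\<forall>v. dir_deriv v \<zeta> (\<lambda>y. D y \<bullet> v)) \<and>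
    (\<forall>y. 0 \<le> \<zeta> y \<and> \<zeta> y \<le> 1) \<and> (\<forall>y. (\<exists>i\<in>I. y \<in> ball (c i) (r i)) \<longrightarrow> \<zeta> y = 0) \<and>
    (\<forall>y. (\<forall>i\<in>I. 2 * r i \<le> norm (y - c i)) \<longrightarrow> \<zeta> y = 1) \<and>
    (\<forall>y. norm (D y) \<le> (\<Sum>i\<in>I. 16 / r i * indicator (ball (c i) (2 * r i)) y))"
  using assms
proof (induction I rule: finite_induct)
  case empty
  show ?case
    by (rule exI[of _ "\<lambda>_. 1"], rule exI[of _ "\<lambda>_. 0"]) (auto intro: dir_deriv_const)
next
  case (insert i I)
  then obtain \<zeta> D where \<zeta>: "continuous_on UNIV \<zeta>" "continuous_on UNIV D" "\<And>v. dir_deriv v \<zeta> (\<lambda>y. D y \<bullet> v)"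
    "\<And>y. 0 \<le> \<zeta> y" "\<And>y. \<zeta> y \<le> 1" "\<And>y. (\<exists>i\<in>I. y \<in> ball (c i) (r i)) \<Longrightarrow> \<zeta> y = 0"
    "\<And>y. (\<forall>i\<in>I. 2 * r i \<le> norm (y - c i)) \<Longrightarrow> \<zeta> y = 1"
    "\<And>y. norm (D y) \<le> (\<Sum>i\<in>I. 16 / r i * indicator (ball (c i) (2 * r i)) y)"
    by auto
  have ri: "r i > 0" using insert by auto
  let ?b = "ball_cutoff (c i) (r i)" and ?g = "ball_cutoff_grad (c i) (r i)"
  have b01: "0 \<le> ?b y" "?b y \<le> 1" for y
    by (auto simp: ball_cutoff_def smoothstep_nonneg smoothstep_le1)
  show ?case
  proof (rule exI[of _ "\<lambda>y. ?b y * \<zeta> y"], rule exI[of _ "\<lambda>y. \<zeta> y *\<^sub>R ?g y + ?b y *\<^sub>R D y"], intro conjI allI impI)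
    show "continuous_on UNIV (\<lambda>y. ?b y * \<zeta> y)" "continuous_on UNIV (\<lambda>y. \<zeta> y *\<^sub>R ?g y + ?b y *\<^sub>R D y)"
      by (intro continuous_intros \<zeta> ball_cutoff_continuous)+
    show "dir_deriv v (\<lambda>y. ?b y * \<zeta> y) (\<lambda>y. (\<zeta> y *\<^sub>R ?g y + ?b y *\<^sub>R D y) \<bullet> v)" for v
      using dir_deriv_mult[OF ball_cutoff_dir_deriv \<zeta>(3)] by (simp add: inner_add_left mult.commute)
    show "0 \<le> ?b y * \<zeta> y" "?b y * \<zeta> y \<le> 1" for y
      using b01[of y] \<zeta>(4,5)[of y] by (auto intro: mult_le_one)
    show "?b y * \<zeta> y = 0" if "\<exists>i\<in>insert i I. y \<in> ball (c i) (r i)" for y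
    proof (cases "y \<in> ball (c i) (r i)")
      case True
      then have "norm (y - c i) \<le> r i" by (simp add: dist_norm norm_minus_commute)
      then show ?thesis by (simp add: ball_cutoff_inside[OF ri])
    qed (use that \<zeta>(6) in auto)
    show "?b y * \<zeta> y = 1" if "\<forall>i\<in>insert i I. 2 * r i \<le> norm (y - c i)" for y
      using that \<zeta>(7) ball_cutoff_outside[OF ri] by auto
    show "norm (\<zeta> y *\<^sub>R ?g y + ?b y *\<^sub>R D y) \<le> (\<Sum>i\<in>insert i I. 16 / r i * indicator (ball (c i) (2 * r i)) y)" for y
    proof -
      have "norm (\<zeta> y *\<^sub>R ?g y + ?b y *\<^sub>R D y) \<le> \<zeta> y * norm (?g y) + ?b y * norm (D y)"
        using \<zeta>(4) b01 by (intro order_trans[OF norm_triangle_ineq]) simp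
      also have "\<dots> \<le> norm (?g y) + norm (D y)"
        using \<zeta>(4,5)[of y] b01[of y] by (intro add_mono mult_left_le_one_le) auto
      also have "\<dots> \<le> 16 / r i * indicator (ball (c i) (2 * r i)) y + (\<Sum>i\<in>I. 16 / r i * indicator (ball (c i) (2 * r i)) y)"
        by (intro add_mono ball_cutoff_grad_bound ri \<zeta>)
      finally show ?thesis using insert by simp
    qed
  qed
qed

section \<open>Near-optimal finite coverings by balls, weighted by a function\<close>

lemma powr_radius:
  fixes d :: real
  assumes "s > 0" "0 \<le> d" "d < \<delta>" "e > 0"
  shows "\<exists>r. d < r \<and> r \<le> \<delta> \<and> r powr s \<le> d powr s + e"
proof -
  define r where "r = min \<delta> ((d powr s + e) powr (1 / s))"
  have "d = (d powr s) powr (1 / s)" using assms by (simp add: powr_powr)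
  also have "\<dots> < (d powr s + e) powr (1 / s)" using assms by (intro powr_less_mono2) auto
  finally have "d < r" using assms by (simp add: r_def)
  moreover have "r powr s \<le> ((d powr s + e) powr (1 / s)) powr s"
    using assms \<open>d < r\<close> by (intro powr_mono2) (auto simp: r_def)
  moreover have "((d powr s + e) powr (1 / s)) powr s = d powr s + e"
    using assms by (simp add: powr_powr add_nonneg_pos less_imp_le)
  ultimately show ?thesis by (intro exI[of _ r]) (auto simp: r_def)
qed

lemma sum_le_iterated_suminf:
  fixes f :: "nat \<Rightarrow> nat \<Rightarrow> ennreal"
  assumes "finite I" "I \<subseteq> {..<N} \<times> UNIV"
  shows "(\<Sum>(k, j)\<in>I. f k j) \<le> (\<Sum>k<N. \<Sum>j. f k j)"
proof -
  obtain J where J: "snd ` I \<subseteq> {..<J}" using finite_nat_bounded[of "snd ` I"] assms by auto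
  have "I \<subseteq> {..<N} \<times> {..<J}" using assms J by force
  then have "(\<Sum>(k, j)\<in>I. f k j) \<le> (\<Sum>(k, j)\<in>{..<N} \<times> {..<J}. f k j)"
    by (intro sum_mono2) auto
  also have "\<dots> = (\<Sum>k<N. \<Sum>j<J. f k j)" by (simp add: sum.cartesian_product)
  also have "\<dots> \<le> (\<Sum>k<N. \<Sum>j. f k j)" by (intro sum_mono sum_le_suminf) auto
  finally show ?thesis .
qed

text \<open>The covering is chosen separately on the level sets of \<open>g\<close>, so that \<open>g\<close> is nearly constant
  on each piece.\<close>

lemma hausdorff_weighted_cover:
  fixes K S :: "'a::euclidean_space set" and g :: "'a \<Rightarrow> real"
  assumes s: "s > 0" and S: "S \<in> sets borel" and K: "compact K" "K \<subseteq> S" and fin: "hausdorff_outer s K < top"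
    and g: "continuous_on K g" "\<And>y. y \<in> K \<Longrightarrow> 0 \<le> g y" and \<delta>: "\<delta> > 0" and \<eta>: "\<eta> > 0"
  shows "\<exists>(I :: (nat \<times> nat) set) c r. finite I \<and> K \<subseteq> (\<Union>i\<in>I. ball (c i) (r i)) \<and>
    (\<forall>i\<in>I. c i \<in> K \<and> 0 < r i \<and> r i \<le> \<delta>) \<and>
    (\<Sum>i\<in>I. ennreal (hausdorff_const s * g (c i) * r i powr s)) \<le>
      (\<integral>\<^sup>+y. ennreal (g y + \<eta>) * indicator K y \<partial>hausdorff_measure_on s S) + ennreal \<eta>"
proof -
  define \<kappa> where "\<kappa> = hausdorff_const s"
  have \<kappa>: "\<kappa> > 0" using hausdorff_const_pos[of s] s by (simp add: \<kappa>_def)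
  let ?M = "hausdorff_measure_on s S"
  obtain B where B: "\<And>y. y \<in> K \<Longrightarrow> g y \<le> B"
  proof -
    have "bounded (g ` K)" using compact_continuous_image[OF g(1) K(1)] compact_imp_bounded by blast
    then obtain B where "\<And>y. y \<in> K \<Longrightarrow> \<bar>g y\<bar> \<le> B" by (auto simp: bounded_iff)
    then show thesis using that[of B] by fastforce
  qed
  obtain N :: nat where N: "B / \<eta> < real N" using reals_Archimedean2 by blast
  define A where "A k = K \<inter> g -` {real k * \<eta> ..< (real k + 1) * \<eta>}" for k :: nat
  have AK: "A k \<subseteq> K" for k by (auto simp: A_def)
  have Kb: "K \<in> sets borel" using K(1) by (rule borel_compact)
  have Ab: "A k \<in> sets borel" for k
  proof -
    have "(\<lambda>y. indicator K y *\<^sub>R g y) \<in> borel_measurable borel"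
      using Kb g(1) by (rule borel_measurable_continuous_on_indicator)
    then have "K \<inter> (\<lambda>y. indicator K y *\<^sub>R g y) -` {real k * \<eta> ..< (real k + 1) * \<eta>} \<in> sets borel"
      using Kb by (auto simp: measurable_def)
    also have "K \<inter> (\<lambda>y. indicator K y *\<^sub>R g y) -` {real k * \<eta> ..< (real k + 1) * \<eta>} = A k"
      by (auto simp: A_def)
    finally show ?thesis .
  qed
  have ex: "\<exists>k<N. y \<in> A k" if y: "y \<in> K" for y
  proof -
    define k where "k = nat \<lfloor>g y / \<eta>\<rfloor>"
    have gy: "0 \<le> g y / \<eta>" using g(2)[OF y] \<eta> by simp
    then have "real k \<le> g y / \<eta>" "g y / \<eta> < real k + 1" unfolding k_def by linarith+
    then have 1: "real k * \<eta> \<le> g y" "g y < (real k + 1) * \<eta>" using \<eta> by (simp_all add: field_simps)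
    have "real k * \<eta> \<le> B" using 1 B[OF y] by linarith
    then have "real k \<le> B / \<eta>" using \<eta> by (simp add: field_simps)
    then have "k < N" using N by linarith
    then show ?thesis using 1 y by (auto simp: A_def)
  qed
  \<comment> \<open>There are N slabs with weights at most N \<eta>, each carrying an error 2 e;
    this choice keeps the total N * N \<eta> * 2 e below \<eta>.\<close>
  define e where "e = 1 / (2 * (real N + 1)\<^sup>2)"
  have e: "e > 0" by (simp add: e_def)
  have finA: "hausdorff_outer s (A k) < top" for k
    using hausdorff_outer_mono[OF AK] fin by (rule le_less_trans)
  have pre_le: "hausdorff_pre s (\<delta> / 2) (A k) \<le> hausdorff_outer s (A k)" for k
    unfolding hausdorff_outer_eq_SUP using \<delta> by (intro SUP_upper) auto
  have "\<exists>C. A k \<subseteq> (\<Union>j. C j) \<and> (\<forall>j::nat. bounded (C j) \<and> diameter (C j) \<le> \<delta> / 2) \<and>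
       (\<Sum>j. ennreal (\<kappa> * diameter (C j) powr s)) \<le> hausdorff_outer s (A k) + ennreal e" for k
  proof -
    have "hausdorff_pre s (\<delta> / 2) (A k) < top" using pre_le finA by (rule le_less_trans)
    from hausdorff_pre_approx[OF this e] obtain C where "A k \<subseteq> (\<Union>j. C j)" "\<And>j::nat. bounded (C j)" "\<And>j. diameter (C j) \<le> \<delta> / 2"
      "(\<Sum>j. ennreal (\<kappa> * diameter (C j) powr s)) \<le> hausdorff_pre s (\<delta> / 2) (A k) + ennreal e"
      unfolding \<kappa>_def by blast
    then show ?thesis using pre_le[of k] by (intro exI[of _ C]) (auto intro: order_trans add_right_mono)
  qed
  then obtain C where C: "\<And>k. A k \<subseteq> (\<Union>j. C k j)" "\<And>k j::nat. bounded (C k j)" "\<And>k j. diameter (C k j) \<le> \<delta> / 2"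
       "\<And>k. (\<Sum>j. ennreal (\<kappa> * diameter (C k j) powr s)) \<le> hausdorff_outer s (A k) + ennreal e"
    by metis
  \<comment> \<open>Open balls need radii strictly above the diameters, which may be 0; the excess
    in the s-th power is made geometrically summable.\<close>
  have "\<exists>r. diameter (C k j) < r \<and> r \<le> \<delta> \<and> r powr s \<le> diameter (C k j) powr s + e * (1/2) ^ Suc j / \<kappa>" for k j
    using C(2,3)[of k j] \<delta> e \<kappa> s diameter_ge_0[OF C(2)] by (intro powr_radius) auto
  then obtain \<rho> where \<rho>: "\<And>k j. diameter (C k j) < \<rho> k j" "\<And>k j. \<rho> k j \<le> \<delta>"
    "\<And>k j. \<rho> k j powr s \<le> diameter (C k j) powr s + e * (1/2) ^ Suc j / \<kappa>"
    by metis
  define r where "r i = (case i of (k, j) \<Rightarrow> \<rho> k j)" for i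
  \<comment> \<open>Covering sets that miss their slab will be dropped (see \<open>P\<close>); every
    other one receives a centre inside the slab, where g is at most (k+1) \<eta>.\<close>
  define c where "c i = (case i of (k, j) \<Rightarrow> SOME y. y \<in> C k j \<inter> A k)" for i
  define P where "P = {(k, j). k < N \<and> C k j \<inter> A k \<noteq> {}}"
  have c: "c i \<in> C (fst i) (snd i)" "c i \<in> A (fst i)" if "i \<in> P" for i
  proof -
    have "C (fst i) (snd i) \<inter> A (fst i) \<noteq> {}" using that by (auto simp: P_def)
    then have "\<exists>y. y \<in> C (fst i) (snd i) \<inter> A (fst i)" by blast
    from someI_ex[OF this] show "c i \<in> C (fst i) (snd i)" "c i \<in> A (fst i)"
      by (auto simp: c_def case_prod_beta)
  qed
  have cov: "K \<subseteq> (\<Union>i\<in>P. ball (c i) (r i))"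
  proof
    fix y assume "y \<in> K"
    then obtain k where k: "k < N" "y \<in> A k" using ex by blast
    then obtain j where j: "y \<in> C k j" using C(1) by blast
    have i: "(k, j) \<in> P" using k j by (auto simp: P_def)
    have "dist (c (k, j)) y \<le> diameter (C k j)"
      using c(1)[OF i] j by (intro diameter_bounded_bound C) auto
    also have "\<dots> < \<rho> k j" by (rule \<rho>)
    finally show "y \<in> (\<Union>i\<in>P. ball (c i) (r i))" by (intro UN_I[OF i]) (simp add: r_def)
  qed
  obtain I where I: "I \<subseteq> P" "finite I" "K \<subseteq> (\<Union>i\<in>I. ball (c i) (r i))"
    using compactE_image[OF K(1) _ cov] by (metis open_ball)
  have "(\<Sum>i\<in>I. ennreal (\<kappa> * g (c i) * r i powr s)) \<le> (\<Sum>(k, j)\<in>I. ennreal ((real k + 1) * \<eta>) * ennreal (\<kappa> * \<rho> k j powr s))"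
  proof (rule sum_mono)
    fix i assume i: "i \<in> I"
    obtain k j where kj: "i = (k, j)" by (cases i)
    have "c i \<in> A k" using c(2)[of i] i I kj by auto
    then have "g (c i) \<le> (real k + 1) * \<eta>" by (auto simp: A_def)
    then have "\<kappa> * g (c i) * r i powr s \<le> \<kappa> * ((real k + 1) * \<eta>) * \<rho> k j powr s"
      using mult_left_mono[OF mult_right_mono[of _ _ "\<rho> k j powr s"], of "g (c i)" "(real k + 1) * \<eta>" \<kappa>] \<kappa>
      by (simp add: kj r_def mult.assoc)
    then show "ennreal (\<kappa> * g (c i) * r i powr s) \<le> (case i of (k, j) \<Rightarrow> ennreal ((real k + 1) * \<eta>) * ennreal (\<kappa> * \<rho> k j powr s))"
      using \<eta> \<kappa> by (simp add: kj ennreal_mult[symmetric] ac_simps ennreal_leI)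
  qed
  also have "\<dots> \<le> (\<Sum>k<N. \<Sum>j. ennreal ((real k + 1) * \<eta>) * ennreal (\<kappa> * \<rho> k j powr s))"
    using I by (intro sum_le_iterated_suminf) (auto simp: P_def)
  also have "\<dots> \<le> (\<Sum>k<N. ennreal ((real k + 1) * \<eta>) * (hausdorff_outer s (A k) + ennreal (2 * e)))"
  proof (rule sum_mono)
    fix k
    have "(\<Sum>j. ennreal (\<kappa> * \<rho> k j powr s)) \<le> (\<Sum>j. ennreal (\<kappa> * diameter (C k j) powr s) + ennreal (e * (1/2) ^ Suc j))"
    proof (intro suminf_le summableI)
      fix j
      have "\<kappa> * \<rho> k j powr s \<le> \<kappa> * (diameter (C k j) powr s + e * (1/2) ^ Suc j / \<kappa>)"
        using \<rho>(3) \<kappa> by (intro mult_left_mono) auto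
      also have "\<dots> = \<kappa> * diameter (C k j) powr s + e * (1/2) ^ Suc j" using \<kappa> by (simp add: distrib_left)
      finally have "ennreal (\<kappa> * \<rho> k j powr s) \<le> ennreal (\<kappa> * diameter (C k j) powr s + e * (1/2) ^ Suc j)"
        by (rule ennreal_leI)
      also have "\<dots> = ennreal (\<kappa> * diameter (C k j) powr s) + ennreal (e * (1/2) ^ Suc j)"
        using e \<kappa> by (intro ennreal_plus) auto
      finally show "ennreal (\<kappa> * \<rho> k j powr s) \<le> ennreal (\<kappa> * diameter (C k j) powr s) + ennreal (e * (1/2) ^ Suc j)" .
    qed
    also have "\<dots> = (\<Sum>j. ennreal (\<kappa> * diameter (C k j) powr s)) + (\<Sum>j. ennreal (e * (1/2) ^ Suc j))"
      by (subst suminf_add) auto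
    also have "(\<Sum>j. ennreal (e * (1/2) ^ Suc j)) = ennreal e"
      using sums_mult[OF power_half_series, of e] e by (subst suminf_ennreal_eq[of _ e]) auto
    also have "(\<Sum>j. ennreal (\<kappa> * diameter (C k j) powr s)) + ennreal e \<le> (hausdorff_outer s (A k) + ennreal e) + ennreal e"
      by (intro add_right_mono C)
    also have "\<dots> = hausdorff_outer s (A k) + ennreal (2 * e)"
      using e by (simp add: add.assoc ennreal_plus[symmetric] del: ennreal_plus)
    finally show "(\<Sum>j. ennreal ((real k + 1) * \<eta>) * ennreal (\<kappa> * \<rho> k j powr s)) \<le> ennreal ((real k + 1) * \<eta>) * (hausdorff_outer s (A k) + ennreal (2 * e))"
      by (simp add: ennreal_suminf_cmult mult_left_mono)
  qed
  also have "\<dots> = (\<Sum>k<N. ennreal ((real k + 1) * \<eta>) * hausdorff_outer s (A k)) + (\<Sum>k<N. ennreal ((real k + 1) * \<eta>) * ennreal (2 * e))"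
    by (simp add: distrib_left sum.distrib)
  also have "\<dots> \<le> (\<integral>\<^sup>+y. ennreal (g y + \<eta>) * indicator K y \<partial>?M) + ennreal \<eta>"
  proof (rule add_mono)
    have Am: "A k \<in> sets ?M" for k
      using Ab AK K S by (auto simp: sets_hausdorff_measure_on sets_restrict_space_iff)
    have em: "emeasure ?M (A k) = hausdorff_outer s (A k)" for k
      by (rule emeasure_hausdorff_measure_on[OF S Ab]) (use AK K in blast)
    have "(\<Sum>k<N. ennreal ((real k + 1) * \<eta>) * hausdorff_outer s (A k)) = (\<Sum>k<N. \<integral>\<^sup>+y. ennreal ((real k + 1) * \<eta>) * indicator (A k) y \<partial>?M)"
      using Am by (intro sum.cong refl) (simp add: nn_integral_cmult_indicator em)
    also have "\<dots> = (\<integral>\<^sup>+y. (\<Sum>k<N. ennreal ((real k + 1) * \<eta>) * indicator (A k) y) \<partial>?M)"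
      using Am by (subst nn_integral_sum) auto
    also have "\<dots> \<le> (\<integral>\<^sup>+y. ennreal (g y + \<eta>) * indicator K y \<partial>?M)"
    proof (rule nn_integral_mono)
      fix y
      show "(\<Sum>k<N. ennreal ((real k + 1) * \<eta>) * indicator (A k) y) \<le> ennreal (g y + \<eta>) * indicator K y"
      proof (cases "y \<in> K")
        case True
        then obtain k where k: "k < N" "y \<in> A k" using ex by blast
        \<comment> \<open>The slabs are disjoint, so the sum has the single value (k+1) \<eta>,
          which exceeds g y by at most \<eta>.\<close>
        have uniq: "j = k" if "y \<in> A j" for j
        proof -
          have "real j * \<eta> < (real k + 1) * \<eta>" "real k * \<eta> < (real j + 1) * \<eta>" using k that by (auto simp: A_def)
          then have "real j < real k + 1" "real k < real j + 1"
            using mult_right_less_imp_less[OF _ less_imp_le[OF \<eta>]] by metis+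
          then show ?thesis by linarith
        qed
        have "(\<Sum>k<N. ennreal ((real k + 1) * \<eta>) * indicator (A k) y) = (\<Sum>j<N. if j = k then ennreal ((real k + 1) * \<eta>) else 0)"
        proof (rule sum.cong[OF refl])
          fix j
          show "ennreal ((real j + 1) * \<eta>) * indicator (A j) y = (if j = k then ennreal ((real k + 1) * \<eta>) else 0)"
            using k(2) uniq[of j] by (cases "j = k") (auto simp: indicator_def)
        qed
        also have "\<dots> = ennreal ((real k + 1) * \<eta>)" using k by simp
        also have "\<dots> \<le> ennreal (g y + \<eta>)" using k by (intro ennreal_leI) (auto simp: A_def algebra_simps)
        finally show ?thesis using True by simp
      next
        case False
        then have "y \<notin> A k" for k using AK by blast
        then show ?thesis by simp
      qed
    qed
    finally show "(\<Sum>k<N. ennreal ((real k + 1) * \<eta>) * hausdorff_outer s (A k)) \<le> (\<integral>\<^sup>+y. ennreal (g y + \<eta>) * indicator K y \<partial>?M)" .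
    have "(\<Sum>k<N. (real k + 1) * \<eta> * (2 * e)) \<le> (\<Sum>k<N. real N * \<eta> * (2 * e))"
      using \<eta> e by (intro sum_mono mult_right_mono) auto
    also have "\<dots> = (real N)\<^sup>2 * (2 * e) * \<eta>" by (simp add: power2_eq_square)
    also have "\<dots> \<le> 1 * \<eta>"
    proof (rule mult_right_mono)
      have "(real N)\<^sup>2 \<le> (real N + 1)\<^sup>2" by (intro power_mono) auto
      then show "(real N)\<^sup>2 * (2 * e) \<le> 1" by (simp add: e_def divide_le_eq)
    qed (use \<eta> in simp)
    finally show "(\<Sum>k<N. ennreal ((real k + 1) * \<eta>) * ennreal (2 * e)) \<le> ennreal \<eta>"
      using \<eta> e by (simp add: ennreal_mult[symmetric] sum_ennreal ennreal_leI)
  qed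
  finally have "(\<Sum>i\<in>I. ennreal (hausdorff_const s * g (c i) * r i powr s)) \<le> (\<integral>\<^sup>+y. ennreal (g y + \<eta>) * indicator K y \<partial>?M) + ennreal \<eta>"
    by (simp add: \<kappa>_def)
  moreover have "\<forall>i\<in>I. c i \<in> K \<and> 0 < r i \<and> r i \<le> \<delta>"
  proof
    fix i assume i: "i \<in> I"
    then have "c i \<in> K" using c(2)[of i] I AK by blast
    moreover have "0 < r i" using \<rho>(1)[of "fst i" "snd i"] diameter_ge_0[OF C(2)[of "fst i" "snd i"]]
      by (simp add: r_def case_prod_beta)
    ultimately show "c i \<in> K \<and> 0 < r i \<and> r i \<le> \<delta>" using \<rho>(2) by (simp add: r_def case_prod_beta)
  qed
  ultimately show ?thesis using I by blast
qed

section \<open>The pointwise estimate\<close>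

text \<open>The kernel of the potential of order one, up to a constant factor. At y = x its value is
  0, because \<open>0 powr\<close> any exponent is 0.\<close>

definition riesz :: "'a::euclidean_space \<Rightarrow> 'a \<Rightarrow> real" where
  "riesz x y = norm (x - y) powr (1 - real DIM('a))"

lemma riesz_nonneg: "riesz x y \<ge> 0" by (simp add: riesz_def)

lemma riesz_measurable [measurable]: "(\<lambda>z. riesz (fst z) (snd z)) \<in> borel_measurable (borel \<Otimes>\<^sub>M borel)"
  "riesz x \<in> borel_measurable borel"
  unfolding riesz_def by measurable

text \<open>f vanishes on a neighbourhood W of the frontier, so restricting it to \<Omega> creates
  no jump. The space is covered by two open sets, \<Omega> and the union of W with the exterior, and
  on each of them regularity is clear.\<close>

lemma indicator_cutoff:
  fixes f :: "'a::euclidean_space \<Rightarrow> real" and D :: "'a \<Rightarrow> 'a"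
  assumes \<Omega>: "open \<Omega>" and W: "open W" "frontier \<Omega> \<subseteq> W" "\<And>x. x \<in> W \<Longrightarrow> f x = 0"
    and f: "continuous_on UNIV f" "continuous_on UNIV D" "\<And>v. dir_deriv v f (\<lambda>x. D x \<bullet> v)"
  shows "continuous_on UNIV (\<lambda>x. indicator \<Omega> x * f x)" "continuous_on UNIV (\<lambda>x. indicator \<Omega> x *\<^sub>R D x)"
    "dir_deriv v (\<lambda>x. indicator \<Omega> x * f x) (\<lambda>x. (indicator \<Omega> x *\<^sub>R D x) \<bullet> v)"
proof -
  have D0: "D x = 0" if "x \<in> W" for x
  proof -
    have "D x \<bullet> v = 0" for v
      by (rule dir_deriv_eq_zero_outside[OF f(3), of "- W"]) (use W that in auto)
    from this[of "D x"] show ?thesis by simp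
  qed
  have op: "open (\<Omega> \<union> (W \<union> - closure \<Omega>))" "open (W \<union> - closure \<Omega>)"
    using \<Omega> W by (auto intro!: open_Un)
  have un: "\<Omega> \<union> (W \<union> - closure \<Omega>) = UNIV"
    using W(2) \<Omega> by (auto simp: frontier_def interior_open)
  have z: "indicator \<Omega> x * f x = 0" "indicator \<Omega> x *\<^sub>R D x = 0" if "x \<in> W \<union> - closure \<Omega>" for x
    using that W(3) D0 closure_subset[of \<Omega>] by (auto simp: indicator_def)
  have "continuous_on (\<Omega> \<union> (W \<union> - closure \<Omega>)) (\<lambda>x. indicator \<Omega> x * f x)"
  proof (rule continuous_on_open_Un)
    show "continuous_on \<Omega> (\<lambda>x. indicator \<Omega> x * f x)"
      by (rule continuous_on_eq[OF continuous_on_subset[OF f(1)]]) auto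
    show "continuous_on (W \<union> - closure \<Omega>) (\<lambda>x. indicator \<Omega> x * f x)"
      by (rule continuous_on_eq[of _ "\<lambda>x. 0"]) (use z in auto)
  qed (use \<Omega> op in auto)
  then show "continuous_on UNIV (\<lambda>x. indicator \<Omega> x * f x)" by (simp add: un)
  have "continuous_on (\<Omega> \<union> (W \<union> - closure \<Omega>)) (\<lambda>x. indicator \<Omega> x *\<^sub>R D x)"
  proof (rule continuous_on_open_Un)
    show "continuous_on \<Omega> (\<lambda>x. indicator \<Omega> x *\<^sub>R D x)"
      by (rule continuous_on_eq[OF continuous_on_subset[OF f(2)]]) auto
    show "continuous_on (W \<union> - closure \<Omega>) (\<lambda>x. indicator \<Omega> x *\<^sub>R D x)"
      by (rule continuous_on_eq[of _ "\<lambda>x. 0"]) (use z in auto)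
  qed (use \<Omega> op in auto)
  then show "continuous_on UNIV (\<lambda>x. indicator \<Omega> x *\<^sub>R D x)" by (simp add: un)
  show "dir_deriv v (\<lambda>x. indicator \<Omega> x * f x) (\<lambda>x. (indicator \<Omega> x *\<^sub>R D x) \<bullet> v)"
    unfolding dir_deriv_def
  proof
    fix x
    have tend: "filterlim (\<lambda>t. x + t *\<^sub>R v) (nhds x) (nhds 0)"
    proof -
      have "((\<lambda>t. x + t *\<^sub>R v) \<longlongrightarrow> x + 0 *\<^sub>R v) (nhds 0)"
        by (intro tendsto_intros filterlim_ident)
      then show ?thesis by simp
    qed
    have tr: "eventually (\<lambda>t. x + t *\<^sub>R v \<in> S) (nhds 0)" if "open S" "x \<in> S" for S
      using tend that eventually_nhds_in_open[of S x] unfolding filterlim_iff by blast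
    show "((\<lambda>t. indicator \<Omega> (x + t *\<^sub>R v) * f (x + t *\<^sub>R v)) has_real_derivative (indicator \<Omega> x *\<^sub>R D x) \<bullet> v) (at 0)"
    proof (cases "x \<in> \<Omega>")
      case True
      have "eventually (\<lambda>t. indicator \<Omega> (x + t *\<^sub>R v) * f (x + t *\<^sub>R v) = f (x + t *\<^sub>R v)) (nhds 0)"
        using tr[OF \<Omega> True] by eventually_elim simp
      then show ?thesis
        using dir_derivD[OF f(3), of x v] True by (subst DERIV_cong_ev[OF refl _ refl]) auto
    next
      case False
      then have "x \<in> W \<union> - closure \<Omega>" using un by auto
      from tr[OF op(2) this]
      have "eventually (\<lambda>t. indicator \<Omega> (x + t *\<^sub>R v) * f (x + t *\<^sub>R v) = 0) (nhds 0)"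
        by eventually_elim (rule z)
      from DERIV_cong_ev[OF refl this refl, of 0]
      have "((\<lambda>t. indicator \<Omega> (x + t *\<^sub>R v) * f (x + t *\<^sub>R v)) has_real_derivative 0) (at 0)"
        by (metis DERIV_const)
      then show ?thesis using False by simp
    qed
  qed
qed

text \<open>The regularised fundamental vector field \<open>(y - x) (|y - x|\<^sup>2 + \<epsilon>\<^sup>2)\<^bsup>-n/2\<^esup>\<close>, written through its
  scalar factor; its divergence is the positive kernel \<open>field_div\<close>.\<close>

definition field_factor :: "real \<Rightarrow> 'a::euclidean_space \<Rightarrow> 'a \<Rightarrow> real" where
  "field_factor \<epsilon> x y = ((norm (y - x))\<^sup>2 + \<epsilon>\<^sup>2) powr (- real DIM('a) / 2)"

definition field_div :: "real \<Rightarrow> 'a::euclidean_space \<Rightarrow> 'a \<Rightarrow> real" where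
  "field_div \<epsilon> x y = real DIM('a) * \<epsilon>\<^sup>2 * ((norm (y - x))\<^sup>2 + \<epsilon>\<^sup>2) powr (- real DIM('a) / 2 - 1)"

lemma field_factor_dir_deriv:
  fixes x :: "'a::euclidean_space"
  assumes "\<epsilon> > 0"
  shows "dir_deriv v (field_factor \<epsilon> x)
     (\<lambda>y. - real DIM('a) * ((norm (y - x))\<^sup>2 + \<epsilon>\<^sup>2) powr (- real DIM('a) / 2 - 1) * ((y - x) \<bullet> v))"
proof -
  have d1: "dir_deriv v (\<lambda>y. (norm (y - x))\<^sup>2 + \<epsilon>\<^sup>2) (\<lambda>y. 2 * ((y - x) \<bullet> v) + 0)"
    by (intro dir_deriv_add dir_deriv_norm_sq dir_deriv_const)
  have d2: "((\<lambda>z. z powr (- real DIM('a) / 2)) has_real_derivative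
      (- real DIM('a) / 2) * ((norm (y - x))\<^sup>2 + \<epsilon>\<^sup>2) powr (- real DIM('a) / 2 - 1)) (at ((norm (y - x))\<^sup>2 + \<epsilon>\<^sup>2))" for y
    using assms by (intro has_real_derivative_powr) (simp add: add_nonneg_pos)
  from dir_deriv_chain_at[OF d1 d2] show ?thesis
    by (simp add: field_factor_def[abs_def] mult.assoc)
qed

lemma field_continuous:
  assumes "\<epsilon> > 0"
  shows "continuous_on S (field_factor \<epsilon> x)" "continuous_on S (field_div \<epsilon> x)"
    "continuous_on S (\<lambda>y. ((norm (y - x))\<^sup>2 + \<epsilon>\<^sup>2) powr (- real DIM('a::euclidean_space) / 2 - 1))"
  using assms unfolding field_factor_def field_div_def
  by (intro continuous_intros; simp add: add_nonneg_eq_0_iff)+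

lemma power2_powr:
  fixes r :: real
  assumes "r > 0"
  shows "(r\<^sup>2) powr a = r powr (2 * a)"
proof -
  have "r\<^sup>2 = r powr 2" using assms by simp
  then show ?thesis by (simp only: powr_powr)
qed

text \<open>Adding \<epsilon>^2 only shrinks the negative power, so the bound by the Riesz kernel is
  uniform in \<epsilon>; at y = x both sides are 0.\<close>

lemma field_bound:
  fixes x y :: "'a::euclidean_space"
  assumes "\<epsilon> > 0"
  shows "field_factor \<epsilon> x y * norm (y - x) \<le> riesz x y"
proof (cases "x = y")
  case False
  let ?r = "norm (y - x)"
  have r: "?r > 0" using False by simp
  have "field_factor \<epsilon> x y \<le> (?r\<^sup>2) powr (- real DIM('a) / 2)"
    unfolding field_factor_def using r by (intro powr_mono2') auto
  also have "\<dots> = ?r powr (- real DIM('a))"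
    by (simp add: power2_powr[OF r])
  finally have "field_factor \<epsilon> x y * ?r \<le> ?r powr (- real DIM('a)) * ?r"
    by (intro mult_right_mono) auto
  also have "\<dots> = ?r powr (1 - real DIM('a))"
    using r powr_add[of ?r "- real DIM('a)" 1] by (simp add: algebra_simps)
  finally show ?thesis by (simp add: riesz_def norm_minus_commute)
qed (simp add: riesz_def)

text \<open>With s = |y - x|^2, the terms - n s and n (s + \<epsilon>^2) multiply the same power (s
  + \<epsilon>^2)^(-n/2-1), and only n \<epsilon>^2 survives. The unregularised field is divergence
  free away from x.\<close>

lemma field_divergence:
  fixes x y :: "'a::euclidean_space"
  assumes "\<epsilon> > 0"
  shows "(\<Sum>v\<in>Basis. - real DIM('a) * ((norm (y - x))\<^sup>2 + \<epsilon>\<^sup>2) powr (- real DIM('a) / 2 - 1) * ((y - x) \<bullet> v) * ((y - x) \<bullet> v)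
      + field_factor \<epsilon> x y) = field_div \<epsilon> x y"
proof -
  let ?s = "(norm (y - x))\<^sup>2" and ?n = "real DIM('a)"
  let ?p = "(?s + \<epsilon>\<^sup>2) powr (- ?n / 2 - 1)"
  have pos: "?s + \<epsilon>\<^sup>2 > 0" using assms by (simp add: add_nonneg_pos)
  have "(\<Sum>v\<in>Basis. - ?n * ?p * ((y - x) \<bullet> v) * ((y - x) \<bullet> v) + field_factor \<epsilon> x y)
     = - ?n * ?p * (\<Sum>v\<in>Basis. ((y - x) \<bullet> v) * ((y - x) \<bullet> v)) + ?n * field_factor \<epsilon> x y"
    by (simp add: sum.distrib sum_distrib_left mult.assoc sum_negf sum_subtractf)
  also have "(\<Sum>v\<in>Basis. ((y - x) \<bullet> v) * ((y - x) \<bullet> v)) = ?s"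
    by (simp add: power2_norm_eq_inner euclidean_inner[of "y - x" "y - x"])
  also have "- ?n * ?p * ?s + ?n * field_factor \<epsilon> x y = field_div \<epsilon> x y"
    using pos powr_add[of "?s + \<epsilon>\<^sup>2" "- ?n / 2 - 1" 1]
    by (simp add: field_factor_def field_div_def algebra_simps)
  finally show ?thesis .
qed

lemma enn_abs_integral_le:
  fixes f :: "'a \<Rightarrow> real"
  assumes "integrable M f" "\<And>x. \<bar>f x\<bar> \<le> g x"
  shows "ennreal \<bar>\<integral>x. f x \<partial>M\<bar> \<le> (\<integral>\<^sup>+x. ennreal (g x) \<partial>M)"
proof -
  have "ennreal (norm (\<integral>x. f x \<partial>M)) \<le> (\<integral>\<^sup>+x. ennreal (norm (f x)) \<partial>M)"
    by (rule integral_norm_bound_ennreal[OF assms(1)])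
  also have "\<dots> \<le> (\<integral>\<^sup>+x. ennreal (g x) \<partial>M)"
    using assms(2) by (intro nn_integral_mono ennreal_leI) simp
  finally show ?thesis by simp
qed

text \<open>The chain rule is tested with Z times each coordinate of the regularised field. Summed
  over the basis, the derivatives of the field become its divergence, which stays on the left; the
  derivatives of Z and of \<phi> (u) go to the right and meet the Riesz kernel.\<close>

lemma representation_inequality:
  fixes \<Omega> :: "'a::euclidean_space set"
  assumes \<Omega>: "open \<Omega>" and wg: "weak_gradient \<Omega> u G" and Gm: "G \<in> borel_measurable borel"
    and cu: "continuous_on \<Omega> u"
    and \<phi>: "\<And>s. (\<phi> has_real_derivative \<phi>' s) (at s)" "continuous_on UNIV \<phi>'" "\<And>s. \<phi> s \<ge> 0"
    and Z: "continuous_on UNIV Z" "continuous_on UNIV D" "\<And>v. dir_deriv v Z (\<lambda>y. D y \<bullet> v)" "\<And>y. 0 \<le> Z y" "\<And>y. Z y \<le> 1"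
    and K: "compact K" "K \<subseteq> \<Omega>" "\<And>y. y \<notin> K \<Longrightarrow> Z y = 0"
    and \<epsilon>: "\<epsilon> > 0"
  shows "integrable lborel (\<lambda>y. \<phi> (u y) * Z y * field_div \<epsilon> x y)"
    "ennreal (\<integral>y. \<phi> (u y) * Z y * field_div \<epsilon> x y \<partial>lborel) \<le>
      (\<integral>\<^sup>+y. ennreal (\<phi> (u y) * norm (D y) * riesz x y) \<partial>lborel)
      + (\<integral>\<^sup>+y. ennreal (indicator \<Omega> y * (\<bar>\<phi>' (u y)\<bar> * norm (G y) * riesz x y)) \<partial>lborel)"
proof -
  let ?m = "field_factor \<epsilon> x" and ?n = "real DIM('a)"
  let ?p = "\<lambda>y. ((norm (y - x))\<^sup>2 + \<epsilon>\<^sup>2) powr (- ?n / 2 - 1)"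
  have D0: "D y = 0" if "y \<notin> K" for y
  proof -
    have "D y \<bullet> v = 0" for v
      by (rule dir_deriv_eq_zero_outside[OF Z(3) compact_imp_closed[OF K(1)] K(3) that])
    from this[of "D y"] show ?thesis by simp
  qed
  have c\<phi>: "continuous_on UNIV \<phi>" using \<phi>(1) DERIV_isCont continuous_at_imp_continuous_on by blast
  have c\<phi>u: "continuous_on \<Omega> (\<lambda>y. \<phi> (u y))" "continuous_on \<Omega> (\<lambda>y. \<phi>' (u y))"
    by (rule continuous_on_compose2[OF c\<phi> cu] continuous_on_compose2[OF \<phi>(2) cu]; simp)+
  define \<psi> where "\<psi> v y = Z y * (?m y * ((y - x) \<bullet> v))" for v y
  define \<psi>' where "\<psi>' v y = (D y \<bullet> v) * (?m y * ((y - x) \<bullet> v))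
     + Z y * ((- ?n * ?p y * ((y - x) \<bullet> v)) * ((y - x) \<bullet> v) + ?m y * (v \<bullet> v))" for v y
  have d\<psi>: "dir_deriv v (\<psi> v) (\<psi>' v)" for v
    unfolding \<psi>_def \<psi>'_def
    by (intro dir_deriv_mult Z field_factor_dir_deriv \<epsilon> dir_deriv_inner)
  have c\<psi>: "continuous_on UNIV (\<psi> v)" "continuous_on UNIV (\<psi>' v)" for v
    unfolding \<psi>_def \<psi>'_def by (intro continuous_intros Z field_continuous \<epsilon>)+
  have int: "integrable lborel (\<lambda>y. \<phi> (u y) * f y)" if "continuous_on UNIV f" "\<And>y. y \<notin> K \<Longrightarrow> f y = 0" for f
  proof (rule integrable_continuous_compact_support[OF _ K(1)])
    show "continuous_on UNIV (\<lambda>y. \<phi> (u y) * f y)"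
      by (rule continuous_on_mult_compact_support[OF \<Omega> c\<phi>u(1) that(1) K(1,2) that(2)])
    show "\<phi> (u y) * f y = 0" if "y \<notin> K" for y
      using \<open>\<And>y. y \<notin> K \<Longrightarrow> f y = 0\<close> that by simp
  qed
  have i\<psi>': "integrable lborel (\<lambda>y. \<phi> (u y) * \<psi>' v y)" for v
    by (rule int[OF c\<psi>(2)]) (simp add: \<psi>'_def D0 K)
  have i1: "integrable lborel (\<lambda>y. \<phi> (u y) * (?m y * (D y \<bullet> (y - x))))"
    by (rule int) (auto intro!: continuous_intros Z field_continuous \<epsilon> simp: D0)
  have i2: "integrable lborel (\<lambda>y. \<phi> (u y) * (Z y * field_div \<epsilon> x y))"
    by (rule int) (auto intro!: continuous_intros Z field_continuous \<epsilon> simp: K)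
  then show "integrable lborel (\<lambda>y. \<phi> (u y) * Z y * field_div \<epsilon> x y)" by (simp add: mult.assoc)
  have iG: "integrable lborel (\<lambda>y. \<phi>' (u y) * (G y \<bullet> v) * \<psi> v y)" for v
  proof -
    have "integrable (lebesgue_on K) G" using wg K by (auto simp: weak_gradient_def)
    then have "integrable lborel (\<lambda>y. indicator K y *\<^sub>R G y)"
      by (subst (asm) lebesgue_on_integral_lborel(2)) (use Gm borel_compact[OF K(1)] in auto)
    then have g: "integrable lborel (\<lambda>y. (indicator K y *\<^sub>R G y) \<bullet> v)" by (rule integrable_inner_left)
    have \<psi>0: "y \<notin> K \<Longrightarrow> \<psi> v y = 0" for y by (simp add: \<psi>_def K)
    have c: "continuous_on UNIV (\<lambda>y. \<phi>' (u y) * \<psi> v y)"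
      by (rule continuous_on_mult_compact_support[OF \<Omega> c\<phi>u(2) c\<psi>(1) K(1,2) \<psi>0])
    obtain B where B: "\<And>y. \<bar>\<phi>' (u y) * \<psi> v y\<bar> \<le> B"
      using bounded_continuous_compact_support[OF c K(1)] \<psi>0 by auto
    have "integrable lborel (\<lambda>y. (indicator K y *\<^sub>R G y) \<bullet> v * (\<phi>' (u y) * \<psi> v y))"
      by (rule integrable_mult_bounded[OF g _ B]) (use borel_measurable_continuous_onI[OF c] in simp)
    also have "(\<lambda>y. (indicator K y *\<^sub>R G y) \<bullet> v * (\<phi>' (u y) * \<psi> v y)) = (\<lambda>y. \<phi>' (u y) * (G y \<bullet> v) * \<psi> v y)"
      by (auto simp: fun_eq_iff indicator_def \<psi>0)
    finally show ?thesis .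
  qed
  \<comment> \<open>Divergence of Z times the field: D contributes its inner product with the field,
    Z keeps the positive kernel.\<close>
  have sum\<psi>': "(\<Sum>v\<in>Basis. \<psi>' v y) = ?m y * (D y \<bullet> (y - x)) + Z y * field_div \<epsilon> x y" for y
  proof -
    have "(\<Sum>v\<in>Basis. \<psi>' v y) = (\<Sum>v\<in>Basis. ?m y * ((D y \<bullet> v) * ((y - x) \<bullet> v))
       + Z y * (- ?n * ?p y * ((y - x) \<bullet> v) * ((y - x) \<bullet> v) + ?m y))"
      unfolding \<psi>'_def by (intro sum.cong refl) (simp add: algebra_simps)
    also have "\<dots> = ?m y * (\<Sum>v\<in>Basis. (D y \<bullet> v) * ((y - x) \<bullet> v)) +
       Z y * (\<Sum>v\<in>Basis. - ?n * ?p y * ((y - x) \<bullet> v) * ((y - x) \<bullet> v) + ?m y)"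
      by (subst sum.distrib) (simp only: sum_distrib_left)
    also have "(\<Sum>v\<in>Basis. (D y \<bullet> v) * ((y - x) \<bullet> v)) = D y \<bullet> (y - x)" by (rule euclidean_inner[symmetric])
    finally show ?thesis by (simp only: field_divergence[OF \<epsilon>])
  qed
  have sum\<psi>: "(\<Sum>v\<in>Basis. \<phi>' (u y) * (G y \<bullet> v) * \<psi> v y) = \<phi>' (u y) * Z y * ?m y * (G y \<bullet> (y - x))" for y
  proof -
    have "(\<Sum>v\<in>Basis. \<phi>' (u y) * (G y \<bullet> v) * \<psi> v y) = (\<Sum>v\<in>Basis. \<phi>' (u y) * Z y * ?m y * ((G y \<bullet> v) * ((y - x) \<bullet> v)))"
      by (intro sum.cong refl) (simp add: \<psi>_def algebra_simps)
    then show ?thesis by (simp only: sum_distrib_left[symmetric] euclidean_inner[symmetric])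
  qed
  have "(\<integral>y. \<phi> (u y) * (?m y * (D y \<bullet> (y - x))) \<partial>lborel) + (\<integral>y. \<phi> (u y) * (Z y * field_div \<epsilon> x y) \<partial>lborel)
     = (\<integral>y. (\<Sum>v\<in>Basis. \<phi> (u y) * \<psi>' v y) \<partial>lborel)"
    using i1 i2 by (simp add: sum_distrib_left[symmetric] sum\<psi>' distrib_left)
  also have "\<dots> = (\<Sum>v\<in>Basis. \<integral>y. \<phi> (u y) * \<psi>' v y \<partial>lborel)"
    by (rule Bochner_Integration.integral_sum) (rule i\<psi>')
  also have "\<dots> = (\<Sum>v\<in>Basis. - (\<integral>y. \<phi>' (u y) * (G y \<bullet> v) * \<psi> v y \<partial>lborel))"
    by (intro sum.cong refl weak_gradient_chain[OF \<Omega> wg Gm cu \<phi>(1,2) _ c\<psi> d\<psi> K(1,2)]) (auto simp: \<psi>_def K)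
  also have "\<dots> = - (\<integral>y. \<phi>' (u y) * Z y * ?m y * (G y \<bullet> (y - x)) \<partial>lborel)"
    by (simp only: sum_negf Bochner_Integration.integral_sum[OF iG, symmetric] sum\<psi>)
  finally have eq: "(\<integral>y. \<phi> (u y) * Z y * field_div \<epsilon> x y \<partial>lborel) =
     - (\<integral>y. \<phi> (u y) * (?m y * (D y \<bullet> (y - x))) \<partial>lborel) - (\<integral>y. \<phi>' (u y) * Z y * ?m y * (G y \<bullet> (y - x)) \<partial>lborel)"
    by (simp add: mult.assoc)
  have i3: "integrable lborel (\<lambda>y. \<phi>' (u y) * Z y * ?m y * (G y \<bullet> (y - x)))"
    unfolding sum\<psi>[symmetric] by (intro Bochner_Integration.integrable_sum iG)
  have m0: "?m y \<ge> 0" for y by (simp add: field_factor_def)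
  have b: "?m y * \<bar>w \<bullet> (y - x)\<bar> \<le> norm w * riesz x y" for w y
  proof -
    have "?m y * \<bar>w \<bullet> (y - x)\<bar> \<le> ?m y * (norm w * norm (y - x))"
      by (intro mult_left_mono Cauchy_Schwarz_ineq2 m0)
    also have "\<dots> = norm w * (?m y * norm (y - x))" by simp
    also have "\<dots> \<le> norm w * riesz x y" by (intro mult_left_mono field_bound \<epsilon>) auto
    finally show ?thesis .
  qed
  have "ennreal (\<integral>y. \<phi> (u y) * Z y * field_div \<epsilon> x y \<partial>lborel) \<le>
     ennreal (\<bar>\<integral>y. \<phi> (u y) * (?m y * (D y \<bullet> (y - x))) \<partial>lborel\<bar> + \<bar>\<integral>y. \<phi>' (u y) * Z y * ?m y * (G y \<bullet> (y - x)) \<partial>lborel\<bar>)"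
    unfolding eq by (intro ennreal_leI) linarith
  also have "\<dots> = ennreal \<bar>\<integral>y. \<phi> (u y) * (?m y * (D y \<bullet> (y - x))) \<partial>lborel\<bar> + ennreal \<bar>\<integral>y. \<phi>' (u y) * Z y * ?m y * (G y \<bullet> (y - x)) \<partial>lborel\<bar>"
    by (rule ennreal_plus) auto
  also have "\<dots> \<le> (\<integral>\<^sup>+y. ennreal (\<phi> (u y) * norm (D y) * riesz x y) \<partial>lborel)
      + (\<integral>\<^sup>+y. ennreal (indicator \<Omega> y * (\<bar>\<phi>' (u y)\<bar> * norm (G y) * riesz x y)) \<partial>lborel)"
  proof (intro add_mono enn_abs_integral_le i1 i3)
    fix y
    have "\<bar>\<phi> (u y) * (?m y * (D y \<bullet> (y - x)))\<bar> = \<phi> (u y) * (?m y * \<bar>D y \<bullet> (y - x)\<bar>)"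
      using \<phi>(3) m0 by (simp add: abs_mult)
    also have "\<dots> \<le> \<phi> (u y) * (norm (D y) * riesz x y)" by (intro mult_left_mono b \<phi>(3))
    finally show "\<bar>\<phi> (u y) * (?m y * (D y \<bullet> (y - x)))\<bar> \<le> \<phi> (u y) * norm (D y) * riesz x y" by (simp add: mult.assoc)
    show "\<bar>\<phi>' (u y) * Z y * ?m y * (G y \<bullet> (y - x))\<bar> \<le> indicator \<Omega> y * (\<bar>\<phi>' (u y)\<bar> * norm (G y) * riesz x y)"
    proof (cases "y \<in> K")
      case True
      have "\<bar>\<phi>' (u y) * Z y * ?m y * (G y \<bullet> (y - x))\<bar> = Z y * (\<bar>\<phi>' (u y)\<bar> * (?m y * \<bar>G y \<bullet> (y - x)\<bar>))"
        using Z m0 by (simp add: abs_mult)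
      also have "\<dots> \<le> 1 * (\<bar>\<phi>' (u y)\<bar> * (norm (G y) * riesz x y))"
        using Z m0 by (intro mult_mono mult_left_mono b) auto
      finally show ?thesis using True K by (auto simp: mult.assoc)
    next
      case False
      then show ?thesis by (simp add: K riesz_nonneg)
    qed
  qed
  finally show "ennreal (\<integral>y. \<phi> (u y) * Z y * field_div \<epsilon> x y \<partial>lborel) \<le>
      (\<integral>\<^sup>+y. ennreal (\<phi> (u y) * norm (D y) * riesz x y) \<partial>lborel)
      + (\<integral>\<^sup>+y. ennreal (indicator \<Omega> y * (\<bar>\<phi>' (u y)\<bar> * norm (G y) * riesz x y)) \<partial>lborel)" .
qed

text \<open>A lower bound, free of \<epsilon>, for the mass of \<open>field_div\<close> on the ball
  of radius \<epsilon>: there |y - x|^2 + \<epsilon>^2 is at most 2 \<epsilon>^2, and the remaining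
  \<epsilon>^(-n) cancels the volume.\<close>

definition mass_const :: "'a::euclidean_space itself \<Rightarrow> real" where
  "mass_const T = real DIM('a) * 2 powr (- real DIM('a) / 2 - 1) * unit_ball_vol (real DIM('a))"

lemma mass_const_pos: "mass_const TYPE('a::euclidean_space) > 0"
  unfolding mass_const_def by (intro mult_pos_pos unit_ball_vol_pos) auto

lemma field_div_mass:
  fixes x :: "'a::euclidean_space"
  assumes \<epsilon>: "\<epsilon> > 0" and int: "integrable lborel (\<lambda>y. f y * field_div \<epsilon> x y)"
    and f: "\<And>y. f y \<ge> 0" "\<And>y. y \<in> ball x \<epsilon> \<Longrightarrow> f y \<ge> a" and a: "a \<ge> 0"
  shows "mass_const TYPE('a) * a \<le> (\<integral>y. f y * field_div \<epsilon> x y \<partial>lborel)"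
proof -
  let ?n = "real DIM('a)"
  let ?c = "?n * \<epsilon>\<^sup>2 * (2 * \<epsilon>\<^sup>2) powr (- ?n / 2 - 1)"
  have c: "?c = ?n * 2 powr (- ?n / 2 - 1) * \<epsilon> powr (- ?n)"
  proof -
    have "(\<epsilon>\<^sup>2) powr (- ?n / 2 - 1) = \<epsilon> powr (- ?n - 2)"
      by (simp add: power2_powr[OF \<epsilon>] algebra_simps)
    moreover have "\<epsilon>\<^sup>2 * \<epsilon> powr (- ?n - 2) = \<epsilon> powr (- ?n)"
      using \<epsilon> powr_add[of \<epsilon> 2 "- ?n - 2"] by simp
    ultimately show ?thesis using \<epsilon> by (simp add: powr_mult mult.left_commute mult.assoc)
  qed
  have "?c * measure lborel (ball x \<epsilon>) = mass_const TYPE('a)"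
  proof -
    have "measure lborel (ball x \<epsilon>) = unit_ball_vol ?n * \<epsilon> ^ DIM('a)"
      using content_ball[of \<epsilon> x] \<epsilon> by simp
    moreover have "\<epsilon> powr (- ?n) * \<epsilon> ^ DIM('a) = 1"
      using \<epsilon> by (simp add: powr_minus powr_realpow)
    ultimately show ?thesis unfolding c mass_const_def by simp
  qed
  then have "mass_const TYPE('a) * a = (\<integral>y. indicator (ball x \<epsilon>) y * (a * ?c) \<partial>lborel)"
    by (simp add: mult.commute)
  also have "\<dots> \<le> (\<integral>y. f y * field_div \<epsilon> x y \<partial>lborel)"
  proof (rule integral_mono[OF _ int])
    show "integrable lborel (\<lambda>y. indicator (ball x \<epsilon>) y * (a * ?c))"
      using emeasure_bounded_finite[OF bounded_ball] by (intro integrable_mult_left integrable_real_indicator) auto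
    fix y
    show "indicator (ball x \<epsilon>) y * (a * ?c) \<le> f y * field_div \<epsilon> x y"
    proof (cases "y \<in> ball x \<epsilon>")
      case True
      then have "(norm (y - x))\<^sup>2 \<le> \<epsilon>\<^sup>2" by (intro power_mono) (auto simp: dist_norm norm_minus_commute)
      then have "?c \<le> field_div \<epsilon> x y"
        unfolding field_div_def using \<epsilon> by (intro mult_left_mono powr_mono2') (auto simp: add_nonneg_pos)
      then have "a * ?c \<le> f y * field_div \<epsilon> x y" using f[of y] True a by (intro mult_mono) auto
      then show ?thesis using True by simp
    next
      case False
      then show ?thesis using f(1)[of y] by (simp add: field_div_def)
    qed
  qed
  finally show ?thesis .
qed

text \<open>The boundary is hidden behind a cutoff built on a near-optimal covering; the gradient of the
  cutoff produces the boundary integral.\<close>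

theorem pointwise_estimate:
  assumes dim: "DIM('a::euclidean_space) \<ge> 2"
  shows "\<exists>C>0. \<forall>(\<Omega>::'a set) u G \<phi> \<phi>' x.
    standing_domain \<Omega> \<and> Cb_closure \<Omega> u \<and> weak_gradient \<Omega> u G \<and> G \<in> borel_measurable borel \<and>
    (\<forall>s. (\<phi> has_real_derivative \<phi>' s) (at s)) \<and> continuous_on UNIV \<phi>' \<and> (\<forall>s. \<phi> s \<ge> 0) \<and> \<phi> 0 = 0 \<and> x \<in> \<Omega> \<longrightarrow>
    ennreal (\<phi> (u x)) \<le> ennreal C *
      ((\<integral>\<^sup>+y. ennreal (indicator \<Omega> y * (\<bar>\<phi>' (u y)\<bar> * norm (G y) * riesz x y)) \<partial>lborel)
       + (\<integral>\<^sup>+y. ennreal (\<phi> (u y) * riesz x y) \<partial>boundary_measure \<Omega>))"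
proof -
  define s where "s = real DIM('a) - 1"
  have s: "s > 0" using dim by (simp add: s_def)
  define \<kappa> where "\<kappa> = hausdorff_const s"
  have \<kappa>: "\<kappa> > 0" using hausdorff_const_pos[of s] s by (simp add: \<kappa>_def)
  define m where "m = mass_const TYPE('a)"
  have m: "m > 0" unfolding m_def by (rule mass_const_pos)
  \<comment> \<open>16/r is the gradient bound of one cutoff and 2^n \<open>unit_ball_vol\<close>
    r^n the volume of the doubled ball; dividing by the Hausdorff constant \<kappa> turns the
    product into a term of the Hausdorff sum.\<close>
  define b where "b = 16 * 2 ^ DIM('a) * unit_ball_vol (real DIM('a)) / \<kappa>"
  have b: "b > 0" using \<kappa> by (simp add: b_def)
  define C where "C = (1 + b) / m"
  have C: "C > 0" using m b by (simp add: C_def)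
  show ?thesis
  proof (intro exI[of _ C] conjI allI impI C)
    fix \<Omega> :: "'a set" and u G \<phi> \<phi>' x
    assume "standing_domain \<Omega> \<and> Cb_closure \<Omega> u \<and> weak_gradient \<Omega> u G \<and> G \<in> borel_measurable borel \<and>
      (\<forall>s. (\<phi> has_real_derivative \<phi>' s) (at s)) \<and> continuous_on UNIV \<phi>' \<and> (\<forall>s. \<phi> s \<ge> 0) \<and> \<phi> 0 = 0 \<and> x \<in> \<Omega>"
    then have \<Omega>: "open \<Omega>" and Hfin: "hausdorff_outer s (frontier \<Omega>) < top"
      and cu: "continuous_on (closure \<Omega>) u" and bu: "bounded {x\<in>closure \<Omega>. u x \<noteq> 0}"
      and wg: "weak_gradient \<Omega> u G" and Gm: "G \<in> borel_measurable borel"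
      and \<phi>: "\<And>s. (\<phi> has_real_derivative \<phi>' s) (at s)" "continuous_on UNIV \<phi>'" "\<And>s. \<phi> s \<ge> 0"
      and \<phi>0: "\<phi> 0 = 0" and x: "x \<in> \<Omega>"
      by (auto simp: standing_domain_def Cb_closure_def s_def)
    let ?M = "boundary_measure \<Omega>"
    have M: "?M = hausdorff_measure_on s (frontier \<Omega>)" by (simp add: boundary_measure_def s_def)
    have fb: "frontier \<Omega> \<in> sets borel" by (simp add: borel_closed frontier_closed)
    define H where "H = enn2real (hausdorff_outer s (frontier \<Omega>))"
    have H: "ennreal H = hausdorff_outer s (frontier \<Omega>)" "H \<ge> 0" using Hfin by (auto simp: H_def)
    define I1 where "I1 = (\<integral>\<^sup>+y. ennreal (indicator \<Omega> y * (\<bar>\<phi>' (u y)\<bar> * norm (G y) * riesz x y)) \<partial>lborel)"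
    define J where "J = (\<integral>\<^sup>+y. ennreal (\<phi> (u y) * riesz x y) \<partial>?M)"
    have c\<phi>: "continuous_on UNIV \<phi>" using \<phi>(1) DERIV_isCont continuous_at_imp_continuous_on by blast
    have cu\<Omega>: "continuous_on \<Omega> u" using cu closure_subset continuous_on_subset by blast
    obtain d where d: "d > 0" "ball x (2 * d) \<subseteq> \<Omega>"
    proof -
      obtain e where "e > 0" "ball x e \<subseteq> \<Omega>" using \<Omega> x open_contains_ball by blast
      then show thesis using that[of "e / 2"] by simp
    qed
    have far: "norm (y - x) \<ge> 2 * d" if "y \<in> frontier \<Omega>" for y
    proof (rule ccontr)
      assume "\<not> ?thesis"
      then have "y \<in> ball x (2 * d)" by (simp add: dist_norm norm_minus_commute)
      then show False using d(2) that \<Omega> by (auto simp: frontier_def interior_open)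
    qed
    obtain R where R: "R > 0" "\<And>y. y \<in> closure \<Omega> \<Longrightarrow> norm y > R \<Longrightarrow> u y = 0" "norm x + d \<le> R"
    proof -
      obtain B where "\<And>y. y \<in> closure \<Omega> \<Longrightarrow> u y \<noteq> 0 \<Longrightarrow> norm y \<le> B" using bu by (auto simp: bounded_iff)
      note B = this
      show thesis
      proof (rule that[of "max B (norm x + d)"])
        show "0 < max B (norm x + d)" using d(1) norm_ge_zero[of x] by (simp add: less_max_iff_disj add_nonneg_pos)
        show "u y = 0" if "y \<in> closure \<Omega>" "norm y > max B (norm x + d)" for y
          using B[of y] that by fastforce
      qed simp
    qed
    \<comment> \<open>Compact and away from x, so g is uniformly continuous here in spite of the
      singular kernel. T contains the covered boundary points as well as the points near them at
      which the cutoff varies and u need not vanish.\<close>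
    define T where "T = closure \<Omega> \<inter> cball 0 (2 * R + d) - ball x d"
    have T: "compact T" unfolding T_def by (intro compact_diff closed_Int_compact) auto
    define g where "g y = \<phi> (u y) * riesz x y" for y
    have gT: "continuous_on T g"
      unfolding g_def riesz_def
    proof (intro continuous_intros)
      show "continuous_on T (\<lambda>y. \<phi> (u y))"
        by (rule continuous_on_compose2[OF c\<phi> continuous_on_subset[OF cu]]) (auto simp: T_def)
      show "\<forall>y\<in>T. norm (x - y) \<noteq> 0" using d by (auto simp: T_def)
    qed
    have g0: "g y \<ge> 0" for y by (simp add: g_def \<phi> riesz_nonneg)
    have main: "ennreal (m * (\<phi> (u x) - \<eta>)) \<le> I1 + ennreal b * (J + ennreal ((2 * H + 1) * \<eta>))" if \<eta>: "\<eta> > 0" for \<eta>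
    proof (cases "\<phi> (u x) - \<eta> \<ge> 0")
      case False
      then have "m * (\<phi> (u x) - \<eta>) \<le> 0" using m by (intro mult_nonneg_nonpos) auto
      then show ?thesis by (simp add: ennreal_neg)
    next
      case True
      have "uniformly_continuous_on T g" by (rule compact_uniformly_continuous[OF gT T])
      then obtain \<delta>1 where \<delta>1: "\<delta>1 > 0" "\<And>y z. y \<in> T \<Longrightarrow> z \<in> T \<Longrightarrow> dist z y < \<delta>1 \<Longrightarrow> dist (g z) (g y) < \<eta>"
        using \<eta> unfolding uniformly_continuous_on_def by metis
      \<comment> \<open>Doubled covering balls have radius at most 2 \<delta>, which is at most d/2:
        they avoid \<open>ball x d\<close>, and inside T the function g stays within \<eta> of its
        value at the centre.\<close>
      define \<delta> where "\<delta> = min \<delta>1 d / 4"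
      have \<delta>: "\<delta> > 0" "4 * \<delta> \<le> \<delta>1" "4 * \<delta> \<le> d" using \<delta>1 d by (auto simp: \<delta>_def)
      define K where "K = frontier \<Omega> \<inter> cball 0 (2 * R)"
      have K: "compact K" "K \<subseteq> frontier \<Omega>" unfolding K_def by (auto intro: closed_Int_compact frontier_closed)
      have KT: "K \<subseteq> T"
        using far d(1) by (force simp: K_def T_def frontier_def dist_norm norm_minus_commute)
      have finK: "hausdorff_outer s K < top" using hausdorff_outer_mono[OF K(2)] Hfin by (rule le_less_trans)
      have gK: "continuous_on K (\<lambda>y. g y + \<eta>)"
        by (intro continuous_on_add continuous_on_subset[OF gT KT] continuous_on_const)
      have "\<exists>(I :: (nat \<times> nat) set) c r. finite I \<and> K \<subseteq> (\<Union>i\<in>I. ball (c i) (r i)) \<and>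
        (\<forall>i\<in>I. c i \<in> K \<and> 0 < r i \<and> r i \<le> \<delta>) \<and>
        (\<Sum>i\<in>I. ennreal (\<kappa> * (g (c i) + \<eta>) * r i powr s)) \<le>
          (\<integral>\<^sup>+y. ennreal ((g y + \<eta>) + \<eta>) * indicator K y \<partial>?M) + ennreal \<eta>"
        unfolding M \<kappa>_def
        by (rule hausdorff_weighted_cover[OF s fb K finK gK _ \<delta>(1) \<eta>])
          (use g0 \<eta> in \<open>simp add: add_nonneg_nonneg less_imp_le\<close>)
      then obtain I :: "(nat \<times> nat) set" and c r where I: "finite I" "K \<subseteq> (\<Union>i\<in>I. ball (c i) (r i))"
        and cr': "\<forall>i\<in>I. c i \<in> K \<and> 0 < r i \<and> r i \<le> \<delta>"
        and sum: "(\<Sum>i\<in>I. ennreal (\<kappa> * (g (c i) + \<eta>) * r i powr s)) \<le>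
          (\<integral>\<^sup>+y. ennreal ((g y + \<eta>) + \<eta>) * indicator K y \<partial>?M) + ennreal \<eta>"
        by (elim exE conjE) (rule that)
      have cr: "\<And>i. i \<in> I \<Longrightarrow> c i \<in> K" "\<And>i. i \<in> I \<Longrightarrow> 0 < r i" "\<And>i. i \<in> I \<Longrightarrow> r i \<le> \<delta>"
        using cr' by blast+
      have rpos: "\<forall>i\<in>I. 0 < r i" using cr(2) by blast
      obtain \<zeta> D where \<zeta>': "continuous_on UNIV \<zeta>" "continuous_on UNIV D" "\<forall>v. dir_deriv v \<zeta> (\<lambda>y. D y \<bullet> v)"
        "\<forall>y. 0 \<le> \<zeta> y \<and> \<zeta> y \<le> 1" "\<forall>y. (\<exists>i\<in>I. y \<in> ball (c i) (r i)) \<longrightarrow> \<zeta> y = 0"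
        "\<forall>y. (\<forall>i\<in>I. 2 * r i \<le> norm (y - c i)) \<longrightarrow> \<zeta> y = 1"
        "\<forall>y. norm (D y) \<le> (\<Sum>i\<in>I. 16 / r i * indicator (ball (c i) (2 * r i)) y)"
        using ball_family_cutoff[where c = c and r = r, OF I(1) rpos] by (elim exE conjE) (rule that)
      note \<zeta> = \<zeta>'(1,2) \<zeta>'(3)[rule_format] \<zeta>'(4)[rule_format, THEN conjunct1] \<zeta>'(4)[rule_format, THEN conjunct2]
        \<zeta>'(5,6,7)[rule_format]
      \<comment> \<open>\<Omega> may be unbounded and only the boundary inside
        \<open>cball 0 (2 * R)\<close> is covered, so a second cutoff supplies compact support. Its
        gradient is nonzero only for |y| > R, where u vanishes on the closure of \<Omega>, so it
        costs nothing.\<close>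
      define \<tau> where "\<tau> y = 1 + (- 1) * ball_cutoff 0 R y" for y :: 'a
      define E where "E y = (- 1) *\<^sub>R ball_cutoff_grad 0 R y" for y :: 'a
      have \<tau>: "continuous_on UNIV \<tau>" "continuous_on UNIV E" "\<And>v. dir_deriv v \<tau> (\<lambda>y. E y \<bullet> v)"
      proof -
        show "continuous_on UNIV \<tau>" "continuous_on UNIV E"
          unfolding \<tau>_def E_def by (intro continuous_intros ball_cutoff_continuous)+
        show "dir_deriv v \<tau> (\<lambda>y. E y \<bullet> v)" for v
          using dir_deriv_add[OF dir_deriv_const[of v 1] dir_deriv_mult[OF dir_deriv_const[of v "-1"] ball_cutoff_dir_deriv[of v 0 R]]]
          by (simp add: \<tau>_def[abs_def] E_def)
      qed
      have \<tau>01: "0 \<le> \<tau> y" "\<tau> y \<le> 1" for y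
        by (auto simp: \<tau>_def ball_cutoff_def smoothstep_nonneg smoothstep_le1)
      have \<tau>1: "\<tau> y = 1" "E y = 0" if "norm y \<le> R" for y
        using that R(1) ball_cutoff_inside[of R y 0] ball_cutoff_grad_inside[of R y 0] by (auto simp: \<tau>_def E_def)
      have \<tau>0: "\<tau> y = 0" if "norm y \<ge> 2 * R" for y
        using that R(1) ball_cutoff_outside[of R y 0] by (auto simp: \<tau>_def)
      define W where "W = (\<Union>i\<in>I. ball (c i) (r i)) \<union> - cball 0 (2 * R)"
      have W: "open W" "frontier \<Omega> \<subseteq> W" "\<And>y. y \<in> W \<Longrightarrow> \<zeta> y * \<tau> y = 0"
      proof -
        show "open W" unfolding W_def by (intro open_Un open_UN ballI open_ball open_Compl closed_cball)
        show "frontier \<Omega> \<subseteq> W" using I(2) by (auto simp: W_def K_def)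
        show "\<zeta> y * \<tau> y = 0" if "y \<in> W" for y using that \<zeta>(6)[of y] \<tau>0[of y] by (auto simp: W_def)
      qed
      define Z where "Z y = indicator \<Omega> y * (\<zeta> y * \<tau> y)" for y
      define F where "F y = indicator \<Omega> y *\<^sub>R (\<tau> y *\<^sub>R D y + \<zeta> y *\<^sub>R E y)" for y
      have dd: "dir_deriv v (\<lambda>y. \<zeta> y * \<tau> y) (\<lambda>y. (\<tau> y *\<^sub>R D y + \<zeta> y *\<^sub>R E y) \<bullet> v)" for v
        using dir_deriv_mult[OF \<zeta>(3) \<tau>(3)] by (simp add: inner_add_left mult.commute)
      have cc: "continuous_on UNIV (\<lambda>y. \<zeta> y * \<tau> y)" "continuous_on UNIV (\<lambda>y. \<tau> y *\<^sub>R D y + \<zeta> y *\<^sub>R E y)"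
        by (intro continuous_intros \<zeta> \<tau>)+
      have Z: "continuous_on UNIV Z" "continuous_on UNIV F" "\<And>v. dir_deriv v Z (\<lambda>y. F y \<bullet> v)"
      proof -
        note ic = indicator_cutoff[where f = "\<lambda>y. \<zeta> y * \<tau> y" and D = "\<lambda>y. \<tau> y *\<^sub>R D y + \<zeta> y *\<^sub>R E y", OF \<Omega> W cc dd]
        show "continuous_on UNIV Z" unfolding Z_def by (rule ic(1))
        show "continuous_on UNIV F" unfolding F_def by (rule ic(2))
        show "dir_deriv v Z (\<lambda>y. F y \<bullet> v)" for v unfolding F_def Z_def by (rule ic(3))
      qed
      have Z01: "0 \<le> Z y" "Z y \<le> 1" for y
        using \<zeta>(4,5)[of y] \<tau>01[of y] by (auto simp: Z_def indicator_def intro: mult_le_one)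
      define K0 where "K0 = closure \<Omega> \<inter> cball 0 (2 * R) - W"
      have K0: "compact K0" "K0 \<subseteq> \<Omega>" "\<And>y. y \<notin> K0 \<Longrightarrow> Z y = 0"
      proof -
        show "compact K0" unfolding K0_def by (intro compact_diff closed_Int_compact W) auto
        show "K0 \<subseteq> \<Omega>" using W(2) \<Omega> by (auto simp: K0_def frontier_def interior_open)
        show "Z y = 0" if "y \<notin> K0" for y
          using that W(3)[of y] closure_subset[of \<Omega>] \<tau>0[of y] by (auto simp: K0_def Z_def indicator_def)
      qed
      \<comment> \<open>Near x neither cutoff is active: the boundary is at distance at least 2 d
        while the inner cutoff varies within 2 \<delta> of it, and R was chosen beyond |x| +
        d.\<close>
      have Z1: "Z y = 1" if "y \<in> ball x d" for y
      proof -
        have "norm (y - x) < d" using that by (simp add: dist_norm norm_minus_commute)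
        have "2 * r i \<le> norm (y - c i)" if "i \<in> I" for i
        proof -
          have "2 * d \<le> norm (c i - x)" using far cr(1)[OF that] K by auto
          also have "\<dots> \<le> norm (y - c i) + norm (y - x)" using norm_triangle_ineq4[of "y - x" "y - c i"] by simp
          finally show ?thesis using \<open>norm (y - x) < d\<close> cr(3)[OF that] \<delta> d(1) by linarith
        qed
        then have "\<zeta> y = 1" by (intro \<zeta>(7)) auto
        moreover have "norm y \<le> R"
          using \<open>norm (y - x) < d\<close> R(3) norm_triangle_ineq[of "y - x" x] by simp
        then have "\<tau> y = 1" by (rule \<tau>1)
        moreover have "y \<in> \<Omega>" using d \<open>norm (y - x) < d\<close> by (auto simp: dist_norm norm_minus_commute)
        ultimately show ?thesis by (simp add: Z_def)
      qed
      obtain \<epsilon> where \<epsilon>: "\<epsilon> > 0" "\<epsilon> \<le> d" "\<And>y. y \<in> ball x \<epsilon> \<Longrightarrow> \<phi> (u x) - \<eta> \<le> \<phi> (u y)"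
      proof -
        have "continuous_on \<Omega> (\<lambda>y. \<phi> (u y))" by (rule continuous_on_compose2[OF c\<phi> cu\<Omega>]) simp
        then obtain e where e: "e > 0" "\<And>y. y \<in> \<Omega> \<Longrightarrow> dist y x < e \<Longrightarrow> dist (\<phi> (u y)) (\<phi> (u x)) < \<eta>"
          using x \<eta> unfolding continuous_on_iff by metis
        show thesis
        proof (rule that[of "min e d"])
          fix y assume y: "y \<in> ball x (min e d)"
          then have "y \<in> \<Omega>" using d by auto
          then have "dist (\<phi> (u y)) (\<phi> (u x)) < \<eta>" using e(2)[of y] y by (simp add: dist_commute)
          then show "\<phi> (u x) - \<eta> \<le> \<phi> (u y)" by (simp add: dist_real_def abs_less_iff)
        qed (use e d in auto)
      qed
      have rep1: "integrable lborel (\<lambda>y. \<phi> (u y) * Z y * field_div \<epsilon> x y)"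
        by (rule representation_inequality(1)[OF \<Omega> wg Gm cu\<Omega> \<phi> Z Z01 K0 \<epsilon>(1)])
      have rep2: "ennreal (\<integral>y. \<phi> (u y) * Z y * field_div \<epsilon> x y \<partial>lborel)
        \<le> (\<integral>\<^sup>+y. ennreal (\<phi> (u y) * norm (F y) * riesz x y) \<partial>lborel) + I1"
        unfolding I1_def by (rule representation_inequality(2)[OF \<Omega> wg Gm cu\<Omega> \<phi> Z Z01 K0 \<epsilon>(1)])
      have "m * (\<phi> (u x) - \<eta>) \<le> (\<integral>y. (\<phi> (u y) * Z y) * field_div \<epsilon> x y \<partial>lborel)"
        unfolding m_def
      proof (rule field_div_mass[OF \<epsilon>(1) rep1 _ _ True])
        show "\<phi> (u y) * Z y \<ge> 0" for y by (simp add: \<phi> Z01)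
        show "\<phi> (u x) - \<eta> \<le> \<phi> (u y) * Z y" if "y \<in> ball x \<epsilon>" for y
          using \<epsilon>(3)[OF that] Z1[of y] that \<epsilon>(2) by simp
      qed
      then have "ennreal (m * (\<phi> (u x) - \<eta>)) \<le> ennreal (\<integral>y. \<phi> (u y) * Z y * field_div \<epsilon> x y \<partial>lborel)"
        by (rule ennreal_leI)
      also have "\<dots> \<le> (\<integral>\<^sup>+y. ennreal (\<phi> (u y) * norm (F y) * riesz x y) \<partial>lborel) + I1"
        by (rule rep2)
      also have "(\<integral>\<^sup>+y. ennreal (\<phi> (u y) * norm (F y) * riesz x y) \<partial>lborel)
        \<le> (\<integral>\<^sup>+y. (\<Sum>i\<in>I. ennreal ((g (c i) + \<eta>) * (16 / r i)) * indicator (ball (c i) (2 * r i)) y) \<partial>lborel)"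
      proof (rule nn_integral_mono)
        fix y
        show "ennreal (\<phi> (u y) * norm (F y) * riesz x y) \<le> (\<Sum>i\<in>I. ennreal ((g (c i) + \<eta>) * (16 / r i)) * indicator (ball (c i) (2 * r i)) y)"
        proof (cases "y \<in> \<Omega> \<and> norm y \<le> R")
          case False
          then have "\<phi> (u y) * norm (F y) = 0"
            using R(2)[of y] subsetD[OF closure_subset, of y \<Omega>] \<phi>0 by (cases "y \<in> \<Omega>") (auto simp: F_def)
          then have "\<phi> (u y) * norm (F y) * riesz x y = 0" by (simp only: mult_zero_left)
          then show ?thesis by (simp only: ennreal_0 zero_le)
        next
          case True
          have "norm (F y) = \<tau> y * norm (D y)" using True \<tau>1[of y] by (simp add: F_def)
          also have "\<dots> \<le> norm (D y)" using \<tau>01 by (intro mult_left_le_one_le) auto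
          also have "\<dots> \<le> (\<Sum>i\<in>I. 16 / r i * indicator (ball (c i) (2 * r i)) y)" by (rule \<zeta>)
          finally have "\<phi> (u y) * norm (F y) * riesz x y \<le> \<phi> (u y) * (\<Sum>i\<in>I. 16 / r i * indicator (ball (c i) (2 * r i)) y) * riesz x y"
            using \<phi>(3) riesz_nonneg by (intro mult_right_mono mult_left_mono) auto
          also have "\<dots> = (\<Sum>i\<in>I. g y * (16 / r i) * indicator (ball (c i) (2 * r i)) y)"
            by (simp add: g_def sum_distrib_left sum_distrib_right mult_ac)
          also have "\<dots> \<le> (\<Sum>i\<in>I. (g (c i) + \<eta>) * (16 / r i) * indicator (ball (c i) (2 * r i)) y)"
          proof (rule sum_mono)
            fix i assume i: "i \<in> I"
            show "g y * (16 / r i) * indicator (ball (c i) (2 * r i)) y \<le> (g (c i) + \<eta>) * (16 / r i) * indicator (ball (c i) (2 * r i)) y"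
            proof (cases "y \<in> ball (c i) (2 * r i)")
              case y: True
              have "norm (y - c i) < 2 * r i" using y by (simp add: dist_norm norm_minus_commute)
              then have yc: "norm (y - c i) < 2 * \<delta>" using cr(3)[OF i] by linarith
              have "c i \<in> frontier \<Omega>" using cr(1)[OF i] K by auto
              then have "2 * d \<le> norm (c i - x)" by (rule far)
              also have "\<dots> \<le> norm (y - c i) + norm (y - x)" using norm_triangle_ineq4[of "y - x" "y - c i"] by simp
              finally have "y \<notin> ball x d" using yc \<delta> d(1) by (simp add: dist_norm norm_minus_commute)
              then have "y \<in> T" using True closure_subset[of \<Omega>] R(1) d(1) by (auto simp: T_def)
              moreover have "c i \<in> T" using KT cr(1)[OF i] by auto
              moreover have "dist y (c i) < \<delta>1" using yc \<delta> by (simp add: dist_norm)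
              ultimately have "dist (g y) (g (c i)) < \<eta>" by (intro \<delta>1(2))
              then have "g y \<le> g (c i) + \<eta>" by (simp add: dist_real_def abs_less_iff)
              then show ?thesis using cr(2)[OF i] by (intro mult_right_mono) auto
            qed simp
          qed
          finally have "ennreal (\<phi> (u y) * norm (F y) * riesz x y) \<le> ennreal (\<Sum>i\<in>I. (g (c i) + \<eta>) * (16 / r i) * indicator (ball (c i) (2 * r i)) y)"
            by (rule ennreal_leI)
          also have "\<dots> = (\<Sum>i\<in>I. ennreal ((g (c i) + \<eta>) * (16 / r i) * indicator (ball (c i) (2 * r i)) y))"
            using g0 \<eta> cr(2) by (intro sum_ennreal[symmetric]) (auto intro!: mult_nonneg_nonneg add_nonneg_nonneg simp: less_imp_le)
          also have "\<dots> = (\<Sum>i\<in>I. ennreal ((g (c i) + \<eta>) * (16 / r i)) * indicator (ball (c i) (2 * r i)) y)"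
            by (intro sum.cong refl) (auto simp: indicator_def)
          finally show ?thesis .
        qed
      qed
      also have "\<dots> = (\<Sum>i\<in>I. ennreal ((g (c i) + \<eta>) * (16 / r i)) * emeasure lborel (ball (c i) (2 * r i)))"
      proof -
        have "(\<integral>\<^sup>+y. ennreal w * indicator (ball z \<rho>) y \<partial>lborel) = ennreal w * emeasure lborel (ball z \<rho>)"
          for w \<rho> and z :: 'a by (rule nn_integral_cmult_indicator) simp
        moreover have "(\<lambda>y. ennreal w * indicator (ball z \<rho>) y) \<in> borel_measurable lborel" for w \<rho> and z :: 'a
          by (intro borel_measurable_times_ennreal borel_measurable_indicator) auto
        ultimately show ?thesis by (simp only: nn_integral_sum)
      qed
      also have "\<dots> = (\<Sum>i\<in>I. ennreal b * ennreal (\<kappa> * (g (c i) + \<eta>) * r i powr s))"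
      proof (rule sum.cong[OF refl])
        fix i assume i: "i \<in> I"
        have ri: "r i > 0" using cr i by auto
        have pw: "r i powr s = r i ^ DIM('a) / r i"
          using ri by (simp add: s_def powr_diff powr_realpow)
        have "(g (c i) + \<eta>) * (16 / r i) * (unit_ball_vol (real DIM('a)) * (2 * r i) ^ DIM('a)) = b * (\<kappa> * (g (c i) + \<eta>) * r i powr s)"
          unfolding pw using \<kappa> ri by (simp add: b_def power_mult_distrib field_simps)
        moreover have "emeasure lborel (ball (c i) (2 * r i)) = ennreal (unit_ball_vol (real DIM('a)) * (2 * r i) ^ DIM('a))"
          using emeasure_ball[of "2 * r i" "c i"] ri by simp
        ultimately show "ennreal ((g (c i) + \<eta>) * (16 / r i)) * emeasure lborel (ball (c i) (2 * r i)) = ennreal b * ennreal (\<kappa> * (g (c i) + \<eta>) * r i powr s)"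
          using g0[of "c i"] \<eta> ri b \<kappa> by (simp add: ennreal_mult[symmetric] mult_nonneg_nonneg add_nonneg_nonneg less_imp_le)
      qed
      also have "\<dots> \<le> ennreal b * ((\<integral>\<^sup>+y. ennreal ((g y + \<eta>) + \<eta>) * indicator K y \<partial>?M) + ennreal \<eta>)"
        unfolding sum_distrib_left[symmetric] by (intro mult_left_mono sum) auto
      also have "(\<integral>\<^sup>+y. ennreal ((g y + \<eta>) + \<eta>) * indicator K y \<partial>?M) \<le> (\<integral>\<^sup>+y. ennreal (g y) + ennreal (2 * \<eta>) \<partial>?M)"
      proof (rule nn_integral_mono)
        show "ennreal ((g y + \<eta>) + \<eta>) * indicator K y \<le> ennreal (g y) + ennreal (2 * \<eta>)" for y
          using g0[of y] \<eta> by (auto simp: indicator_def ennreal_plus[symmetric] simp del: ennreal_plus)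
      qed
      also have "\<dots> = J + ennreal (2 * \<eta>) * ennreal H"
      proof -
        have "continuous_on (frontier \<Omega>) g"
          unfolding g_def riesz_def
        proof (intro continuous_intros)
          show "continuous_on (frontier \<Omega>) (\<lambda>y. \<phi> (u y))"
            by (rule continuous_on_compose2[OF c\<phi> continuous_on_subset[OF cu]]) (auto simp: frontier_def)
          show "\<forall>y\<in>frontier \<Omega>. norm (x - y) \<noteq> 0" using far d by fastforce
        qed
        then have "g \<in> borel_measurable (restrict_space borel (frontier \<Omega>))"
          by (rule borel_measurable_continuous_on_restrict)
        then have "g \<in> borel_measurable ?M"
          by (subst measurable_cong_sets[OF _ refl]) (auto simp: M sets_hausdorff_measure_on)
        moreover have "emeasure ?M (space ?M) = ennreal H"
          using emeasure_hausdorff_measure_on[OF fb fb, of s] H by (simp add: M space_hausdorff_measure_on)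
        moreover have "J = (\<integral>\<^sup>+y. ennreal (g y) \<partial>?M)" by (simp add: J_def g_def)
        ultimately show ?thesis by (simp add: nn_integral_add)
      qed
      finally have *: "ennreal (m * (\<phi> (u x) - \<eta>)) \<le> ennreal b * (J + ennreal (2 * \<eta>) * ennreal H + ennreal \<eta>) + I1"
        by (simp add: add_right_mono mult_left_mono)
      have "ennreal (2 * \<eta>) * ennreal H + ennreal \<eta> = ennreal ((2 * H + 1) * \<eta>)"
        using \<eta> H(2) by (simp add: ennreal_mult[symmetric] ennreal_plus[symmetric] algebra_simps del: ennreal_plus)
      then show ?thesis using * by (simp add: add.assoc add.commute[of I1])
    qed
    have "ennreal (m * \<phi> (u x)) \<le> I1 + ennreal b * J"
    proof (rule ennreal_le_epsilon)
      fix e :: real assume e: "e > 0"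
      \<comment> \<open>The total error made with \<eta> is (m + b (2 H + 1)) \<eta>; finiteness of
        the boundary measure is what makes it vanish with \<eta>.\<close>
      define \<eta> where "\<eta> = e / (m + b * (2 * H + 1))"
      have pos: "m + b * (2 * H + 1) > 0" using m b H by (intro add_pos_nonneg mult_nonneg_nonneg) auto
      then have \<eta>: "\<eta> > 0" using e by (simp add: \<eta>_def)
      have "ennreal (m * \<phi> (u x)) = ennreal (m * (\<phi> (u x) - \<eta>) + m * \<eta>)" by (simp add: algebra_simps)
      also have "\<dots> \<le> ennreal (m * (\<phi> (u x) - \<eta>)) + ennreal (m * \<eta>)"
        using m \<eta> by (cases "m * (\<phi> (u x) - \<eta>) \<ge> 0") (auto simp: ennreal_plus ennreal_neg intro!: ennreal_leI)
      also have "\<dots> \<le> I1 + ennreal b * (J + ennreal ((2 * H + 1) * \<eta>)) + ennreal (m * \<eta>)"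
        by (intro add_right_mono main \<eta>)
      also have "\<dots> = I1 + ennreal b * J + ennreal (b * ((2 * H + 1) * \<eta>) + m * \<eta>)"
        using b H m \<eta> by (simp add: distrib_left ennreal_mult ennreal_plus add.assoc mult_nonneg_nonneg)
      also have "b * ((2 * H + 1) * \<eta>) + m * \<eta> = (m + b * (2 * H + 1)) * \<eta>" by (simp add: algebra_simps)
      also have "\<dots> = e" using pos by (simp add: \<eta>_def)
      finally show "ennreal (m * \<phi> (u x)) \<le> I1 + ennreal b * J + ennreal e" .
    qed
    also have "\<dots> \<le> ennreal (1 + b) * I1 + ennreal (1 + b) * J"
      using b mult_right_mono[of "1::ennreal" "ennreal (1 + b)" I1]
      by (intro add_mono mult_right_mono) (auto intro!: ennreal_leI)
    finally have "ennreal (1 / m) * ennreal (m * \<phi> (u x)) \<le> ennreal (1 / m) * (ennreal (1 + b) * I1 + ennreal (1 + b) * J)"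
      by (rule mult_left_mono) simp
    moreover have "ennreal (1 / m) * ennreal (m * \<phi> (u x)) = ennreal (\<phi> (u x))"
      using m \<phi>(3) by (simp add: ennreal_mult[symmetric])
    moreover have "ennreal (1 / m) * (ennreal (1 + b) * I1 + ennreal (1 + b) * J) = ennreal C * (I1 + J)"
    proof -
      have "ennreal C = ennreal (1 / m * (1 + b))" unfolding C_def by simp
      also have "\<dots> = ennreal (1 / m) * ennreal (1 + b)" using m b by (intro ennreal_mult) auto
      finally have "ennreal C = ennreal (1 / m) * ennreal (1 + b)" .
      then show ?thesis by (simp add: distrib_left mult.assoc)
    qed
    ultimately show "ennreal (\<phi> (u x)) \<le> ennreal C *
      ((\<integral>\<^sup>+y. ennreal (indicator \<Omega> y * (\<bar>\<phi>' (u y)\<bar> * norm (G y) * riesz x y)) \<partial>lborel)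
       + (\<integral>\<^sup>+y. ennreal (\<phi> (u y) * riesz x y) \<partial>boundary_measure \<Omega>))"
      by (simp add: I1_def J_def)
  qed
qed

section \<open>Integral inequalities\<close>

lemma ennreal_affine:
  "0 \<le> P \<Longrightarrow> 0 \<le> a \<Longrightarrow> 0 \<le> b \<Longrightarrow> 0 \<le> f \<Longrightarrow> 0 \<le> g \<Longrightarrow>
    ennreal (P * (a * f + b * g)) = ennreal P * (ennreal a * ennreal f + ennreal b * ennreal g)"
  by (simp add: ennreal_mult)

text \<open>Hoelder with exponents \<theta> and 1 - \<theta>, from the weighted Young inequality for
  f/A and g/B. If A or B is 0 there is nothing to divide by, but then one factor vanishes almost
  everywhere.\<close>

lemma holder_nn_integral:
  fixes f g :: "'b \<Rightarrow> real"
  assumes [measurable]: "f \<in> borel_measurable M" "g \<in> borel_measurable M"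
    and nn: "\<And>x. f x \<ge> 0" "\<And>x. g x \<ge> 0" and \<theta>: "0 < \<theta>" "\<theta> < 1"
    and A: "(\<integral>\<^sup>+x. ennreal (f x) \<partial>M) \<le> ennreal A" "A \<ge> 0"
    and B: "(\<integral>\<^sup>+x. ennreal (g x) \<partial>M) \<le> ennreal B" "B \<ge> 0"
  shows "(\<integral>\<^sup>+x. ennreal (f x powr \<theta> * g x powr (1 - \<theta>)) \<partial>M) \<le> ennreal (A powr \<theta> * B powr (1 - \<theta>))"
proof (cases "A = 0 \<or> B = 0")
  case True
  then have "(\<integral>\<^sup>+x. ennreal (f x) \<partial>M) = 0 \<or> (\<integral>\<^sup>+x. ennreal (g x) \<partial>M) = 0" using A B by auto
  moreover have "AE x in M. h x = 0" if "(\<integral>\<^sup>+x. ennreal (h x) \<partial>M) = 0" "h \<in> borel_measurable M" "\<And>x. h x \<ge> 0" for h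
  proof -
    have "AE x in M. ennreal (h x) = 0" using that(1,2) by (subst (asm) nn_integral_0_iff_AE) auto
    then show ?thesis by (rule eventually_mono) (use that(3) in \<open>auto simp: ennreal_eq_0_iff intro: antisym\<close>)
  qed
  ultimately have "(AE x in M. f x = 0) \<or> (AE x in M. g x = 0)" using nn assms(1,2) by blast
  then have "AE x in M. ennreal (f x powr \<theta> * g x powr (1 - \<theta>)) = 0" by auto
  then have "(\<integral>\<^sup>+x. ennreal (f x powr \<theta> * g x powr (1 - \<theta>)) \<partial>M) = 0"
    by (subst nn_integral_0_iff_AE) auto
  then show ?thesis by simp
next
  case False
  then have AB: "A > 0" "B > 0" using A B by auto
  let ?P = "A powr \<theta> * B powr (1 - \<theta>)"
  have P: "?P > 0" using AB by simp
  have young: "f x powr \<theta> * g x powr (1 - \<theta>) \<le> ?P * (\<theta> / A * f x + (1 - \<theta>) / B * g x)" for x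
  proof (cases "f x = 0 \<or> g x = 0")
    case True
    then show ?thesis using nn[of x] \<theta> AB by (auto intro!: mult_nonneg_nonneg add_nonneg_nonneg)
  next
    case False
    then have "f x > 0" "g x > 0" using nn[of x] by auto
    then have "(f x / A) powr \<theta> * (g x / B) powr (1 - \<theta>) \<le> \<theta> * (f x / A) + (1 - \<theta>) * (g x / B)"
      using \<theta> AB by (intro Youngs_inequality_0) auto
    then have "?P * ((f x / A) powr \<theta> * (g x / B) powr (1 - \<theta>)) \<le> ?P * (\<theta> * (f x / A) + (1 - \<theta>) * (g x / B))"
      using P by (intro mult_left_mono) auto
    moreover have "?P * ((f x / A) powr \<theta> * (g x / B) powr (1 - \<theta>)) = f x powr \<theta> * g x powr (1 - \<theta>)"
      using AB nn by (simp add: powr_divide)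
    ultimately show ?thesis by simp
  qed
  have "(\<integral>\<^sup>+x. ennreal (f x powr \<theta> * g x powr (1 - \<theta>)) \<partial>M)
     \<le> (\<integral>\<^sup>+x. ennreal ?P * (ennreal (\<theta> / A) * ennreal (f x) + ennreal ((1 - \<theta>) / B) * ennreal (g x)) \<partial>M)"
  proof (rule nn_integral_mono)
    fix x
    have "ennreal (f x powr \<theta> * g x powr (1 - \<theta>)) \<le> ennreal (?P * (\<theta> / A * f x + (1 - \<theta>) / B * g x))"
      by (rule ennreal_leI[OF young])
    also have "\<dots> = ennreal ?P * (ennreal (\<theta> / A) * ennreal (f x) + ennreal ((1 - \<theta>) / B) * ennreal (g x))"
      using nn[of x] \<theta> AB P by (intro ennreal_affine) auto
    finally show "ennreal (f x powr \<theta> * g x powr (1 - \<theta>)) \<le> \<dots>" .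
  qed
  also have "\<dots> = ennreal ?P * (ennreal (\<theta> / A) * (\<integral>\<^sup>+x. ennreal (f x) \<partial>M) + ennreal ((1 - \<theta>) / B) * (\<integral>\<^sup>+x. ennreal (g x) \<partial>M))"
    by (simp add: nn_integral_cmult nn_integral_add)
  also have "\<dots> \<le> ennreal ?P * (ennreal (\<theta> / A) * ennreal A + ennreal ((1 - \<theta>) / B) * ennreal B)"
    by (intro mult_left_mono add_mono A B) auto
  also have "ennreal (\<theta> / A) * ennreal A + ennreal ((1 - \<theta>) / B) * ennreal B = 1"
    using \<theta> AB by (simp add: ennreal_mult[symmetric] ennreal_plus[symmetric] del: ennreal_plus)
  finally show ?thesis by simp
qed

lemma lp_norm_le:
  assumes "(\<integral>\<^sup>+x. ennreal (\<bar>f x\<bar> powr p) \<partial>M) \<le> ennreal (A powr p)" "A \<ge> 0" "p > 0"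
  shows "lp_norm M p f \<le> ennreal A"
proof -
  let ?I = "\<integral>\<^sup>+x. ennreal (\<bar>f x\<bar> powr p) \<partial>M"
  have fin: "?I \<noteq> top" using assms(1) by (auto simp: top_unique)
  have "enn2real ?I \<le> A powr p" using assms(1) by (intro enn2real_leI) auto
  then have "enn2real ?I powr (1 / p) \<le> (A powr p) powr (1 / p)" using assms by (intro powr_mono2) auto
  also have "\<dots> = A" using assms by (simp add: powr_powr)
  finally show ?thesis using fin by (simp add: lp_norm_def enn_root_def ennreal_leI)
qed

lemma lp_norm_finiteD:
  assumes "lp_norm M p f < top" "p > 0"
  obtains A where "A \<ge> 0" "lp_norm M p f = ennreal A" "(\<integral>\<^sup>+x. ennreal (\<bar>f x\<bar> powr p) \<partial>M) = ennreal (A powr p)"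
proof -
  let ?I = "\<integral>\<^sup>+x. ennreal (\<bar>f x\<bar> powr p) \<partial>M"
  have fin: "?I \<noteq> top" using assms(1) by (auto simp: lp_norm_def enn_root_def)
  then obtain r where r: "r \<ge> 0" "?I = ennreal r" by (cases ?I) auto
  show thesis
    by (rule that[of "r powr (1 / p)"]) (use r assms in \<open>auto simp: lp_norm_def enn_root_def powr_powr\<close>)
qed

text \<open>Hoelder against the constant 1. The factor is set to 1 at equal exponents because
  \<open>m powr 0\<close> would be 0 for m = 0.\<close>

lemma lp_norm_exponent_mono:
  assumes [measurable]: "f \<in> borel_measurable N" and m: "emeasure N (space N) = ennreal m" "m \<ge> 0"
    and p: "0 < p" "p \<le> r"
  shows "lp_norm N p f \<le> ennreal (if p = r then 1 else m powr (1 / p - 1 / r)) * lp_norm N r f"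
proof (cases "p = r \<or> lp_norm N r f = top")
  case True
  show ?thesis
  proof (cases "p = r")
    case False
    with True have inf: "lp_norm N r f = top" by simp
    show ?thesis
    proof (cases "m = 0")
      case True
      then have "AE x in N. False" using m by (intro AE_I[of _ _ "space N"]) auto
      then have "(\<integral>\<^sup>+x. ennreal (\<bar>f x\<bar> powr q) \<partial>N) = 0" for q
        by (subst nn_integral_0_iff_AE) (auto elim: AE_mp)
      then show ?thesis using inf by (simp add: lp_norm_def enn_root_def)
    next
      case False
      then show ?thesis using inf \<open>p \<noteq> r\<close> m by (simp add: ennreal_mult_top)
    qed
  qed simp
next
  case False
  then have pr: "p < r" and fin: "lp_norm N r f < top" using p by (auto simp: top.not_eq_extremum)
  have r: "r > 0" using p by simp
  obtain A where A: "A \<ge> 0" "lp_norm N r f = ennreal A" "(\<integral>\<^sup>+x. ennreal (\<bar>f x\<bar> powr r) \<partial>N) = ennreal (A powr r)"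
    using lp_norm_finiteD[OF fin r] .
  have "(\<integral>\<^sup>+x. ennreal ((\<bar>f x\<bar> powr r) powr (p / r) * 1 powr (1 - p / r)) \<partial>N) \<le> ennreal ((A powr r) powr (p / r) * m powr (1 - p / r))"
    using p pr A m by (intro holder_nn_integral) auto
  then have "(\<integral>\<^sup>+x. ennreal (\<bar>f x\<bar> powr p) \<partial>N) \<le> ennreal (A powr p * m powr (1 - p / r))"
    using r by (simp add: powr_powr)
  also have "A powr p * m powr (1 - p / r) = (m powr (1 / p - 1 / r) * A) powr p"
    using p A m r by (simp add: powr_mult powr_powr algebra_simps)
  finally have "lp_norm N p f \<le> ennreal (m powr (1 / p - 1 / r) * A)"
    using p A by (intro lp_norm_le) auto
  then show ?thesis using pr A by (simp add: ennreal_mult)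
qed

lemma dyadic_scale:
  fixes z R :: real
  assumes "0 < z" "z < R"
  shows "\<exists>k. R * (1/2) ^ Suc k \<le> z \<and> z < R * (1/2) ^ k"
proof -
  have "\<exists>k. R * (1/2) ^ Suc k \<le> z"
  proof -
    obtain k where "(1/2 :: real) ^ k < z / R" using real_arch_pow_inv[of "z / R" "1/2"] assms by auto
    then have "R * (1/2) ^ k < z" using assms by (simp add: field_simps)
    moreover have "R * (1/2) ^ Suc k \<le> R * (1/2) ^ k" using assms by simp
    ultimately show ?thesis by (intro exI[of _ k]) linarith
  qed
  define k where "k = (LEAST k. R * (1/2) ^ Suc k \<le> z)"
  have k: "R * (1/2) ^ Suc k \<le> z" unfolding k_def by (rule LeastI_ex) fact
  have "z < R * (1/2) ^ k"
  proof (cases k)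
    case (Suc j)
    then have "\<not> R * (1/2) ^ Suc j \<le> z" unfolding k_def using not_less_Least[of j] by (metis k_def lessI)
    then show ?thesis using Suc by simp
  qed (use assms in simp)
  with k show ?thesis by blast
qed

lemma term_le_suminf: "f k \<le> (\<Sum>j. f j)" for f :: "nat \<Rightarrow> ennreal"
  using sum_le_suminf[of f "{k}"] by auto

section \<open>Kernel integrals over sets of given measure, and exchange of integrals\<close>

definition kernel_const :: "real \<Rightarrow> real \<Rightarrow> real \<Rightarrow> real" where
  "kernel_const c \<alpha> a = 1 + c * 2 powr a / (1 - 2 powr (a - \<alpha>))"

lemma kernel_const_pos: "c \<ge> 0 \<Longrightarrow> a < \<alpha> \<Longrightarrow> kernel_const c \<alpha> a \<ge> 1"
proof -
  assume "c \<ge> 0" "a < \<alpha>"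
  then have "2 powr (a - \<alpha>) < 2 powr (0::real)" by (intro powr_less_mono) auto
  then show ?thesis using \<open>c \<ge> 0\<close> by (simp add: kernel_const_def)
qed

text \<open>Splitting at the radius R with R^\<alpha> = m balances two parts. Outside, the kernel is
  at most R^(-a) on a set of measure m; inside, the growth of balls gives a geometric series over
  dyadic shells with ratio 2^(a-\<alpha>) < 1. Each is a multiple of m^(1-a/\<alpha>); the multiples
  are the two summands of \<open>kernel_const\<close>.\<close>

lemma kernel_integral:
  fixes x :: "'a::euclidean_space"
  assumes E: "E \<in> sets M" "emeasure M E = ennreal m" "m \<ge> 0"
    and sm: "\<And>\<rho>. E \<inter> ball x \<rho> \<in> sets M"
    and balls: "\<And>\<rho>. \<rho> > 0 \<Longrightarrow> emeasure M (E \<inter> ball x \<rho>) \<le> ennreal (c * \<rho> powr \<alpha>)"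
    and c: "c \<ge> 0" and a: "0 < a" "a < \<alpha>"
  shows "(\<integral>\<^sup>+y. ennreal (norm (x - y) powr (- a)) * indicator E y \<partial>M) \<le> ennreal (kernel_const c \<alpha> a * m powr (1 - a / \<alpha>))"
proof (cases "m = 0")
  case True
  have "AE y in M. y \<notin> E"
    using E True by (subst AE_iff_null_sets[symmetric]) (auto simp: null_sets_def)
  then have "AE y in M. ennreal (norm (x - y) powr (- a)) * indicator E y = 0" by eventually_elim auto
  then have "(\<integral>\<^sup>+y. ennreal (norm (x - y) powr (- a)) * indicator E y \<partial>M) = (\<integral>\<^sup>+y. 0 \<partial>M)"
    by (rule nn_integral_cong_AE)
  then show ?thesis by simp
next
  case False
  then have m: "m > 0" using E by simp
  define R where "R = m powr (1 / \<alpha>)"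
  have R: "R > 0" using m by (simp add: R_def)
  define D where "D = 2 powr (a - \<alpha>)"
  have D: "0 < D" "D < 1" using a powr_less_mono[of "a - \<alpha>" 0 2] by (auto simp: D_def)
  define \<rho> where "\<rho> k = R * (1/2) ^ k" for k :: nat
  have \<rho>: "\<rho> k > 0" for k using R by (simp add: \<rho>_def)
  have "(\<integral>\<^sup>+y. ennreal (norm (x - y) powr (- a)) * indicator E y \<partial>M) \<le>
     (\<integral>\<^sup>+y. ennreal (R powr (- a)) * indicator E y + (\<Sum>k. ennreal (\<rho> (Suc k) powr (- a)) * indicator (E \<inter> ball x (\<rho> k)) y) \<partial>M)"
  proof (rule nn_integral_mono)
    fix y
    show "ennreal (norm (x - y) powr (- a)) * indicator E y \<le>
      ennreal (R powr (- a)) * indicator E y + (\<Sum>k. ennreal (\<rho> (Suc k) powr (- a)) * indicator (E \<inter> ball x (\<rho> k)) y)"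
    proof (cases "y \<in> E \<and> x \<noteq> y")
      case True
      show ?thesis
      proof (cases "R \<le> norm (x - y)")
        case far: True
        have "ennreal (norm (x - y) powr (- a)) \<le> ennreal (R powr (- a))"
          using R a far by (intro ennreal_leI powr_mono2') auto
        then show ?thesis using True by (simp add: add_increasing2)
      next
        case False
        obtain k where k: "\<rho> (Suc k) \<le> norm (x - y)" "norm (x - y) < \<rho> k"
          using dyadic_scale[of "norm (x - y)" R] False True unfolding \<rho>_def by auto
        have "ennreal (norm (x - y) powr (- a)) \<le> ennreal (\<rho> (Suc k) powr (- a))"
          using \<rho> a k by (intro ennreal_leI powr_mono2') auto
        also have "\<dots> = ennreal (\<rho> (Suc k) powr (- a)) * indicator (E \<inter> ball x (\<rho> k)) y"
          using True k by (simp add: dist_norm)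
        also have "\<dots> \<le> (\<Sum>k. ennreal (\<rho> (Suc k) powr (- a)) * indicator (E \<inter> ball x (\<rho> k)) y)"
          by (rule term_le_suminf)
        finally show ?thesis using True by (simp add: add_increasing)
      qed
    qed auto
  qed
  also have "\<dots> = ennreal (R powr (- a)) * emeasure M E + (\<Sum>k. ennreal (\<rho> (Suc k) powr (- a)) * emeasure M (E \<inter> ball x (\<rho> k)))"
    using E sm by (subst nn_integral_add) (auto simp: nn_integral_suminf nn_integral_cmult_indicator)
  also have "\<dots> \<le> ennreal (R powr (- a)) * ennreal m + (\<Sum>k. ennreal (c * 2 powr a * R powr (\<alpha> - a) * D ^ k))"
  proof (intro add_mono suminf_le summableI)
    fix k
    have "ennreal (\<rho> (Suc k) powr (- a)) * emeasure M (E \<inter> ball x (\<rho> k)) \<le> ennreal (\<rho> (Suc k) powr (- a)) * ennreal (c * \<rho> k powr \<alpha>)"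
      by (intro mult_left_mono balls \<rho>) auto
    also have "\<dots> = ennreal (\<rho> (Suc k) powr (- a) * (c * \<rho> k powr \<alpha>))" using c by (simp add: ennreal_mult)
    also have "\<rho> (Suc k) powr (- a) * (c * \<rho> k powr \<alpha>) = c * 2 powr a * R powr (\<alpha> - a) * D ^ k"
    proof -
      have half: "\<rho> (Suc k) = \<rho> k / 2" by (simp add: \<rho>_def)
      have "\<rho> (Suc k) powr (- a) = \<rho> k powr (- a) * 2 powr a"
        unfolding half using \<rho>[of k] by (simp add: powr_divide powr_minus divide_simps)
      moreover have "\<rho> k powr (- a) * \<rho> k powr \<alpha> = \<rho> k powr (\<alpha> - a)" by (simp add: powr_add[symmetric])
      moreover have "\<rho> k powr (\<alpha> - a) = R powr (\<alpha> - a) * D ^ k"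
      proof -
        have "((1/2::real) ^ k) powr (\<alpha> - a) = ((1/2) powr (\<alpha> - a)) ^ k"
          by (simp add: powr_realpow[symmetric] powr_powr mult.commute)
        moreover have "(1/2::real) powr (\<alpha> - a) = D"
          by (simp add: D_def powr_divide powr_minus_divide[symmetric])
        ultimately show ?thesis using R by (simp add: \<rho>_def powr_mult)
      qed
      ultimately show ?thesis by (simp add: algebra_simps)
    qed
    finally show "ennreal (\<rho> (Suc k) powr (- a)) * emeasure M (E \<inter> ball x (\<rho> k)) \<le> ennreal (c * 2 powr a * R powr (\<alpha> - a) * D ^ k)" .
  qed (use E in simp)
  also have "(\<Sum>k. ennreal (c * 2 powr a * R powr (\<alpha> - a) * D ^ k)) = ennreal (c * 2 powr a * R powr (\<alpha> - a) * (1 / (1 - D)))"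
    using D c by (intro suminf_ennreal_eq sums_mult geometric_sums) auto
  also have "ennreal (R powr (- a)) * ennreal m + ennreal (c * 2 powr a * R powr (\<alpha> - a) * (1 / (1 - D)))
     = ennreal (kernel_const c \<alpha> a * m powr (1 - a / \<alpha>))"
  proof -
    have al: "\<alpha> > 0" using a by simp
    have "R powr (- a) * m = m powr (1 - a / \<alpha>)"
      using m powr_add[of m "- a / \<alpha>" 1] by (simp add: R_def powr_powr)
    moreover have "R powr (\<alpha> - a) = m powr (1 - a / \<alpha>)"
      using m al by (simp add: R_def powr_powr diff_divide_distrib)
    ultimately have "R powr (- a) * m + c * 2 powr a * R powr (\<alpha> - a) * (1 / (1 - D)) = kernel_const c \<alpha> a * m powr (1 - a / \<alpha>)"
      by (simp add: kernel_const_def D_def algebra_simps)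
    moreover have "ennreal (R powr (- a)) * ennreal m + ennreal (c * 2 powr a * R powr (\<alpha> - a) * (1 / (1 - D)))
      = ennreal (R powr (- a) * m + c * 2 powr a * R powr (\<alpha> - a) * (1 / (1 - D)))"
      using m c D by (subst ennreal_plus) (auto simp: ennreal_mult)
    ultimately show ?thesis by simp
  qed
  finally show ?thesis .
qed

text \<open>After the exchange of integrals only the kernel integral over E at a source point y
  remains, and B bounds it uniformly in y. The source thus enters only through the total mass of
  w.\<close>

lemma riesz_fubini:
  fixes M N :: "'a::euclidean_space measure"
  assumes M: "sigma_finite_measure M" "(\<lambda>x. x) \<in> measurable M borel" and N: "sigma_finite_measure N" "(\<lambda>x. x) \<in> measurable N borel"
    and E: "E \<in> sets M" and w: "w \<in> borel_measurable N"
    and B: "\<And>y. (\<integral>\<^sup>+x. ennreal (riesz x y) * indicator E x \<partial>M) \<le> B"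
  shows "(\<integral>\<^sup>+x. (\<integral>\<^sup>+y. w y * ennreal (riesz x y) \<partial>N) * indicator E x \<partial>M) \<le> B * (\<integral>\<^sup>+y. w y \<partial>N)"
proof -
  interpret M: sigma_finite_measure M by (rule M)
  interpret N: sigma_finite_measure N by (rule N)
  interpret pair_sigma_finite M N ..
  have f: "fst \<in> measurable (M \<Otimes>\<^sub>M N) borel" by (rule measurable_compose[OF measurable_fst M(2)])
  have f': "snd \<in> measurable (M \<Otimes>\<^sub>M N) borel" by (rule measurable_compose[OF measurable_snd N(2)])
  have r: "(\<lambda>z. riesz (fst z) (snd z)) \<in> borel_measurable (M \<Otimes>\<^sub>M N)"
    unfolding riesz_def using f f' by measurable
  have w': "(\<lambda>z. w (snd z)) \<in> borel_measurable (M \<Otimes>\<^sub>M N)" using w by measurable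
  have iE: "(\<lambda>z. indicator E (fst z) :: ennreal) \<in> borel_measurable (M \<Otimes>\<^sub>M N)" using E by measurable
  have r1: "(\<lambda>y. riesz x y) \<in> borel_measurable N" for x unfolding riesz_def using N(2) by measurable
  have r2: "(\<lambda>x. riesz x y) \<in> borel_measurable M" for y unfolding riesz_def using M(2) by measurable
  have "(\<integral>\<^sup>+x. (\<integral>\<^sup>+y. w y * ennreal (riesz x y) \<partial>N) * indicator E x \<partial>M)
     = (\<integral>\<^sup>+x. (\<integral>\<^sup>+y. w y * ennreal (riesz x y) * indicator E x \<partial>N) \<partial>M)"
    using w r1 by (intro nn_integral_cong) (simp add: nn_integral_multc)
  also have "\<dots> = (\<integral>\<^sup>+y. (\<integral>\<^sup>+x. w y * ennreal (riesz x y) * indicator E x \<partial>M) \<partial>N)"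
    using r w' iE by (intro Fubini'[symmetric]) (simp add: case_prod_beta')
  also have "\<dots> = (\<integral>\<^sup>+y. w y * (\<integral>\<^sup>+x. ennreal (riesz x y) * indicator E x \<partial>M) \<partial>N)"
    using r2 E by (intro nn_integral_cong) (simp add: nn_integral_cmult mult.assoc)
  also have "\<dots> \<le> (\<integral>\<^sup>+y. B * w y \<partial>N)"
    using B by (intro nn_integral_mono) (simp add: mult.commute[of B] mult_left_mono)
  also have "\<dots> = B * (\<integral>\<^sup>+y. w y \<partial>N)" using w by (rule nn_integral_cmult)
  finally show ?thesis .
qed

section \<open>Level sets\<close>

text \<open>Replacing \<open>u\<close> and its gradient by Borel representatives reduces everything to Borel measures.\<close>

definition regular_pair :: "'a::euclidean_space set \<Rightarrow> ('a \<Rightarrow> real) \<Rightarrow> ('a \<Rightarrow> 'a) \<Rightarrow> bool" where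
  "regular_pair \<Omega> u G \<longleftrightarrow> standing_domain \<Omega> \<and> Cb_closure \<Omega> u \<and> weak_gradient \<Omega> u G \<and>
     u \<in> borel_measurable borel \<and> G \<in> borel_measurable borel"

lemma borel_lebesgue_on: "f \<in> borel_measurable borel \<Longrightarrow> f \<in> borel_measurable (lebesgue_on S)"
  by (intro measurable_restrict_space1 measurable_completion) simp

text \<open>\<Omega> is exhausted by compact sets, on each of which G is integrable; G on \<Omega>
  is the pointwise limit of its restrictions.\<close>

lemma weak_gradient_measurable:
  fixes \<Omega> :: "'a::euclidean_space set"
  assumes "open \<Omega>" "weak_gradient \<Omega> u G"
  shows "(\<lambda>x. indicator \<Omega> x *\<^sub>R G x) \<in> borel_measurable lebesgue"
proof -
  have "\<exists>C. (\<forall>n::nat. compact (C n) \<and> C n \<subseteq> \<Omega>) \<and> (\<forall>x\<in>\<Omega>. \<exists>N. \<forall>n\<ge>N. x \<in> C n)"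
  proof (rule open_Union_compact_subsets[OF assms(1)])
    fix C :: "nat \<Rightarrow> 'a set"
    assume c: "\<And>n. compact (C n)" "\<And>n. C n \<subseteq> \<Omega>"
      and ex: "\<And>K. compact K \<Longrightarrow> K \<subseteq> \<Omega> \<Longrightarrow> \<exists>N. \<forall>n\<ge>N. K \<subseteq> C n"
    have "\<exists>N. \<forall>n\<ge>N. x \<in> C n" if "x \<in> \<Omega>" for x using ex[of "{x}"] that by auto
    then show ?thesis using c by blast
  qed
  then obtain C where C: "\<And>n::nat. compact (C n)" "\<And>n. C n \<subseteq> \<Omega>" "\<And>x. x \<in> \<Omega> \<Longrightarrow> \<exists>N. \<forall>n\<ge>N. x \<in> C n"
    by blast
  show ?thesis
  proof (rule borel_measurable_LIMSEQ_metric)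
    fix n
    have "integrable (lebesgue_on (C n)) G" using assms(2) C by (auto simp: weak_gradient_def)
    then have "integrable lebesgue (\<lambda>x. indicator (C n) x *\<^sub>R G x)"
      using borel_compact[OF C(1)] by (subst (asm) integrable_restrict_space) auto
    then show "(\<lambda>x. indicator (C n) x *\<^sub>R G x) \<in> borel_measurable lebesgue" by auto
  next
    fix x
    show "(\<lambda>n. indicator (C n) x *\<^sub>R G x) \<longlonglongrightarrow> indicator \<Omega> x *\<^sub>R G x"
    proof (cases "x \<in> \<Omega>")
      case True
      then obtain N where "\<forall>n\<ge>N. x \<in> C n" using C(3) by blast
      then have "eventually (\<lambda>n. indicator (C n) x *\<^sub>R G x = G x) sequentially"
        by (auto simp: eventually_sequentially intro!: exI[of _ N])
      then show ?thesis using True by (simp add: tendsto_eventually)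
    next
      case False
      then have "x \<notin> C n" for n using C(2) by blast
      then show ?thesis using False by simp
    qed
  qed
qed

text \<open>Coordinatewise: a real function measurable for the completion agrees almost everywhere
  with a Borel function, and there are finitely many coordinates.\<close>

lemma borel_representative:
  fixes H :: "'a::euclidean_space \<Rightarrow> 'b::euclidean_space"
  assumes "H \<in> borel_measurable lebesgue"
  shows "\<exists>H'. H' \<in> borel_measurable borel \<and> (AE x in lborel. H x = H' x)"
proof -
  have "\<exists>h. h \<in> borel_measurable borel \<and> (AE x in lborel. H x \<bullet> b = h x)" for b
  proof -
    have "(\<lambda>x. H x \<bullet> b) \<in> borel_measurable (completion lborel)" using assms by simp
    from completion_ex_borel_measurable_real[OF this] show ?thesis by auto
  qed
  then obtain h where h: "\<And>b. h b \<in> borel_measurable borel" "\<And>b. AE x in lborel. H x \<bullet> b = h b x" by metis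
  have "AE x in lborel. \<forall>b\<in>Basis. H x \<bullet> b = h b x" using h(2) by (intro AE_finite_allI) auto
  then have "AE x in lborel. H x = (\<Sum>b\<in>Basis. h b x *\<^sub>R b)"
    by (rule eventually_mono) (metis (no_types, lifting) euclidean_representation sum.cong)
  moreover have "(\<lambda>x. \<Sum>b\<in>Basis. h b x *\<^sub>R b) \<in> borel_measurable borel"
    using h(1) by (intro borel_measurable_sum borel_measurable_scaleR) auto
  ultimately show ?thesis by blast
qed

text \<open>u is cut off to the closure, where continuity makes it Borel. G is replaced by a Borel
  function equal to it almost everywhere in \<Omega>, which changes neither the test identities nor
  the integrals of powers.\<close>

lemma regular_reduction:
  fixes \<Omega> :: "'a::euclidean_space set"
  assumes sd: "standing_domain \<Omega>" and cb: "Cb_closure \<Omega> u" and wg: "weak_gradient \<Omega> u G"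
  shows "\<exists>u' G'. regular_pair \<Omega> u' G' \<and> (\<forall>x\<in>closure \<Omega>. u' x = u x) \<and>
    (\<forall>p. (\<integral>\<^sup>+x. ennreal (norm (G x) powr p) \<partial>lebesgue_on \<Omega>) = (\<integral>\<^sup>+x. ennreal (indicator \<Omega> x * norm (G' x) powr p) \<partial>lborel))"
proof -
  have \<Omega>: "open \<Omega>" using sd by (simp add: standing_domain_def)
  then have \<Omega>b: "\<Omega> \<in> sets borel" "\<Omega> \<in> sets lebesgue" by auto
  define u' where "u' x = indicator (closure \<Omega>) x *\<^sub>R u x" for x
  have u': "x \<in> closure \<Omega> \<Longrightarrow> u' x = u x" for x by (simp add: u'_def)
  have u'\<Omega>: "x \<in> \<Omega> \<Longrightarrow> u' x = u x" for x using u' closure_subset by blast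
  have u'm: "u' \<in> borel_measurable borel"
    unfolding u'_def[abs_def] using cb
    by (intro borel_measurable_continuous_on_indicator) (auto simp: Cb_closure_def)
  obtain G' where G': "G' \<in> borel_measurable borel" "AE x in lborel. indicator \<Omega> x *\<^sub>R G x = G' x"
    using borel_representative[OF weak_gradient_measurable[OF \<Omega> wg]] by blast
  have AE: "AE x in lebesgue_on S. G x = G' x" if S: "S \<subseteq> \<Omega>" "S \<in> sets lebesgue" for S
  proof -
    have "AE x in lebesgue. indicator \<Omega> x *\<^sub>R G x = G' x" using G'(2) by (rule AE_completion)
    then have "AE x in lebesgue. x \<in> S \<longrightarrow> G x = G' x"
      by (rule eventually_mono) (use S in auto)
    then show ?thesis using S by (subst AE_restrict_space_iff) auto
  qed
  have Gm: "G \<in> borel_measurable (lebesgue_on \<Omega>)"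
  proof -
    have "(\<lambda>x. indicator \<Omega> x *\<^sub>R G x) \<in> borel_measurable (lebesgue_on \<Omega>)"
      by (intro measurable_restrict_space1 weak_gradient_measurable[OF \<Omega> wg])
    then show ?thesis by (subst (asm) measurable_cong[of _ _ G]) (auto simp: space_lebesgue_on)
  qed
  have "weak_gradient \<Omega> u' G'"
    unfolding weak_gradient_def
  proof (intro conjI allI impI ballI)
    fix K assume K: "compact K \<and> K \<subseteq> \<Omega>"
    then have Kl: "K \<in> sets lebesgue" using borel_compact[of K] by auto
    have iu: "integrable (lebesgue_on K) u" "integrable (lebesgue_on K) G" using wg K by (auto simp: weak_gradient_def)
    show "integrable (lebesgue_on K) u'"
      using iu(1) by (subst Bochner_Integration.integrable_cong[OF refl, of _ _ u]) (use K u'\<Omega> in auto)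
    show "integrable (lebesgue_on K) G'"
      using iu(2) AE[of K] K Kl borel_lebesgue_on[OF G'(1)]
      by (subst integrable_cong_AE[of G' _ G]) (auto elim: eventually_mono)
  next
    fix \<phi> i assume \<phi>: "test_function \<Omega> \<phi>" and i: "(i::'a) \<in> Basis"
    have "continuous_on UNIV \<phi>"
      using \<phi> unfolding test_function_def smooth_fun_def by (metis empty_subsetI iter_partial.simps(1) list.set(1))
    then have \<phi>m: "\<phi> \<in> borel_measurable (lebesgue_on \<Omega>)"
      by (intro borel_lebesgue_on borel_measurable_continuous_onI)
    have "(LINT x|lebesgue_on \<Omega>. u' x * partial_deriv i \<phi> x) = (LINT x|lebesgue_on \<Omega>. u x * partial_deriv i \<phi> x)"
      by (intro Bochner_Integration.integral_cong refl) (simp add: u'\<Omega>)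
    also have "\<dots> = - (LINT x|lebesgue_on \<Omega>. (G x \<bullet> i) * \<phi> x)" using wg \<phi> i by (auto simp: weak_gradient_def)
    also have "(LINT x|lebesgue_on \<Omega>. (G x \<bullet> i) * \<phi> x) = (LINT x|lebesgue_on \<Omega>. (G' x \<bullet> i) * \<phi> x)"
      using Gm \<phi>m borel_lebesgue_on[OF G'(1)] AE[of \<Omega>] \<Omega>b
      by (intro integral_cong_AE) (auto elim: eventually_mono)
    finally show "(LINT x|lebesgue_on \<Omega>. u' x * partial_deriv i \<phi> x) = - (LINT x|lebesgue_on \<Omega>. (G' x \<bullet> i) * \<phi> x)" .
  qed
  moreover have "Cb_closure \<Omega> u'"
  proof -
    have "continuous_on (closure \<Omega>) u'" using cb u' by (auto simp: Cb_closure_def cong: continuous_on_cong)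
    moreover have "{x \<in> closure \<Omega>. u' x \<noteq> 0} = {x \<in> closure \<Omega>. u x \<noteq> 0}" using u' by auto
    ultimately show ?thesis using cb by (simp add: Cb_closure_def)
  qed
  moreover have "(\<integral>\<^sup>+x. ennreal (norm (G x) powr p) \<partial>lebesgue_on \<Omega>) = (\<integral>\<^sup>+x. ennreal (indicator \<Omega> x * norm (G' x) powr p) \<partial>lborel)" for p
  proof -
    have "(\<integral>\<^sup>+x. ennreal (norm (G x) powr p) \<partial>lebesgue_on \<Omega>) = (\<integral>\<^sup>+x. ennreal (norm (G' x) powr p) \<partial>lebesgue_on \<Omega>)"
      using AE[of \<Omega>] \<Omega>b by (intro nn_integral_cong_AE) (auto elim: eventually_mono)
    also have "\<dots> = (\<integral>\<^sup>+x. ennreal (norm (G' x) powr p) * indicator \<Omega> x \<partial>lborel)"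
      using \<Omega>b by (simp add: nn_integral_restrict_space nn_integral_completion)
    also have "\<dots> = (\<integral>\<^sup>+x. ennreal (indicator \<Omega> x * norm (G' x) powr p) \<partial>lborel)"
      by (intro nn_integral_cong) (simp add: indicator_def)
    finally show ?thesis .
  qed
  ultimately show ?thesis using sd u' u'm G' by (intro exI[of _ u'] exI[of _ G']) (auto simp: regular_pair_def)
qed

section \<open>Smooth truncation at a level and the weak-type estimate\<close>

definition trunc :: "real \<Rightarrow> real \<Rightarrow> real" where
  "trunc t s = t * smoothstep (((s / t)\<^sup>2 - 1) / 3)"

definition trunc' :: "real \<Rightarrow> real \<Rightarrow> real" where
  "trunc' t s = smoothstep' (((s / t)\<^sup>2 - 1) / 3) * (2 * s / (3 * t))"

lemma trunc_deriv: "t > 0 \<Longrightarrow> (trunc t has_real_derivative trunc' t s) (at s)"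
proof -
  assume t: "t > 0"
  have "((\<lambda>s. ((s / t)\<^sup>2 - 1) / 3) has_real_derivative 2 * s / (3 * t\<^sup>2)) (at s)"
    using t by (auto intro!: derivative_eq_intros simp: power2_eq_square)
  from DERIV_cmult[OF DERIV_chain2[OF smoothstep_deriv this], of t]
  show ?thesis using t by (simp add: trunc_def[abs_def] trunc'_def power2_eq_square)
qed

lemma continuous_on_trunc': "t > 0 \<Longrightarrow> continuous_on S (trunc' t)"
  unfolding trunc'_def
  by (intro continuous_intros continuous_on_compose2[OF continuous_on_smoothstep'[of UNIV]]) auto

lemma trunc_nonneg: "t > 0 \<Longrightarrow> trunc t s \<ge> 0"
  by (simp add: trunc_def smoothstep_nonneg)

lemma abs_le_square_scaled: "t > 0 \<Longrightarrow> \<bar>s\<bar> \<le> c * t \<Longrightarrow> c \<ge> 0 \<Longrightarrow> (s / t)\<^sup>2 \<le> c\<^sup>2"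
  for s t c :: real
  by (subst abs_le_square_iff[symmetric]) (auto simp: abs_divide divide_le_eq)

lemma square_scaled_le_abs: "t > 0 \<Longrightarrow> c * t \<le> \<bar>s\<bar> \<Longrightarrow> c \<ge> 0 \<Longrightarrow> c\<^sup>2 \<le> (s / t)\<^sup>2"
  for s t c :: real
  by (subst abs_le_square_iff[symmetric]) (auto simp: abs_divide le_divide_eq)

lemma trunc_bound: "t > 0 \<Longrightarrow> trunc t s \<le> t * indicator {t<..} \<bar>s\<bar>"
proof -
  assume t: "t > 0"
  show ?thesis
  proof (cases "\<bar>s\<bar> \<le> t")
    case True
    then have "(s / t)\<^sup>2 \<le> 1\<^sup>2" using t by (intro abs_le_square_scaled) auto
    then show ?thesis using True by (simp add: trunc_def smoothstep_le0)
  next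
    case False
    then show ?thesis using t smoothstep_le1 by (simp add: trunc_def)
  qed
qed

lemma trunc_top: "t > 0 \<Longrightarrow> 2 * t \<le> \<bar>s\<bar> \<Longrightarrow> trunc t s = t"
proof -
  assume t: "t > 0" "2 * t \<le> \<bar>s\<bar>"
  then have "2\<^sup>2 \<le> (s / t)\<^sup>2" by (intro square_scaled_le_abs) auto
  then show ?thesis by (simp add: trunc_def smoothstep_ge1)
qed

text \<open>The argument of \<open>smoothstep'\<close> runs from 0 to 1 as |s| runs from t to 2 t,
  so the derivative lives on that shell; there it is at most 4 * (4/3), rounded up to 6. Squaring
  s/t avoids the kink of the absolute value.\<close>

lemma trunc'_bound: "t > 0 \<Longrightarrow> \<bar>trunc' t s\<bar> \<le> 6 * indicator {t<..<2 * t} \<bar>s\<bar>"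
proof -
  assume t: "t > 0"
  consider "\<bar>s\<bar> \<le> t" | "2 * t \<le> \<bar>s\<bar>" | "t < \<bar>s\<bar>" "\<bar>s\<bar> < 2 * t" by linarith
  then show ?thesis
  proof cases
    case 1
    then have "(s / t)\<^sup>2 \<le> 1\<^sup>2" using t by (intro abs_le_square_scaled) auto
    then show ?thesis using t by (simp add: trunc'_def smoothstep'_zero)
  next
    case 2
    then have "2\<^sup>2 \<le> (s / t)\<^sup>2" using t by (intro square_scaled_le_abs) auto
    then show ?thesis using t by (simp add: trunc'_def smoothstep'_zero)
  next
    case 3
    have "\<bar>trunc' t s\<bar> = smoothstep' (((s / t)\<^sup>2 - 1) / 3) * (2 * \<bar>s\<bar> / (3 * t))"
      using t smoothstep'_bound by (simp add: trunc'_def abs_mult)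
    also have "\<dots> \<le> 4 * (4 / 3)"
      using 3 t smoothstep'_bound by (intro mult_mono) (auto simp: divide_le_eq)
    finally show ?thesis using 3 by simp
  qed
qed

text \<open>The pointwise estimate with \<phi> = \<open>trunc t\<close>: its value at u x is t, on
  the boundary it is at most t where |u| > t and 0 elsewhere, and its derivative is confined to the
  shell between t and 2 t. The bound 6 on the derivative goes into C.\<close>

lemma level_estimate:
  assumes dim: "DIM('a::euclidean_space) \<ge> 2"
  shows "\<exists>C>0. \<forall>(\<Omega>::'a set) u G x t. regular_pair \<Omega> u G \<and> x \<in> \<Omega> \<and> t > 0 \<and> 2 * t \<le> \<bar>u x\<bar> \<longrightarrow>
    ennreal t \<le> ennreal C *
      ((\<integral>\<^sup>+y. ennreal (indicator \<Omega> y * indicator {t<..<2 * t} \<bar>u y\<bar> * norm (G y)) * ennreal (riesz x y) \<partial>lborel)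
       + (\<integral>\<^sup>+y. ennreal (t * indicator {t<..} \<bar>u y\<bar>) * ennreal (riesz x y) \<partial>boundary_measure \<Omega>))"
proof -
  obtain C0 where C0: "C0 > 0" and est: "\<And>(\<Omega>::'a set) u G \<phi> \<phi>' x.
    standing_domain \<Omega> \<and> Cb_closure \<Omega> u \<and> weak_gradient \<Omega> u G \<and> G \<in> borel_measurable borel \<and>
    (\<forall>s. (\<phi> has_real_derivative \<phi>' s) (at s)) \<and> continuous_on UNIV \<phi>' \<and> (\<forall>s. \<phi> s \<ge> 0) \<and> \<phi> 0 = 0 \<and> x \<in> \<Omega> \<Longrightarrow>
    ennreal (\<phi> (u x)) \<le> ennreal C0 *
      ((\<integral>\<^sup>+y. ennreal (indicator \<Omega> y * (\<bar>\<phi>' (u y)\<bar> * norm (G y) * riesz x y)) \<partial>lborel)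
       + (\<integral>\<^sup>+y. ennreal (\<phi> (u y) * riesz x y) \<partial>boundary_measure \<Omega>))"
    using pointwise_estimate[OF dim] by blast
  show ?thesis
  proof (intro exI[of _ "6 * C0"] conjI allI impI)
    show "6 * C0 > 0" using C0 by simp
    fix \<Omega> :: "'a set" and u G x and t :: real
    assume a: "regular_pair \<Omega> u G \<and> x \<in> \<Omega> \<and> t > 0 \<and> 2 * t \<le> \<bar>u x\<bar>"
    then have t: "t > 0" and [measurable]: "u \<in> borel_measurable borel" "G \<in> borel_measurable borel" "\<Omega> \<in> sets borel"
      by (auto simp: regular_pair_def standing_domain_def)
    let ?I = "\<integral>\<^sup>+y. ennreal (indicator \<Omega> y * indicator {t<..<2 * t} \<bar>u y\<bar> * norm (G y)) * ennreal (riesz x y) \<partial>lborel"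
    let ?J = "\<integral>\<^sup>+y. ennreal (t * indicator {t<..} \<bar>u y\<bar>) * ennreal (riesz x y) \<partial>boundary_measure \<Omega>"
    have z: "trunc t 0 = 0" using trunc_bound[OF t, of 0] trunc_nonneg[OF t, of 0] t by simp
    have base: "ennreal (trunc t (u x)) \<le> ennreal C0 *
      ((\<integral>\<^sup>+y. ennreal (indicator \<Omega> y * (\<bar>trunc' t (u y)\<bar> * norm (G y) * riesz x y)) \<partial>lborel)
       + (\<integral>\<^sup>+y. ennreal (trunc t (u y) * riesz x y) \<partial>boundary_measure \<Omega>))"
      using a t by (intro est) (auto simp: regular_pair_def z trunc_deriv trunc_nonneg continuous_on_trunc')
    have t_le: "ennreal t \<le> ennreal C0 *
      ((\<integral>\<^sup>+y. ennreal (indicator \<Omega> y * (\<bar>trunc' t (u y)\<bar> * norm (G y) * riesz x y)) \<partial>lborel)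
       + (\<integral>\<^sup>+y. ennreal (trunc t (u y) * riesz x y) \<partial>boundary_measure \<Omega>))"
      using base trunc_top[OF t, of "u x"] a by simp
    have "(\<integral>\<^sup>+y. ennreal (indicator \<Omega> y * (\<bar>trunc' t (u y)\<bar> * norm (G y) * riesz x y)) \<partial>lborel) \<le>
      (\<integral>\<^sup>+y. ennreal 6 * (ennreal (indicator \<Omega> y * indicator {t<..<2 * t} \<bar>u y\<bar> * norm (G y)) * ennreal (riesz x y)) \<partial>lborel)"
    proof (rule nn_integral_mono)
      fix y
      have "indicator \<Omega> y * (\<bar>trunc' t (u y)\<bar> * norm (G y) * riesz x y) \<le> indicator \<Omega> y * ((6 * indicator {t<..<2 * t} \<bar>u y\<bar>) * norm (G y) * riesz x y)"
        using trunc'_bound[OF t] riesz_nonneg by (intro mult_left_mono mult_right_mono) auto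
      also have "\<dots> = 6 * (indicator \<Omega> y * indicator {t<..<2 * t} \<bar>u y\<bar> * norm (G y) * riesz x y)" by simp
      finally show "ennreal (indicator \<Omega> y * (\<bar>trunc' t (u y)\<bar> * norm (G y) * riesz x y)) \<le>
         ennreal 6 * (ennreal (indicator \<Omega> y * indicator {t<..<2 * t} \<bar>u y\<bar> * norm (G y)) * ennreal (riesz x y))"
        using riesz_nonneg[of x y] by (subst ennreal_mult[symmetric], simp, simp)+ (rule ennreal_leI)
    qed
    also have "\<dots> = ennreal 6 * ?I"
      by (rule nn_integral_cmult) (measurable)
    finally have I6: "(\<integral>\<^sup>+y. ennreal (indicator \<Omega> y * (\<bar>trunc' t (u y)\<bar> * norm (G y) * riesz x y)) \<partial>lborel) \<le> ennreal 6 * ?I" .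
    have J6: "(\<integral>\<^sup>+y. ennreal (trunc t (u y) * riesz x y) \<partial>boundary_measure \<Omega>) \<le> ennreal 6 * ?J"
    proof -
      have "(\<integral>\<^sup>+y. ennreal (trunc t (u y) * riesz x y) \<partial>boundary_measure \<Omega>) \<le> ?J"
      proof (rule nn_integral_mono)
        fix y
        have "ennreal (trunc t (u y) * riesz x y) \<le> ennreal (t * indicator {t<..} \<bar>u y\<bar> * riesz x y)"
          by (intro ennreal_leI mult_right_mono trunc_bound t riesz_nonneg)
        then show "ennreal (trunc t (u y) * riesz x y) \<le> ennreal (t * indicator {t<..} \<bar>u y\<bar>) * ennreal (riesz x y)"
          using t riesz_nonneg by (subst ennreal_mult[symmetric]) auto
      qed
      also have "\<dots> = 1 * ?J" by simp
      also have "\<dots> \<le> ennreal 6 * ?J" by (intro mult_right_mono) auto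
      finally show ?thesis .
    qed
    have "ennreal t \<le> ennreal C0 * (ennreal 6 * ?I + ennreal 6 * ?J)"
      by (rule order_trans[OF t_le]) (intro mult_left_mono add_mono I6 J6 zero_le)
    also have "\<dots> = (ennreal C0 * ennreal 6) * (?I + ?J)"
      by (simp only: distrib_left mult.assoc)
    also have "ennreal C0 * ennreal 6 = ennreal (6 * C0)"
      by (subst ennreal_mult[symmetric]) (use C0 in \<open>auto simp: mult.commute\<close>)
    finally show "ennreal t \<le> ennreal (6 * C0) * (?I + ?J)" .
  qed
qed

lemma boundary_measure_properties:
  fixes \<Omega> :: "'a::euclidean_space set"
  assumes "standing_domain \<Omega>"
  shows "finite_measure (boundary_measure \<Omega>)" "(\<lambda>x. x) \<in> measurable (boundary_measure \<Omega>) borel"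
    "space (boundary_measure \<Omega>) = frontier \<Omega>"
    "emeasure (boundary_measure \<Omega>) (space (boundary_measure \<Omega>)) = ennreal (enn2real (hausdorff_outer (real DIM('a) - 1) (frontier \<Omega>)))"
proof -
  let ?s = "real DIM('a) - 1"
  have fb: "frontier \<Omega> \<in> sets borel" by (simp add: borel_closed frontier_closed)
  show sp: "space (boundary_measure \<Omega>) = frontier \<Omega>"
    by (simp add: boundary_measure_def space_hausdorff_measure_on)
  have fin: "hausdorff_outer ?s (frontier \<Omega>) < top" using assms by (simp add: standing_domain_def)
  have em: "emeasure (boundary_measure \<Omega>) (frontier \<Omega>) = hausdorff_outer ?s (frontier \<Omega>)"
    using emeasure_hausdorff_measure_on[OF fb fb] by (simp add: boundary_measure_def)
  show "finite_measure (boundary_measure \<Omega>)" using fin by (intro finite_measureI) (simp add: sp em)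
  show "emeasure (boundary_measure \<Omega>) (space (boundary_measure \<Omega>)) = ennreal (enn2real (hausdorff_outer ?s (frontier \<Omega>)))"
    using fin by (simp add: sp em)
  show "(\<lambda>x. x) \<in> measurable (boundary_measure \<Omega>) borel"
    by (subst measurable_cong_sets[OF _ refl, of _ "restrict_space borel (frontier \<Omega>)"])
      (simp_all add: boundary_measure_def sets_hausdorff_measure_on measurable_restrict_space1)
qed

lemma admissible_measure_properties:
  fixes \<Omega> :: "'a::euclidean_space set"
  assumes "open \<Omega>" "admissible_measure \<Omega> M \<alpha> c"
  shows "finite_measure M" "(\<lambda>x. x) \<in> measurable M borel" "space M = \<Omega>"
    "\<And>E. E \<in> sets borel \<Longrightarrow> E \<subseteq> \<Omega> \<Longrightarrow> E \<in> sets M"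
proof -
  have s: "sets M = sets (restrict_space borel \<Omega>)" and fin: "emeasure M \<Omega> < top"
    using assms by (auto simp: admissible_measure_def)
  show sp: "space M = \<Omega>" using sets_eq_imp_space_eq[OF s] by (simp add: space_restrict_space)
  show "finite_measure M" using fin by (intro finite_measureI) (simp add: sp)
  show "(\<lambda>x. x) \<in> measurable M borel"
    by (subst measurable_cong_sets[OF s refl]) (simp add: measurable_restrict_space1)
  show "E \<in> sets M" if "E \<in> sets borel" "E \<subseteq> \<Omega>" for E
    using that \<open>open \<Omega>\<close> by (simp add: s sets_restrict_space_iff)
qed

text \<open>The growth condition concerns balls centred in \<Omega>, but here y is arbitrary, in
  particular on the boundary. If a ball about y meets E, its part in E lies in the ball of twice the
  radius about a point of E; this costs the factor 2^\<alpha>.\<close>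

lemma admissible_kernel_bound:
  fixes \<Omega> :: "'a::euclidean_space set"
  assumes \<Omega>: "open \<Omega>" and M: "admissible_measure \<Omega> M \<alpha> c" and c: "c > 0"
    and \<alpha>: "real DIM('a) - 1 < \<alpha>" and dim: "DIM('a) \<ge> 2"
    and E: "E \<in> sets borel" "E \<subseteq> \<Omega>"
  shows "(\<integral>\<^sup>+x. ennreal (riesz x y) * indicator E x \<partial>M) \<le>
    ennreal (kernel_const (c * 2 powr \<alpha>) \<alpha> (real DIM('a) - 1) * measure M E powr (1 - (real DIM('a) - 1) / \<alpha>))"
proof -
  note p = admissible_measure_properties[OF \<Omega> M]
  interpret finite_measure M by (rule p)
  have "(\<integral>\<^sup>+x. ennreal (norm (y - x) powr (- (real DIM('a) - 1))) * indicator E x \<partial>M) \<le>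
    ennreal (kernel_const (c * 2 powr \<alpha>) \<alpha> (real DIM('a) - 1) * measure M E powr (1 - (real DIM('a) - 1) / \<alpha>))"
  proof (rule kernel_integral)
    show "E \<in> sets M" using E by (rule p(4))
    show "emeasure M E = ennreal (measure M E)" by (rule emeasure_eq_measure)
    show "E \<inter> ball y \<rho> \<in> sets M" for \<rho> using E by (intro p(4)) auto
    show "emeasure M (E \<inter> ball y \<rho>) \<le> ennreal (c * 2 powr \<alpha> * \<rho> powr \<alpha>)" if "\<rho> > 0" for \<rho>
    proof (cases "E \<inter> ball y \<rho> = {}")
      case False
      then obtain z where z: "z \<in> E" "dist y z < \<rho>" by auto
      have "E \<inter> ball y \<rho> \<subseteq> ball z (2 * \<rho>) \<inter> \<Omega>"
      proof
        fix w assume w: "w \<in> E \<inter> ball y \<rho>"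
        then have "dist z w < 2 * \<rho>" using z dist_triangle[of z w y] by (simp add: dist_commute)
        then show "w \<in> ball z (2 * \<rho>) \<inter> \<Omega>" using w E by auto
      qed
      then have "emeasure M (E \<inter> ball y \<rho>) \<le> emeasure M (ball z (2 * \<rho>) \<inter> \<Omega>)"
        using \<Omega> by (intro emeasure_mono p(4)) auto
      also have "\<dots> \<le> ennreal (c * (2 * \<rho>) powr \<alpha>)"
        using M z E that unfolding admissible_measure_def by auto
      also have "c * (2 * \<rho>) powr \<alpha> = c * 2 powr \<alpha> * \<rho> powr \<alpha>" using that by (simp add: powr_mult)
      finally show ?thesis .
    qed (use c in simp)
  qed (use c \<alpha> dim in auto)
  then show ?thesis by (simp add: riesz_def norm_minus_commute)
qed

lemma riesz_potential_measurable:
  fixes M N :: "'a::euclidean_space measure"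
  assumes M: "(\<lambda>x. x) \<in> measurable M borel" and N: "sigma_finite_measure N" "(\<lambda>x. x) \<in> measurable N borel"
    and w: "w \<in> borel_measurable N"
  shows "(\<lambda>x. \<integral>\<^sup>+y. w y * ennreal (riesz x y) \<partial>N) \<in> borel_measurable M"
proof -
  interpret N: sigma_finite_measure N by (rule N)
  have f: "fst \<in> measurable (M \<Otimes>\<^sub>M N) borel" by (rule measurable_compose[OF measurable_fst M])
  have f': "snd \<in> measurable (M \<Otimes>\<^sub>M N) borel" by (rule measurable_compose[OF measurable_snd N(2)])
  have r: "(\<lambda>z. riesz (fst z) (snd z)) \<in> borel_measurable (M \<Otimes>\<^sub>M N)"
    unfolding riesz_def using f f' by measurable
  have w': "(\<lambda>z. w (snd z)) \<in> borel_measurable (M \<Otimes>\<^sub>M N)" using w by measurable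
  show ?thesis
    by (rule N.borel_measurable_nn_integral) (use r w' in \<open>simp add: case_prod_beta'\<close>)
qed

definition grad_mass :: "'a::euclidean_space set \<Rightarrow> ('a \<Rightarrow> real) \<Rightarrow> ('a \<Rightarrow> 'a) \<Rightarrow> real \<Rightarrow> ennreal" where
  "grad_mass \<Omega> u G t = (\<integral>\<^sup>+y. ennreal (indicator \<Omega> y * indicator {t<..<2 * t} \<bar>u y\<bar> * norm (G y)) \<partial>lborel)"

definition bdry_mass :: "'a::euclidean_space set \<Rightarrow> ('a \<Rightarrow> real) \<Rightarrow> real \<Rightarrow> ennreal" where
  "bdry_mass \<Omega> u t = (\<integral>\<^sup>+y. ennreal (t * indicator {t<..} \<bar>u y\<bar>) \<partial>boundary_measure \<Omega>)"

text \<open>The level estimate is integrated over the superlevel set, of measure m. By Fubini each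
  potential contributes at most m^(1-\<theta>) times the mass of its source, where \<theta> =
  (n-1)/\<alpha>; dividing t m by m^(1-\<theta>) leaves t m^\<theta>.\<close>

lemma weak_type_estimate:
  assumes dim: "DIM('a::euclidean_space) \<ge> 2" and \<alpha>: "real DIM('a) - 1 < \<alpha>" and c: "c > 0"
  shows "\<exists>C>0. \<forall>(\<Omega>::'a set) M u G t. regular_pair \<Omega> u G \<and> admissible_measure \<Omega> M \<alpha> c \<and> t > 0 \<longrightarrow>
    ennreal (t * measure M {x\<in>\<Omega>. 2 * t \<le> \<bar>u x\<bar>} powr ((real DIM('a) - 1) / \<alpha>)) \<le>
      ennreal C * (grad_mass \<Omega> u G t + bdry_mass \<Omega> u t)"
proof -
  obtain C0 where C0: "C0 > 0" and est: "\<And>(\<Omega>::'a set) u G x t. regular_pair \<Omega> u G \<and> x \<in> \<Omega> \<and> t > 0 \<and> 2 * t \<le> \<bar>u x\<bar> \<Longrightarrow>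
    ennreal t \<le> ennreal C0 *
      ((\<integral>\<^sup>+y. ennreal (indicator \<Omega> y * indicator {t<..<2 * t} \<bar>u y\<bar> * norm (G y)) * ennreal (riesz x y) \<partial>lborel)
       + (\<integral>\<^sup>+y. ennreal (t * indicator {t<..} \<bar>u y\<bar>) * ennreal (riesz x y) \<partial>boundary_measure \<Omega>))"
    using level_estimate[OF dim] by blast
  define kc where "kc = kernel_const (c * 2 powr \<alpha>) \<alpha> (real DIM('a) - 1)"
  have kc: "kc \<ge> 1" unfolding kc_def using c \<alpha> by (intro kernel_const_pos) auto
  define \<theta> where "\<theta> = (real DIM('a) - 1) / \<alpha>"
  have \<theta>: "0 < \<theta>" "\<theta> < 1" using dim \<alpha> by (auto simp: \<theta>_def)
  show ?thesis
  proof (intro exI[of _ "C0 * kc"] conjI allI impI)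
    show "C0 * kc > 0" using C0 kc by simp
    fix \<Omega> :: "'a set" and M u G and t :: real
    assume a: "regular_pair \<Omega> u G \<and> admissible_measure \<Omega> M \<alpha> c \<and> t > 0"
    then have rp: "regular_pair \<Omega> u G" and M: "admissible_measure \<Omega> M \<alpha> c" and t: "t > 0"
      and sd: "standing_domain \<Omega>" and \<Omega>: "open \<Omega>" and [measurable]: "\<Omega> \<in> sets borel" "u \<in> borel_measurable borel" "G \<in> borel_measurable borel"
      by (auto simp: regular_pair_def standing_domain_def)
    note p = admissible_measure_properties[OF \<Omega> M]
    note q = boundary_measure_properties[OF sd]
    interpret M: finite_measure M by (rule p)
    interpret B: finite_measure "boundary_measure \<Omega>" by (rule q)
    define E where "E = {x\<in>\<Omega>. 2 * t \<le> \<bar>u x\<bar>}"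
    have "{x \<in> space borel. x \<in> \<Omega> \<and> 2 * t \<le> \<bar>u x\<bar>} \<in> sets borel" by measurable
    then have E: "E \<in> sets borel" "E \<subseteq> \<Omega>" by (auto simp: E_def)
    have EM: "E \<in> sets M" using E by (rule p(4))
    define m where "m = measure M E"
    have m: "m \<ge> 0" "emeasure M E = ennreal m" by (auto simp: m_def M.emeasure_eq_measure)
    define w1 where "w1 y = ennreal (indicator \<Omega> y * indicator {t<..<2 * t} \<bar>u y\<bar> * norm (G y))" for y
    define w2 where "w2 y = ennreal (t * indicator {t<..} \<bar>u y\<bar>)" for y
    have w1: "w1 \<in> borel_measurable lborel" unfolding w1_def by measurable
    have "w2 \<in> borel_measurable borel" unfolding w2_def by measurable
    then have w2: "w2 \<in> borel_measurable (boundary_measure \<Omega>)" by (rule measurable_compose[OF q(2)])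
    define I where "I x = (\<integral>\<^sup>+y. w1 y * ennreal (riesz x y) \<partial>lborel)" for x
    define J where "J x = (\<integral>\<^sup>+y. w2 y * ennreal (riesz x y) \<partial>boundary_measure \<Omega>)" for x
    have sl: "sigma_finite_measure (lborel :: 'a measure)" by (rule lborel.sigma_finite_measure_axioms)
    have il: "(\<lambda>x. x) \<in> measurable (lborel :: 'a measure) borel" by simp
    have Im: "I \<in> borel_measurable M" unfolding I_def by (rule riesz_potential_measurable[OF p(2) sl il w1])
    have Jm: "J \<in> borel_measurable M" unfolding J_def
      by (rule riesz_potential_measurable[OF p(2) B.sigma_finite_measure_axioms q(2) w2])
    have iE: "(indicator E :: 'a \<Rightarrow> ennreal) \<in> borel_measurable M" using EM by simp
    let ?B = "ennreal (kc * m powr (1 - \<theta>))"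
    have Bb: "(\<integral>\<^sup>+x. ennreal (riesz x y) * indicator E x \<partial>M) \<le> ?B" for y
      unfolding kc_def m_def \<theta>_def by (rule admissible_kernel_bound[OF \<Omega> M c \<alpha> dim E])
    have "ennreal (t * m) = (\<integral>\<^sup>+x. ennreal t * indicator E x \<partial>M)"
      using EM m t by (simp add: nn_integral_cmult_indicator ennreal_mult)
    also have "\<dots> \<le> (\<integral>\<^sup>+x. ennreal C0 * (I x * indicator E x + J x * indicator E x) \<partial>M)"
    proof (rule nn_integral_mono)
      fix x
      show "ennreal t * indicator E x \<le> ennreal C0 * (I x * indicator E x + J x * indicator E x)"
      proof (cases "x \<in> E")
        case True
        then show ?thesis using est[of \<Omega> u G x t] rp t by (simp add: E_def I_def J_def w1_def w2_def)
      qed simp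
    qed
    also have "\<dots> = ennreal C0 * ((\<integral>\<^sup>+x. I x * indicator E x \<partial>M) + (\<integral>\<^sup>+x. J x * indicator E x \<partial>M))"
      using Im Jm iE by (simp add: nn_integral_cmult nn_integral_add)
    also have "\<dots> \<le> ennreal C0 * (?B * (\<integral>\<^sup>+y. w1 y \<partial>lborel) + ?B * (\<integral>\<^sup>+y. w2 y \<partial>boundary_measure \<Omega>))"
      unfolding I_def J_def
      by (intro mult_left_mono add_mono riesz_fubini[OF M.sigma_finite_measure_axioms p(2) sl il EM w1 Bb]
          riesz_fubini[OF M.sigma_finite_measure_axioms p(2) B.sigma_finite_measure_axioms q(2) EM w2 Bb] zero_le)
    also have "\<dots> = ennreal C0 * ?B * (grad_mass \<Omega> u G t + bdry_mass \<Omega> u t)"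
      by (simp only: grad_mass_def bdry_mass_def w1_def w2_def distrib_left mult.assoc)
    finally have main: "ennreal (t * m) \<le> ennreal C0 * ?B * (grad_mass \<Omega> u G t + bdry_mass \<Omega> u t)" .
    show "ennreal (t * measure M {x\<in>\<Omega>. 2 * t \<le> \<bar>u x\<bar>} powr ((real DIM('a) - 1) / \<alpha>)) \<le>
      ennreal (C0 * kc) * (grad_mass \<Omega> u G t + bdry_mass \<Omega> u t)"
    proof (cases "m = 0")
      case True
      then show ?thesis using \<theta> by (simp add: m_def E_def)
    next
      case False
      then have m0: "m > 0" using m by simp
      have pw: "m powr (\<theta> - 1) * m = m powr \<theta>" "m powr (\<theta> - 1) * m powr (1 - \<theta>) = 1"
        using m0 powr_add[of m "\<theta> - 1" 1] powr_add[of m "\<theta> - 1" "1 - \<theta>"] by simp_all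
      have "ennreal (m powr (\<theta> - 1)) * ennreal (t * m) \<le> ennreal (m powr (\<theta> - 1)) * (ennreal C0 * ?B * (grad_mass \<Omega> u G t + bdry_mass \<Omega> u t))"
        by (intro mult_left_mono main zero_le)
      also have "ennreal (m powr (\<theta> - 1)) * ennreal (t * m) = ennreal (t * m powr \<theta>)"
        using t m0 pw by (subst ennreal_mult[symmetric]) (auto simp: mult.left_commute)
      also have "ennreal (m powr (\<theta> - 1)) * (ennreal C0 * ?B * (grad_mass \<Omega> u G t + bdry_mass \<Omega> u t))
         = ennreal (m powr (\<theta> - 1) * (C0 * (kc * m powr (1 - \<theta>)))) * (grad_mass \<Omega> u G t + bdry_mass \<Omega> u t)"
        using C0 kc by (simp add: ennreal_mult mult.assoc)
      also have "m powr (\<theta> - 1) * (C0 * (kc * m powr (1 - \<theta>))) = C0 * kc"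
        using pw(2) by (simp add: mult.left_commute[of "m powr (\<theta> - 1)"] mult.assoc)
      finally show ?thesis by (simp add: m_def E_def \<theta>_def)
    qed
  qed
qed

section \<open>Dyadic summation\<close>

lemma dyadic_level_exists:
  fixes v a :: real
  assumes "2 * a \<le> v" "v < 2 * (a * 2 ^ N)"
  shows "\<exists>j<N. 2 * (a * 2 ^ j) \<le> v \<and> v < 4 * (a * 2 ^ j)"
  using assms(2)
proof (induction N)
  case 0
  then show ?case using assms by simp
next
  case (Suc N)
  show ?case
  proof (cases "v < 2 * (a * 2 ^ N)")
    case True
    then show ?thesis using Suc.IH less_SucI by blast
  next
    case False
    then show ?thesis using Suc.prems by (intro exI[of _ N]) auto
  qed
qed

text \<open>For s >= 1 successive powers at least double, so the sum is at most twice its largest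
  term, taken at the highest level below v.\<close>

lemma dyadic_powr_sum_below:
  fixes v a s :: real
  assumes a: "a > 0" and s: "s \<ge> 1"
  shows "(\<Sum>j<N. (a * 2 ^ j) powr s * indicator {a * 2 ^ j<..} v) \<le> 2 * \<bar>v\<bar> powr s"
proof -
  have tot: "(\<Sum>j<N. (a * 2 ^ j) powr s) \<le> (a * 2 ^ N) powr s" for N
  proof (induction N)
    case (Suc N)
    have "(2::real) powr 1 \<le> 2 powr s" using s by (intro powr_mono) auto
    then have "2 * (a * 2 ^ N) powr s \<le> 2 powr s * (a * 2 ^ N) powr s" by (intro mult_right_mono) auto
    also have "\<dots> = (a * 2 ^ Suc N) powr s" using a by (simp add: powr_mult[symmetric] algebra_simps)
    finally show ?case using Suc by simp
  qed simp
  show ?thesis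
  proof (induction N)
    case (Suc N)
    show ?case
    proof (cases "a * 2 ^ N < v")
      case True
      have "(\<Sum>j<Suc N. (a * 2 ^ j) powr s * indicator {a * 2 ^ j<..} v) \<le> (\<Sum>j<Suc N. (a * 2 ^ j) powr s)"
        by (intro sum_mono) (auto simp: indicator_def)
      also have "\<dots> \<le> 2 * (a * 2 ^ N) powr s" using tot[of N] by simp
      also have "(a * 2 ^ N) powr s \<le> \<bar>v\<bar> powr s" using True a s by (intro powr_mono2) auto
      finally show ?thesis by simp
    qed (use Suc in simp)
  qed simp
qed

text \<open>The shells are disjoint, so at most one term is nonzero. The induction is strengthened
  by the indicator of \<open>{..<a * 2 ^ N}\<close>: once v reaches the next shell, the earlier
  terms sum to 0.\<close>

lemma dyadic_powr_sum_shell: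
  fixes v a s :: real
  assumes a: "a > 0" and s: "s \<ge> 1"
  shows "(\<Sum>j<N. (a * 2 ^ j) powr (s - 1) * indicator {a * 2 ^ j<..<2 * (a * 2 ^ j)} v) \<le> \<bar>v\<bar> powr (s - 1)"
proof -
  have "(\<Sum>j<N. (a * 2 ^ j) powr (s - 1) * indicator {a * 2 ^ j<..<2 * (a * 2 ^ j)} v) \<le> \<bar>v\<bar> powr (s - 1) * indicator {..<a * 2 ^ N} v"
  proof (induction N)
    case 0
    then show ?case by simp
  next
    case (Suc N)
    define b where "b = a * 2 ^ N"
    have b: "b > 0" "a * 2 ^ Suc N = 2 * b" using a by (simp_all add: b_def)
    define S where "S = (\<Sum>j<N. (a * 2 ^ j) powr (s - 1) * indicator {a * 2 ^ j<..<2 * (a * 2 ^ j)} v)"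
    have IH: "S \<le> \<bar>v\<bar> powr (s - 1) * indicator {..<b} v" using Suc by (simp only: S_def b_def)
    have "S + b powr (s - 1) * indicator {b<..<2 * b} v \<le> \<bar>v\<bar> powr (s - 1) * indicator {..<2 * b} v"
    proof -
      consider "v < b" | "v = b" | "b < v" "v < 2 * b" | "2 * b \<le> v" by linarith
      then show ?thesis
      proof cases
        case 2
        then have "S \<le> 0" using IH by simp
        also have "0 \<le> \<bar>v\<bar> powr (s - 1)" by simp
        finally show ?thesis using 2 b by simp
      next
        case 3
        have "b powr (s - 1) \<le> \<bar>v\<bar> powr (s - 1)" using 3 b s by (intro powr_mono2) auto
        then show ?thesis using IH 3 by simp
      qed (use IH b in simp_all)
    qed
    then show ?case unfolding b(2) by (simp add: S_def b_def)
  qed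
  also have "\<dots> \<le> \<bar>v\<bar> powr (s - 1)" by (simp add: indicator_def)
  finally show ?thesis .
qed

text \<open>Each x_i^q is x_i times x_i^(q-1), and the second factor is at most the (q-1)-th power
  of the whole sum.\<close>

lemma sum_powr_le_powr_sum:
  fixes x :: "'i \<Rightarrow> real"
  assumes "finite I" "\<And>i. i \<in> I \<Longrightarrow> 0 \<le> x i" "q \<ge> 1"
  shows "(\<Sum>i\<in>I. x i powr q) \<le> (\<Sum>i\<in>I. x i) powr q"
proof -
  let ?S = "\<Sum>i\<in>I. x i"
  have "(\<Sum>i\<in>I. x i powr q) \<le> (\<Sum>i\<in>I. x i * ?S powr (q - 1))"
  proof (rule sum_mono)
    fix i assume i: "i \<in> I"
    show "x i powr q \<le> x i * ?S powr (q - 1)"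
    proof (cases "x i = 0")
      case False
      then have xi: "x i > 0" using assms(2)[OF i] by simp
      have "x i \<le> ?S" using assms i by (intro member_le_sum) auto
      then have "x i powr (q - 1) \<le> ?S powr (q - 1)" using assms xi by (intro powr_mono2) auto
      then have "x i * x i powr (q - 1) \<le> x i * ?S powr (q - 1)" using xi by (intro mult_left_mono) auto
      moreover have "x i * x i powr (q - 1) = x i powr q" using xi powr_add[of "x i" 1 "q - 1"] by simp
      ultimately show ?thesis by simp
    qed simp
  qed
  also have "\<dots> = ?S * ?S powr (q - 1)" by (simp add: sum_distrib_right)
  also have "\<dots> = ?S powr q"
  proof (cases "?S = 0")
    case False
    then have "?S > 0" using sum_nonneg[of I x] assms by (simp add: less_le)
    then show ?thesis using powr_add[of ?S 1 "q - 1"] by simp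
  qed simp
  finally show ?thesis .
qed

lemma Cb_closure_bounded:
  assumes "Cb_closure \<Omega> u"
  shows "\<exists>B>0. \<forall>x\<in>closure \<Omega>. \<bar>u x\<bar> \<le> B"
proof -
  have cu: "continuous_on (closure \<Omega>) u" and bu: "bounded {x\<in>closure \<Omega>. u x \<noteq> 0}"
    using assms by (auto simp: Cb_closure_def)
  obtain R where R: "\<And>x. x \<in> closure \<Omega> \<Longrightarrow> u x \<noteq> 0 \<Longrightarrow> norm x \<le> R"
    using bu by (auto simp: bounded_iff)
  have "compact (closure \<Omega> \<inter> cball 0 R)" by (intro closed_Int_compact) auto
  then have "bounded (u ` (closure \<Omega> \<inter> cball 0 R))"
    by (intro compact_imp_bounded compact_continuous_image continuous_on_subset[OF cu]) auto
  then obtain B where "\<forall>y\<in>u ` (closure \<Omega> \<inter> cball 0 R). norm y \<le> B" unfolding bounded_iff by blast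
  then have B: "\<And>x. x \<in> closure \<Omega> \<Longrightarrow> norm x \<le> R \<Longrightarrow> \<bar>u x\<bar> \<le> B" by auto
  have "\<bar>u x\<bar> \<le> max B 1" if "x \<in> closure \<Omega>" for x
    using R[OF that] B[OF that] by (cases "u x = 0") auto
  then show ?thesis by (intro exI[of _ "max B 1"]) auto
qed

section \<open>The critical Sobolev inequality\<close>

lemma nn_integral_weighted_indicators:
  assumes "A \<in> sets M" "\<And>j. E j \<in> sets M"
  shows "(\<integral>\<^sup>+x. w * indicator A x + (\<Sum>j\<in>I. b j * indicator (E j) x) \<partial>M) = w * emeasure M A + (\<Sum>j\<in>I. b j * emeasure M (E j))"
proof -
  have m: "(\<lambda>x. w * indicator A x) \<in> borel_measurable M" "\<And>j. (\<lambda>x. b j * indicator (E j) x) \<in> borel_measurable M"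
    using assms by auto
  have "(\<integral>\<^sup>+x. w * indicator A x + (\<Sum>j\<in>I. b j * indicator (E j) x) \<partial>M)
    = (\<integral>\<^sup>+x. w * indicator A x \<partial>M) + (\<Sum>j\<in>I. \<integral>\<^sup>+x. b j * indicator (E j) x \<partial>M)"
    using m by (subst nn_integral_add) (auto intro!: nn_integral_sum arg_cong2[where f = "(+)"])
  then show ?thesis using assms by (simp only: nn_integral_cmult_indicator)
qed

text \<open>Values below 2 a are estimated crudely by the measure of \<Omega>; a small choice of a
  makes them negligible later, so finitely many levels suffice.\<close>

lemma nn_integral_dyadic_le:
  fixes \<Omega> :: "'a::euclidean_space set"
  assumes \<Omega>: "open \<Omega>" and M: "admissible_measure \<Omega> M \<alpha> c" and u: "u \<in> borel_measurable borel"
    and B: "\<And>x. x \<in> \<Omega> \<Longrightarrow> \<bar>u x\<bar> < 2 * (a * 2 ^ N)" and a: "a > 0" and q: "q > 0"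
  shows "(\<integral>\<^sup>+x. ennreal (\<bar>u x\<bar> powr q) \<partial>M) \<le>
    ennreal ((2 * a) powr q * measure M \<Omega> + (\<Sum>j<N. (4 * (a * 2 ^ j)) powr q * measure M {x\<in>\<Omega>. 2 * (a * 2 ^ j) \<le> \<bar>u x\<bar>}))"
proof -
  note p = admissible_measure_properties[OF \<Omega> M]
  interpret M: finite_measure M by (rule p)
  define E where "E t = {x\<in>\<Omega>. 2 * t \<le> \<bar>u x\<bar>}" for t
  have EM: "E t \<in> sets M" for t
  proof -
    have [measurable]: "\<Omega> \<in> sets borel" "u \<in> borel_measurable borel" using \<Omega> u by auto
    have "{x \<in> space borel. x \<in> \<Omega> \<and> 2 * t \<le> \<bar>u x\<bar>} \<in> sets borel" by measurable
    then show ?thesis by (intro p(4)) (auto simp: E_def)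
  qed
  have OM: "\<Omega> \<in> sets M" using p(3) sets.top[of M] by simp
  have "(\<integral>\<^sup>+x. ennreal (\<bar>u x\<bar> powr q) \<partial>M) \<le>
    (\<integral>\<^sup>+x. ennreal ((2 * a) powr q) * indicator \<Omega> x + (\<Sum>j<N. ennreal ((4 * (a * 2 ^ j)) powr q) * indicator (E (a * 2 ^ j)) x) \<partial>M)"
  proof (rule nn_integral_mono)
    fix x assume "x \<in> space M"
    then have x: "x \<in> \<Omega>" using p(3) by simp
    show "ennreal (\<bar>u x\<bar> powr q) \<le> ennreal ((2 * a) powr q) * indicator \<Omega> x + (\<Sum>j<N. ennreal ((4 * (a * 2 ^ j)) powr q) * indicator (E (a * 2 ^ j)) x)"
    proof (cases "\<bar>u x\<bar> < 2 * a")
      case True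
      then have "ennreal (\<bar>u x\<bar> powr q) \<le> ennreal ((2 * a) powr q)" using q by (intro ennreal_leI powr_mono2) auto
      then show ?thesis using x by (simp add: add_increasing2)
    next
      case False
      then obtain j where j: "j < N" "2 * (a * 2 ^ j) \<le> \<bar>u x\<bar>" "\<bar>u x\<bar> < 4 * (a * 2 ^ j)"
        using dyadic_level_exists[of a "\<bar>u x\<bar>" N] B[OF x] by auto
      have "ennreal (\<bar>u x\<bar> powr q) \<le> ennreal ((4 * (a * 2 ^ j)) powr q) * indicator (E (a * 2 ^ j)) x"
        using j x q by (auto simp: E_def intro!: ennreal_leI powr_mono2)
      also have "\<dots> \<le> (\<Sum>j<N. ennreal ((4 * (a * 2 ^ j)) powr q) * indicator (E (a * 2 ^ j)) x)"
        using j by (intro member_le_sum) auto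
      finally show ?thesis by (simp add: add_increasing)
    qed
  qed
  also have "\<dots> = ennreal ((2 * a) powr q) * ennreal (measure M \<Omega>) + (\<Sum>j<N. ennreal ((4 * (a * 2 ^ j)) powr q) * ennreal (measure M (E (a * 2 ^ j))))"
    unfolding M.emeasure_eq_measure[symmetric] by (rule nn_integral_weighted_indicators[OF OM EM])
  also have "\<dots> = ennreal ((2 * a) powr q * measure M \<Omega> + (\<Sum>j<N. (4 * (a * 2 ^ j)) powr q * measure M (E (a * 2 ^ j))))"
    by (simp add: ennreal_mult[symmetric] sum_ennreal sum_nonneg)
  finally show ?thesis by (simp add: E_def)
qed

lemma small_scale_exists:
  fixes B q m e :: real
  assumes "q > 0" "m \<ge> 0" "e > 0"
  shows "\<exists>a>0. (2 * a) powr q * m \<le> e \<and> (\<exists>N. B < 2 * (a * 2 ^ N))"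
proof -
  define a where "a = (e / (m + 1)) powr (1 / q) / 2"
  have a: "a > 0" using assms by (simp add: a_def)
  have "(2 * a) powr q = e / (m + 1)" using assms by (simp add: a_def powr_powr)
  moreover have "e / (m + 1) * m \<le> e" using assms by (simp add: divide_le_eq distrib_left)
  ultimately have "(2 * a) powr q * m \<le> e" by simp
  moreover obtain N where "B / (2 * a) < 2 ^ N" using real_arch_pow[of 2 "B / (2 * a)"] by auto
  then have "B < 2 * (a * 2 ^ N)" using a by (simp add: field_simps)
  ultimately show ?thesis using a by blast
qed

text \<open>Unlike the gradient shells, the sets where |u| > t are nested, so every level below |u
  y| contributes; the geometric sum costs only a factor 2.\<close>

lemma bdry_mass_dyadic_sum:
  fixes \<Omega> :: "'a::euclidean_space set"
  assumes sd: "standing_domain \<Omega>" and u: "u \<in> borel_measurable borel" and a: "a > 0" and s: "s \<ge> 1"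
  shows "(\<Sum>j<N. ennreal ((a * 2 ^ j) powr (s - 1)) * bdry_mass \<Omega> u (a * 2 ^ j)) \<le> ennreal 2 * (\<integral>\<^sup>+y. ennreal (\<bar>u y\<bar> powr s) \<partial>boundary_measure \<Omega>)"
proof -
  note q = boundary_measure_properties[OF sd]
  have um: "u \<in> borel_measurable (boundary_measure \<Omega>)" using u by (rule measurable_compose[OF q(2)])
  have "(\<Sum>j<N. ennreal ((a * 2 ^ j) powr (s - 1)) * bdry_mass \<Omega> u (a * 2 ^ j))
     = (\<integral>\<^sup>+y. (\<Sum>j<N. ennreal ((a * 2 ^ j) powr (s - 1)) * ennreal (a * 2 ^ j * indicator {a * 2 ^ j<..} \<bar>u y\<bar>)) \<partial>boundary_measure \<Omega>)"
    using um unfolding bdry_mass_def by (simp add: nn_integral_sum nn_integral_cmult)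
  also have "\<dots> \<le> (\<integral>\<^sup>+y. ennreal 2 * ennreal (\<bar>u y\<bar> powr s) \<partial>boundary_measure \<Omega>)"
  proof (rule nn_integral_mono)
    fix y
    have "(\<Sum>j<N. ennreal ((a * 2 ^ j) powr (s - 1)) * ennreal (a * 2 ^ j * indicator {a * 2 ^ j<..} \<bar>u y\<bar>))
       = (\<Sum>j<N. ennreal ((a * 2 ^ j) powr s * indicator {a * 2 ^ j<..} \<bar>u y\<bar>))"
    proof (rule sum.cong[OF refl])
      fix j
      have "(a * 2 ^ j) powr (s - 1) * (a * 2 ^ j) = (a * 2 ^ j) powr s" using a powr_add[of "a * 2 ^ j" "s - 1" 1] by simp
      then show "ennreal ((a * 2 ^ j) powr (s - 1)) * ennreal (a * 2 ^ j * indicator {a * 2 ^ j<..} \<bar>u y\<bar>)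
        = ennreal ((a * 2 ^ j) powr s * indicator {a * 2 ^ j<..} \<bar>u y\<bar>)"
        using a by (subst ennreal_mult[symmetric]) (auto simp: mult.assoc[symmetric])
    qed
    also have "\<dots> = ennreal (\<Sum>j<N. (a * 2 ^ j) powr s * indicator {a * 2 ^ j<..} \<bar>u y\<bar>)" by (rule sum_ennreal) simp
    also have "\<dots> \<le> ennreal (2 * \<bar>\<bar>u y\<bar>\<bar> powr s)" by (intro ennreal_leI dyadic_powr_sum_below a s)
    also have "\<dots> = ennreal 2 * ennreal (\<bar>u y\<bar> powr s)" by (subst ennreal_mult[symmetric]) auto
    finally show "(\<Sum>j<N. ennreal ((a * 2 ^ j) powr (s - 1)) * ennreal (a * 2 ^ j * indicator {a * 2 ^ j<..} \<bar>u y\<bar>)) \<le> \<dots>" .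
  qed
  also have "\<dots> = ennreal 2 * (\<integral>\<^sup>+y. ennreal (\<bar>u y\<bar> powr s) \<partial>boundary_measure \<Omega>)"
    using um by (intro nn_integral_cmult) simp
  finally show ?thesis .
qed

text \<open>At most one shell contains |u y|, and there the weight t^(s-1) is at most |u
  y|^(s-1).\<close>

lemma grad_mass_dyadic_sum:
  fixes \<Omega> :: "'a::euclidean_space set"
  assumes [measurable]: "\<Omega> \<in> sets borel" "u \<in> borel_measurable borel" "G \<in> borel_measurable borel"
    and a: "a > 0" and s: "s \<ge> 1"
  shows "(\<Sum>j<N. ennreal ((a * 2 ^ j) powr (s - 1)) * grad_mass \<Omega> u G (a * 2 ^ j)) \<le> (\<integral>\<^sup>+y. ennreal (indicator \<Omega> y * \<bar>u y\<bar> powr (s - 1) * norm (G y)) \<partial>lborel)"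
proof -
  have "(\<Sum>j<N. ennreal ((a * 2 ^ j) powr (s - 1)) * grad_mass \<Omega> u G (a * 2 ^ j))
     = (\<integral>\<^sup>+y. (\<Sum>j<N. ennreal ((a * 2 ^ j) powr (s - 1)) * ennreal (indicator \<Omega> y * indicator {a * 2 ^ j<..<2 * (a * 2 ^ j)} \<bar>u y\<bar> * norm (G y))) \<partial>lborel)"
    unfolding grad_mass_def by (simp add: nn_integral_sum nn_integral_cmult)
  also have "\<dots> \<le> (\<integral>\<^sup>+y. ennreal (indicator \<Omega> y * \<bar>u y\<bar> powr (s - 1) * norm (G y)) \<partial>lborel)"
  proof (rule nn_integral_mono)
    fix y
    have "(\<Sum>j<N. ennreal ((a * 2 ^ j) powr (s - 1)) * ennreal (indicator \<Omega> y * indicator {a * 2 ^ j<..<2 * (a * 2 ^ j)} \<bar>u y\<bar> * norm (G y)))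
       = (\<Sum>j<N. ennreal ((indicator \<Omega> y * norm (G y)) * ((a * 2 ^ j) powr (s - 1) * indicator {a * 2 ^ j<..<2 * (a * 2 ^ j)} \<bar>u y\<bar>)))"
      by (intro sum.cong refl, subst ennreal_mult[symmetric]) (auto simp: mult_ac)
    also have "\<dots> = ennreal (\<Sum>j<N. (indicator \<Omega> y * norm (G y)) * ((a * 2 ^ j) powr (s - 1) * indicator {a * 2 ^ j<..<2 * (a * 2 ^ j)} \<bar>u y\<bar>))"
      by (rule sum_ennreal) simp
    also have "\<dots> \<le> ennreal ((indicator \<Omega> y * norm (G y)) * \<bar>\<bar>u y\<bar>\<bar> powr (s - 1))"
      unfolding sum_distrib_left[symmetric] by (intro ennreal_leI mult_left_mono dyadic_powr_sum_shell a s) auto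
    also have "(indicator \<Omega> y * norm (G y)) * \<bar>\<bar>u y\<bar>\<bar> powr (s - 1) = indicator \<Omega> y * \<bar>u y\<bar> powr (s - 1) * norm (G y)" by simp
    finally show "(\<Sum>j<N. ennreal ((a * 2 ^ j) powr (s - 1)) * ennreal (indicator \<Omega> y * indicator {a * 2 ^ j<..<2 * (a * 2 ^ j)} \<bar>u y\<bar> * norm (G y)))
      \<le> ennreal (indicator \<Omega> y * \<bar>u y\<bar> powr (s - 1) * norm (G y))" .
  qed
  finally show ?thesis .
qed

text \<open>Maz'ya truncation. The weak estimates at dyadic levels t_j, weighted by t_j^(s-1), bound
  the sum of x_j = t_j^s \<mu>(|u| >= 2 t_j)^(1/q), where q = \<alpha>/(n-1). As q >= 1, the sum of
  x_j^q, which controls the integral of |u|^(s q), is at most the q-th power of that sum.\<close>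

lemma strong_type_estimate:
  assumes dim: "DIM('a::euclidean_space) \<ge> 2" and \<alpha>: "real DIM('a) - 1 < \<alpha>" and c: "c > 0" and s: "s \<ge> 1"
  shows "\<exists>C>0. \<forall>(\<Omega>::'a set) M u G S. regular_pair \<Omega> u G \<and> admissible_measure \<Omega> M \<alpha> c \<and> S \<ge> 0 \<and>
    (\<integral>\<^sup>+y. ennreal (indicator \<Omega> y * \<bar>u y\<bar> powr (s - 1) * norm (G y)) \<partial>lborel)
      + (\<integral>\<^sup>+y. ennreal (\<bar>u y\<bar> powr s) \<partial>boundary_measure \<Omega>) \<le> ennreal S \<longrightarrow>
    (\<integral>\<^sup>+x. ennreal (\<bar>u x\<bar> powr (s * (\<alpha> / (real DIM('a) - 1)))) \<partial>M) \<le> ennreal (C * S powr (\<alpha> / (real DIM('a) - 1)))"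
proof -
  obtain C0 where C0: "C0 > 0" and weak: "\<And>(\<Omega>::'a set) M u G t. regular_pair \<Omega> u G \<and> admissible_measure \<Omega> M \<alpha> c \<and> t > 0 \<Longrightarrow>
    ennreal (t * measure M {x\<in>\<Omega>. 2 * t \<le> \<bar>u x\<bar>} powr ((real DIM('a) - 1) / \<alpha>)) \<le>
      ennreal C0 * (grad_mass \<Omega> u G t + bdry_mass \<Omega> u t)"
    using weak_type_estimate[OF dim \<alpha> c] by blast
  define q where "q = \<alpha> / (real DIM('a) - 1)"
  have q: "q > 1" using \<alpha> dim by (simp add: q_def)
  have \<theta>: "(real DIM('a) - 1) / \<alpha> = 1 / q" by (simp add: q_def)
  define C where "C = 4 powr (s * q) * (2 * C0) powr q"
  show ?thesis
  proof (intro exI[of _ C] conjI allI impI)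
    show "C > 0" using C0 by (simp add: C_def)
    fix \<Omega> :: "'a set" and M u and G :: "'a \<Rightarrow> 'a" and S :: real
    let ?A = "\<integral>\<^sup>+y. ennreal (indicator \<Omega> y * \<bar>u y\<bar> powr (s - 1) * norm (G y)) \<partial>lborel"
    let ?D = "\<integral>\<^sup>+y. ennreal (\<bar>u y\<bar> powr s) \<partial>boundary_measure \<Omega>"
    assume as: "regular_pair \<Omega> u G \<and> admissible_measure \<Omega> M \<alpha> c \<and> S \<ge> 0 \<and> ?A + ?D \<le> ennreal S"
    then have rp: "regular_pair \<Omega> u G" and M: "admissible_measure \<Omega> M \<alpha> c" and S: "S \<ge> 0" "?A + ?D \<le> ennreal S"
      and sd: "standing_domain \<Omega>" and cb: "Cb_closure \<Omega> u" and \<Omega>: "open \<Omega>"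
      and m: "\<Omega> \<in> sets borel" "u \<in> borel_measurable borel" "G \<in> borel_measurable borel"
      by (auto simp: regular_pair_def standing_domain_def)
    obtain B where B: "\<And>x. x \<in> closure \<Omega> \<Longrightarrow> \<bar>u x\<bar> \<le> B" using Cb_closure_bounded[OF cb] by blast
    have "(\<integral>\<^sup>+x. ennreal (\<bar>u x\<bar> powr (s * q)) \<partial>M) \<le> ennreal (C * S powr q)"
    proof (rule ennreal_le_epsilon)
      fix e :: real assume e: "e > 0"
      \<comment> \<open>The levels start at a, so small that values below 2 a contribute at most e,
        and end above the supremum of |u|.\<close>
      obtain a N where a: "a > 0" "(2 * a) powr (s * q) * measure M \<Omega> \<le> e" "B < 2 * (a * 2 ^ N)"
        using small_scale_exists[of "s * q" "measure M \<Omega>" e B] s q e by auto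
      define x where "x j = (a * 2 ^ j) powr s * measure M {x\<in>\<Omega>. 2 * (a * 2 ^ j) \<le> \<bar>u x\<bar>} powr (1 / q)" for j :: nat
      have x0: "x j \<ge> 0" for j by (simp add: x_def)
      have "ennreal (\<Sum>j<N. x j) = (\<Sum>j<N. ennreal (x j))" by (rule sum_ennreal[symmetric]) (rule x0)
      also have "\<dots> \<le> (\<Sum>j<N. ennreal ((a * 2 ^ j) powr (s - 1)) * (ennreal C0 * (grad_mass \<Omega> u G (a * 2 ^ j) + bdry_mass \<Omega> u (a * 2 ^ j))))"
      proof (rule sum_mono)
        fix j
        have t: "a * 2 ^ j > 0" using a by simp
        have "(a * 2 ^ j) powr s = (a * 2 ^ j) powr (s - 1) * (a * 2 ^ j)" using t powr_add[of "a * 2 ^ j" "s - 1" 1] by simp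
        then have "ennreal (x j) = ennreal ((a * 2 ^ j) powr (s - 1)) * ennreal (a * 2 ^ j * measure M {x\<in>\<Omega>. 2 * (a * 2 ^ j) \<le> \<bar>u x\<bar>} powr (1 / q))"
          using t by (subst ennreal_mult[symmetric]) (auto simp: x_def)
        also have "\<dots> \<le> ennreal ((a * 2 ^ j) powr (s - 1)) * (ennreal C0 * (grad_mass \<Omega> u G (a * 2 ^ j) + bdry_mass \<Omega> u (a * 2 ^ j)))"
          using weak[of \<Omega> u G M "a * 2 ^ j"] rp M t unfolding \<theta> by (intro mult_left_mono) auto
        finally show "ennreal (x j) \<le> \<dots>" .
      qed
      also have "\<dots> = ennreal C0 * ((\<Sum>j<N. ennreal ((a * 2 ^ j) powr (s - 1)) * grad_mass \<Omega> u G (a * 2 ^ j))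
          + (\<Sum>j<N. ennreal ((a * 2 ^ j) powr (s - 1)) * bdry_mass \<Omega> u (a * 2 ^ j)))"
        by (simp only: sum.distrib[symmetric] sum_distrib_left distrib_left mult.left_commute[of "ennreal C0"])
      also have "\<dots> \<le> ennreal C0 * (ennreal 2 * ?A + ennreal 2 * ?D)"
      proof (intro mult_left_mono add_mono bdry_mass_dyadic_sum sd m a s zero_le)
        have "?A = 1 * ?A" by simp
        also have "\<dots> \<le> ennreal 2 * ?A" by (intro mult_right_mono) auto
        finally show "(\<Sum>j<N. ennreal ((a * 2 ^ j) powr (s - 1)) * grad_mass \<Omega> u G (a * 2 ^ j)) \<le> ennreal 2 * ?A"
          using grad_mass_dyadic_sum[OF m a(1) s, of N] by (rule order_trans[rotated])
      qed
      also have "\<dots> = ennreal C0 * (ennreal 2 * (?A + ?D))" by (simp only: distrib_left)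
      also have "\<dots> \<le> ennreal C0 * (ennreal 2 * ennreal S)" by (intro mult_left_mono S zero_le)
      also have "\<dots> = ennreal (2 * C0 * S)" using C0 S by (simp add: ennreal_mult mult_ac)
      finally have sx: "(\<Sum>j<N. x j) \<le> 2 * C0 * S" using C0 S by (subst (asm) ennreal_le_iff) auto
      have "(\<integral>\<^sup>+x. ennreal (\<bar>u x\<bar> powr (s * q)) \<partial>M) \<le>
        ennreal ((2 * a) powr (s * q) * measure M \<Omega> + (\<Sum>j<N. (4 * (a * 2 ^ j)) powr (s * q) * measure M {x\<in>\<Omega>. 2 * (a * 2 ^ j) \<le> \<bar>u x\<bar>}))"
      proof (rule nn_integral_dyadic_le[OF \<Omega> M m(2) _ a(1)])
        show "\<bar>u x\<bar> < 2 * (a * 2 ^ N)" if "x \<in> \<Omega>" for x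
          using B[of x] that closure_subset[of \<Omega>] a(3) by auto
      qed (use s q in simp)
      also have "\<dots> \<le> ennreal (e + C * S powr q)"
      proof (intro ennreal_leI add_mono a)
        have "(\<Sum>j<N. (4 * (a * 2 ^ j)) powr (s * q) * measure M {x\<in>\<Omega>. 2 * (a * 2 ^ j) \<le> \<bar>u x\<bar>}) = (\<Sum>j<N. 4 powr (s * q) * x j powr q)"
          using a q by (intro sum.cong refl) (simp add: x_def powr_mult powr_powr)
        also have "\<dots> \<le> 4 powr (s * q) * (\<Sum>j<N. x j) powr q"
          unfolding sum_distrib_left[symmetric] using x0 q by (intro mult_left_mono sum_powr_le_powr_sum) auto
        also have "\<dots> \<le> 4 powr (s * q) * (2 * C0 * S) powr q"
          using sx q x0 by (intro mult_left_mono powr_mono2 sum_nonneg) auto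
        also have "\<dots> = C * S powr q" using C0 S by (simp add: C_def powr_mult)
        finally show "(\<Sum>j<N. (4 * (a * 2 ^ j)) powr (s * q) * measure M {x\<in>\<Omega>. 2 * (a * 2 ^ j) \<le> \<bar>u x\<bar>}) \<le> C * S powr q" .
      qed
      also have "\<dots> = ennreal (C * S powr q) + ennreal e"
        using e C0 by (subst ennreal_plus[symmetric]) (auto simp: C_def add.commute)
      finally show "(\<integral>\<^sup>+x. ennreal (\<bar>u x\<bar> powr (s * q)) \<partial>M) \<le> ennreal (C * S powr q) + ennreal e" .
    qed
    then show "(\<integral>\<^sup>+x. ennreal (\<bar>u x\<bar> powr (s * (\<alpha> / (real DIM('a) - 1)))) \<partial>M) \<le> ennreal (C * S powr (\<alpha> / (real DIM('a) - 1)))"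
      by (simp only: q_def)
  qed
qed

text \<open>Lets the strong estimate be used for Lebesgue measure, with \<alpha> = n.\<close>

lemma lebesgue_admissible:
  fixes \<Omega> :: "'a::euclidean_space set"
  assumes "standing_domain \<Omega>"
  shows "admissible_measure \<Omega> (restrict_space lborel \<Omega>) (real DIM('a)) (unit_ball_vol (real DIM('a)))"
proof -
  have \<Omega>: "open \<Omega>" "emeasure lebesgue \<Omega> < top" using assms by (auto simp: standing_domain_def)
  then have [measurable]: "\<Omega> \<in> sets borel" by auto
  have e: "emeasure (restrict_space lborel \<Omega>) A = emeasure lborel A" if "A \<in> sets borel" "A \<subseteq> \<Omega>" for A
    using that by (subst emeasure_restrict_space) auto
  show ?thesis
    unfolding admissible_measure_def
  proof (intro conjI ballI allI impI)
    show "sets (restrict_space lborel \<Omega>) = sets (restrict_space borel \<Omega>)" by (rule sets_restrict_space_cong) simp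
    show "emeasure (restrict_space lborel \<Omega>) \<Omega> < top" using \<Omega> by (simp add: e)
    fix x and \<rho> :: real assume \<rho>: "0 < \<rho>"
    have "emeasure (restrict_space lborel \<Omega>) (ball x \<rho> \<inter> \<Omega>) = emeasure lborel (ball x \<rho> \<inter> \<Omega>)" by (rule e) auto
    also have "\<dots> \<le> emeasure lborel (ball x \<rho>)" by (rule emeasure_mono) auto
    also have "\<dots> = ennreal (unit_ball_vol (real DIM('a)) * \<rho> powr real DIM('a))"
      using emeasure_ball[of \<rho> x] \<rho> by (simp add: powr_realpow)
    finally show "emeasure (restrict_space lborel \<Omega>) (ball x \<rho> \<inter> \<Omega>) \<le> \<dots>" .
  qed
qed

text \<open>For Lebesgue measure the strong estimate controls the exponent \<sigma> = p n/(n-p), and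
  s satisfies \<sigma> (1 - 1/p) = s - 1. Hoelder therefore bounds the weighted gradient term by
  x^(s-1) g with x the L^\<sigma> norm of u, and absorption gives x <= K (g + y). The strong
  estimate for \<mu>, with this bound inserted, then has the right-hand side wanted.\<close>

lemma critical_estimate:
  assumes dim: "DIM('a::euclidean_space) \<ge> 2" and \<alpha>: "real DIM('a) - 1 < \<alpha>" and c: "c > 0"
    and p: "1 < p" "p < real DIM('a)"
  defines "s \<equiv> p * (real DIM('a) - 1) / (real DIM('a) - p)" and "q \<equiv> p * \<alpha> / (real DIM('a) - p)"
  shows "\<exists>C>0. \<forall>(\<Omega>::'a set) M u G g y. regular_pair \<Omega> u G \<and> admissible_measure \<Omega> M \<alpha> c \<and> g \<ge> 0 \<and> y \<ge> 0 \<and>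
    (\<integral>\<^sup>+x. ennreal (indicator \<Omega> x * norm (G x) powr p) \<partial>lborel) \<le> ennreal (g powr p) \<and>
    (\<integral>\<^sup>+x. ennreal (\<bar>u x\<bar> powr s) \<partial>boundary_measure \<Omega>) \<le> ennreal (y powr s) \<longrightarrow>
    (\<integral>\<^sup>+x. ennreal (\<bar>u x\<bar> powr q) \<partial>M) \<le> ennreal ((C * (g + y)) powr q)"
proof -
  let ?n = "real DIM('a)"
  have n: "?n \<ge> 2" using dim by simp
  have "?n - p < p * (?n - 1)" using p n by (simp add: algebra_simps)
  then have s: "s > 1" using p by (simp add: s_def less_divide_eq)
  define \<sigma> where "\<sigma> = s * (?n / (?n - 1))"
  have \<sigma>: "\<sigma> > 0" using s n by (simp add: \<sigma>_def)
  have \<sigma>p: "\<sigma> * (1 - 1 / p) = s - 1"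
  proof -
    have "\<sigma> = p * ?n / (?n - p)" using n by (simp add: \<sigma>_def s_def)
    moreover have "s - 1 = (p * (?n - 1) - (?n - p)) / (?n - p)" using p by (simp add: s_def diff_divide_distrib)
    moreover have "p * ?n / (?n - p) * (1 - 1 / p) = (p * ?n - ?n) / (?n - p)" using p by (simp add: right_diff_distrib diff_divide_distrib)
    ultimately show ?thesis by (simp add: algebra_simps)
  qed
  have \<sigma>n: "\<sigma> * ((?n - 1) / ?n) = s" using n by (simp add: \<sigma>_def)
  have qs: "q = s * (\<alpha> / (?n - 1))" using n by (simp add: q_def s_def)
  have q: "q > 0" using s \<alpha> n by (simp add: qs)
  obtain C1 where C1: "C1 > 0" and st1: "\<And>(\<Omega>::'a set) M u G S. regular_pair \<Omega> u G \<and> admissible_measure \<Omega> M ?n (unit_ball_vol ?n) \<and> S \<ge> 0 \<and>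
    (\<integral>\<^sup>+y. ennreal (indicator \<Omega> y * \<bar>u y\<bar> powr (s - 1) * norm (G y)) \<partial>lborel)
      + (\<integral>\<^sup>+y. ennreal (\<bar>u y\<bar> powr s) \<partial>boundary_measure \<Omega>) \<le> ennreal S \<Longrightarrow>
    (\<integral>\<^sup>+x. ennreal (\<bar>u x\<bar> powr (s * (?n / (?n - 1)))) \<partial>M) \<le> ennreal (C1 * S powr (?n / (?n - 1)))"
    using strong_type_estimate[OF dim, of ?n "unit_ball_vol ?n" s] s by auto
  obtain C3 where C3: "C3 > 0" and st3: "\<And>(\<Omega>::'a set) M u G S. regular_pair \<Omega> u G \<and> admissible_measure \<Omega> M \<alpha> c \<and> S \<ge> 0 \<and>
    (\<integral>\<^sup>+y. ennreal (indicator \<Omega> y * \<bar>u y\<bar> powr (s - 1) * norm (G y)) \<partial>lborel)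
      + (\<integral>\<^sup>+y. ennreal (\<bar>u y\<bar> powr s) \<partial>boundary_measure \<Omega>) \<le> ennreal S \<Longrightarrow>
    (\<integral>\<^sup>+x. ennreal (\<bar>u x\<bar> powr (s * (\<alpha> / (?n - 1)))) \<partial>M) \<le> ennreal (C3 * S powr (\<alpha> / (?n - 1)))"
    using strong_type_estimate[OF dim \<alpha> c, of s] s by auto
  define K where "K = max 1 (C1 powr ((?n - 1) / ?n))"
  have K: "K \<ge> 1" by (simp add: K_def)
  define C where "C = (C3 * (K powr (s - 1)) powr (\<alpha> / (?n - 1))) powr (1 / q)"
  show ?thesis
  proof (intro exI[of _ C] conjI allI impI)
    show "C > 0" using C3 K by (simp add: C_def)
    fix \<Omega> :: "'a set" and M u G and g y :: real
    assume as: "regular_pair \<Omega> u G \<and> admissible_measure \<Omega> M \<alpha> c \<and> g \<ge> 0 \<and> y \<ge> 0 \<and>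
      (\<integral>\<^sup>+x. ennreal (indicator \<Omega> x * norm (G x) powr p) \<partial>lborel) \<le> ennreal (g powr p) \<and>
      (\<integral>\<^sup>+x. ennreal (\<bar>u x\<bar> powr s) \<partial>boundary_measure \<Omega>) \<le> ennreal (y powr s)"
    then have rp: "regular_pair \<Omega> u G" and M: "admissible_measure \<Omega> M \<alpha> c" and g: "g \<ge> 0" and y: "y \<ge> 0"
      and gi: "(\<integral>\<^sup>+x. ennreal (indicator \<Omega> x * norm (G x) powr p) \<partial>lborel) \<le> ennreal (g powr p)"
      and yi: "(\<integral>\<^sup>+x. ennreal (\<bar>u x\<bar> powr s) \<partial>boundary_measure \<Omega>) \<le> ennreal (y powr s)"
      and sd: "standing_domain \<Omega>" and cb: "Cb_closure \<Omega> u" and \<Omega>: "open \<Omega>" "emeasure lebesgue \<Omega> < top"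
      and [measurable]: "\<Omega> \<in> sets borel" "u \<in> borel_measurable borel" "G \<in> borel_measurable borel"
      by (auto simp: regular_pair_def standing_domain_def)
    let ?M0 = "restrict_space lborel \<Omega>"
    let ?A = "\<integral>\<^sup>+y. ennreal (indicator \<Omega> y * \<bar>u y\<bar> powr (s - 1) * norm (G y)) \<partial>lborel"
    let ?D = "\<integral>\<^sup>+y. ennreal (\<bar>u y\<bar> powr s) \<partial>boundary_measure \<Omega>"
    have M0: "admissible_measure \<Omega> ?M0 ?n (unit_ball_vol ?n)" by (rule lebesgue_admissible[OF sd])
    have X_eq: "(\<integral>\<^sup>+x. ennreal (\<bar>u x\<bar> powr \<sigma>) \<partial>?M0) = (\<integral>\<^sup>+x. ennreal (indicator \<Omega> x * \<bar>u x\<bar> powr \<sigma>) \<partial>lborel)"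
      by (subst nn_integral_restrict_space) (auto intro!: nn_integral_cong simp: indicator_def)
    \<comment> \<open>Absorption needs the L^\<sigma> norm to be finite beforehand. Boundedness of u
      and the finite measure of \<Omega> give this; the bound B enters no constant.\<close>
    obtain B where B: "\<And>x. x \<in> closure \<Omega> \<Longrightarrow> \<bar>u x\<bar> \<le> B" using Cb_closure_bounded[OF cb] by blast
    have "(\<integral>\<^sup>+x. ennreal (indicator \<Omega> x * \<bar>u x\<bar> powr \<sigma>) \<partial>lborel) \<le> (\<integral>\<^sup>+x. ennreal (B powr \<sigma>) * indicator \<Omega> x \<partial>lborel)"
    proof (rule nn_integral_mono)
      fix x
      show "ennreal (indicator \<Omega> x * \<bar>u x\<bar> powr \<sigma>) \<le> ennreal (B powr \<sigma>) * indicator \<Omega> x"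
        using B[of x] closure_subset[of \<Omega>] \<sigma> by (auto simp: indicator_def intro!: ennreal_leI powr_mono2)
    qed
    also have "\<dots> = ennreal (B powr \<sigma>) * emeasure lborel \<Omega>" by (simp add: nn_integral_cmult_indicator)
    also have "\<dots> < top" using \<Omega> by (simp add: ennreal_mult_less_top)
    finally obtain X where X: "X \<ge> 0" "(\<integral>\<^sup>+x. ennreal (indicator \<Omega> x * \<bar>u x\<bar> powr \<sigma>) \<partial>lborel) = ennreal X"
      by (cases "\<integral>\<^sup>+x. ennreal (indicator \<Omega> x * \<bar>u x\<bar> powr \<sigma>) \<partial>lborel") auto
    define x where "x = X powr (1 / \<sigma>)"
    have x0: "x \<ge> 0" by (simp add: x_def)
    have Xx: "X = x powr \<sigma>" using X \<sigma> by (simp add: x_def powr_powr)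
    define S where "S = x powr (s - 1) * g + y powr s"
    have S0: "S \<ge> 0" using g by (simp add: S_def)
    have "?A = (\<integral>\<^sup>+x. ennreal ((indicator \<Omega> x * \<bar>u x\<bar> powr \<sigma>) powr (1 - 1 / p) * (indicator \<Omega> x * norm (G x) powr p) powr (1 - (1 - 1 / p))) \<partial>lborel)"
      using p \<sigma>p by (intro nn_integral_cong) (auto simp: indicator_def powr_powr)
    also have "\<dots> \<le> ennreal (X powr (1 - 1 / p) * (g powr p) powr (1 - (1 - 1 / p)))"
      using p X gi by (intro holder_nn_integral) (auto simp: divide_less_eq)
    also have "X powr (1 - 1 / p) * (g powr p) powr (1 - (1 - 1 / p)) = x powr (s - 1) * g"
      using p g \<sigma>p by (simp add: Xx powr_powr)
    finally have "?A \<le> ennreal (x powr (s - 1) * g)" .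
    then have "?A + ?D \<le> ennreal (x powr (s - 1) * g) + ennreal (y powr s)" using yi by (rule add_mono)
    also have "\<dots> = ennreal S" using g by (simp add: S_def)
    finally have AS: "?A + ?D \<le> ennreal S" .
    have "ennreal X \<le> ennreal (C1 * S powr (?n / (?n - 1)))"
      using st1[of \<Omega> u G ?M0 S] rp M0 S0 AS X X_eq by (simp add: \<sigma>_def)
    then have "X \<le> C1 * S powr (?n / (?n - 1))" using C1 by (subst (asm) ennreal_le_iff) auto
    then have "X powr ((?n - 1) / ?n) \<le> (C1 * S powr (?n / (?n - 1))) powr ((?n - 1) / ?n)"
      using X n by (intro powr_mono2) auto
    also have "\<dots> = C1 powr ((?n - 1) / ?n) * S" using C1 S0 n by (simp add: powr_mult powr_powr)
    also have "\<dots> \<le> K * S" using S0 by (intro mult_right_mono) (auto simp: K_def)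
    finally have xs: "x powr s \<le> K * S" using \<sigma>n by (simp add: Xx powr_powr)
    \<comment> \<open>If x exceeds g + y, then y^s is at most x^(s-1) y, hence x^s <= K x^(s-1) (g +
      y), and x^(s-1) cancels.\<close>
    have xz: "x \<le> K * (g + y)"
    proof (cases "x \<le> g + y")
      case True
      have "1 * (g + y) \<le> K * (g + y)" using K g y by (intro mult_right_mono) auto
      then show ?thesis using True by simp
    next
      case False
      then have x: "x > 0" "y \<le> x" using g y by auto
      have "y powr s \<le> x powr (s - 1) * y"
      proof (cases "y = 0")
        case False
        then have "y powr s = y powr (s - 1) * y" using y powr_add[of y "s - 1" 1] by simp
        also have "\<dots> \<le> x powr (s - 1) * y" using x y s by (intro mult_right_mono powr_mono2) auto
        finally show ?thesis .
      qed simp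
      then have "S \<le> x powr (s - 1) * (g + y)" by (simp add: S_def distrib_left)
      then have "x powr s \<le> K * (x powr (s - 1) * (g + y))" using xs K by (meson mult_left_mono order_trans zero_le_one)
      moreover have "x powr s = x powr (s - 1) * x" using x powr_add[of x "s - 1" 1] by simp
      ultimately have "x powr (s - 1) * x \<le> x powr (s - 1) * (K * (g + y))" by (simp add: mult.left_commute)
      then show ?thesis using x by simp
    qed
    define z where "z = g + y"
    have z: "z \<ge> 0" "g \<le> z" "y \<le> z" using g y by (auto simp: z_def)
    have Sz: "S \<le> K powr (s - 1) * z powr s"
    proof -
      have "x powr (s - 1) * g \<le> (K * z) powr (s - 1) * g"
        using xz x0 s g by (intro mult_right_mono powr_mono2) (auto simp: z_def)
      also have "(K * z) powr (s - 1) = K powr (s - 1) * z powr (s - 1)" using K z by (simp add: powr_mult)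
      finally have 1: "x powr (s - 1) * g \<le> K powr (s - 1) * z powr (s - 1) * g" .
      have K1: "1 \<le> K powr (s - 1)" using K s by (intro ge_one_powr_ge_zero) auto
      have "y powr s \<le> z powr (s - 1) * y"
      proof (cases "y = 0")
        case False
        then have "y powr s = y powr (s - 1) * y" using y powr_add[of y "s - 1" 1] by simp
        also have "\<dots> \<le> z powr (s - 1) * y" using z y s by (intro mult_right_mono powr_mono2) auto
        finally show ?thesis .
      qed simp
      also have "\<dots> = 1 * (z powr (s - 1) * y)" by simp
      also have "\<dots> \<le> K powr (s - 1) * (z powr (s - 1) * y)" using K1 y by (intro mult_right_mono) auto
      finally have "S \<le> K powr (s - 1) * (z powr (s - 1) * z)" using 1 by (simp add: S_def z_def algebra_simps)
      moreover have "z powr (s - 1) * z = z powr s"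
        using z powr_add[of z "s - 1" 1] by (cases "z = 0") auto
      ultimately show ?thesis by simp
    qed
    have "(\<integral>\<^sup>+x. ennreal (\<bar>u x\<bar> powr q) \<partial>M) \<le> ennreal (C3 * S powr (\<alpha> / (?n - 1)))"
      using st3[of \<Omega> u G M S] rp M S0 AS by (simp add: qs)
    also have "\<dots> \<le> ennreal (C3 * (K powr (s - 1) * z powr s) powr (\<alpha> / (?n - 1)))"
      using Sz S0 C3 \<alpha> n by (intro ennreal_leI mult_left_mono powr_mono2) auto
    also have "C3 * (K powr (s - 1) * z powr s) powr (\<alpha> / (?n - 1)) = (C * z) powr q"
    proof -
      have "(C * z) powr q = C powr q * z powr q" using z C3 by (simp add: powr_mult C_def)
      also have "C powr q = C3 * (K powr (s - 1)) powr (\<alpha> / (?n - 1))" using q C3 K by (simp add: C_def powr_powr)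
      finally show ?thesis by (auto simp: powr_mult powr_powr qs)
    qed
    finally show "(\<integral>\<^sup>+x. ennreal (\<bar>u x\<bar> powr q) \<partial>M) \<le> ennreal ((C * (g + y)) powr q)" by (simp add: z_def)
  qed
qed

section \<open>Exponents below and above the dimension\<close>

lemma emeasure_lebesgue_on_space:
  assumes "standing_domain \<Omega>"
  shows "emeasure (lebesgue_on \<Omega>) (space (lebesgue_on \<Omega>)) = ennreal (measure lebesgue \<Omega>)"
proof -
  have \<Omega>: "open \<Omega>" "emeasure lebesgue \<Omega> < top" using assms by (auto simp: standing_domain_def)
  then have "\<Omega> \<in> sets lebesgue" by auto
  then have "emeasure (lebesgue_on \<Omega>) (space (lebesgue_on \<Omega>)) = emeasure lebesgue \<Omega>"
    by (simp add: emeasure_restrict_space space_lebesgue_on)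
  then show ?thesis using \<Omega> by (simp add: emeasure_eq_ennreal_measure)
qed

lemma nn_integral_lebesgue_on:
  assumes "\<Omega> \<in> sets borel"
  shows "(\<integral>\<^sup>+x. f x \<partial>lebesgue_on \<Omega>) = (\<integral>\<^sup>+x. f x * indicator \<Omega> x \<partial>lborel)"
proof -
  have "\<Omega> \<in> sets lebesgue" using assms by auto
  then show ?thesis by (simp add: nn_integral_restrict_space nn_integral_completion)
qed

lemma lp_norm_cong: "(\<And>x. x \<in> space N \<Longrightarrow> f x = g x) \<Longrightarrow> lp_norm N p f = lp_norm N p g"
  unfolding lp_norm_def by (intro arg_cong2[where f = enn_root] nn_integral_cong refl) auto

lemma regular_lp_reduction:
  fixes \<Omega> :: "'a::euclidean_space set"
  assumes sd: "standing_domain \<Omega>" and "Cb_closure \<Omega> u" "weak_gradient \<Omega> u G"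
  shows "\<exists>u' G'. regular_pair \<Omega> u' G' \<and> (\<forall>x\<in>closure \<Omega>. u' x = u x) \<and>
    (\<forall>p. lp_norm (lebesgue_on \<Omega>) p (\<lambda>x. norm (G' x)) = lp_norm (lebesgue_on \<Omega>) p (\<lambda>x. norm (G x))) \<and>
    (\<forall>p. (\<integral>\<^sup>+x. ennreal (\<bar>norm (G' x)\<bar> powr p) \<partial>lebesgue_on \<Omega>) = (\<integral>\<^sup>+x. ennreal (indicator \<Omega> x * norm (G' x) powr p) \<partial>lborel)) \<and>
    (\<forall>p. lp_norm (boundary_measure \<Omega>) p u' = lp_norm (boundary_measure \<Omega>) p u)"
proof -
  obtain u' G' where r: "regular_pair \<Omega> u' G'" "\<forall>x\<in>closure \<Omega>. u' x = u x"
    "\<forall>p. (\<integral>\<^sup>+x. ennreal (norm (G x) powr p) \<partial>lebesgue_on \<Omega>) = (\<integral>\<^sup>+x. ennreal (indicator \<Omega> x * norm (G' x) powr p) \<partial>lborel)"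
    using regular_reduction[OF assms] by (elim exE conjE) (rule that)
  have \<Omega>b: "\<Omega> \<in> sets borel" using sd by (auto simp: standing_domain_def)
  have e: "(\<integral>\<^sup>+x. ennreal (\<bar>norm (G' x)\<bar> powr p) \<partial>lebesgue_on \<Omega>) = (\<integral>\<^sup>+x. ennreal (indicator \<Omega> x * norm (G' x) powr p) \<partial>lborel)" for p
    unfolding nn_integral_lebesgue_on[OF \<Omega>b] by (intro nn_integral_cong) (simp add: indicator_def)
  show ?thesis
  proof (intro exI conjI allI)
    show "regular_pair \<Omega> u' G'" "\<forall>x\<in>closure \<Omega>. u' x = u x" by fact+
    show "lp_norm (lebesgue_on \<Omega>) p (\<lambda>x. norm (G' x)) = lp_norm (lebesgue_on \<Omega>) p (\<lambda>x. norm (G x))" for p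
      using e[of p] r(3) by (simp add: lp_norm_def)
    show "lp_norm (boundary_measure \<Omega>) p u' = lp_norm (boundary_measure \<Omega>) p u" for p
      using r(2) by (intro lp_norm_cong) (simp add: boundary_measure_properties(3)[OF sd] frontier_def)
  qed (rule e)
qed

lemma bdry_lp_finite:
  fixes \<Omega> :: "'a::euclidean_space set"
  assumes rp: "regular_pair \<Omega> u G" and r: "r > 0"
  shows "lp_norm (boundary_measure \<Omega>) r u < top"
proof -
  have sd: "standing_domain \<Omega>" and cb: "Cb_closure \<Omega> u" using rp by (auto simp: regular_pair_def)
  note q = boundary_measure_properties[OF sd]
  interpret B: finite_measure "boundary_measure \<Omega>" by (rule q)
  obtain B where B: "\<And>x. x \<in> closure \<Omega> \<Longrightarrow> \<bar>u x\<bar> \<le> B" using Cb_closure_bounded[OF cb] by blast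
  have "(\<integral>\<^sup>+x. ennreal (\<bar>u x\<bar> powr r) \<partial>boundary_measure \<Omega>) \<le> (\<integral>\<^sup>+x. ennreal (B powr r) \<partial>boundary_measure \<Omega>)"
    using B r by (intro nn_integral_mono ennreal_leI powr_mono2) (auto simp: q(3) frontier_def)
  also have "\<dots> = ennreal (B powr r) * emeasure (boundary_measure \<Omega>) (space (boundary_measure \<Omega>))" by simp
  also have "\<dots> < top" unfolding B.emeasure_eq_measure by (simp add: ennreal_mult_less_top)
  finally show ?thesis by (simp add: lp_norm_def enn_root_def)
qed

text \<open>P and R are the gradient and boundary exponents for which q is critical. That q is a
  minimum means P <= p and R <= r, so Hoelder on \<Omega> and on its boundary reduces to the
  critical case; the powers of the measures that it produces are the ones claimed.\<close>

theorem sobolev_subcritical: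
  assumes dim: "DIM('a::euclidean_space) \<ge> 2" and p: "1 < p" "p < real DIM('a)" and r: "r > 1"
    and \<alpha>: "real DIM('a) - 1 < \<alpha>" and c: "c > 0"
  defines "n \<equiv> real DIM('a)"
  defines "q \<equiv> min (p * \<alpha> / (n - p)) (r * \<alpha> / (n - 1))"
  shows "\<exists>C>0. \<forall>(\<Omega>::'a set) M u G. standing_domain \<Omega> \<and> admissible_measure \<Omega> M \<alpha> c \<and>
     Cb_closure \<Omega> u \<and> weak_gradient \<Omega> u G \<and> lp_norm (lebesgue_on \<Omega>) p (\<lambda>x. norm (G x)) < top \<longrightarrow>
     lp_norm M q u \<le> ennreal C *
       (ennreal (max (measure M \<Omega> powr (n / \<alpha>)) (measure lebesgue \<Omega>) powr (\<alpha> / (q * n) - (n - p) / (p * n)))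
          * lp_norm (lebesgue_on \<Omega>) p (\<lambda>x. norm (G x))
        + ennreal (max (measure M \<Omega> powr ((n - 1) / \<alpha>)) (enn2real (hausdorff_outer (n - 1) (frontier \<Omega>)))
             powr (\<alpha> / (q * (n - 1)) - 1 / r))
          * lp_norm (boundary_measure \<Omega>) r u)"
proof -
  have n: "n \<ge> 2" "p < n" "n - 1 < \<alpha>" using dim p \<alpha> by (auto simp: n_def)
  have \<alpha>0: "\<alpha> > 0" using n by simp
  have q1: "q > \<alpha> / (n - 1)"
  proof -
    have "n - p < p * (n - 1)" using p n by (simp add: algebra_simps)
    then have "\<alpha> * (n - p) < \<alpha> * (p * (n - 1))" using \<alpha>0 by (rule mult_strict_left_mono)
    then have "\<alpha> / (n - 1) < p * \<alpha> / (n - p)" using n by (simp add: divide_simps mult_ac)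
    moreover have "\<alpha> / (n - 1) < r * \<alpha> / (n - 1)" using r \<alpha>0 n by (simp add: divide_strict_right_mono)
    ultimately show ?thesis by (simp add: q_def)
  qed
  have q0: "q > 0" using q1 \<alpha>0 n by (meson divide_pos_pos less_trans diff_gt_0_iff_gt less_le_trans one_less_numeral_iff semiring_norm(76))
  \<comment> \<open>Solves P \<alpha>/(n - P) = q, and R is then P (n - 1)/(n - P). The condition P
    > 1 amounts to q > \<alpha>/(n-1), which \<open>q1\<close> supplies.\<close>
  define P where "P = q * n / (\<alpha> + q)"
  define R where "R = q * (n - 1) / \<alpha>"
  have aq: "\<alpha> + q > 0" using \<alpha>0 q0 by simp
  have P: "1 < P" "P < n"
  proof -
    have "\<alpha> < q * (n - 1)" using q1 n by (simp add: divide_less_eq)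
    then show "1 < P" using aq by (simp add: P_def less_divide_eq algebra_simps)
    show "P < n" using aq \<alpha>0 n by (simp add: P_def divide_less_eq algebra_simps)
  qed
  have nP: "n - P = n * \<alpha> / (\<alpha> + q)" using aq by (simp add: P_def field_simps)
  have crit: "P * \<alpha> / (n - P) = q" "P * (n - 1) / (n - P) = R"
    unfolding nP using aq \<alpha>0 n q0 by (simp_all add: P_def R_def)
  have e1: "1 / P - 1 / p = \<alpha> / (q * n) - (n - p) / (p * n)"
    using q0 n p aq by (simp add: P_def field_simps)
  have e2: "1 / R - 1 / r = \<alpha> / (q * (n - 1)) - 1 / r" by (simp add: R_def)
  have Pp: "P \<le> p"
  proof -
    have "q \<le> p * \<alpha> / (n - p)" by (simp add: q_def)
    then have "q * (n - p) \<le> p * \<alpha>" using n by (simp add: le_divide_eq)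
    then show ?thesis using aq by (simp add: P_def divide_le_eq algebra_simps)
  qed
  have Rr: "R \<le> r"
  proof -
    have "q \<le> r * \<alpha> / (n - 1)" by (simp add: q_def)
    then show ?thesis using n \<alpha>0 by (simp add: R_def field_simps)
  qed
  have R0: "R > 0" using q0 n \<alpha>0 by (simp add: R_def)
  have e10: "1 / P - 1 / p \<ge> 0" using P Pp by (simp add: frac_le)
  have e20: "1 / R - 1 / r \<ge> 0" using R0 Rr by (simp add: frac_le)
  obtain C where C: "C > 0" and est: "\<And>(\<Omega>::'a set) M u G g y. regular_pair \<Omega> u G \<and> admissible_measure \<Omega> M \<alpha> c \<and> g \<ge> 0 \<and> y \<ge> 0 \<and>
    (\<integral>\<^sup>+x. ennreal (indicator \<Omega> x * norm (G x) powr P) \<partial>lborel) \<le> ennreal (g powr P) \<and>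
    (\<integral>\<^sup>+x. ennreal (\<bar>u x\<bar> powr R) \<partial>boundary_measure \<Omega>) \<le> ennreal (y powr R) \<Longrightarrow>
    (\<integral>\<^sup>+x. ennreal (\<bar>u x\<bar> powr q) \<partial>M) \<le> ennreal ((C * (g + y)) powr q)"
    using critical_estimate[OF dim \<alpha> c, of P] P unfolding n_def[symmetric] crit by blast
  show ?thesis
  proof (intro exI[of _ C] conjI allI impI C)
    fix \<Omega> :: "'a set" and M u and G :: "'a \<Rightarrow> 'a"
    assume as: "standing_domain \<Omega> \<and> admissible_measure \<Omega> M \<alpha> c \<and>
     Cb_closure \<Omega> u \<and> weak_gradient \<Omega> u G \<and> lp_norm (lebesgue_on \<Omega>) p (\<lambda>x. norm (G x)) < top"
    then have sd: "standing_domain \<Omega>" and M: "admissible_measure \<Omega> M \<alpha> c" and \<Omega>: "open \<Omega>"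
      by (auto simp: standing_domain_def)
    let ?L = "measure lebesgue \<Omega>" and ?H = "enn2real (hausdorff_outer (n - 1) (frontier \<Omega>))" and ?m = "measure M \<Omega>"
    note pM = admissible_measure_properties[OF \<Omega> M]
    interpret M: finite_measure M by (rule pM)
    have red: "Cb_closure \<Omega> u" "weak_gradient \<Omega> u G" using as by auto
    obtain u' G' where rp: "regular_pair \<Omega> u' G'" and uu': "\<forall>x\<in>closure \<Omega>. u' x = u x"
      and lpG': "\<forall>p. lp_norm (lebesgue_on \<Omega>) p (\<lambda>x. norm (G' x)) = lp_norm (lebesgue_on \<Omega>) p (\<lambda>x. norm (G x))"
      and intG': "\<forall>p. (\<integral>\<^sup>+x. ennreal (\<bar>norm (G' x)\<bar> powr p) \<partial>lebesgue_on \<Omega>) = (\<integral>\<^sup>+x. ennreal (indicator \<Omega> x * norm (G' x) powr p) \<partial>lborel)"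
      and lpu': "\<forall>p. lp_norm (boundary_measure \<Omega>) p u' = lp_norm (boundary_measure \<Omega>) p u"
      using regular_lp_reduction[OF sd red] by (elim exE conjE) (rule that)
    note uu = uu'[rule_format] and lpG = lpG'[rule_format] and intG = intG'[rule_format] and lpu = lpu'[rule_format]
    have lpM: "lp_norm M q u = lp_norm M q u'"
      using uu closure_subset[of \<Omega>] by (intro lp_norm_cong) (auto simp: pM(3))
    show "lp_norm M q u \<le> ennreal C *
       (ennreal (max (?m powr (n / \<alpha>)) ?L powr (\<alpha> / (q * n) - (n - p) / (p * n))) * lp_norm (lebesgue_on \<Omega>) p (\<lambda>x. norm (G x))
        + ennreal (max (?m powr ((n - 1) / \<alpha>)) ?H powr (\<alpha> / (q * (n - 1)) - 1 / r)) * lp_norm (boundary_measure \<Omega>) r u)"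
    \<comment> \<open>For \<mu> = 0 the left side is 0. Otherwise both maxima are positive, so their
      zeroth power is 1 and not \<open>0 powr 0\<close>, which is 0; \<open>weight\<close> then
      covers equal exponents too.\<close>
    proof (cases "?m = 0")
      case True
      have "AE x in M. False"
        using True pM(3) by (intro AE_I[of _ _ "space M"]) (auto simp: M.emeasure_eq_measure)
      then have "(\<integral>\<^sup>+x. ennreal (\<bar>u x\<bar> powr q) \<partial>M) = (\<integral>\<^sup>+x. 0 \<partial>M)" by (intro nn_integral_cong_AE) (auto elim: eventually_mono)
      then show ?thesis by (simp add: lp_norm_def enn_root_def)
    next
      case False
      then have m: "?m > 0" by (simp add: less_le)
      have weight: "(if P' = p' then 1 else w powr (1 / P' - 1 / p')) \<le> max (?m powr b) w powr (1 / P' - 1 / p')"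
        if "1 / P' - 1 / p' \<ge> 0" "w \<ge> 0" for P' p' w b :: real
      proof -
        have "max (?m powr b) w > 0" using m by (simp add: less_max_iff_disj)
        then show ?thesis using that by (auto intro!: powr_mono2)
      qed
      have G'm: "(\<lambda>x. norm (G' x)) \<in> borel_measurable (lebesgue_on \<Omega>)"
        using rp by (intro borel_lebesgue_on) (auto simp: regular_pair_def)
      have u'm: "u' \<in> borel_measurable (boundary_measure \<Omega>)"
        using rp by (intro measurable_compose[OF boundary_measure_properties(2)[OF sd]]) (auto simp: regular_pair_def)
      have g1: "lp_norm (lebesgue_on \<Omega>) P (\<lambda>x. norm (G' x)) \<le>
          ennreal (max (?m powr (n / \<alpha>)) ?L powr (1 / P - 1 / p)) * lp_norm (lebesgue_on \<Omega>) p (\<lambda>x. norm (G' x))"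
      proof -
        have "lp_norm (lebesgue_on \<Omega>) P (\<lambda>x. norm (G' x)) \<le>
            ennreal (if P = p then 1 else ?L powr (1 / P - 1 / p)) * lp_norm (lebesgue_on \<Omega>) p (\<lambda>x. norm (G' x))"
          by (rule lp_norm_exponent_mono[OF G'm emeasure_lebesgue_on_space[OF sd]]) (use P Pp in auto)
        also have "\<dots> \<le> ennreal (max (?m powr (n / \<alpha>)) ?L powr (1 / P - 1 / p)) * lp_norm (lebesgue_on \<Omega>) p (\<lambda>x. norm (G' x))"
          by (intro mult_right_mono ennreal_leI weight e10 measure_nonneg zero_le)
        finally show ?thesis .
      qed
      have y1: "lp_norm (boundary_measure \<Omega>) R u' \<le>
          ennreal (max (?m powr ((n - 1) / \<alpha>)) ?H powr (1 / R - 1 / r)) * lp_norm (boundary_measure \<Omega>) r u'"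
      proof -
        have "lp_norm (boundary_measure \<Omega>) R u' \<le>
            ennreal (if R = r then 1 else ?H powr (1 / R - 1 / r)) * lp_norm (boundary_measure \<Omega>) r u'"
          unfolding n_def
          by (rule lp_norm_exponent_mono[OF u'm boundary_measure_properties(4)[OF sd]]) (use R0 Rr in auto)
        also have "\<dots> \<le> ennreal (max (?m powr ((n - 1) / \<alpha>)) ?H powr (1 / R - 1 / r)) * lp_norm (boundary_measure \<Omega>) r u'"
          by (intro mult_right_mono ennreal_leI weight e20 enn2real_nonneg zero_le)
        finally show ?thesis .
      qed
      have "lp_norm (lebesgue_on \<Omega>) P (\<lambda>x. norm (G' x)) < top"
        using g1 as by (auto simp: lpG intro: le_less_trans simp: ennreal_mult_less_top)
      then obtain g where g: "g \<ge> 0" "lp_norm (lebesgue_on \<Omega>) P (\<lambda>x. norm (G' x)) = ennreal g"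
        "(\<integral>\<^sup>+x. ennreal (\<bar>norm (G' x)\<bar> powr P) \<partial>lebesgue_on \<Omega>) = ennreal (g powr P)"
        using lp_norm_finiteD[of "lebesgue_on \<Omega>" P "\<lambda>x. norm (G' x)"] P by auto
      obtain y where y: "y \<ge> 0" "lp_norm (boundary_measure \<Omega>) R u' = ennreal y"
        "(\<integral>\<^sup>+x. ennreal (\<bar>u' x\<bar> powr R) \<partial>boundary_measure \<Omega>) = ennreal (y powr R)"
        using lp_norm_finiteD[OF bdry_lp_finite[OF rp R0] R0] by auto
      have "(\<integral>\<^sup>+x. ennreal (\<bar>u' x\<bar> powr q) \<partial>M) \<le> ennreal ((C * (g + y)) powr q)"
        using rp M g y intG[of P] by (intro est) auto
      then have "lp_norm M q u' \<le> ennreal (C * (g + y))"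
        using C g y q0 by (intro lp_norm_le) auto
      also have "\<dots> = ennreal C * (lp_norm (lebesgue_on \<Omega>) P (\<lambda>x. norm (G' x)) + lp_norm (boundary_measure \<Omega>) R u')"
        using C g y by (simp add: ennreal_mult)
      also have "\<dots> \<le> ennreal C * (ennreal (max (?m powr (n / \<alpha>)) ?L powr (1 / P - 1 / p)) * lp_norm (lebesgue_on \<Omega>) p (\<lambda>x. norm (G' x))
         + ennreal (max (?m powr ((n - 1) / \<alpha>)) ?H powr (1 / R - 1 / r)) * lp_norm (boundary_measure \<Omega>) r u')"
        by (intro mult_left_mono add_mono g1 y1 zero_le)
      finally show ?thesis unfolding lpM lpG lpu e1 e2 .
    qed
  qed
qed

text \<open>Once the boundary potential is gone, Hoelder bounds the gradient potential: the
  conjugate power of the Riesz kernel is |x-y|^(-a) with a = (n-1) p/(p-1), and a < n exactly when p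
  > n. Points with |u x| / 2 <= b need no estimate.\<close>

theorem sobolev_supercritical:
  assumes dim: "DIM('a::euclidean_space) \<ge> 2" and p: "p > real DIM('a)"
  shows "\<exists>C>0. \<forall>(\<Omega>::'a set) u G. standing_domain \<Omega> \<and> Cb_closure \<Omega> u \<and> weak_gradient \<Omega> u G \<and>
     lp_norm (lebesgue_on \<Omega>) p (\<lambda>x. norm (G x)) < top \<longrightarrow>
     linf_norm (lebesgue_on \<Omega>) u \<le> ennreal C *
       (ennreal (measure lebesgue \<Omega> powr (1 / real DIM('a) - 1 / p)) * lp_norm (lebesgue_on \<Omega>) p (\<lambda>x. norm (G x))
        + linf_norm (boundary_measure \<Omega>) u)"
proof -
  let ?n = "real DIM('a)" and ?\<omega> = "unit_ball_vol (real DIM('a))"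
  have n: "?n \<ge> 2" "p > 2" using dim p by auto
  obtain C0 where C0: "C0 > 0" and est: "\<And>(\<Omega>::'a set) u G x t. regular_pair \<Omega> u G \<and> x \<in> \<Omega> \<and> t > 0 \<and> 2 * t \<le> \<bar>u x\<bar> \<Longrightarrow>
    ennreal t \<le> ennreal C0 *
      ((\<integral>\<^sup>+y. ennreal (indicator \<Omega> y * indicator {t<..<2 * t} \<bar>u y\<bar> * norm (G y)) * ennreal (riesz x y) \<partial>lborel)
       + (\<integral>\<^sup>+y. ennreal (t * indicator {t<..} \<bar>u y\<bar>) * ennreal (riesz x y) \<partial>boundary_measure \<Omega>))"
    using level_estimate[OF dim] by blast
  define a where "a = (?n - 1) * p / (p - 1)"
  have a: "0 < a" "a < ?n"
  proof -
    show "0 < a" using n by (simp add: a_def)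
    show "a < ?n" using p n by (simp add: a_def divide_less_eq algebra_simps)
  qed
  define k where "k = kernel_const ?\<omega> ?n a"
  have k: "k \<ge> 1" unfolding k_def using a by (intro kernel_const_pos) auto
  define C where "C = 2 * (1 + C0 * k powr (1 - 1 / p))"
  have C: "C \<ge> 2" using C0 k by (simp add: C_def)
  have exps: "(1 - a / ?n) * (1 - 1 / p) = 1 / ?n - 1 / p"
    using n by (simp add: a_def field_simps)
  show ?thesis
  proof (intro exI[of _ C] conjI allI impI)
    show "C > 0" using C by simp
    fix \<Omega> :: "'a set" and u and G :: "'a \<Rightarrow> 'a"
    assume as: "standing_domain \<Omega> \<and> Cb_closure \<Omega> u \<and> weak_gradient \<Omega> u G \<and> lp_norm (lebesgue_on \<Omega>) p (\<lambda>x. norm (G x)) < top"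
    then have sd: "standing_domain \<Omega>" by simp
    let ?L = "measure lebesgue \<Omega>"
    have red: "Cb_closure \<Omega> u" "weak_gradient \<Omega> u G" using as by auto
    obtain u' G' where rp: "regular_pair \<Omega> u' G'" and uu': "\<forall>x\<in>closure \<Omega>. u' x = u x"
      and lpG': "\<forall>p. lp_norm (lebesgue_on \<Omega>) p (\<lambda>x. norm (G' x)) = lp_norm (lebesgue_on \<Omega>) p (\<lambda>x. norm (G x))"
      and intG': "\<forall>p. (\<integral>\<^sup>+x. ennreal (\<bar>norm (G' x)\<bar> powr p) \<partial>lebesgue_on \<Omega>) = (\<integral>\<^sup>+x. ennreal (indicator \<Omega> x * norm (G' x) powr p) \<partial>lborel)"
      using regular_lp_reduction[OF sd red] by (elim exE conjE) (rule that)
    note uu = uu'[rule_format] and lpG = lpG'[rule_format] and intG = intG'[rule_format]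
    have [measurable]: "\<Omega> \<in> sets borel" "u' \<in> borel_measurable borel" "G' \<in> borel_measurable borel"
      and \<Omega>: "open \<Omega>" "emeasure lebesgue \<Omega> < top"
      using rp by (auto simp: regular_pair_def standing_domain_def)
    obtain g where g: "g \<ge> 0" "lp_norm (lebesgue_on \<Omega>) p (\<lambda>x. norm (G' x)) = ennreal g"
      "(\<integral>\<^sup>+x. ennreal (\<bar>norm (G' x)\<bar> powr p) \<partial>lebesgue_on \<Omega>) = ennreal (g powr p)"
      using lp_norm_finiteD[of "lebesgue_on \<Omega>" p "\<lambda>x. norm (G' x)"] as n by (auto simp: lpG)
    define W where "W = C0 * (k powr (1 - 1 / p) * (?L powr (1 / ?n - 1 / p) * g))"
    have W: "W \<ge> 0" using C0 k g by (simp add: W_def)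
    \<comment> \<open>Hoelder with exponents 1/p and 1 - 1/p. The kernel integral over \<Omega>
      contributes the measure of \<Omega> to the power (1 - a/n)(1 - 1/p), which is 1/n -
      1/p.\<close>
    have pot: "(\<integral>\<^sup>+y. ennreal (indicator \<Omega> y * norm (G' y)) * ennreal (riesz x y) \<partial>lborel) \<le> ennreal (k powr (1 - 1 / p) * (?L powr (1 / ?n - 1 / p) * g))" for x
    proof -
      have kern: "(\<integral>\<^sup>+y. ennreal (norm (x - y) powr (- a)) * indicator \<Omega> y \<partial>lborel) \<le> ennreal (k * ?L powr (1 - a / ?n))"
        unfolding k_def
      proof (rule kernel_integral)
        show "emeasure lborel \<Omega> = ennreal ?L" using \<Omega> by (simp add: emeasure_eq_ennreal_measure)
        show "emeasure lborel (\<Omega> \<inter> ball x \<rho>) \<le> ennreal (?\<omega> * \<rho> powr ?n)" if "\<rho> > 0" for \<rho>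
        proof -
          have "emeasure lborel (\<Omega> \<inter> ball x \<rho>) \<le> emeasure lborel (ball x \<rho>)" by (rule emeasure_mono) auto
          then show ?thesis using emeasure_ball[of \<rho> x] that by (simp add: powr_realpow)
        qed
      qed (use a in auto)
      have "(\<integral>\<^sup>+y. ennreal (indicator \<Omega> y * norm (G' y)) * ennreal (riesz x y) \<partial>lborel)
        = (\<integral>\<^sup>+y. ennreal ((indicator \<Omega> y * norm (G' y) powr p) powr (1 / p) * (norm (x - y) powr (- a) * indicator \<Omega> y) powr (1 - 1 / p)) \<partial>lborel)"
      proof (rule nn_integral_cong)
        fix y
        have "- a * (1 - 1 / p) = 1 - ?n" using n by (simp add: a_def field_simps)
        then have "(norm (x - y) powr (- a)) powr (1 - 1 / p) = riesz x y" by (simp only: powr_powr riesz_def)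
        moreover have "(norm (G' y) powr p) powr (1 / p) = norm (G' y)" using n by (simp add: powr_powr)
        ultimately show "ennreal (indicator \<Omega> y * norm (G' y)) * ennreal (riesz x y) =
          ennreal ((indicator \<Omega> y * norm (G' y) powr p) powr (1 / p) * (norm (x - y) powr (- a) * indicator \<Omega> y) powr (1 - 1 / p))"
          using riesz_nonneg[of x y] by (cases "y \<in> \<Omega>") (simp_all add: ennreal_mult)
      qed
      also have "\<dots> \<le> ennreal ((g powr p) powr (1 / p) * (k * ?L powr (1 - a / ?n)) powr (1 - 1 / p))"
      proof (rule holder_nn_integral)
        show "(\<integral>\<^sup>+y. ennreal (indicator \<Omega> y * norm (G' y) powr p) \<partial>lborel) \<le> ennreal (g powr p)" using intG[of p] g by simp
        have "(\<integral>\<^sup>+y. ennreal (norm (x - y) powr (- a) * indicator \<Omega> y) \<partial>lborel) = (\<integral>\<^sup>+y. ennreal (norm (x - y) powr (- a)) * indicator \<Omega> y \<partial>lborel)"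
          by (intro nn_integral_cong) (simp add: indicator_def)
        then show "(\<integral>\<^sup>+y. ennreal (norm (x - y) powr (- a) * indicator \<Omega> y) \<partial>lborel) \<le> ennreal (k * ?L powr (1 - a / ?n))" using kern by simp
      qed (use n k in auto)
      also have "(g powr p) powr (1 / p) * (k * ?L powr (1 - a / ?n)) powr (1 - 1 / p) = k powr (1 - 1 / p) * (?L powr (1 / ?n - 1 / p) * g)"
        using g n k exps by (simp add: powr_powr powr_mult)
      finally show ?thesis .
    qed
    show "linf_norm (lebesgue_on \<Omega>) u \<le> ennreal C *
       (ennreal (?L powr (1 / ?n - 1 / p)) * lp_norm (lebesgue_on \<Omega>) p (\<lambda>x. norm (G x)) + linf_norm (boundary_measure \<Omega>) u)"
    proof (cases "linf_norm (boundary_measure \<Omega>) u = top")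
      case True
      then show ?thesis using C by (simp add: ennreal_mult_top)
    next
      case False
      then obtain b where b: "b \<ge> 0" "linf_norm (boundary_measure \<Omega>) u = ennreal b"
        by (cases "linf_norm (boundary_measure \<Omega>) u") auto
      \<comment> \<open>Only an inequality can be recovered: \<open>e2ennreal\<close> sends negative
        values to 0, and the essential supremum for a null measure is negative infinity.\<close>
      have "esssup (boundary_measure \<Omega>) (\<lambda>x. ereal \<bar>u x\<bar>) \<le> ereal b"
      proof (rule ccontr)
        assume "\<not> ?thesis"
        then have lt: "ereal b < esssup (boundary_measure \<Omega>) (\<lambda>x. ereal \<bar>u x\<bar>)" by simp
        also have "\<dots> = enn2ereal (linf_norm (boundary_measure \<Omega>) u)"
          unfolding linf_norm_def using lt b(1)
          by (intro enn2ereal_e2ennreal[symmetric]) (auto intro: order_trans[of 0 "ereal b"] less_imp_le)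
        also have "\<dots> = ereal b" using b by (simp add: enn2ereal_ennreal)
        finally show False by simp
      qed
      then have bd: "AE x in boundary_measure \<Omega>. \<bar>u x\<bar> \<le> b"
        using esssup_AE[of "\<lambda>x. ereal \<bar>u x\<bar>" "boundary_measure \<Omega>"]
        by (auto elim!: eventually_mono dest: order_trans)
      have bound: "\<bar>u x\<bar> \<le> 2 * (b + W)" if x: "x \<in> \<Omega>" for x
      proof (cases "\<bar>u x\<bar> / 2 \<le> b")
        case False
        define t where "t = \<bar>u x\<bar> / 2"
        have t: "t > 0" "t > b" using False b by (auto simp: t_def)
        have "AE y in boundary_measure \<Omega>. ennreal (t * indicator {t<..} \<bar>u' y\<bar>) * ennreal (riesz x y) = 0"
          using bd
        proof (rule AE_mp, intro AE_I2 impI)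
          fix y assume "y \<in> space (boundary_measure \<Omega>)" "\<bar>u y\<bar> \<le> b"
          then show "ennreal (t * indicator {t<..} \<bar>u' y\<bar>) * ennreal (riesz x y) = 0"
            using uu[of y] t by (simp add: boundary_measure_properties(3)[OF sd] frontier_def)
        qed
        then have z: "(\<integral>\<^sup>+y. ennreal (t * indicator {t<..} \<bar>u' y\<bar>) * ennreal (riesz x y) \<partial>boundary_measure \<Omega>) = 0"
          by (subst nn_integral_cong_AE[of _ "\<lambda>_. 0"]) auto
        have ux: "u' x = u x" using uu x closure_subset by blast
        have "ennreal t \<le> ennreal C0 * (\<integral>\<^sup>+y. ennreal (indicator \<Omega> y * indicator {t<..<2 * t} \<bar>u' y\<bar> * norm (G' y)) * ennreal (riesz x y) \<partial>lborel)"
          using est[of \<Omega> u' G' x t] rp x t z ux by (simp add: t_def)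
        also have "\<dots> \<le> ennreal C0 * (\<integral>\<^sup>+y. ennreal (indicator \<Omega> y * norm (G' y)) * ennreal (riesz x y) \<partial>lborel)"
          by (intro mult_left_mono nn_integral_mono mult_right_mono ennreal_leI) (auto simp: indicator_def)
        also have "\<dots> \<le> ennreal C0 * ennreal (k powr (1 - 1 / p) * (?L powr (1 / ?n - 1 / p) * g))"
          by (intro mult_left_mono pot zero_le)
        also have "\<dots> = ennreal W" using C0 g by (simp add: W_def ennreal_mult)
        finally have "t \<le> W" using W by (simp add: ennreal_le_iff)
        then show ?thesis using b by (simp add: t_def)
      qed (use W in simp)
      have um: "(\<lambda>x. ereal \<bar>u x\<bar>) \<in> borel_measurable (lebesgue_on \<Omega>)"
      proof -
        have "(\<lambda>x. ereal \<bar>u' x\<bar>) \<in> borel_measurable (lebesgue_on \<Omega>)" by (intro borel_lebesgue_on) measurable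
        then show ?thesis using uu closure_subset[of \<Omega>]
          by (subst measurable_cong[of _ _ "\<lambda>x. ereal \<bar>u' x\<bar>"]) (auto simp: space_lebesgue_on)
      qed
      have "esssup (lebesgue_on \<Omega>) (\<lambda>x. ereal \<bar>u x\<bar>) \<le> ereal (2 * (b + W))"
        using bound by (intro esssup_I um AE_I2) (auto simp: space_lebesgue_on)
      then have "linf_norm (lebesgue_on \<Omega>) u \<le> e2ennreal (ereal (2 * (b + W)))"
        unfolding linf_norm_def by (rule e2ennreal_mono)
      also have "\<dots> = ennreal (2 * (b + W))" by (simp add: ennreal_def)
      also have "\<dots> \<le> ennreal (C * (?L powr (1 / ?n - 1 / p) * g + b))"
      proof (rule ennreal_leI)
        have "2 * b \<le> C * b" using C b by (intro mult_right_mono) auto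
        moreover have "2 * W \<le> C * (?L powr (1 / ?n - 1 / p) * g)"
        proof -
          have "2 * W = 2 * (C0 * k powr (1 - 1 / p)) * (?L powr (1 / ?n - 1 / p) * g)" by (simp add: W_def)
          also have "\<dots> \<le> C * (?L powr (1 / ?n - 1 / p) * g)" using g by (intro mult_right_mono) (auto simp: C_def)
          finally show ?thesis .
        qed
        ultimately show "2 * (b + W) \<le> C * (?L powr (1 / ?n - 1 / p) * g + b)" by (simp add: distrib_left)
      qed
      also have "\<dots> = ennreal C * (ennreal (?L powr (1 / ?n - 1 / p)) * ennreal g + ennreal b)"
        using C g b by (simp add: ennreal_mult)
      finally show ?thesis using g b by (simp add: lpG)
    qed
  qed
qed

section \<open>The exponential case\<close>

text \<open>As the kernel exponent approaches n, the geometric series in \<open>kernel_const\<close>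
  blows up like 1/(1 - 2^(-t)) with t = n/q. Concavity of 1 - 2^(-t), obtained from Young's
  inequality, bounds it below by t/2, so the growth is linear in q.\<close>

lemma kernel_const_growth:
  assumes "w \<ge> 0" "1 \<le> n" "n \<le> q"
  shows "kernel_const w n (n * (1 - 1 / q)) \<le> (1 + 2 * w * 2 powr n) * q"
proof -
  define t where "t = n / q"
  have t: "0 < t" "t \<le> 1" using assms by (auto simp: t_def)
  have "(1 / 2 :: real) powr t * 1 powr (1 - t) \<le> t * (1 / 2) + (1 - t) * 1"
    using t by (intro Youngs_inequality_0) auto
  moreover have "n * (1 - 1 / q) - n = - t" by (simp add: t_def algebra_simps)
  moreover have "(1 / 2 :: real) powr t = 2 powr (- t)" by (simp add: powr_divide powr_minus divide_simps)
  ultimately have den: "t / 2 \<le> 1 - 2 powr (n * (1 - 1 / q) - n)" by simp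
  have "w * 2 powr (n * (1 - 1 / q)) / (1 - 2 powr (n * (1 - 1 / q) - n)) \<le> w * 2 powr n / (t / 2)"
  proof (intro frac_le mult_left_mono powr_mono)
    have "n * (1 / q) \<ge> 0" using assms by simp
    then show "n * (1 - 1 / q) \<le> n" by (simp add: right_diff_distrib)
  qed (use assms t den in auto)
  also have "\<dots> = (2 * w * 2 powr n) * (q / n)" using assms by (simp add: t_def)
  also have "\<dots> \<le> (2 * w * 2 powr n) * q"
    using assms by (intro mult_left_mono) (auto simp: divide_le_eq mult_le_cancel_left1)
  finally show ?thesis using assms by (simp add: kernel_const_def distrib_right)
qed

text \<open>Three-fold Hoelder with exponents \<open>1/q\<close>, \<open>1 - 1/n\<close> and \<open>1/n - 1/q\<close>; the middle factor
  only costs a power of \<open>q\<close>, which is where the exponent \<open>n' = n/(n-1)\<close> comes from.\<close>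

lemma potential_power:
  fixes \<Omega> :: "'a::euclidean_space set"
  assumes dim: "DIM('a) \<ge> 2" and \<Omega>: "\<Omega> \<in> sets borel" "emeasure lborel \<Omega> = ennreal L" "L \<ge> 0"
    and G: "G \<in> borel_measurable borel" and q: "q > real DIM('a)" and a: "a > 0"
    and Ga: "(\<integral>\<^sup>+y. ennreal (indicator \<Omega> y * norm (G y) powr real DIM('a)) \<partial>lborel) \<le> ennreal (a powr real DIM('a))"
    and f: "f \<ge> 0" "ennreal f \<le> (\<integral>\<^sup>+y. ennreal (indicator \<Omega> y * norm (G y)) * ennreal (riesz x y) \<partial>lborel)"
  defines "K \<equiv> (1 + 2 * unit_ball_vol (real DIM('a)) * 2 powr real DIM('a)) * max 1 L"
  shows "ennreal (f powr q) \<le> ennreal ((K * q) powr (q * (1 - 1 / real DIM('a))) * a powr (q - real DIM('a)))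
    * (\<integral>\<^sup>+y. ennreal (indicator \<Omega> y * norm (G y) powr real DIM('a)) * ennreal (riesz x y) \<partial>lborel)"
proof -
  let ?n = "real DIM('a)" and ?w = "unit_ball_vol (real DIM('a))"
  let ?A = "\<integral>\<^sup>+y. ennreal (indicator \<Omega> y * norm (G y) powr ?n) * ennreal (riesz x y) \<partial>lborel"
  note [measurable] = \<Omega>(1) G
  have n: "?n \<ge> 2" "q > 2" using dim q by auto
  have K: "K \<ge> 1" unfolding K_def by (rule mult_ge1_I) (auto intro!: mult_nonneg_nonneg)
  define co where "co = (K * q) powr (q * (1 - 1 / ?n)) * a powr (q - ?n)"
  have co: "co > 0" using K n a by (simp add: co_def)
  show ?thesis
  proof (cases "?A = top")
    case True
    then show ?thesis using co by (simp add: co_def[symmetric] ennreal_mult_top)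
  next
    case False
    then obtain A where A: "A \<ge> 0" "?A = ennreal A" by (cases ?A) auto
    \<comment> \<open>The exponent is forced: the first factor uses up the power 1/q of the Riesz
      kernel, so the middle one must supply |x-y| to the power -(n-1)(1 - 1/q), which is -b (1 -
      1/n).\<close>
    define b where "b = ?n * (1 - 1 / q)"
    have b: "0 < b" "b < ?n" using n by (auto simp: b_def divide_simps algebra_simps)
    define \<theta> where "\<theta> = 1 / q"
    \<comment> \<open>The three-fold inequality is applied as two nested ones; l splits the
      complementary exponent 1 - 1/q into 1 - 1/n and 1/n - 1/q.\<close>
    define l where "l = (1 - 1 / ?n) / (1 - 1 / q)"
    have th: "0 < \<theta>" "\<theta> < 1" using n by (auto simp: \<theta>_def)
    have "1 / q < 1 / ?n" using q n by (intro divide_strict_left_mono) auto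
    moreover have q1: "0 < 1 - 1 / q" using n by simp
    ultimately have l: "0 < l" "l < 1" using n by (simp_all add: l_def divide_less_eq)
    have lq: "l * (1 - 1 / q) = 1 - 1 / ?n" "(1 - l) * (1 - 1 / q) = 1 / ?n - 1 / q"
    proof -
      have "1 - 1 / q \<noteq> 0" using n by simp
      then show 1: "l * (1 - 1 / q) = 1 - 1 / ?n" by (simp add: l_def)
      have "(1 - l) * (1 - 1 / q) = (1 - 1 / q) - l * (1 - 1 / q)" by (simp only: left_diff_distrib mult_1)
      then show "(1 - l) * (1 - 1 / q) = 1 / ?n - 1 / q" unfolding 1 by simp
    qed
    have kern: "(\<integral>\<^sup>+y. ennreal (indicator \<Omega> y * norm (x - y) powr (- b)) \<partial>lborel) \<le> ennreal (K * q)"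
    proof -
      have "(\<integral>\<^sup>+y. ennreal (indicator \<Omega> y * norm (x - y) powr (- b)) \<partial>lborel) = (\<integral>\<^sup>+y. ennreal (norm (x - y) powr (- b)) * indicator \<Omega> y \<partial>lborel)"
        by (intro nn_integral_cong) (simp add: indicator_def)
      also have "\<dots> \<le> ennreal (kernel_const ?w ?n b * L powr (1 - b / ?n))"
      proof (rule kernel_integral)
        show "emeasure lborel (\<Omega> \<inter> ball x \<rho>) \<le> ennreal (?w * \<rho> powr ?n)" if "\<rho> > 0" for \<rho>
        proof -
          have "emeasure lborel (\<Omega> \<inter> ball x \<rho>) \<le> emeasure lborel (ball x \<rho>)" by (rule emeasure_mono) auto
          then show ?thesis using emeasure_ball[of \<rho> x] that by (simp add: powr_realpow)
        qed
      qed (use b \<Omega> in auto)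
      also have "\<dots> \<le> ennreal (((1 + 2 * ?w * 2 powr ?n) * q) * max 1 L)"
      proof (intro ennreal_leI mult_mono)
        show "kernel_const ?w ?n b \<le> (1 + 2 * ?w * 2 powr ?n) * q" unfolding b_def using q n by (intro kernel_const_growth) auto
        have e: "1 - b / ?n = 1 / q" using n by (simp add: b_def)
        have "L powr (1 / q) \<le> max 1 L powr (1 / q)" using \<Omega>(3) n by (intro powr_mono2) auto
        also have "\<dots> \<le> max 1 L powr 1" using n by (intro powr_mono) auto
        finally show "L powr (1 - b / ?n) \<le> max 1 L" by (simp add: e)
      qed (use n in auto)
      also have "((1 + 2 * ?w * 2 powr ?n) * q) * max 1 L = K * q" by (simp add: K_def)
      finally show ?thesis .
    qed
    define H where "H y = (indicator \<Omega> y * norm (x - y) powr (- b)) powr l * (indicator \<Omega> y * norm (G y) powr ?n) powr (1 - l)" for y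
    have Hm: "H \<in> borel_measurable lborel" unfolding H_def by measurable
    have Hi: "(\<integral>\<^sup>+y. ennreal (H y) \<partial>lborel) \<le> ennreal ((K * q) powr l * (a powr ?n) powr (1 - l))"
      unfolding H_def using kern Ga l K n by (intro holder_nn_integral) auto
    have Ai: "(\<integral>\<^sup>+y. ennreal (indicator \<Omega> y * norm (G y) powr ?n * riesz x y) \<partial>lborel) \<le> ennreal A"
      using A riesz_nonneg[of x] by (simp add: ennreal_mult)
    have "(\<integral>\<^sup>+y. ennreal (indicator \<Omega> y * norm (G y)) * ennreal (riesz x y) \<partial>lborel)
       = (\<integral>\<^sup>+y. ennreal ((indicator \<Omega> y * norm (G y) powr ?n * riesz x y) powr \<theta> * H y powr (1 - \<theta>)) \<partial>lborel)"
    proof (rule nn_integral_cong)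
      fix y
      have r: "riesz x y powr \<theta> * (norm (x - y) powr (- b)) powr (1 - 1 / ?n) = riesz x y"
      proof -
        have "(1 - ?n) * \<theta> + - b * (1 - 1 / ?n) = 1 - ?n" using n by (simp add: b_def \<theta>_def field_simps)
        then show ?thesis by (simp add: riesz_def powr_powr powr_add[symmetric])
      qed
      have g: "(norm (G y) powr ?n) powr \<theta> * (norm (G y) powr ?n) powr (1 / ?n - 1 / q) = norm (G y)"
      proof -
        have "?n * \<theta> + ?n * (1 / ?n - 1 / q) = 1" using n by (simp add: \<theta>_def algebra_simps)
        then show ?thesis by (simp add: powr_powr powr_add[symmetric])
      qed
      show "ennreal (indicator \<Omega> y * norm (G y)) * ennreal (riesz x y) =
        ennreal ((indicator \<Omega> y * norm (G y) powr ?n * riesz x y) powr \<theta> * H y powr (1 - \<theta>))"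
      proof (cases "y \<in> \<Omega>")
        case True
        have "H y powr (1 - \<theta>) = (norm (x - y) powr (- b)) powr (1 - 1 / ?n) * (norm (G y) powr ?n) powr (1 / ?n - 1 / q)"
          using True by (simp add: H_def powr_mult powr_powr[of _ l] powr_powr[of _ "1 - l"] lq \<theta>_def)
        then have "(indicator \<Omega> y * norm (G y) powr ?n * riesz x y) powr \<theta> * H y powr (1 - \<theta>) =
          ((norm (G y) powr ?n) powr \<theta> * (norm (G y) powr ?n) powr (1 / ?n - 1 / q)) *
          (riesz x y powr \<theta> * (norm (x - y) powr (- b)) powr (1 - 1 / ?n))"
          using True by (simp add: powr_mult riesz_nonneg)
        also have "\<dots> = norm (G y) * riesz x y" by (simp only: r g)
        finally show ?thesis using True riesz_nonneg[of x y] by (simp add: ennreal_mult)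
      qed simp
    qed
    also have "\<dots> \<le> ennreal (A powr \<theta> * ((K * q) powr l * (a powr ?n) powr (1 - l)) powr (1 - \<theta>))"
      using Hm Hi Ai A th K n riesz_nonneg[of x]
      by (intro holder_nn_integral) (auto simp: H_def intro!: mult_nonneg_nonneg)
    finally have "ennreal f \<le> ennreal (A powr \<theta> * ((K * q) powr l * (a powr ?n) powr (1 - l)) powr (1 - \<theta>))"
      using f(2) by (rule order_trans[rotated])
    then have "f \<le> A powr \<theta> * ((K * q) powr l * (a powr ?n) powr (1 - l)) powr (1 - \<theta>)"
      by (subst (asm) ennreal_le_iff) auto
    also have "((K * q) powr l * (a powr ?n) powr (1 - l)) powr (1 - \<theta>) = (K * q) powr (1 - 1 / ?n) * (a powr ?n) powr (1 / ?n - 1 / q)"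
      by (simp add: powr_mult powr_powr[of _ l] powr_powr[of _ "1 - l"] lq \<theta>_def)
    finally have "f powr q \<le> (A powr \<theta> * ((K * q) powr (1 - 1 / ?n) * (a powr ?n) powr (1 / ?n - 1 / q))) powr q"
      using f n by (intro powr_mono2) auto
    also have "\<dots> = A * co"
    proof -
      have "?n * (1 / ?n - 1 / q) * q = q - ?n" using n by (simp add: field_simps)
      then have "((a powr ?n) powr (1 / ?n - 1 / q)) powr q = a powr (q - ?n)" by (simp add: powr_powr)
      moreover have "(A powr \<theta>) powr q = A" using A n by (simp add: powr_powr \<theta>_def)
      moreover have "((K * q) powr (1 - 1 / ?n)) powr q = (K * q) powr (q * (1 - 1 / ?n))" by (simp add: powr_powr mult.commute)
      ultimately show ?thesis by (simp add: powr_mult co_def)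
    qed
    finally show ?thesis using A co unfolding co_def[symmetric] by (simp add: ennreal_mult[symmetric] mult.commute ennreal_leI)
  qed
qed

text \<open>Where |u| lies between 2 t and 4 t, the gradient or the boundary potential is at least
  t/(2 C). In the first case \<open>potential_power\<close> bounds |u|^q by a multiple of P, which
  does not depend on t, so no summation over levels is needed. The boundary terms depend on t and
  are summed dyadically. T is the kernel bound over all of \<Omega>.\<close>

lemma moment_estimate:
  assumes dim: "DIM('a::euclidean_space) \<ge> 2" and \<alpha>: "real DIM('a) - 1 < \<alpha>" and c: "c > 0" and L: "L \<ge> 0" and m: "m \<ge> 0"
  shows "\<exists>K\<ge>1. \<exists>T\<ge>0. \<forall>(\<Omega>::'a set) M u G a q D. regular_pair \<Omega> u G \<and> admissible_measure \<Omega> M \<alpha> c \<and>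
    measure lebesgue \<Omega> = L \<and> measure M \<Omega> = m \<and> a > 0 \<and> q > real DIM('a) \<and> D \<ge> 0 \<and>
    (\<integral>\<^sup>+y. ennreal (indicator \<Omega> y * norm (G y) powr real DIM('a)) \<partial>lborel) \<le> ennreal (a powr real DIM('a)) \<and>
    (\<integral>\<^sup>+y. ennreal (\<bar>u y\<bar> powr q) \<partial>boundary_measure \<Omega>) \<le> ennreal D \<longrightarrow>
    (\<integral>\<^sup>+x. ennreal (\<bar>u x\<bar> powr q) \<partial>M) \<le> ennreal (T * ((K * a) powr q * q powr (q * (1 - 1 / real DIM('a))) + K powr q * D))"
proof -
  let ?n = "real DIM('a)" and ?w = "unit_ball_vol (real DIM('a))"
  obtain C where C: "C > 0" and est: "\<And>(\<Omega>::'a set) u G x t. regular_pair \<Omega> u G \<and> x \<in> \<Omega> \<and> t > 0 \<and> 2 * t \<le> \<bar>u x\<bar> \<Longrightarrow>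
    ennreal t \<le> ennreal C *
      ((\<integral>\<^sup>+y. ennreal (indicator \<Omega> y * indicator {t<..<2 * t} \<bar>u y\<bar> * norm (G y)) * ennreal (riesz x y) \<partial>lborel)
       + (\<integral>\<^sup>+y. ennreal (t * indicator {t<..} \<bar>u y\<bar>) * ennreal (riesz x y) \<partial>boundary_measure \<Omega>))"
    using level_estimate[OF dim] by blast
  define K2 where "K2 = (1 + 2 * ?w * 2 powr ?n) * max 1 L"
  have K2: "K2 \<ge> 1" unfolding K2_def by (rule mult_ge1_I) (auto intro!: mult_nonneg_nonneg)
  \<comment> \<open>In the gradient case 4 t is 8 C times the lower bound t/(2 C), and
    \<open>K2\<close> comes from \<open>potential_power\<close>. In the boundary case 4^q * 4 C is
    at most the q-th power of 4 max(1, 4 C).\<close>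
  define K where "K = max (8 * C * K2) (4 * max 1 (4 * C))"
  have K: "K \<ge> 1" unfolding K_def using max.cobounded1[of 1 "4 * C"] max.cobounded2[of "4 * max 1 (4 * C)" "8 * C * K2"] by linarith
  define T where "T = kernel_const (c * 2 powr \<alpha>) \<alpha> (?n - 1) * m powr (1 - (?n - 1) / \<alpha>)"
  have T: "T \<ge> 0" unfolding T_def using kernel_const_pos[of "c * 2 powr \<alpha>" "?n - 1" \<alpha>] c \<alpha> by (intro mult_nonneg_nonneg) auto
  show ?thesis
  proof (rule exI[of _ K], rule conjI[OF K], rule exI[of _ T], rule conjI[OF T], intro allI impI)
    fix \<Omega> :: "'a set" and M u G and a q D :: real
    assume as: "regular_pair \<Omega> u G \<and> admissible_measure \<Omega> M \<alpha> c \<and>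
      measure lebesgue \<Omega> = L \<and> measure M \<Omega> = m \<and> a > 0 \<and> q > ?n \<and> D \<ge> 0 \<and>
      (\<integral>\<^sup>+y. ennreal (indicator \<Omega> y * norm (G y) powr ?n) \<partial>lborel) \<le> ennreal (a powr ?n) \<and>
      (\<integral>\<^sup>+y. ennreal (\<bar>u y\<bar> powr q) \<partial>boundary_measure \<Omega>) \<le> ennreal D"
    then have rp: "regular_pair \<Omega> u G" and M: "admissible_measure \<Omega> M \<alpha> c" and Lm: "measure lebesgue \<Omega> = L" "measure M \<Omega> = m"
      and a: "a > 0" and q: "q > ?n" and D: "D \<ge> 0"
      and Ga: "(\<integral>\<^sup>+y. ennreal (indicator \<Omega> y * norm (G y) powr ?n) \<partial>lborel) \<le> ennreal (a powr ?n)"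
      and uD: "(\<integral>\<^sup>+y. ennreal (\<bar>u y\<bar> powr q) \<partial>boundary_measure \<Omega>) \<le> ennreal D"
      and sd: "standing_domain \<Omega>" and cb: "Cb_closure \<Omega> u" and \<Omega>: "open \<Omega>" "emeasure lebesgue \<Omega> < top"
      and Om: "\<Omega> \<in> sets borel" and um: "u \<in> borel_measurable borel" and Gm: "G \<in> borel_measurable borel"
      by (auto simp: regular_pair_def standing_domain_def)
    note [measurable] = Om um Gm
    have n: "?n \<ge> 2" "q > 2" using dim q by auto
    note pM = admissible_measure_properties[OF \<Omega>(1) M]
    note qB = boundary_measure_properties[OF sd]
    interpret M: finite_measure M by (rule pM)
    interpret B: finite_measure "boundary_measure \<Omega>" by (rule qB)
    have OM: "\<Omega> \<in> sets M" using pM(3) sets.top[of M] by simp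
    have EL: "emeasure lborel \<Omega> = ennreal L" using \<Omega> Lm by (simp add: emeasure_eq_ennreal_measure)
    obtain Bd where Bd: "\<And>x. x \<in> closure \<Omega> \<Longrightarrow> \<bar>u x\<bar> \<le> Bd" using Cb_closure_bounded[OF cb] by blast
    define co where "co = (K2 * q) powr (q * (1 - 1 / ?n)) * a powr (q - ?n)"
    have co: "co \<ge> 0" by (simp add: co_def)
    define w1 where "w1 y = ennreal (indicator \<Omega> y * norm (G y) powr ?n)" for y
    define w2 where "w2 t y = ennreal (t * indicator {t<..} \<bar>u y\<bar>)" for t y
    define P where "P x = (\<integral>\<^sup>+y. w1 y * ennreal (riesz x y) \<partial>lborel)" for x
    define J where "J t x = (\<integral>\<^sup>+y. w2 t y * ennreal (riesz x y) \<partial>boundary_measure \<Omega>)" for t x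
    have sl: "sigma_finite_measure (lborel :: 'a measure)" by (rule lborel.sigma_finite_measure_axioms)
    have il: "(\<lambda>x. x) \<in> measurable (lborel :: 'a measure) borel" by simp
    have w1: "w1 \<in> borel_measurable lborel" unfolding w1_def by measurable
    have w2: "w2 t \<in> borel_measurable (boundary_measure \<Omega>)" for t
    proof -
      have "w2 t \<in> borel_measurable borel" unfolding w2_def by measurable
      then show ?thesis by (rule measurable_compose[OF qB(2)])
    qed
    have Pm: "P \<in> borel_measurable M" unfolding P_def by (rule riesz_potential_measurable[OF pM(2) sl il w1])
    have Jm: "J t \<in> borel_measurable M" for t unfolding J_def
      by (rule riesz_potential_measurable[OF pM(2) B.sigma_finite_measure_axioms qB(2) w2])
    have Bb: "(\<integral>\<^sup>+x. ennreal (riesz x y) * indicator \<Omega> x \<partial>M) \<le> ennreal T" for y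
      unfolding T_def Lm(2)[symmetric] by (rule admissible_kernel_bound[OF \<Omega>(1) M c \<alpha> dim Om subset_refl])
    have PI: "(\<integral>\<^sup>+x. P x * indicator \<Omega> x \<partial>M) \<le> ennreal T * ennreal (a powr ?n)"
    proof -
      have "(\<integral>\<^sup>+x. P x * indicator \<Omega> x \<partial>M) \<le> ennreal T * (\<integral>\<^sup>+y. w1 y \<partial>lborel)"
        unfolding P_def by (rule riesz_fubini[OF M.sigma_finite_measure_axioms pM(2) sl il OM w1 Bb])
      also have "\<dots> \<le> ennreal T * ennreal (a powr ?n)" unfolding w1_def by (intro mult_left_mono Ga zero_le)
      finally show ?thesis .
    qed
    have JI: "(\<integral>\<^sup>+x. J t x * indicator \<Omega> x \<partial>M) \<le> ennreal T * bdry_mass \<Omega> u t" for t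
      unfolding J_def bdry_mass_def w2_def[symmetric]
      by (rule riesz_fubini[OF M.sigma_finite_measure_axioms pM(2) B.sigma_finite_measure_axioms qB(2) OM w2 Bb])
    define c1 where "c1 = (8 * C) powr q * co"
    define c2 where "c2 = 4 powr q * (4 * C)"
    have c12: "c1 \<ge> 0" "c2 \<ge> 0" using co C by (auto simp: c1_def c2_def)
    have level: "ennreal (\<bar>u x\<bar> powr q) \<le> ennreal c1 * P x + ennreal (c2 / 2 * t powr (q - 1)) * J t x"
      if x: "x \<in> \<Omega>" and t: "t > 0" "2 * t \<le> \<bar>u x\<bar>" "\<bar>u x\<bar> < 4 * t" for x t
    proof -
      let ?I = "\<integral>\<^sup>+y. ennreal (indicator \<Omega> y * norm (G y)) * ennreal (riesz x y) \<partial>lborel"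
      have "ennreal t \<le> ennreal C *
        ((\<integral>\<^sup>+y. ennreal (indicator \<Omega> y * indicator {t<..<2 * t} \<bar>u y\<bar> * norm (G y)) * ennreal (riesz x y) \<partial>lborel) + J t x)"
        using est[of \<Omega> u G x t] rp x t by (simp add: J_def w2_def)
      also have "\<dots> \<le> ennreal C * (?I + J t x)"
        by (intro mult_left_mono add_right_mono nn_integral_mono mult_right_mono ennreal_leI) (auto simp: indicator_def)
      finally have tIJ: "ennreal t \<le> ennreal C * (?I + J t x)" .
      have "ennreal (t / (2 * C)) \<le> ?I \<or> ennreal (t / (2 * C)) \<le> J t x"
      proof (rule ccontr)
        assume "\<not> ?thesis"
        then have "?I + J t x < ennreal (t / (2 * C)) + ennreal (t / (2 * C))" by (intro add_strict_mono) auto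
        also have "\<dots> = ennreal (t / C)" using t C by (simp add: ennreal_plus[symmetric] del: ennreal_plus)
        finally have lt: "?I + J t x < ennreal (t / C)" .
        have "ennreal C * (?I + J t x) < ennreal C * ennreal (t / C)"
          using lt C by (intro ennreal_mult_strict_left_mono) auto
        also have "\<dots> = ennreal t" using C t by (simp add: ennreal_mult[symmetric])
        finally show False using tIJ by simp
      qed
      moreover have u4: "ennreal (\<bar>u x\<bar> powr q) \<le> ennreal ((4 * t) powr q)" using t n by (intro ennreal_leI powr_mono2) auto
      moreover have "ennreal ((4 * t) powr q) \<le> ennreal c1 * P x" if "ennreal (t / (2 * C)) \<le> ?I"
      proof -
        have "ennreal ((t / (2 * C)) powr q) \<le> ennreal co * P x"
          unfolding co_def P_def w1_def K2_def
          by (rule potential_power[OF dim Om EL L Gm q a Ga _ that]) (use t C in simp)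
        then have "ennreal ((8 * C) powr q) * ennreal ((t / (2 * C)) powr q) \<le> ennreal ((8 * C) powr q) * (ennreal co * P x)"
          by (rule mult_left_mono) simp
        moreover have "ennreal ((8 * C) powr q) * ennreal ((t / (2 * C)) powr q) = ennreal ((4 * t) powr q)"
          using C t by (subst ennreal_mult[symmetric]) (auto simp: powr_mult[symmetric])
        moreover have "ennreal ((8 * C) powr q) * (ennreal co * P x) = ennreal c1 * P x"
          using co by (simp add: c1_def ennreal_mult mult.assoc)
        ultimately show ?thesis by simp
      qed
      moreover have "ennreal ((4 * t) powr q) \<le> ennreal (c2 / 2 * t powr (q - 1)) * J t x" if "ennreal (t / (2 * C)) \<le> J t x"
      proof -
        have "(4 * t) powr q = c2 / 2 * t powr (q - 1) * (t / (2 * C))"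
          using t C powr_add[of t "q - 1" 1] by (simp add: powr_mult c2_def)
        then have "ennreal ((4 * t) powr q) = ennreal (c2 / 2 * t powr (q - 1)) * ennreal (t / (2 * C))"
          using c12 t C by (subst ennreal_mult[symmetric]) auto
        also have "\<dots> \<le> ennreal (c2 / 2 * t powr (q - 1)) * J t x" by (intro mult_left_mono that zero_le)
        finally show ?thesis .
      qed
      ultimately show ?thesis by (meson add_increasing add_increasing2 order_trans zero_le)
    qed
    have main: "(\<integral>\<^sup>+x. ennreal (\<bar>u x\<bar> powr q) \<partial>M) \<le> ennreal (T * (c1 * a powr ?n + c2 * D))"
    proof (rule ennreal_le_epsilon)
      fix e :: real assume e: "e > 0"
      obtain h N where h: "h > 0" "(2 * h) powr q * m \<le> e" "Bd < 2 * (h * 2 ^ N)"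
        using small_scale_exists[of q m e Bd] n m e by auto
      define b where "b j = ennreal (c2 / 2 * (h * 2 ^ j) powr (q - 1))" for j :: nat
      have "(\<integral>\<^sup>+x. ennreal (\<bar>u x\<bar> powr q) \<partial>M) \<le>
        (\<integral>\<^sup>+x. ennreal ((2 * h) powr q) * indicator \<Omega> x + (ennreal c1 * (P x * indicator \<Omega> x) + (\<Sum>j<N. b j * (J (h * 2 ^ j) x * indicator \<Omega> x))) \<partial>M)"
      proof (rule nn_integral_mono)
        fix x assume "x \<in> space M"
        then have x: "x \<in> \<Omega>" using pM(3) by simp
        have ux: "\<bar>u x\<bar> < 2 * (h * 2 ^ N)" using Bd[of x] x closure_subset[of \<Omega>] h by auto
        show "ennreal (\<bar>u x\<bar> powr q) \<le> ennreal ((2 * h) powr q) * indicator \<Omega> x + (ennreal c1 * (P x * indicator \<Omega> x) + (\<Sum>j<N. b j * (J (h * 2 ^ j) x * indicator \<Omega> x)))"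
        proof (cases "\<bar>u x\<bar> < 2 * h")
          case True
          then have "ennreal (\<bar>u x\<bar> powr q) \<le> ennreal ((2 * h) powr q)" using n by (intro ennreal_leI powr_mono2) auto
          then show ?thesis using x by (simp add: add_increasing2)
        next
          case False
          then obtain j where j: "j < N" "2 * (h * 2 ^ j) \<le> \<bar>u x\<bar>" "\<bar>u x\<bar> < 4 * (h * 2 ^ j)"
            using dyadic_level_exists[of h "\<bar>u x\<bar>" N] ux by auto
          have "ennreal (\<bar>u x\<bar> powr q) \<le> ennreal c1 * P x + b j * J (h * 2 ^ j) x"
            unfolding b_def by (rule level[OF x _ j(2,3)]) (use h in simp)
          also have "b j * J (h * 2 ^ j) x \<le> (\<Sum>j<N. b j * J (h * 2 ^ j) x)"
            using j by (intro member_le_sum[of j "{..<N}" "\<lambda>j. b j * J (h * 2 ^ j) x"]) auto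
          finally have "ennreal (\<bar>u x\<bar> powr q) \<le> ennreal c1 * P x + (\<Sum>j<N. b j * J (h * 2 ^ j) x)" by (simp add: add_left_mono)
          then show ?thesis using x by (simp add: add_increasing)
        qed
      qed
      also have "\<dots> = ennreal ((2 * h) powr q) * emeasure M \<Omega> + (ennreal c1 * (\<integral>\<^sup>+x. P x * indicator \<Omega> x \<partial>M)
          + (\<Sum>j<N. b j * (\<integral>\<^sup>+x. J (h * 2 ^ j) x * indicator \<Omega> x \<partial>M)))"
      proof -
        have m1: "(\<lambda>x. P x * indicator \<Omega> x) \<in> borel_measurable M" using Pm OM by measurable
        have m2: "(\<lambda>x. J t x * indicator \<Omega> x) \<in> borel_measurable M" for t using Jm[of t] OM by measurable
        show ?thesis using m1 m2 OM by (simp add: nn_integral_add nn_integral_cmult nn_integral_sum nn_integral_cmult_indicator)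
      qed
      also have "\<dots> \<le> ennreal e + (ennreal c1 * (ennreal T * ennreal (a powr ?n)) + ennreal (c2 / 2) * (ennreal T * (ennreal 2 * ennreal D)))"
      proof (intro add_mono mult_left_mono PI zero_le)
        show "ennreal ((2 * h) powr q) * emeasure M \<Omega> \<le> ennreal e"
          using h(2) m by (simp add: M.emeasure_eq_measure Lm ennreal_mult[symmetric] ennreal_leI)
        have "(\<Sum>j<N. b j * (\<integral>\<^sup>+x. J (h * 2 ^ j) x * indicator \<Omega> x \<partial>M)) \<le> (\<Sum>j<N. b j * (ennreal T * bdry_mass \<Omega> u (h * 2 ^ j)))"
          by (intro sum_mono mult_left_mono JI zero_le)
        also have "\<dots> = (\<Sum>j<N. ennreal (c2 / 2) * (ennreal T * (ennreal ((h * 2 ^ j) powr (q - 1)) * bdry_mass \<Omega> u (h * 2 ^ j))))"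
        proof (rule sum.cong[OF refl])
          fix j
          have bj: "b j = ennreal (c2 / 2) * ennreal ((h * 2 ^ j) powr (q - 1))"
            unfolding b_def using c12 by (intro ennreal_mult) auto
          show "b j * (ennreal T * bdry_mass \<Omega> u (h * 2 ^ j)) = ennreal (c2 / 2) * (ennreal T * (ennreal ((h * 2 ^ j) powr (q - 1)) * bdry_mass \<Omega> u (h * 2 ^ j)))"
            unfolding bj by (simp only: mult.assoc mult.left_commute)
        qed
        also have "\<dots> = ennreal (c2 / 2) * (ennreal T * (\<Sum>j<N. ennreal ((h * 2 ^ j) powr (q - 1)) * bdry_mass \<Omega> u (h * 2 ^ j)))"
          by (simp only: sum_distrib_left)
        also have "\<dots> \<le> ennreal (c2 / 2) * (ennreal T * (ennreal 2 * (\<integral>\<^sup>+y. ennreal (\<bar>u y\<bar> powr q) \<partial>boundary_measure \<Omega>)))"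
          using n by (intro mult_left_mono bdry_mass_dyadic_sum sd um h zero_le) auto
        also have "\<dots> \<le> ennreal (c2 / 2) * (ennreal T * (ennreal 2 * ennreal D))"
          by (intro mult_left_mono uD zero_le)
        finally show "(\<Sum>j<N. b j * (\<integral>\<^sup>+x. J (h * 2 ^ j) x * indicator \<Omega> x \<partial>M)) \<le> ennreal (c2 / 2) * (ennreal T * (ennreal 2 * ennreal D))" .
      qed
      also have "\<dots> = ennreal e + ennreal (c1 * (T * a powr ?n) + c2 / 2 * (T * (2 * D)))"
      proof -
        have "ennreal c1 * (ennreal T * ennreal (a powr ?n)) = ennreal (c1 * (T * a powr ?n))"
          using c12 T by (simp add: ennreal_mult)
        moreover have "ennreal (c2 / 2) * (ennreal T * (ennreal 2 * ennreal D)) = ennreal (c2 / 2 * (T * (2 * D)))"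
          using c12(2) T D by (subst ennreal_mult, simp, simp, subst ennreal_mult, simp, simp, subst ennreal_mult) auto
        ultimately show ?thesis using c12 T D by (simp add: ennreal_plus)
      qed
      also have "c1 * (T * a powr ?n) + c2 / 2 * (T * (2 * D)) = T * (c1 * a powr ?n + c2 * D)" by (simp add: algebra_simps)
      finally show "(\<integral>\<^sup>+x. ennreal (\<bar>u x\<bar> powr q) \<partial>M) \<le> ennreal (T * (c1 * a powr ?n + c2 * D)) + ennreal e"
        by (simp add: add.commute)
    qed
    have 1: "c1 * a powr ?n \<le> (K * a) powr q * q powr (q * (1 - 1 / ?n))"
    proof -
      have e1: "q * (1 - 1 / ?n) \<le> q" using n by (simp add: algebra_simps)
      have "c1 * a powr ?n = (8 * C) powr q * K2 powr (q * (1 - 1 / ?n)) * q powr (q * (1 - 1 / ?n)) * (a powr (q - ?n) * a powr ?n)"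
        using K2 n by (simp add: c1_def co_def powr_mult)
      also have "a powr (q - ?n) * a powr ?n = a powr q" by (simp add: powr_add[symmetric])
      also have "(8 * C) powr q * K2 powr (q * (1 - 1 / ?n)) * q powr (q * (1 - 1 / ?n)) * a powr q
        \<le> (8 * C) powr q * K2 powr q * q powr (q * (1 - 1 / ?n)) * a powr q"
        using K2 e1 by (intro mult_right_mono mult_left_mono powr_mono) auto
      also have "\<dots> = (8 * C * K2) powr q * (q powr (q * (1 - 1 / ?n)) * a powr q)" using C K2 by (simp add: powr_mult)
      also have "\<dots> \<le> K powr q * (q powr (q * (1 - 1 / ?n)) * a powr q)"
        using C K2 n by (intro mult_right_mono powr_mono2) (auto simp: K_def)
      also have "\<dots> = (K * a) powr q * q powr (q * (1 - 1 / ?n))" using a K by (simp add: powr_mult)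
      finally show ?thesis .
    qed
    have 2: "c2 * D \<le> K powr q * D"
    proof (rule mult_right_mono[OF _ D])
      have "max 1 (4 * C) powr 1 \<le> max 1 (4 * C) powr q" using n by (intro powr_mono) auto
      then have "4 * C \<le> max 1 (4 * C) powr q" by simp
      then have "c2 \<le> 4 powr q * max 1 (4 * C) powr q" by (simp add: c2_def)
      also have "\<dots> = (4 * max 1 (4 * C)) powr q" by (simp add: powr_mult)
      also have "\<dots> \<le> K powr q" using n by (intro powr_mono2) (auto simp: K_def)
      finally show "c2 \<le> K powr q" .
    qed
    have "T * (c1 * a powr ?n + c2 * D) \<le> T * ((K * a) powr q * q powr (q * (1 - 1 / ?n)) + K powr q * D)"
      by (intro mult_left_mono add_mono 1 2 T)
    then show "(\<integral>\<^sup>+x. ennreal (\<bar>u x\<bar> powr q) \<partial>M) \<le> ennreal (T * ((K * a) powr q * q powr (q * (1 - 1 / ?n)) + K powr q * D))"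
      using main by (meson ennreal_leI order_trans)
  qed
qed

section \<open>Young functions and exponential integrals\<close>

lemma mono_ennreal_measurable:
  fixes f :: "real \<Rightarrow> ennreal"
  assumes "mono f"
  shows "f \<in> borel_measurable borel"
proof (rule borel_measurableI_greater)
  fix y
  let ?S = "{x. y < f x}"
  \<comment> \<open>The indicator of a superlevel set of a monotone function is monotone, and
    monotone real functions are Borel.\<close>
  have "mono (indicator ?S :: real \<Rightarrow> real)"
    using assms by (auto simp: mono_def indicator_def intro: less_le_trans)
  then have "(indicator ?S :: real \<Rightarrow> real) \<in> borel_measurable borel" by (rule borel_measurable_mono)
  then show "{x \<in> space borel. y < f x} \<in> sets borel" by (simp add: borel_measurable_indicator_iff)
qed

lemma young_function_scale:
  assumes "young_function A" "0 \<le> t" "0 \<le> l" "l \<le> 1"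
  shows "A (l * t) \<le> ennreal l * A t"
proof -
  have "A (l * t + (1 - l) * 0) \<le> ennreal l * A t + ennreal (1 - l) * A 0" and "A 0 = 0"
    using assms unfolding young_function_def by blast+
  then show ?thesis by simp
qed

text \<open>Convexity together with A 0 = 0 gives A s <= (s/t) A t for s <= t.\<close>

lemma young_function_mono:
  assumes "young_function A" "0 \<le> s" "s \<le> t"
  shows "A s \<le> A t"
proof (cases "t = 0")
  case False
  then have t: "t > 0" using assms by simp
  have "A s = A ((s / t) * t)" using t by simp
  also have "\<dots> \<le> ennreal (s / t) * A t" using assms t by (intro young_function_scale) (auto simp: divide_le_eq)
  also have "\<dots> \<le> ennreal 1 * A t" using assms t by (intro mult_right_mono ennreal_leI) (auto simp: divide_le_eq)
  finally show ?thesis by simp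
qed (use assms in auto)

text \<open>The inequality ln z <= z at z = y/s, multiplied by s and exponentiated. The loss s^s
  decides the growth of the moments.\<close>

lemma powr_le_exp:
  fixes y s :: real
  assumes "y \<ge> 0" "s > 0"
  shows "y powr s \<le> s powr s * exp y"
proof (cases "y = 0")
  case False
  then have y: "y > 0" using assms by simp
  have "ln (y / s) \<le> y / s" using ln_le_minus_one[of "y / s"] y assms by simp
  then have "s * ln y - s * ln s \<le> y" using y assms by (simp add: ln_div field_simps)
  then have "exp (s * ln y) \<le> exp (s * ln s + y)" by simp
  then show ?thesis using y assms by (simp add: powr_def exp_add mult.commute)
qed (use assms in simp)

text \<open>k^k / k! is a single term of the exponential series at k.\<close>

lemma power_self_le_fact_exp: "real k ^ k \<le> fact k * exp (real k)"
proof -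
  have s: "(\<lambda>n. real k ^ n / fact n) sums exp (real k)"
    using exp_converges[of "real k"] by (simp add: divide_inverse mult.commute)
  have "(\<Sum>n\<in>{k}. real k ^ n / fact n) \<le> (\<Sum>n. real k ^ n / fact n)"
    using s by (intro sum_le_suminf) (auto simp: sums_iff)
  then have "real k ^ k / fact k \<le> exp (real k)" using s by (simp add: sums_iff)
  then show ?thesis by (simp add: divide_le_eq mult.commute)
qed

text \<open>Moments will be controlled from order \<open>k1\<close> on only, so the lower terms of
  the series are each absorbed into 1 + y^k1.\<close>

lemma exp_split_ennreal:
  fixes y :: real
  assumes "y \<ge> 0"
  shows "ennreal (exp y) \<le> (\<Sum>k. ennreal (y ^ (k + k1) / fact (k + k1))) + ennreal (real k1 * (1 + y ^ k1))"
proof -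
  have s: "(\<lambda>n. y ^ n / fact n) sums exp y"
    using exp_converges[of y] by (simp add: divide_inverse mult.commute)
  have "ennreal (exp y) = (\<Sum>k. ennreal (y ^ k / fact k))"
    using assms s by (intro suminf_ennreal_eq[symmetric]) auto
  also have "\<dots> = (\<Sum>k. ennreal (y ^ (k + k1) / fact (k + k1))) + (\<Sum>k<k1. ennreal (y ^ k / fact k))"
    by (rule suminf_offset) (rule summableI)
  also have "(\<Sum>k<k1. ennreal (y ^ k / fact k)) = ennreal (\<Sum>k<k1. y ^ k / fact k)"
    using assms by (intro sum_ennreal) auto
  also have "\<dots> \<le> ennreal (real k1 * (1 + y ^ k1))"
  proof (rule ennreal_leI)
    have "y ^ k / fact k \<le> 1 + y ^ k1" if "k < k1" for k
    proof -
      have "y ^ k / fact k \<le> y ^ k / 1" using assms by (intro divide_left_mono) (auto simp: fact_ge_1)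
      also have "\<dots> \<le> 1 + y ^ k1"
      proof (cases "y \<le> 1")
        case True
        then have "y ^ k \<le> 1" using assms by (intro power_le_one) auto
        moreover have "0 \<le> y ^ k1" using assms by simp
        ultimately show ?thesis by simp
      next
        case False
        then have "y ^ k \<le> y ^ k1" using that by (intro power_increasing) auto
        then show ?thesis by simp
      qed
      finally show ?thesis .
    qed
    then have "(\<Sum>k<k1. y ^ k / fact k) \<le> (\<Sum>k<k1. 1 + y ^ k1)" by (intro sum_mono) auto
    then show "(\<Sum>k<k1. y ^ k / fact k) \<le> real k1 * (1 + y ^ k1)" by simp
  qed
  finally show ?thesis by (simp add: add_left_mono)
qed

text \<open>By k^k <= k! e^k the k-th term of the integrated series is at most D 2^(-k); the
  constant 2 e in the moment condition is made for this.\<close>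

lemma exp_integral_of_moments:
  fixes y :: "'b \<Rightarrow> real"
  assumes [measurable]: "y \<in> borel_measurable M" and y: "\<And>x. y x \<ge> 0" and M: "emeasure M (space M) = ennreal m" "m \<ge> 0"
    and D: "D \<ge> 0" and mom: "\<And>k. k \<ge> k1 \<Longrightarrow> (\<integral>\<^sup>+x. ennreal (y x ^ k) \<partial>M) \<le> ennreal (D * (real k / (2 * exp 1)) ^ k)"
  shows "(\<integral>\<^sup>+x. ennreal (exp (y x)) \<partial>M) \<le> ennreal (2 * D + real k1 * (m + D * (real k1 / (2 * exp 1)) ^ k1))"
proof -
  have "(\<integral>\<^sup>+x. ennreal (exp (y x)) \<partial>M) \<le>
    (\<integral>\<^sup>+x. (\<Sum>k. ennreal (y x ^ (k + k1) / fact (k + k1))) + ennreal (real k1) * (1 + ennreal (y x ^ k1)) \<partial>M)"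
  proof (rule nn_integral_mono)
    fix x
    have "ennreal (real k1 * (1 + y x ^ k1)) = ennreal (real k1) * (1 + ennreal (y x ^ k1))"
      using y[of x] by (simp add: ennreal_mult)
    then show "ennreal (exp (y x)) \<le> (\<Sum>k. ennreal (y x ^ (k + k1) / fact (k + k1))) + ennreal (real k1) * (1 + ennreal (y x ^ k1))"
      using exp_split_ennreal[OF y[of x], of k1] by (simp only:)
  qed
  also have "\<dots> = (\<Sum>k. \<integral>\<^sup>+x. ennreal (y x ^ (k + k1) / fact (k + k1)) \<partial>M) + ennreal (real k1) * (emeasure M (space M) + (\<integral>\<^sup>+x. ennreal (y x ^ k1) \<partial>M))"
    by (simp add: nn_integral_add nn_integral_suminf nn_integral_cmult)
  also have "\<dots> \<le> (\<Sum>k. ennreal (D * (1 / 2) ^ k)) + ennreal (real k1) * (ennreal m + ennreal (D * (real k1 / (2 * exp 1)) ^ k1))"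
  proof (intro add_mono mult_left_mono suminf_le summableI zero_le mom order_refl)
    fix k
    let ?k = "k + k1"
    have "(\<integral>\<^sup>+x. ennreal (y x ^ ?k / fact ?k) \<partial>M) = (\<integral>\<^sup>+x. ennreal (1 / fact ?k) * ennreal (y x ^ ?k) \<partial>M)"
      using y by (intro nn_integral_cong) (simp add: ennreal_mult[symmetric])
    also have "\<dots> = ennreal (1 / fact ?k) * (\<integral>\<^sup>+x. ennreal (y x ^ ?k) \<partial>M)" by (rule nn_integral_cmult) measurable
    also have "\<dots> \<le> ennreal (1 / fact ?k) * ennreal (D * (real ?k / (2 * exp 1)) ^ ?k)" by (intro mult_left_mono mom) auto
    also have "\<dots> = ennreal (1 / fact ?k * (D * (real ?k / (2 * exp 1)) ^ ?k))" using D by (intro ennreal_mult[symmetric]) auto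
    also have "\<dots> \<le> ennreal (D * (1 / 2) ^ k)"
    proof (rule ennreal_leI)
      have "(real ?k / (2 * exp 1)) ^ ?k = real ?k ^ ?k / (2 ^ ?k * exp (real ?k))"
        by (simp add: power_divide power_mult_distrib exp_of_nat_mult[symmetric])
      also have "\<dots> \<le> (fact ?k * exp (real ?k)) / (2 ^ ?k * exp (real ?k))"
        by (intro divide_right_mono power_self_le_fact_exp) auto
      also have "\<dots> = fact ?k * (1 / 2) ^ ?k" by (simp add: power_divide)
      finally have "1 / fact ?k * (D * (real ?k / (2 * exp 1)) ^ ?k) \<le> 1 / fact ?k * (D * (fact ?k * (1 / 2) ^ ?k))"
        using D by (intro mult_left_mono) auto
      also have "\<dots> = D * (1 / 2) ^ ?k" by simp
      also have "\<dots> \<le> D * (1 / 2) ^ k" using D by (intro mult_left_mono power_decreasing) auto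
      finally show "1 / fact ?k * (D * (real ?k / (2 * exp 1)) ^ ?k) \<le> D * (1 / 2) ^ k" .
    qed
    finally show "(\<integral>\<^sup>+x. ennreal (y x ^ ?k / fact ?k) \<partial>M) \<le> ennreal (D * (1 / 2) ^ k)" .
  qed (use M in auto)
  also have "(\<Sum>k. ennreal (D * (1 / 2) ^ k)) = ennreal (D * (1 / (1 - 1 / 2)))"
    using D by (intro suminf_ennreal_eq sums_mult geometric_sums) auto
  also have "ennreal (D * (1 / (1 - 1 / 2))) + ennreal (real k1) * (ennreal m + ennreal (D * (real k1 / (2 * exp 1)) ^ k1))
    = ennreal (2 * D + real k1 * (m + D * (real k1 / (2 * exp 1)) ^ k1))"
  proof -
    define X where "X = D * (real k1 / (2 * exp 1)) ^ k1"
    have X: "X \<ge> 0" using D by (simp add: X_def)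
    have "ennreal (real k1) * (ennreal m + ennreal X) = ennreal (real k1 * (m + X))"
      using X M by (simp add: ennreal_mult)
    moreover have "ennreal (D * (1 / (1 - 1 / 2))) + ennreal (real k1 * (m + X)) = ennreal (D * (1 / (1 - 1 / 2)) + real k1 * (m + X))"
      using D X M by (intro ennreal_plus[symmetric]) auto
    ultimately show ?thesis by (simp add: X_def mult.commute)
  qed
  finally show ?thesis .
qed

text \<open>After scaling by b k a power is dominated by the exponential, at the loss
  (q/\<beta>)^(q/\<beta>). Above t0 the function B controls the exponential, and the integral of B
  is at most 1; below t0 a constant does. The L^q norms thus grow like q^(1/\<beta>).\<close>

lemma young_moment:
  assumes B: "young_function B" and bt: "b > 0" "t0 > 0" "\<And>t. t \<ge> t0 \<Longrightarrow> ennreal (exp (t powr \<beta>) - 1) \<le> B (b * t)"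
    and \<beta>: "\<beta> > 0" and k: "k > 0" "(\<integral>\<^sup>+x. B (\<bar>u x\<bar> / k) \<partial>N) \<le> 1" and q: "q > 0"
    and u: "u \<in> borel_measurable N" and N: "emeasure N (space N) = ennreal H" "H \<ge> 0"
  shows "(\<integral>\<^sup>+x. ennreal (\<bar>u x\<bar> powr q) \<partial>N) \<le> ennreal ((b * k) powr q * (q / \<beta>) powr (q / \<beta>) * ((exp (t0 powr \<beta>) + 1) * H + 1))"
proof -
  define E where "E = exp (t0 powr \<beta>) + 1"
  have E: "E > 0" by (simp add: E_def add_pos_pos)
  define co where "co = (b * k) powr q * (q / \<beta>) powr (q / \<beta>)"
  have co: "co \<ge> 0" by (simp add: co_def)
  have "mono (\<lambda>t. B (max 0 t))" by (rule monoI) (auto intro!: young_function_mono[OF B] simp: max_def)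
  then have "(\<lambda>t. B (max 0 t)) \<in> borel_measurable borel" by (rule mono_ennreal_measurable)
  moreover have "(\<lambda>x. \<bar>u x\<bar> / k) \<in> borel_measurable N" using u by measurable
  ultimately have "(\<lambda>x. B (max 0 (\<bar>u x\<bar> / k))) \<in> borel_measurable N" by (rule measurable_compose[rotated])
  then have Bm: "(\<lambda>x. B (\<bar>u x\<bar> / k)) \<in> borel_measurable N" using k by simp
  have "(\<integral>\<^sup>+x. ennreal (\<bar>u x\<bar> powr q) \<partial>N) \<le> (\<integral>\<^sup>+x. ennreal co * (ennreal E + B (\<bar>u x\<bar> / k)) \<partial>N)"
  proof (rule nn_integral_mono)
    fix x
    define v where "v = \<bar>u x\<bar> / (b * k)"
    have v: "v \<ge> 0" using bt k by (simp add: v_def)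
    have "\<bar>u x\<bar> powr q = ((b * k) * v) powr q" using bt k by (simp add: v_def)
    also have "\<dots> = (b * k) powr q * (v powr \<beta>) powr (q / \<beta>)" using bt k v \<beta> by (simp add: powr_mult powr_powr)
    also have "\<dots> \<le> (b * k) powr q * ((q / \<beta>) powr (q / \<beta>) * exp (v powr \<beta>))"
      using q \<beta> by (intro mult_left_mono powr_le_exp) auto
    also have "\<dots> = co * exp (v powr \<beta>)" by (simp add: co_def)
    finally have "ennreal (\<bar>u x\<bar> powr q) \<le> ennreal co * ennreal (exp (v powr \<beta>))"
      using co by (simp add: ennreal_mult[symmetric] ennreal_leI)
    also have "\<dots> \<le> ennreal co * (ennreal E + B (\<bar>u x\<bar> / k))"
    proof (rule mult_left_mono)
      show "ennreal (exp (v powr \<beta>)) \<le> ennreal E + B (\<bar>u x\<bar> / k)"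
      proof (cases "v \<ge> t0")
        case True
        have "b * v = \<bar>u x\<bar> / k" using bt by (simp add: v_def)
        then have "ennreal (exp (v powr \<beta>) - 1) \<le> B (\<bar>u x\<bar> / k)" using bt(3)[OF True] by simp
        then have "ennreal 1 + ennreal (exp (v powr \<beta>) - 1) \<le> ennreal E + B (\<bar>u x\<bar> / k)"
          by (intro add_mono ennreal_leI) (simp_all add: E_def)
        moreover have "ennreal 1 + ennreal (exp (v powr \<beta>) - 1) = ennreal (exp (v powr \<beta>))"
          by (subst ennreal_plus[symmetric]) (auto simp: one_le_exp_iff)
        ultimately show ?thesis by simp
      next
        case False
        then have "v powr \<beta> \<le> t0 powr \<beta>" using v \<beta> by (intro powr_mono2) auto
        then have "exp (v powr \<beta>) \<le> E" by (simp add: E_def add_increasing2)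
        then show ?thesis by (simp add: add_increasing2 ennreal_leI)
      qed
    qed simp
    finally show "ennreal (\<bar>u x\<bar> powr q) \<le> ennreal co * (ennreal E + B (\<bar>u x\<bar> / k))" .
  qed
  also have "\<dots> = ennreal co * (ennreal E * ennreal H + (\<integral>\<^sup>+x. B (\<bar>u x\<bar> / k) \<partial>N))"
    using Bm N by (simp add: nn_integral_cmult nn_integral_add)
  also have "\<dots> \<le> ennreal co * (ennreal E * ennreal H + 1)" by (intro mult_left_mono add_left_mono k zero_le)
  also have "\<dots> = ennreal (co * (E * H + 1))" using co E N by (simp add: ennreal_mult)
  finally show ?thesis by (simp add: co_def E_def)
qed

text \<open>The L^q norms grow like q^(1-1/n) because of the gradient and like q^(1/\<beta>) because
  of the boundary; 1/\<gamma> is the larger of the two exponents. Moments of order q = \<gamma> k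
  therefore grow like k^k up to geometric factors, which is what exponential integrability of
  |u|^\<gamma> requires.\<close>

theorem sobolev_exponential:
  assumes dim: "DIM('a::euclidean_space) \<ge> 2" and \<beta>: "\<beta> > 0" and \<alpha>: "real DIM('a) - 1 < \<alpha>" and c: "c > 0"
    and A: "young_function A" "equiv_exp_near_infinity A (min (real DIM('a) / (real DIM('a) - 1)) \<beta>)"
    and B: "young_function B" "equiv_exp_near_infinity B \<beta>"
  shows "\<exists>C>0. \<forall>(\<Omega>::'a set) M u G. standing_domain \<Omega> \<and> admissible_measure \<Omega> M \<alpha> c \<and>
      measure lebesgue \<Omega> = L \<and> enn2real (hausdorff_outer (real DIM('a) - 1) (frontier \<Omega>)) = H \<and> measure M \<Omega> = m \<and>
      Cb_closure \<Omega> u \<and> weak_gradient \<Omega> u G \<and> lp_norm (lebesgue_on \<Omega>) (real DIM('a)) (\<lambda>x. norm (G x)) < top \<longrightarrow>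
      luxemburg_norm M A u \<le> ennreal C * (lp_norm (lebesgue_on \<Omega>) (real DIM('a)) (\<lambda>x. norm (G x)) + luxemburg_norm (boundary_measure \<Omega>) B u)"
proof (cases "L \<ge> 0 \<and> H \<ge> 0 \<and> m \<ge> 0")
  \<comment> \<open>L, H and m stand for values of measures; if one of them is negative, no domain
    qualifies.\<close>
  case False
  then show ?thesis by (intro exI[of _ 1]) auto
next
  case True
  then have L: "L \<ge> 0" and H: "H \<ge> 0" and m: "m \<ge> 0" by auto
  let ?n = "real DIM('a)"
  have n: "?n \<ge> 2" using dim by simp
  define \<gamma> where "\<gamma> = min (?n / (?n - 1)) \<beta>"
  have \<gamma>: "\<gamma> > 0" using \<beta> n by (simp add: \<gamma>_def)
  have inv\<gamma>: "1 - 1 / ?n \<le> 1 / \<gamma>" "1 / \<beta> \<le> 1 / \<gamma>"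
  proof -
    have "1 / (?n / (?n - 1)) \<le> 1 / \<gamma>" using \<gamma> n by (intro divide_left_mono) (auto simp: \<gamma>_def)
    then show "1 - 1 / ?n \<le> 1 / \<gamma>" using n by (simp add: diff_divide_distrib)
    show "1 / \<beta> \<le> 1 / \<gamma>" using \<gamma> \<beta> by (intro divide_left_mono) (auto simp: \<gamma>_def)
  qed
  obtain cA tA where cA: "cA > 0" "tA > 0" "\<And>t. t \<ge> tA \<Longrightarrow> A t \<le> ennreal (exp ((cA * t) powr \<gamma>) - 1)"
    using A(2) unfolding equiv_exp_near_infinity_def \<gamma>_def[symmetric] by auto
  obtain cB tB where cB: "cB > 0" "tB > 0" "\<And>t. t \<ge> tB \<Longrightarrow> ennreal (exp (t powr \<beta>) - 1) \<le> B (cB * t)"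
    using B(2) unfolding equiv_exp_near_infinity_def by auto
  obtain K T where K: "K \<ge> 1" and T: "T \<ge> 0" and mom: "\<And>(\<Omega>::'a set) M u G a q D. regular_pair \<Omega> u G \<and> admissible_measure \<Omega> M \<alpha> c \<and>
    measure lebesgue \<Omega> = L \<and> measure M \<Omega> = m \<and> a > 0 \<and> q > ?n \<and> D \<ge> 0 \<and>
    (\<integral>\<^sup>+y. ennreal (indicator \<Omega> y * norm (G y) powr ?n) \<partial>lborel) \<le> ennreal (a powr ?n) \<and>
    (\<integral>\<^sup>+y. ennreal (\<bar>u y\<bar> powr q) \<partial>boundary_measure \<Omega>) \<le> ennreal D \<Longrightarrow>
    (\<integral>\<^sup>+x. ennreal (\<bar>u x\<bar> powr q) \<partial>M) \<le> ennreal (T * ((K * a) powr q * q powr (q * (1 - 1 / ?n)) + K powr q * D))"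
    using moment_estimate[OF dim \<alpha> c L m] by blast
  define h where "h = (exp (tB powr \<beta>) + 1) * H + 1"
  have h: "h > 0" unfolding h_def using H by (intro add_nonneg_pos mult_nonneg_nonneg) auto
  \<comment> \<open>The factor cB (1/\<beta>)^(1/\<beta>) is split off from (cB k)^q
    (q/\<beta>)^(q/\<beta>), so that q^(q/\<beta>) remains.\<close>
  define K3 where "K3 = K * max 1 (cB * (1 / \<beta>) powr (1 / \<beta>))"
  have K3: "K3 > 0" using K by (simp add: K3_def)
  define D where "D = T * (1 + h)"
  have D: "D \<ge> 0" using T h by (simp add: D_def)
  \<comment> \<open>Makes the bound for the moment of order \<gamma> k of u' / (\<Lambda> a) equal
    to D (k/(2 e))^k: the power \<gamma> k of \<open>K3 / \<Lambda>\<close> is (2 e \<gamma>)^(-k),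
    and its \<gamma> cancels against (\<gamma> k)^k.\<close>
  define \<Lambda> where "\<Lambda> = K3 * (2 * exp 1 * \<gamma>) powr (1 / \<gamma>)"
  have \<Lambda>: "\<Lambda> > 0" using K3 \<gamma> by (simp add: \<Lambda>_def)
  \<comment> \<open>\<open>moment_estimate\<close> speaks of exponents above n, that is of \<gamma>
    k > n.\<close>
  define k1 where "k1 = nat \<lceil>?n / \<gamma>\<rceil> + 1"
  have k1: "?n < \<gamma> * real k" if "k \<ge> k1" for k
  proof -
    have "?n / \<gamma> < real k1" unfolding k1_def by linarith
    also have "real k1 \<le> real k" using that by simp
    finally show ?thesis using \<gamma> by (simp add: divide_less_eq mult.commute)
  qed
  define V where "V = 2 * D + real k1 * (m + D * (real k1 / (2 * exp 1)) ^ k1)"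
  have V: "V \<ge> 0" unfolding V_def using D m by (intro add_nonneg_nonneg mult_nonneg_nonneg) auto
  define eA where "eA = exp ((cA * tA) powr \<gamma>)"
  \<comment> \<open>Convexity gives A (t / W) <= A t / W, so a modular of at most W drops to at most
    1 when the argument is divided by W.\<close>
  define W where "W = max 1 (eA * m + V)"
  have W: "W \<ge> 1" by (simp add: W_def)
  define C where "C = \<Lambda> * cA * W"
  have C: "C > 0" using \<Lambda> cA W by (simp add: C_def)
  show ?thesis
  proof (intro exI[of _ C] conjI allI impI C)
    fix \<Omega> :: "'a set" and M u and G :: "'a \<Rightarrow> 'a"
    assume as: "standing_domain \<Omega> \<and> admissible_measure \<Omega> M \<alpha> c \<and>
      measure lebesgue \<Omega> = L \<and> enn2real (hausdorff_outer (?n - 1) (frontier \<Omega>)) = H \<and> measure M \<Omega> = m \<and>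
      Cb_closure \<Omega> u \<and> weak_gradient \<Omega> u G \<and> lp_norm (lebesgue_on \<Omega>) ?n (\<lambda>x. norm (G x)) < top"
    then have sd: "standing_domain \<Omega>" and M: "admissible_measure \<Omega> M \<alpha> c" and mM: "measure M \<Omega> = m"
      and Hd: "enn2real (hausdorff_outer (?n - 1) (frontier \<Omega>)) = H" and \<Omega>: "open \<Omega>"
      and red: "Cb_closure \<Omega> u" "weak_gradient \<Omega> u G"
      by (auto simp: standing_domain_def)
    note pM = admissible_measure_properties[OF \<Omega> M]
    note qB = boundary_measure_properties[OF sd]
    interpret M: finite_measure M by (rule pM)
    obtain u' G' where rp: "regular_pair \<Omega> u' G'" and uu': "\<forall>x\<in>closure \<Omega>. u' x = u x"
      and lpG': "\<forall>p. lp_norm (lebesgue_on \<Omega>) p (\<lambda>x. norm (G' x)) = lp_norm (lebesgue_on \<Omega>) p (\<lambda>x. norm (G x))"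
      and intG': "\<forall>p. (\<integral>\<^sup>+x. ennreal (\<bar>norm (G' x)\<bar> powr p) \<partial>lebesgue_on \<Omega>) = (\<integral>\<^sup>+x. ennreal (indicator \<Omega> x * norm (G' x) powr p) \<partial>lborel)"
      using regular_lp_reduction[OF sd red] by (elim exE conjE) (rule that)
    note uu = uu'[rule_format]
    have um: "u' \<in> borel_measurable M" "u' \<in> borel_measurable (boundary_measure \<Omega>)"
      using rp by (auto simp: regular_pair_def intro: measurable_compose[OF pM(2)] measurable_compose[OF qB(2)])
    have "lp_norm (lebesgue_on \<Omega>) ?n (\<lambda>x. norm (G' x)) < top" using as lpG' by simp
    then obtain g where g: "g \<ge> 0" "lp_norm (lebesgue_on \<Omega>) ?n (\<lambda>x. norm (G' x)) = ennreal g"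
      "(\<integral>\<^sup>+x. ennreal (\<bar>norm (G' x)\<bar> powr ?n) \<partial>lebesgue_on \<Omega>) = ennreal (g powr ?n)"
      using lp_norm_finiteD[of "lebesgue_on \<Omega>" ?n "\<lambda>x. norm (G' x)"] n by auto
    \<comment> \<open>The Luxemburg norm is an infimum that need not be attained, so the estimate is
      first shown for a single admissible k.\<close>
    have one: "luxemburg_norm M A u \<le> ennreal (C * (g + k))"
      if k: "k > 0" "(\<integral>\<^sup>+x. B (\<bar>u x\<bar> / k) \<partial>boundary_measure \<Omega>) \<le> 1" for k
    proof -
      define a where "a = g + k"
      have a: "a > 0" "g \<le> a" "k \<le> a" using g k by (auto simp: a_def)
      have kB: "(\<integral>\<^sup>+x. B (\<bar>u' x\<bar> / k) \<partial>boundary_measure \<Omega>) \<le> 1"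
      proof -
        have "(\<integral>\<^sup>+x. B (\<bar>u' x\<bar> / k) \<partial>boundary_measure \<Omega>) = (\<integral>\<^sup>+x. B (\<bar>u x\<bar> / k) \<partial>boundary_measure \<Omega>)"
          using uu by (intro nn_integral_cong) (simp add: qB(3) frontier_def)
        then show ?thesis using k by simp
      qed
      have Hm: "emeasure (boundary_measure \<Omega>) (space (boundary_measure \<Omega>)) = ennreal H" using qB(4) Hd by simp
      \<comment> \<open>Gradient norm g and boundary constant k are both at most a = g + k, which
        serves as a common unit.\<close>
      have moment: "(\<integral>\<^sup>+x. ennreal (\<bar>u' x\<bar> powr q) \<partial>M) \<le> ennreal (D * ((K3 * a) powr q * q powr (q / \<gamma>)))" if q: "q > ?n" for q
      proof -
        have q0: "q \<ge> 1" using q n by simp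
        define Q where "Q = (cB * k) powr q * (q / \<beta>) powr (q / \<beta>) * h"
        have Q: "Q \<ge> 0" using h by (simp add: Q_def)
        have "(\<integral>\<^sup>+y. ennreal (\<bar>u' y\<bar> powr q) \<partial>boundary_measure \<Omega>) \<le> ennreal Q"
          unfolding Q_def h_def using q0 by (intro young_moment[OF B(1) cB \<beta> k(1) kB _ um(2) Hm H]) auto
        moreover have "(\<integral>\<^sup>+y. ennreal (indicator \<Omega> y * norm (G' y) powr ?n) \<partial>lborel) \<le> ennreal (a powr ?n)"
        proof -
          have "(\<integral>\<^sup>+y. ennreal (indicator \<Omega> y * norm (G' y) powr ?n) \<partial>lborel) = ennreal (g powr ?n)"
            using intG' g by simp
          also have "\<dots> \<le> ennreal (a powr ?n)" using a g by (intro ennreal_leI powr_mono2) auto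
          finally show ?thesis .
        qed
        ultimately have "(\<integral>\<^sup>+x. ennreal (\<bar>u' x\<bar> powr q) \<partial>M) \<le> ennreal (T * ((K * a) powr q * q powr (q * (1 - 1 / ?n)) + K powr q * Q))"
          using as rp a q Q by (intro mom[where \<Omega> = \<Omega> and G = G']) auto
        also have "\<dots> \<le> ennreal (D * ((K3 * a) powr q * q powr (q / \<gamma>)))"
        proof (rule ennreal_leI)
          let ?X = "(K3 * a) powr q * q powr (q / \<gamma>)"
          have "K * 1 \<le> K3" unfolding K3_def using K by (intro mult_left_mono) auto
          then have KK3: "K \<le> K3" by simp
          have "q * (1 - 1 / ?n) \<le> q * (1 / \<gamma>)" using inv\<gamma> q0 by (intro mult_left_mono) auto
          then have e1: "q powr (q * (1 - 1 / ?n)) \<le> q powr (q / \<gamma>)" using q0 by (intro powr_mono) auto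
          have 1: "(K * a) powr q * q powr (q * (1 - 1 / ?n)) \<le> ?X"
            using KK3 K a q0 e1 by (intro mult_mono powr_mono2 mult_right_mono) auto
          have "q * (1 / \<beta>) \<le> q * (1 / \<gamma>)" using inv\<gamma> q0 by (intro mult_left_mono) auto
          then have e2: "q powr (q / \<beta>) \<le> q powr (q / \<gamma>)" using q0 by (intro powr_mono) auto
          have "K powr q * Q = h * ((K * (cB * (1 / \<beta>) powr (1 / \<beta>)) * k) powr q * q powr (q / \<beta>))"
          proof -
            have "(q / \<beta>) powr (q / \<beta>) = q powr (q / \<beta>) * (1 / \<beta>) powr (q / \<beta>)"
              using q0 \<beta> powr_mult[of q "1 / \<beta>" "q / \<beta>"] by simp
            moreover have "((1 / \<beta>) powr (1 / \<beta>)) powr q = (1 / \<beta>) powr (q / \<beta>)" by (simp add: powr_powr)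
            ultimately show ?thesis using K cB k by (simp add: Q_def powr_mult)
          qed
          also have "\<dots> \<le> h * ?X"
          proof (intro mult_left_mono mult_mono e2)
            have "K * (cB * (1 / \<beta>) powr (1 / \<beta>)) * k \<le> K3 * a"
              unfolding K3_def using K cB k a by (intro mult_mono) auto
            then show "(K * (cB * (1 / \<beta>) powr (1 / \<beta>)) * k) powr q \<le> (K3 * a) powr q"
              using K cB k q0 by (intro powr_mono2) auto
          qed (use h in auto)
          finally have 2: "K powr q * Q \<le> h * ?X" .
          have "T * ((K * a) powr q * q powr (q * (1 - 1 / ?n)) + K powr q * Q) \<le> T * (?X + h * ?X)"
            by (intro mult_left_mono add_mono 1 2 T)
          then show "T * ((K * a) powr q * q powr (q * (1 - 1 / ?n)) + K powr q * Q) \<le> D * ?X" by (simp add: D_def algebra_simps)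
        qed
        finally show ?thesis .
      qed
      define y where "y x = (\<bar>u' x\<bar> / (\<Lambda> * a)) powr \<gamma>" for x
      have "(\<integral>\<^sup>+x. ennreal (exp (y x)) \<partial>M) \<le> ennreal V"
        unfolding V_def
      proof (rule exp_integral_of_moments)
        show "y \<in> borel_measurable M" unfolding y_def using um(1) by measurable
        show "emeasure M (space M) = ennreal m" using mM by (simp add: pM(3) M.emeasure_eq_measure)
        fix k assume "k \<ge> k1"
        note kq = k1[OF this]
        have kp: "k > 0" using kq n by (cases k) auto
        have yk: "y x ^ k = (1 / (\<Lambda> * a)) powr (\<gamma> * real k) * \<bar>u' x\<bar> powr (\<gamma> * real k)" for x
        proof -
          have "y x ^ k = y x powr real k"
          \<comment> \<open>Natural and real powers agree only for a positive base; at 0 both sides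
            vanish because k > 0.\<close>
          proof (cases "y x = 0")
            case True
            show ?thesis unfolding True using kp by simp
          next
            case False
            have "y x \<ge> 0" by (simp add: y_def)
            then have "y x > 0" using False by simp
            then show ?thesis by (simp only: powr_realpow)
          qed
          also have "\<dots> = (\<bar>u' x\<bar> * (1 / (\<Lambda> * a))) powr (\<gamma> * real k)" by (simp add: y_def powr_powr)
          also have "\<dots> = \<bar>u' x\<bar> powr (\<gamma> * real k) * (1 / (\<Lambda> * a)) powr (\<gamma> * real k)"
            by (rule powr_mult)
          finally show ?thesis by simp
        qed
        have "(\<integral>\<^sup>+x. ennreal (y x ^ k) \<partial>M) = (\<integral>\<^sup>+x. ennreal ((1 / (\<Lambda> * a)) powr (\<gamma> * real k)) * ennreal (\<bar>u' x\<bar> powr (\<gamma> * real k)) \<partial>M)"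
          by (intro nn_integral_cong) (simp add: yk ennreal_mult)
        also have "\<dots> = ennreal ((1 / (\<Lambda> * a)) powr (\<gamma> * real k)) * (\<integral>\<^sup>+x. ennreal (\<bar>u' x\<bar> powr (\<gamma> * real k)) \<partial>M)"
          using um(1) by (intro nn_integral_cmult) measurable
        also have "\<dots> \<le> ennreal ((1 / (\<Lambda> * a)) powr (\<gamma> * real k)) * ennreal (D * ((K3 * a) powr (\<gamma> * real k) * (\<gamma> * real k) powr (\<gamma> * real k / \<gamma>)))"
          by (intro mult_left_mono moment kq zero_le)
        also have "\<dots> = ennreal ((1 / (\<Lambda> * a)) powr (\<gamma> * real k) * (D * ((K3 * a) powr (\<gamma> * real k) * (\<gamma> * real k) powr (\<gamma> * real k / \<gamma>))))"
          using D by (intro ennreal_mult[symmetric]) auto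
        also have "(1 / (\<Lambda> * a)) powr (\<gamma> * real k) * (D * ((K3 * a) powr (\<gamma> * real k) * (\<gamma> * real k) powr (\<gamma> * real k / \<gamma>)))
          = D * (real k / (2 * exp 1)) ^ k"
        proof -
          have "(1 / (\<Lambda> * a)) powr (\<gamma> * real k) * (K3 * a) powr (\<gamma> * real k) = (1 / (\<Lambda> * a) * (K3 * a)) powr (\<gamma> * real k)"
            by (rule powr_mult[symmetric])
          also have "1 / (\<Lambda> * a) * (K3 * a) = 1 / (2 * exp 1 * \<gamma>) powr (1 / \<gamma>)" using a K3 by (simp add: \<Lambda>_def)
          also have "\<dots> = (1 / (2 * exp 1 * \<gamma>)) powr (1 / \<gamma>)" using \<gamma> by (simp add: powr_divide)
          also have "\<dots> powr (\<gamma> * real k) = (1 / (2 * exp 1 * \<gamma>)) ^ k" using \<gamma> by (simp add: powr_powr powr_realpow)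
          finally have p1: "(1 / (\<Lambda> * a)) powr (\<gamma> * real k) * (K3 * a) powr (\<gamma> * real k) = (1 / (2 * exp 1 * \<gamma>)) ^ k" .
          have p2: "(\<gamma> * real k) powr (\<gamma> * real k / \<gamma>) = (\<gamma> * real k) ^ k" using \<gamma> kp by (simp add: powr_realpow)
          have "(1 / (2 * exp 1 * \<gamma>)) ^ k * (\<gamma> * real k) ^ k = (real k / (2 * exp 1)) ^ k"
            using \<gamma> by (simp add: power_mult_distrib[symmetric])
          note p3 = this
          have "(1 / (\<Lambda> * a)) powr (\<gamma> * real k) * (D * ((K3 * a) powr (\<gamma> * real k) * (\<gamma> * real k) powr (\<gamma> * real k / \<gamma>)))
            = D * (((1 / (\<Lambda> * a)) powr (\<gamma> * real k) * (K3 * a) powr (\<gamma> * real k)) * (\<gamma> * real k) powr (\<gamma> * real k / \<gamma>))"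
            by (simp only: mult_ac)
          also have "\<dots> = D * (real k / (2 * exp 1)) ^ k" unfolding p1 p2 p3 ..
          finally show ?thesis .
        qed
        finally show "(\<integral>\<^sup>+x. ennreal (y x ^ k) \<partial>M) \<le> ennreal (D * (real k / (2 * exp 1)) ^ k)" .
      qed (use m D in \<open>auto simp: y_def\<close>)
      note expV = this
      have ym: "y \<in> borel_measurable M" unfolding y_def using um(1) by measurable
      have "(\<integral>\<^sup>+x. A (\<bar>u x\<bar> / (C * a)) \<partial>M) \<le> (\<integral>\<^sup>+x. ennreal (1 / W) * (ennreal eA + ennreal (exp (y x))) \<partial>M)"
      proof (rule nn_integral_mono)
        fix x assume "x \<in> space M"
        then have ux: "u' x = u x" using uu closure_subset by (auto simp: pM(3))
        define t where "t = \<bar>u x\<bar> / (\<Lambda> * cA * a)"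
        have t: "t \<ge> 0" using \<Lambda> cA a by (simp add: t_def)
        have cAt: "(cA * t) powr \<gamma> = y x" using cA ux by (simp add: t_def y_def)
        have "A (\<bar>u x\<bar> / (C * a)) = A (1 / W * t)" by (simp add: C_def t_def mult_ac)
        also have "\<dots> \<le> ennreal (1 / W) * A t" using W t by (intro young_function_scale[OF A(1)]) auto
        also have "A t \<le> ennreal eA + ennreal (exp (y x))"
        proof (cases "t \<ge> tA")
          case True
          have "A t \<le> ennreal (exp (y x) - 1)" using cA(3)[OF True] by (simp add: cAt)
          also have "\<dots> \<le> ennreal (exp (y x))" by (intro ennreal_leI) simp
          finally show ?thesis by (simp add: add_increasing)
        next
          case False
          have "A t \<le> A tA" using False t by (intro young_function_mono[OF A(1)]) auto
          also have "\<dots> \<le> ennreal (exp ((cA * tA) powr \<gamma>) - 1)" by (rule cA(3)) simp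
          also have "\<dots> \<le> ennreal eA" unfolding eA_def by (intro ennreal_leI) simp
          finally show ?thesis by (simp add: add_increasing2)
        qed
        finally show "A (\<bar>u x\<bar> / (C * a)) \<le> ennreal (1 / W) * (ennreal eA + ennreal (exp (y x)))" by (simp add: mult_left_mono)
      qed
      also have "\<dots> = ennreal (1 / W) * (ennreal eA * ennreal m + (\<integral>\<^sup>+x. ennreal (exp (y x)) \<partial>M))"
        using ym mM by (simp add: nn_integral_cmult nn_integral_add pM(3) M.emeasure_eq_measure)
      also have "\<dots> \<le> ennreal (1 / W) * (ennreal eA * ennreal m + ennreal V)"
        by (intro mult_left_mono add_left_mono expV zero_le)
      also have "ennreal eA * ennreal m + ennreal V = ennreal (eA * m + V)"
        using m V by (simp add: eA_def ennreal_mult)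
      also have "ennreal (1 / W) * ennreal (eA * m + V) = ennreal (1 / W * (eA * m + V))"
        using W m V by (intro ennreal_mult[symmetric]) (auto simp: eA_def)
      also have "\<dots> \<le> ennreal 1" using W by (intro ennreal_leI) (simp add: divide_le_eq W_def)
      finally have "(\<integral>\<^sup>+x. A (\<bar>u x\<bar> / (C * a)) \<partial>M) \<le> 1" by simp
      then show ?thesis
        unfolding luxemburg_norm_def a_def[symmetric] using C a by (intro INF_lower) auto
    qed
    show "luxemburg_norm M A u \<le> ennreal C * (lp_norm (lebesgue_on \<Omega>) ?n (\<lambda>x. norm (G x)) + luxemburg_norm (boundary_measure \<Omega>) B u)"
    proof (cases "luxemburg_norm (boundary_measure \<Omega>) B u = top")
      case True
      then show ?thesis using C by (simp add: ennreal_mult_top)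
    next
      case False
      then obtain l where l: "l \<ge> 0" "luxemburg_norm (boundary_measure \<Omega>) B u = ennreal l"
        by (cases "luxemburg_norm (boundary_measure \<Omega>) B u") auto
      have "luxemburg_norm M A u \<le> ennreal (C * (g + l))"
      proof (rule ennreal_le_epsilon)
        fix e :: real assume e: "e > 0"
        have "luxemburg_norm (boundary_measure \<Omega>) B u < ennreal (l + e / C)"
          using l e C by (simp add: ennreal_less_iff)
        then obtain k where k: "k > 0" "(\<integral>\<^sup>+x. B (\<bar>u x\<bar> / k) \<partial>boundary_measure \<Omega>) \<le> 1" "ennreal k < ennreal (l + e / C)"
          unfolding luxemburg_norm_def INF_less_iff by auto
        have "k < l + e / C" using k by (simp add: ennreal_less_iff)
        then have "C * (g + k) \<le> C * (g + (l + e / C))" using C by (intro mult_left_mono) auto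
        also have "\<dots> = C * (g + l) + e" using C by (simp add: algebra_simps)
        finally have "ennreal (C * (g + k)) \<le> ennreal (C * (g + l) + e)" by (rule ennreal_leI)
        then show "luxemburg_norm M A u \<le> ennreal (C * (g + l)) + ennreal e"
          using one[OF k(1,2)] C g l e by (simp add: ennreal_plus)
      qed
      also have "\<dots> = ennreal C * (ennreal g + ennreal l)" using C g l by (simp add: ennreal_mult)
      finally show ?thesis using g l lpG' by simp
    qed
  qed
qed

theorem theorem3p1:
  assumes "DIM('a::euclidean_space) \<ge> 2"
  shows
  \<comment> \<open>(i)\<close>
  "(\<forall>p r \<alpha> C\<^sub>\<mu>. 1 < p \<and> p < real DIM('a) \<and> r > 1 \<and>
       real DIM('a) - 1 < \<alpha> \<and> \<alpha> \<le> real DIM('a) \<and> C\<^sub>\<mu> > 0 \<longrightarrow>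
     (let n = real DIM('a); q = min (p * \<alpha> / (n - p)) (r * \<alpha> / (n - 1)) in
      \<exists>C::real. C > 0 \<and>
       (\<forall>(\<Omega>::'a set) M u G. standing_domain \<Omega> \<and> admissible_measure \<Omega> M \<alpha> C\<^sub>\<mu> \<and>
          Cb_closure \<Omega> u \<and> weak_gradient \<Omega> u G \<and>
          lp_norm (lebesgue_on \<Omega>) p (\<lambda>x. norm (G x)) < top \<longrightarrow>
          lp_norm M q u \<le> ennreal C *
            (ennreal (max (measure M \<Omega> powr (n / \<alpha>)) (measure lebesgue \<Omega>)
                        powr (\<alpha> / (q * n) - (n - p) / (p * n)))
               * lp_norm (lebesgue_on \<Omega>) p (\<lambda>x. norm (G x))
             + ennreal (max (measure M \<Omega> powr ((n - 1) / \<alpha>))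
                            (enn2real (hausdorff_outer (n - 1) (frontier \<Omega>)))
                        powr (\<alpha> / (q * (n - 1)) - 1 / r))
               * lp_norm (boundary_measure \<Omega>) r u))))
  \<and>
  \<comment> \<open>(ii)\<close>
  (\<forall>\<beta> \<alpha> C\<^sub>\<mu> A B L H m. \<beta> > 0 \<and>
       real DIM('a) - 1 < \<alpha> \<and> \<alpha> \<le> real DIM('a) \<and> C\<^sub>\<mu> > 0 \<and>
       young_function A \<and>
       equiv_exp_near_infinity A (min (real DIM('a) / (real DIM('a) - 1)) \<beta>) \<and>
       young_function B \<and> equiv_exp_near_infinity B \<beta> \<longrightarrow>
     (\<exists>C::real. C > 0 \<and>
       (\<forall>(\<Omega>::'a set) M u G. standing_domain \<Omega> \<and> admissible_measure \<Omega> M \<alpha> C\<^sub>\<mu> \<and>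
          measure lebesgue \<Omega> = L \<and>
          enn2real (hausdorff_outer (real DIM('a) - 1) (frontier \<Omega>)) = H \<and>
          measure M \<Omega> = m \<and>
          Cb_closure \<Omega> u \<and> weak_gradient \<Omega> u G \<and>
          lp_norm (lebesgue_on \<Omega>) (real DIM('a)) (\<lambda>x. norm (G x)) < top \<longrightarrow>
          luxemburg_norm M A u \<le> ennreal C *
            (lp_norm (lebesgue_on \<Omega>) (real DIM('a)) (\<lambda>x. norm (G x))
             + luxemburg_norm (boundary_measure \<Omega>) B u))))
  \<and>
  \<comment> \<open>(iii)\<close>
  (\<forall>p. p > real DIM('a) \<longrightarrow>
     (\<exists>C::real. C > 0 \<and>
       (\<forall>(\<Omega>::'a set) u G. standing_domain \<Omega> \<and>
          Cb_closure \<Omega> u \<and> weak_gradient \<Omega> u G \<and>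
          lp_norm (lebesgue_on \<Omega>) p (\<lambda>x. norm (G x)) < top \<longrightarrow>
          linf_norm (lebesgue_on \<Omega>) u \<le> ennreal C *
            (ennreal (measure lebesgue \<Omega> powr (1 / real DIM('a) - 1 / p))
               * lp_norm (lebesgue_on \<Omega>) p (\<lambda>x. norm (G x))
             + linf_norm (boundary_measure \<Omega>) u))))"
proof (intro conjI, goal_cases)
  case 1
  show ?case
    unfolding Let_def by (intro allI impI, elim conjE, rule sobolev_subcritical[OF assms])
next
  case 2
  show ?case
    by (intro allI impI, elim conjE, rule sobolev_exponential[OF assms])
next
  case 3
  show ?case
    by (intro allI impI, rule sobolev_supercritical[OF assms])
qed

end
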